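(* Let $\sigma_x,\sigma_k>0$, let $f,g\in\mathcal{S}(\mathbb{R}^n)$, and let $L(x,k)$ be the Fourier transform of a compactly supported tempered distribution on $\mathbb{R}^{2n}$ (in particular, it is the restriction to real arguments of an entire analytic function). Let $L$ be the operator with Weyl symbol $L(x,k)$ and let $\tilde{\mathcal{L}}$ be the operator characterized by $$\tilde W[Lf,g](x,k)=\tilde{\mathcal{L}}\,\tilde W[f,g](x,k).$$ Then $\tilde{\mathcal{L}}$ has Weyl symbol $$\tilde{\mathcal{L}}(x,k,X,K)=L\left(x-\frac{K-i\sigma_x^2X}{2},\;k+\frac{X+i\sigma_k^2K}{2}\right),$$ in the sense that, for $w=\tilde W[f,g]$, $$\tilde{\mathcal{L}}w(x,k)=\int_{a,b,X,K\in\mathbb{R}^n}e^{2\pi i[X(x-a)+K(k-b)]}\,\tilde{\mathcal{L}}\left(\frac{x+a}{2},\frac{k+b}{2},X,K\right)w(a,b)\,da\,db\,dX\,dK.$$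
   Context: Fourier transform: $\hat f(k)=\int_{\mathbb{R}^n}e^{-2\pi i k\cdot x}f(x)\,dx$. The operator $L$ with Weyl symbol $L(x,k)$ is $Lf(x)=\int_{y,k\in\mathbb{R}^n}e^{2\pi i k(x-y)}L\left(\frac{x+y}{2},k\right)f(y)\,dy\,dk$. The smoothed Wigner transform is $$\tilde W[f,g](x,k)=\left(\frac{\sqrt2}{\sigma_x}\right)^n\int_{u,y\in\mathbb{R}^n}e^{-2\pi i k y-\frac{\pi\sigma_k^2y^2}{2}-\frac{2\pi(u-x)^2}{\sigma_x^2}}\,f\left(u+\frac y2\right)\bar g\left(u-\frac y2\right)du\,dy.$$ The operator $\tilde{\mathcal{L}}$ is given explicitly, on $w=\tilde W[f,g]$ with $f,g\in\mathcal{S}(\mathbb{R}^n)$ (which extends to an entire function), by $$\tilde{\mathcal{L}}w(x,k)=\int_{S,T\in\mathbb{R}^n}\hat L(S,T)\,e^{2\pi i(Sx+Tk)-\frac{\pi}{2}(\sigma_x^2S^2+\sigma_k^2T^2)}\,w\left(x+\frac{T+i\sigma_x^2S}{2},k-\frac{S-i\sigma_k^2T}{2}\right)dS\,dT,$$ a duality pairing of $\hat L$ with a Schwartz function of $(S,T)$. Products of vectors are dot products. Integrals with exponentially growing symbols are understood as iterated integrals, with the integration in $(a,b)$ performed first. *)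

theory Defs
  imports "HOL-Analysis.Analysis"
begin

section \<open>Schwartz functions, tempered distributions, Fourier transform\<close>

text \<open>Iterated partial derivatives; a multi-index is a list of basis vectors.\<close>

primrec iter_pderiv :: "'a::euclidean_space list \<Rightarrow> ('a \<Rightarrow> complex) \<Rightarrow> 'a \<Rightarrow> complex" where
  "iter_pderiv [] f = f"
| "iter_pderiv (b # bs) f = (\<lambda>x. frechet_derivative (iter_pderiv bs f) (at x) b)"

definition smooth :: "('a::euclidean_space \<Rightarrow> complex) \<Rightarrow> bool" where
  "smooth f \<longleftrightarrow> (\<forall>bs. set bs \<subseteq> Basis \<longrightarrow> iter_pderiv bs f differentiable_on UNIV)"

definition schwartz :: "('a::euclidean_space \<Rightarrow> complex) \<Rightarrow> bool" where
  "schwartz f \<longleftrightarrow> smooth f \<and>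
     (\<forall>N::nat. \<forall>bs. set bs \<subseteq> Basis \<longrightarrow>
        bounded (range (\<lambda>x. (1 + norm x) ^ N *\<^sub>R iter_pderiv bs f x)))"

definition schwartz_seminorm :: "nat \<Rightarrow> ('a::euclidean_space \<Rightarrow> complex) \<Rightarrow> real" where
  "schwartz_seminorm N f =
     Sup {(1 + norm x) ^ N * cmod (iter_pderiv bs f x) | x bs. set bs \<subseteq> Basis \<and> length bs \<le> N}"

text \<open>
  A distribution is a functional on functions of which only the values on Schwartz functions
  matter.  The seminorms are increasing in N and generate the Schwartz topology, so the
  estimate below is continuity of the linear functional.\<close>

definition tempered_distribution :: "(('a::euclidean_space \<Rightarrow> complex) \<Rightarrow> complex) \<Rightarrow> bool" where
  "tempered_distribution u \<longleftrightarrow>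
     (\<forall>\<phi> \<psi>. schwartz \<phi> \<longrightarrow> schwartz \<psi> \<longrightarrow> u (\<lambda>x. \<phi> x + \<psi> x) = u \<phi> + u \<psi>) \<and>
     (\<forall>c \<phi>. schwartz \<phi> \<longrightarrow> u (\<lambda>x. c * \<phi> x) = c * u \<phi>) \<and>
     (\<exists>C N. \<forall>\<phi>. schwartz \<phi> \<longrightarrow> cmod (u \<phi>) \<le> C * schwartz_seminorm N \<phi>)"

definition supported_in :: "(('a::euclidean_space \<Rightarrow> complex) \<Rightarrow> complex) \<Rightarrow> 'a set \<Rightarrow> bool" where
  "supported_in u K \<longleftrightarrow>
     (\<forall>\<phi>. schwartz \<phi> \<longrightarrow> closure {x. \<phi> x \<noteq> 0} \<inter> K = {} \<longrightarrow> u \<phi> = 0)"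

definition compactly_supported :: "(('a::euclidean_space \<Rightarrow> complex) \<Rightarrow> complex) \<Rightarrow> bool" where
  "compactly_supported u \<longleftrightarrow> (\<exists>K. compact K \<and> supported_in u K)"

definition fourier :: "('a::euclidean_space \<Rightarrow> complex) \<Rightarrow> 'a \<Rightarrow> complex" where
  "fourier f \<xi> = (\<integral>x. exp (- (2 * pi * \<i> * of_real (\<xi> \<bullet> x))) * f x \<partial>lborel)"

definition fourier_distribution ::
    "(('a::euclidean_space \<Rightarrow> complex) \<Rightarrow> complex) \<Rightarrow> ('a \<Rightarrow> complex) \<Rightarrow> complex" where
  "fourier_distribution u \<phi> = u (fourier \<phi>)"

definition regular_distribution ::
    "('a::euclidean_space \<Rightarrow> complex) \<Rightarrow> ('a \<Rightarrow> complex) \<Rightarrow> complex" where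
  "regular_distribution L \<phi> = (\<integral>z. L z * \<phi> z \<partial>lborel)"

text \<open>
  The Fourier transform of the distribution v is (the regular distribution of) the function L.
  Continuity selects the representative of L, which is otherwise determined only almost
  everywhere; integrability says that L does define a distribution.\<close>

definition is_fourier_transform_of ::
    "('a::euclidean_space \<Rightarrow> complex) \<Rightarrow> (('a \<Rightarrow> complex) \<Rightarrow> complex) \<Rightarrow> bool" where
  "is_fourier_transform_of L v \<longleftrightarrow> continuous_on UNIV L \<and>
     (\<forall>\<phi>. schwartz \<phi> \<longrightarrow> integrable lborel (\<lambda>z. L z * \<phi> z) \<and>
        regular_distribution L \<phi> = fourier_distribution v \<phi>)"

section \<open>Entire extensions\<close>

definition cvec :: "real ^ 'n \<Rightarrow> complex ^ 'n" where
  "cvec x = (\<chi> i. of_real (x $ i))"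

text \<open>Entire functions of several variables: continuous and holomorphic in each variable.\<close>

definition entire :: "((complex ^ ('n::finite)) \<times> (complex ^ 'n) \<Rightarrow> complex) \<Rightarrow> bool" where
  "entire F \<longleftrightarrow> continuous_on UNIV F \<and>
     (\<forall>z \<zeta> i. (\<lambda>t. F (\<chi> j. if j = i then t else z $ j, \<zeta>)) holomorphic_on UNIV \<and>
               (\<lambda>t. F (z, \<chi> j. if j = i then t else \<zeta> $ j)) holomorphic_on UNIV)"

text \<open>Meaningful only when an entire extension exists; it is then unique.\<close>

definition entire_ext ::
    "((real ^ ('n::finite)) \<times> (real ^ 'n) \<Rightarrow> complex) \<Rightarrow> (complex ^ 'n) \<times> (complex ^ 'n) \<Rightarrow> complex" where
  "entire_ext w = (SOME F. entire F \<and> (\<forall>x k. F (cvec x, cvec k) = w (x, k)))"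

section \<open>Weyl quantization and the smoothed Wigner transform\<close>

text \<open>
  The Weyl integral is an iterated one, with the integration over the position variable
  performed first: for a general symbol there is no absolute convergence in both variables.\<close>

definition weyl_integrand ::
    "('a::euclidean_space \<times> 'a \<Rightarrow> complex) \<Rightarrow> ('a \<Rightarrow> complex) \<Rightarrow> 'a \<Rightarrow> 'a \<Rightarrow> 'a \<Rightarrow> complex" where
  "weyl_integrand a f x \<xi> y =
     exp (2 * pi * \<i> * of_real (\<xi> \<bullet> (x - y))) * a ((1/2) *\<^sub>R (x + y), \<xi>) * f y"

definition weyl_converges ::
    "('a::euclidean_space \<times> 'a \<Rightarrow> complex) \<Rightarrow> ('a \<Rightarrow> complex) \<Rightarrow> 'a \<Rightarrow> bool" where
  "weyl_converges a f x \<longleftrightarrow>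
     (\<forall>\<xi>. integrable lborel (weyl_integrand a f x \<xi>)) \<and>
     integrable lborel (\<lambda>\<xi>. \<integral>y. weyl_integrand a f x \<xi> y \<partial>lborel)"

definition weyl_op ::
    "('a::euclidean_space \<times> 'a \<Rightarrow> complex) \<Rightarrow> ('a \<Rightarrow> complex) \<Rightarrow> 'a \<Rightarrow> complex" where
  "weyl_op a f x = (\<integral>\<xi>. (\<integral>y. weyl_integrand a f x \<xi> y \<partial>lborel) \<partial>lborel)"

definition smoothed_wigner ::
    "real \<Rightarrow> real \<Rightarrow> (real ^ ('n::finite) \<Rightarrow> complex) \<Rightarrow> (real ^ 'n \<Rightarrow> complex) \<Rightarrow>
     (real ^ 'n) \<times> (real ^ 'n) \<Rightarrow> complex" where
  "smoothed_wigner \<sigma>\<^sub>x \<sigma>\<^sub>k f g = (\<lambda>(x, k).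
     of_real ((sqrt 2 / \<sigma>\<^sub>x) ^ CARD('n)) *
     (\<integral>(u, y). exp (- (2 * pi * \<i> * of_real (k \<bullet> y))
                    - of_real (pi * \<sigma>\<^sub>k\<^sup>2 * (y \<bullet> y) / 2)
                    - of_real (2 * pi * ((u - x) \<bullet> (u - x)) / \<sigma>\<^sub>x\<^sup>2))
               * f (u + (1/2) *\<^sub>R y) * cnj (g (u - (1/2) *\<^sub>R y)) \<partial>lborel))"

section \<open>The operator on phase space\<close>

text \<open>
  The pairing with the Fourier transform of L is taken in the sense of tempered distributions;
  w is evaluated at complex arguments through its entire extension.\<close>

definition tilde_op ::
    "real \<Rightarrow> real \<Rightarrow> ((real ^ ('n::finite)) \<times> (real ^ 'n) \<Rightarrow> complex) \<Rightarrow>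
     ((real ^ 'n) \<times> (real ^ 'n) \<Rightarrow> complex) \<Rightarrow> (real ^ 'n) \<times> (real ^ 'n) \<Rightarrow> complex" where
  "tilde_op \<sigma>\<^sub>x \<sigma>\<^sub>k L w = (\<lambda>(x, k).
     fourier_distribution (regular_distribution L) (\<lambda>(S, T).
       exp (2 * pi * \<i> * of_real (S \<bullet> x + T \<bullet> k)
            - of_real (pi / 2 * (\<sigma>\<^sub>x\<^sup>2 * (S \<bullet> S) + \<sigma>\<^sub>k\<^sup>2 * (T \<bullet> T)))) *
       entire_ext w (cvec x + (1/2) *s (cvec T + (\<i> * of_real (\<sigma>\<^sub>x\<^sup>2)) *s cvec S),
                     cvec k - (1/2) *s (cvec S - (\<i> * of_real (\<sigma>\<^sub>k\<^sup>2)) *s cvec T))))"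

definition tilde_symbol ::
    "real \<Rightarrow> real \<Rightarrow> ((real ^ ('n::finite)) \<times> (real ^ 'n) \<Rightarrow> complex) \<Rightarrow>
     ((real ^ 'n) \<times> (real ^ 'n)) \<times> ((real ^ 'n) \<times> (real ^ 'n)) \<Rightarrow> complex" where
  "tilde_symbol \<sigma>\<^sub>x \<sigma>\<^sub>k L = (\<lambda>((x, k), (X, K)).
     entire_ext L (cvec x - (1/2) *s (cvec K - (\<i> * of_real (\<sigma>\<^sub>x\<^sup>2)) *s cvec X),
                   cvec k + (1/2) *s (cvec X + (\<i> * of_real (\<sigma>\<^sub>k\<^sup>2)) *s cvec K)))"

end

theory Submission
  imports Defs "HOL-Complex_Analysis.Complex_Analysis" "HOL-Probability.Probability"
begin

text \<open>
Write \<open>w\<close> for the smoothed Wigner transform of \<open>f\<close> and \<open>g\<close>, and \<open>L\<close> for the symbol.  All three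
quantities in the theorem equal one absolutely convergent integral over phase space, namely
\<open>\<integral>z. L z * test_fun_hat (fst z) (snd z)\<close>, in which \<open>test_fun_hat a b\<close> is a partial
Fourier transform of the Schwartz function \<open>Q a T y\<close>, a product of \<open>f\<close>, the conjugate of \<open>g\<close>, two
Gaussians and a character.  The analytic input about the symbol is that it extends to an entire
function which, on every strip of bounded imaginary part, grows at most polynomially, and that its
restriction to real points has partial derivatives of the same polynomial growth.

That entire extension is \<open>Lext z = v (\<lambda>\<zeta>. \<kappa> \<zeta> * wave z \<zeta>)\<close>, where \<open>wave z\<close> is the
exponential with complex frequency \<open>z\<close> and \<open>\<kappa>\<close> is a cutoff equal to one near the support of
\<open>v\<close>.  Continuity of \<open>v\<close> in a Schwartz seminorm turns estimates for the exponentials into polynomial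
growth (\<open>pairing_strip_bound\<close>) and differentiability (\<open>pairing_has_derivative\<close>); that it restricts to
\<open>L\<close> on real points follows by pairing with Gaussians that concentrate at a point
(\<open>pairing_eq_symbol\<close>).  The entire extension of \<open>w\<close> is its own defining integral, evaluated at complex
arguments; it decays rapidly along every strip (\<open>wigner_ext_decay\<close>).  Entire extensions are
unique (\<open>entire_unique\<close>), so these two functions are the ones that occur in \<open>tilde_op\<close> and
\<open>tilde_symbol\<close>.

The three evaluations are as follows.

\<^item> In \<open>tilde_op\<close>, the quadratic exponential weight cancels exactly the growth of the extension of \<open>w\<close>
  at the shifted complex point, and the product is the rapidly decaying function \<open>test_fun S T\<close>
  (\<open>tilde_integrand\<close>).  Its Fourier transform is \<open>test_fun_hat\<close>, by Fourier inversion in the first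
  variable (\<open>fourier_test_fun\<close>).

\<^item> In the Wigner transform of the Weyl operator applied to \<open>f\<close>, Fubini's theorem and the substitution of the
  midpoint and difference of the two position variables give the same integral (\<open>wigner_of_weyl\<close>).

\<^item> In the Weyl operator on phase space, fix the dual variable \<open>\<Xi> = (X, K)\<close>.  The inner integrand is
  the restriction to real points of an entire function that decays on strips, so the contour may
  be moved by the complex vector \<open>symbol_shift \<Xi>\<close> (\<open>integral_complex_translation\<close>).  The
  shift is chosen such that the argument of the extended symbol becomes real.  What
  remains is \<open>L\<close> integrated against \<open>weyl_kernel \<Xi>\<close>, again a partial Fourier transform of a Schwartz
  function (\<open>wigner_ext_shifted\<close>), which decays rapidly in both variables jointly
  (\<open>weyl_kernel_bound\<close>).  This gives convergence of the iterated integral and permits exchanging the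
  order; Fourier inversion integrates \<open>weyl_kernel\<close> over \<open>\<Xi>\<close> to \<open>test_fun_hat\<close>
  (\<open>weyl_kernel_integral\<close>).

The order of integration matters in the last item: for fixed \<open>\<Xi>\<close> the shift is legitimate, but the
symbol may grow exponentially in \<open>\<Xi>\<close> before the inner integral has been taken.\<close>

section \<open>Families of functions with controlled partial derivatives\<close>

definition pd :: "'a::euclidean_space \<Rightarrow> ('a \<Rightarrow> complex) \<Rightarrow> 'a \<Rightarrow> complex" where
  "pd b f = (\<lambda>x. frechet_derivative f (at x) b)"

text \<open>\<open>hered P n F\<close> says that a family \<open>F\<close> of functions, together with all its partial derivatives of
order at most \<open>n\<close>, satisfies the estimate \<open>P\<close>.  The estimate is imposed on the whole
family, so that constants are uniform in the parameter.  Recursion on \<open>n\<close> makes closure properties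
provable by one induction for all kinds of estimate at once: rapid decay, moderate growth, local
boundedness, or no estimate at all, which is mere smoothness.\<close>
primrec hered ::
    "(('p \<Rightarrow> 'a::euclidean_space \<Rightarrow> complex) \<Rightarrow> bool) \<Rightarrow> nat \<Rightarrow> ('p \<Rightarrow> 'a \<Rightarrow> complex) \<Rightarrow> bool" where
  "hered P 0 F \<longleftrightarrow> P F"
| "hered P (Suc n) F \<longleftrightarrow> P F \<and> (\<forall>p. F p differentiable_on UNIV) \<and>
     (\<forall>b\<in>Basis. hered P n (\<lambda>p. pd b (F p)))"

lemma pd_eq: "(f has_derivative D) (at x) \<Longrightarrow> pd b f x = D b"
  by (simp add: pd_def frechet_derivative_at[symmetric])

lemma has_derivative_pd:
  "f differentiable_on UNIV \<Longrightarrow> (f has_derivative (\<lambda>b. pd b f x)) (at x)"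
  by (simp add: pd_def differentiable_on_def frechet_derivative_works[symmetric])

lemma pd_add:
  assumes "f differentiable_on UNIV" "g differentiable_on UNIV"
  shows "pd b (\<lambda>x. f x + g x) = (\<lambda>x. pd b f x + pd b g x)"
  by (rule ext, rule pd_eq) (intro has_derivative_add has_derivative_pd assms)

lemma pd_mult:
  assumes "f differentiable_on UNIV" "g differentiable_on UNIV"
  shows "pd b (\<lambda>x. f x * g x) = (\<lambda>x. pd b f x * g x + f x * pd b g x)"
proof
  fix x
  have "((\<lambda>x. f x * g x) has_derivative (\<lambda>h. f x * pd h g x + pd h f x * g x)) (at x)"
    by (intro has_derivative_mult has_derivative_pd assms)
  from pd_eq[OF this] show "pd b (\<lambda>x. f x * g x) x = pd b f x * g x + f x * pd b g x" by simp
qed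

lemma pd_const [simp]: "pd b (\<lambda>x. c) = (\<lambda>x. 0)"
  by (rule ext, rule pd_eq) (rule has_derivative_const)

lemma pd_linear: "bounded_linear l \<Longrightarrow> pd b l = (\<lambda>x. l b)"
  by (rule ext, rule pd_eq) (rule bounded_linear_imp_has_derivative)

lemma hered_imp: "hered P n F \<Longrightarrow> P F"
  by (cases n) auto

lemma hered_SucD: "hered P (Suc n) F \<Longrightarrow> hered P n F"
proof (induction n arbitrary: F)
  case (Suc n)
  have "hered P n (\<lambda>p. pd b (F p))" if "b \<in> Basis" for b
    using Suc.prems that Suc.IH[of "\<lambda>p. pd b (F p)"] by simp
  then show ?case using Suc.prems by simp
qed simp

lemma hered_mono: "hered P n F \<Longrightarrow> (\<And>F. P F \<Longrightarrow> Q F) \<Longrightarrow> hered Q n F"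
  by (induction n arbitrary: F) auto

lemma hered_reparam:
  assumes "\<And>F. P F \<Longrightarrow> P' (\<lambda>p. F (\<theta> p))" "hered P n F"
  shows "hered P' n (\<lambda>p. F (\<theta> p))"
  using assms(2)
proof (induction n arbitrary: F)
  case (Suc n)
  have "hered P' n (\<lambda>p. pd b (F (\<theta> p)))" if "b \<in> Basis" for b
    using Suc.prems that Suc.IH[of "\<lambda>p. pd b (F p)"] by simp
  then show ?case using Suc.prems assms(1) by simp
qed (simp add: assms(1))

lemma hered_add:
  assumes add: "\<And>F G. P F \<Longrightarrow> P G \<Longrightarrow> P (\<lambda>p x. F p x + G p x)"
    and "hered P n F" "hered P n G"
  shows "hered P n (\<lambda>p x. F p x + G p x)"
  using assms(2,3)
proof (induction n arbitrary: F G)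
  case (Suc n)
  have "hered P n (\<lambda>p. pd b (\<lambda>x. F p x + G p x))" if "b \<in> Basis" for b
    using Suc.prems that Suc.IH[of "\<lambda>p. pd b (F p)" "\<lambda>p. pd b (G p)"] by (simp add: pd_add)
  then show ?case using Suc.prems add by simp
qed (simp add: add)

text \<open>By the Leibniz rule, differentiating a product yields sums of products of the same two kinds; the
estimates \<open>P1\<close> and \<open>P2\<close> of the factors may differ from the estimate \<open>P\<close> of the product (for
instance, rapid decay times moderate growth is rapid decay).\<close>
lemma hered_mult:
  assumes add: "\<And>F G. P F \<Longrightarrow> P G \<Longrightarrow> P (\<lambda>p x. F p x + G p x)"
    and mult: "\<And>F G. P1 F \<Longrightarrow> P2 G \<Longrightarrow> P (\<lambda>p x. F p x * G p x)"
    and "hered P1 n F" "hered P2 n G"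
  shows "hered P n (\<lambda>p x. F p x * G p x)"
  using assms(3,4)
proof (induction n arbitrary: F G)
  case (Suc n)
  have d: "F p differentiable_on UNIV" "G p differentiable_on UNIV" for p
    using Suc.prems by auto
  have FG: "hered P1 n F" "hered P2 n G" using Suc.prems by (auto intro: hered_SucD)
  have "hered P n (\<lambda>p. pd b (\<lambda>x. F p x * G p x))" if "b \<in> Basis" for b
    unfolding pd_mult[OF d]
    by (rule hered_add[where P=P, OF add]) (use Suc.prems that Suc.IH FG in auto)
  moreover have "P (\<lambda>p x. F p x * G p x)" using mult Suc.prems by simp
  moreover have "(\<lambda>x. F p x * G p x) differentiable_on UNIV" for p
    using d by (intro differentiable_on_mult)
  ultimately show ?case by simp
qed (simp add: mult)

lemma hered_const:
  assumes "P (\<lambda>p x. c p)" "P (\<lambda>p x. 0)"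
  shows "hered P n (\<lambda>p x. c p)"
proof -
  have z: "hered P n (\<lambda>p x. 0)" for n by (induction n) (use assms in auto)
  show ?thesis by (cases n) (use assms z in auto)
qed

lemma hered_linear:
  assumes "\<And>p. bounded_linear (l p)" "P l" "\<And>b. b \<in> Basis \<Longrightarrow> P (\<lambda>p x. l p b)" "P (\<lambda>p x. 0)"
  shows "hered P n l"
proof (cases n)
  case (Suc m)
  have "hered P m (\<lambda>p. pd b (l p))" if "b \<in> Basis" for b
    unfolding pd_linear[OF assms(1)] by (rule hered_const) (use assms that in auto)
  moreover have "l p differentiable_on UNIV" for p
    using assms(1)[of p] by (rule bounded_linear_imp_differentiable_on)
  ultimately show ?thesis using Suc assms by simp
qed (simp add: assms)

lemma hered_sum:
  assumes "finite I" "P (\<lambda>p x. 0)" "\<And>F G. P F \<Longrightarrow> P G \<Longrightarrow> P (\<lambda>p x. F p x + G p x)"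
    "\<And>i. i \<in> I \<Longrightarrow> hered P n (F i)"
  shows "hered P n (\<lambda>p x. \<Sum>i\<in>I. F i p x)"
  using assms(1,4)
proof (induction I rule: finite_induct)
  case empty
  show ?case using hered_const[of P "\<lambda>_. 0" n] assms(2) by simp
next
  case (insert i I)
  then show ?case by (simp, intro hered_add assms(3)) auto
qed

text \<open>Each derivative of the exponential is the exponential times a derivative of the exponent, so only
the exponential itself needs the estimate \<open>P\<close>; the exponent contributes factors of kind \<open>P1\<close>.\<close>
lemma hered_exp:
  assumes add: "\<And>F G. P F \<Longrightarrow> P G \<Longrightarrow> P (\<lambda>p x. F p x + G p x)"
    and mult: "\<And>F G. P1 F \<Longrightarrow> P G \<Longrightarrow> P (\<lambda>p x. F p x * G p x)"
    and l: "hered P1 n l" and e: "P (\<lambda>p x. exp (l p x))"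
  shows "hered P n (\<lambda>p x. exp (l p x))"
  using l
proof (induction n)
  case (Suc n)
  have d: "l p differentiable_on UNIV" for p using Suc.prems by auto
  have D: "((\<lambda>x. exp (l p x)) has_derivative (\<lambda>h. exp (l p x) * pd h (l p) x)) (at x)" for p x
    using has_derivative_compose[OF has_derivative_pd[OF d] DERIV_exp[THEN has_field_derivative_imp_has_derivative]] .
  have "hered P n (\<lambda>p. pd b (\<lambda>x. exp (l p x)))" if "b \<in> Basis" for b
  proof -
    have "hered P n (\<lambda>p x. pd b (l p) x * exp (l p x))"
      using Suc that hered_SucD[of P1 n l] by (intro hered_mult[OF add mult]) auto
    then show ?thesis unfolding pd_eq[OF D, abs_def] by (simp add: mult.commute)
  qed
  moreover have "(\<lambda>x. exp (l p x)) differentiable_on UNIV" for p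
    using D by (auto simp: differentiable_on_def differentiable_def intro: has_derivative_at_withinI)
  ultimately show ?case using e by simp
qed (simp add: e)

text \<open>The chain rule expresses each partial derivative of the composition as a linear combination, with
constant coefficients, of compositions of partial derivatives.  The translation \<open>s p\<close> may depend
on the parameter.\<close>
lemma hered_comp_affine:
  fixes A :: "'a::euclidean_space \<Rightarrow> 'b::euclidean_space"
  assumes lin: "linear A"
    and zero: "P' (\<lambda>p x. 0)"
    and add: "\<And>F G. P' F \<Longrightarrow> P' G \<Longrightarrow> P' (\<lambda>p x. F p x + G p x)"
    and scal: "\<And>F c. P' F \<Longrightarrow> P' (\<lambda>p x. c * F p x)"
    and comp: "\<And>F. P F \<Longrightarrow> P' (\<lambda>p x. F (\<theta> p) (A x + s p))"
    and F: "hered P n F"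
  shows "hered P' n (\<lambda>p x. F (\<theta> p) (A x + s p))"
  using F
proof (induction n arbitrary: F)
  case (Suc n)
  have d: "F p differentiable_on UNIV" for p using Suc.prems by auto
  have dA: "((\<lambda>x. A x + s p) has_derivative A) (at x)" for x p
    using lin by (auto intro!: derivative_eq_intros bounded_linear_imp_has_derivative
      simp: linear_conv_bounded_linear)
  have D: "((\<lambda>x. F (\<theta> p) (A x + s p)) has_derivative (\<lambda>h. pd (A h) (F (\<theta> p)) (A x + s p))) (at x)"
    for p x
    using has_derivative_compose[OF dA has_derivative_pd[OF d]] .
  have ex: "pd b (\<lambda>x. F (\<theta> p) (A x + s p)) =
     (\<lambda>x. \<Sum>c\<in>Basis. of_real (A b \<bullet> c) * pd c (F (\<theta> p)) (A x + s p))" for p b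
  proof
    fix x
    have lin: "linear (\<lambda>b. pd b (F (\<theta> p)) (A x + s p))"
      by (rule has_derivative_pd[OF d, THEN has_derivative_linear])
    have "pd b (\<lambda>x. F (\<theta> p) (A x + s p)) x = pd (A b) (F (\<theta> p)) (A x + s p)"
      by (rule pd_eq[OF D])
    also have "\<dots> = pd (\<Sum>c\<in>Basis. (A b \<bullet> c) *\<^sub>R c) (F (\<theta> p)) (A x + s p)"
      by (simp add: euclidean_representation)
    also have "\<dots> = (\<Sum>c\<in>Basis. (A b \<bullet> c) *\<^sub>R pd c (F (\<theta> p)) (A x + s p))"
      by (simp add: linear_sum[OF lin] linear_cmul[OF lin])
    finally show "pd b (\<lambda>x. F (\<theta> p) (A x + s p)) x =
      (\<Sum>c\<in>Basis. of_real (A b \<bullet> c) * pd c (F (\<theta> p)) (A x + s p))"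
      by (simp add: scaleR_conv_of_real)
  qed
  have "hered P' n (\<lambda>p. pd b (\<lambda>x. F (\<theta> p) (A x + s p)))" if "b \<in> Basis" for b
    unfolding ex
  proof (rule hered_sum[OF _ zero add])
    fix c :: 'b assume c: "c \<in> Basis"
    have "hered P' n (\<lambda>p x. pd c (F (\<theta> p)) (A x + s p))"
      using Suc.IH[of "\<lambda>p. pd c (F p)"] Suc.prems c by simp
    then show "hered P' n (\<lambda>p x. of_real (A b \<bullet> c) * pd c (F (\<theta> p)) (A x + s p))"
      by (intro hered_mult[where P=P', OF add, where ?P1.0="\<lambda>F. \<exists>c. F = (\<lambda>p x. c)" and ?P2.0=P'] hered_const)
        (auto intro: scal)
  qed auto
  moreover have "(\<lambda>x. F (\<theta> p) (A x + s p)) differentiable_on UNIV" for p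
    using D by (auto simp: differentiable_on_def differentiable_def intro: has_derivative_at_withinI)
  moreover have "P' (\<lambda>p x. F (\<theta> p) (A x + s p))" using comp Suc.prems by simp
  ultimately show ?case by simp
qed (simp add: comp)

lemma hered_cnj:
  assumes "\<And>F. P F \<Longrightarrow> P (\<lambda>p x. cnj (F p x))" "hered P n F"
  shows "hered P n (\<lambda>p x. cnj (F p x))"
  using assms(2)
proof (induction n arbitrary: F)
  case (Suc n)
  have d: "F p differentiable_on UNIV" for p using Suc.prems by auto
  have D: "((\<lambda>x. cnj (F p x)) has_derivative (\<lambda>h. cnj (pd h (F p) x))) (at x)" for p x
    by (rule bounded_linear.has_derivative[OF bounded_linear_cnj has_derivative_pd[OF d]])
  have "hered P n (\<lambda>p. pd b (\<lambda>x. cnj (F p x)))" if "b \<in> Basis" for b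
    unfolding pd_eq[OF D, abs_def] using Suc that by simp
  moreover have "(\<lambda>x. cnj (F p x)) differentiable_on UNIV" for p
    using D by (auto simp: differentiable_on_def differentiable_def intro: has_derivative_at_withinI)
  ultimately show ?case using assms(1) Suc.prems by simp
qed (simp add: assms)

lemma hered_inverse:
  fixes F :: "'p \<Rightarrow> 'a::euclidean_space \<Rightarrow> complex"
  assumes "\<And>p x. F p x \<noteq> 0" "hered (\<lambda>_. True) n F"
  shows "hered (\<lambda>_. True) n (\<lambda>p x. inverse (F p x))"
  using assms(2)
proof (induction n)
  case (Suc n)
  have d: "F p differentiable_on UNIV" for p using Suc.prems by auto
  have D: "((\<lambda>x. inverse (F p x)) has_derivative
     (\<lambda>h. - (inverse (F p x) * pd h (F p) x * inverse (F p x)))) (at x)" for p x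
    by (rule Deriv.has_derivative_inverse[OF assms(1) has_derivative_pd[OF d]])
  have "hered (\<lambda>_. True) n (\<lambda>p. pd b (\<lambda>x. inverse (F p x)))" if "b \<in> Basis" for b
  proof -
    have 1: "hered (\<lambda>_. True) n (\<lambda>p x. inverse (F p x))"
      using Suc hered_SucD by blast
    have "hered (\<lambda>_. True) n (\<lambda>p x. -1 * (inverse (F p x) * pd b (F p) x * inverse (F p x)))"
      by (intro hered_mult[where ?P1.0="\<lambda>_. True" and ?P2.0="\<lambda>_. True"] hered_const 1)
        (use Suc.prems that in auto)
    then show ?thesis unfolding pd_eq[OF D, abs_def] by simp
  qed
  moreover have "(\<lambda>x. inverse (F p x)) differentiable_on UNIV" for p
    using D by (auto simp: differentiable_on_def differentiable_def intro: has_derivative_at_withinI)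
  ultimately show ?case by simp
qed simp

text \<open>This produces smooth radial functions on any Euclidean space from smooth functions of one real variable.\<close>
lemma hered_norm_square:
  fixes h :: "real \<Rightarrow> complex"
  assumes "\<And>m. hered (\<lambda>_. True) m (\<lambda>_::unit. h)"
  shows "hered (\<lambda>_. True) n (\<lambda>_::unit. \<lambda>x::'a::euclidean_space. h (x \<bullet> x))"
  using assms
proof (induction n arbitrary: h)
  case (Suc n)
  have d: "h differentiable_on UNIV" using Suc.prems[of 1] by simp
  have D: "((\<lambda>x::'a. h (x \<bullet> x)) has_derivative (\<lambda>b. pd (2 * (x \<bullet> b)) h (x \<bullet> x))) (at x)" for x
    by (rule has_derivative_compose[OF _ has_derivative_pd[OF d]])
      (auto intro!: derivative_eq_intros simp: inner_commute)
  have lin: "pd (2 * (x \<bullet> b)) h t = of_real (2 * (x \<bullet> b)) * pd 1 h t" for x b :: 'a and t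
    using linear_cmul[OF has_derivative_pd[OF d, THEN has_derivative_linear], of "2 * (x \<bullet> b)" 1 t]
    by (simp add: scaleR_conv_of_real)
  have "hered (\<lambda>_. True) n (\<lambda>_::unit. pd b (\<lambda>x::'a. h (x \<bullet> x)))" if "b \<in> Basis" for b
  proof -
    have "hered (\<lambda>_. True) n (\<lambda>_::unit. \<lambda>x::'a. of_real (2 * (x \<bullet> b)) :: complex)"
      by (rule hered_linear) (auto intro!: bounded_linear_compose[OF bounded_linear_of_real]
          bounded_linear_const_mult bounded_linear_inner_left)
    moreover have "hered (\<lambda>_. True) n (\<lambda>_::unit. \<lambda>x::'a. pd 1 h (x \<bullet> x))"
      by (rule Suc.IH) (use Suc.prems[of "Suc _"] in auto)
    ultimately show ?thesis unfolding pd_eq[OF D, abs_def] lin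
      by (intro hered_mult[where ?P1.0="\<lambda>_. True" and ?P2.0="\<lambda>_. True"]) auto
  qed
  moreover have "(\<lambda>x::'a. h (x \<bullet> x)) differentiable_on UNIV"
    using D by (auto simp: differentiable_on_def differentiable_def intro: has_derivative_at_withinI)
  ultimately show ?case by simp
qed simp

text \<open>\<open>iter_pderiv\<close> applies the last derivative of the list first, whereas \<open>hered\<close> peels off the derivative
that is taken first; this is the bridge between the two recursions.\<close>
lemma iter_pderiv_snoc: "iter_pderiv (bs @ [b]) f = iter_pderiv bs (pd b f)"
  by (induction bs) (auto simp: pd_def)

lemma hered_iter_pderiv:
  "hered P n F \<Longrightarrow> set bs \<subseteq> Basis \<Longrightarrow> length bs \<le> n \<Longrightarrow> P (\<lambda>p. iter_pderiv bs (F p))"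
proof (induction bs arbitrary: n F rule: rev_induct)
  case Nil
  then show ?case using hered_imp[of P n F] by simp
next
  case (snoc b bs)
  then obtain m where n: "n = Suc m" by (cases n) auto
  have "P (\<lambda>p. iter_pderiv bs (pd b (F p)))"
    by (rule snoc.IH[of m "\<lambda>p. pd b (F p)"]) (use snoc.prems n in auto)
  then show ?case by (simp only: iter_pderiv_snoc)
qed

lemma hered_iter_pderiv_differentiable:
  "hered P n F \<Longrightarrow> set bs \<subseteq> Basis \<Longrightarrow> length bs < n \<Longrightarrow> iter_pderiv bs (F p) differentiable_on UNIV"
proof (induction bs arbitrary: n F rule: rev_induct)
  case Nil
  then show ?case by (cases n) auto
next
  case (snoc b bs)
  then obtain m where n: "n = Suc m" by (cases n) auto
  have "iter_pderiv bs (pd b (F p)) differentiable_on UNIV"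
    by (rule snoc.IH[of m "\<lambda>p. pd b (F p)"]) (use snoc.prems n in auto)
  then show ?case by (simp only: iter_pderiv_snoc)
qed

lemma smooth_iff: "smooth f \<longleftrightarrow> (\<forall>n. hered (\<lambda>_. True) n (\<lambda>_::unit. f))"
proof
  assume "smooth f"
  have "hered (\<lambda>_. True) n (\<lambda>_::unit. f)" for n
    using \<open>smooth f\<close>
  proof (induction n arbitrary: f)
    case (Suc n)
    have "smooth (pd b f)" if "b \<in> Basis" for b
      unfolding smooth_def iter_pderiv_snoc[symmetric] using Suc.prems that
      unfolding smooth_def by (metis Un_subset_iff empty_subsetI insert_subset list.set(1) list.simps(15) set_append)
    moreover have "f differentiable_on UNIV"
      using Suc.prems unfolding smooth_def by (elim allE[of _ "[]"]) simp
    ultimately show ?case using Suc.IH by simp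
  qed simp
  then show "\<forall>n. hered (\<lambda>_. True) n (\<lambda>_::unit. f)" by blast
next
  assume "\<forall>n. hered (\<lambda>_. True) n (\<lambda>_::unit. f)"
  then show "smooth f"
    unfolding smooth_def using hered_iter_pderiv_differentiable[of "\<lambda>_. True" _ "\<lambda>_::unit. f"] by blast
qed

section \<open>Rapid decay and moderate growth\<close>

text \<open>The size of the argument is measured by a gauge \<open>q\<close>, which may depend on the parameter.  This allows
simultaneous decay in the parameter and in the variable, and tracks which linear combinations of
the variables are controlled by a product of Schwartz functions.\<close>
definition rapid :: "'p set \<Rightarrow> ('p \<Rightarrow> 'a \<Rightarrow> real) \<Rightarrow> ('p \<Rightarrow> 'a \<Rightarrow> complex) \<Rightarrow> bool" where
  "rapid S q F \<longleftrightarrow> (\<forall>N. \<exists>C. \<forall>p\<in>S. \<forall>x. (1 + q p x) ^ N * cmod (F p x) \<le> C)"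

definition moderate :: "'p set \<Rightarrow> ('p \<Rightarrow> 'a \<Rightarrow> real) \<Rightarrow> ('p \<Rightarrow> 'a \<Rightarrow> complex) \<Rightarrow> bool" where
  "moderate S q F \<longleftrightarrow> (\<exists>N C. \<forall>p\<in>S. \<forall>x. cmod (F p x) \<le> C * (1 + q p x) ^ N)"

abbreviation hrapid ::
    "'p set \<Rightarrow> ('p \<Rightarrow> 'a::euclidean_space \<Rightarrow> real) \<Rightarrow> ('p \<Rightarrow> 'a \<Rightarrow> complex) \<Rightarrow> bool" where
  "hrapid S q F \<equiv> \<forall>n. hered (rapid S q) n F"

abbreviation hmoderate ::
    "'p set \<Rightarrow> ('p \<Rightarrow> 'a::euclidean_space \<Rightarrow> real) \<Rightarrow> ('p \<Rightarrow> 'a \<Rightarrow> complex) \<Rightarrow> bool" where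
  "hmoderate S q F \<equiv> \<forall>n. hered (moderate S q) n F"

lemma rapidD:
  assumes "rapid S q F"
  obtains C where "C \<ge> 0" "\<And>p x. p \<in> S \<Longrightarrow> (1 + q p x) ^ N * cmod (F p x) \<le> C"
proof -
  obtain C where C: "\<And>p x. p \<in> S \<Longrightarrow> (1 + q p x) ^ N * cmod (F p x) \<le> C"
    using assms unfolding rapid_def by blast
  show ?thesis by (rule that[of "max C 0"]) (use C in \<open>auto simp: le_max_iff_disj\<close>)
qed

lemma rapid_zero: "rapid S q (\<lambda>p x. 0)"
  by (auto simp: rapid_def intro: exI[of _ 0])

lemma moderate_zero: "moderate S q (\<lambda>p x. 0)"
  by (auto simp: moderate_def intro!: exI[of _ 0])

lemma rapid_add:
  assumes "\<And>p x. 0 \<le> q p x" "rapid S q F" "rapid S q G"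
  shows "rapid S q (\<lambda>p x. F p x + G p x)"
  unfolding rapid_def
proof
  fix N
  obtain C D where C: "\<And>p x. p \<in> S \<Longrightarrow> (1 + q p x) ^ N * cmod (F p x) \<le> C"
    and D: "\<And>p x. p \<in> S \<Longrightarrow> (1 + q p x) ^ N * cmod (G p x) \<le> D"
    using assms(2,3) unfolding rapid_def by metis
  have "(1 + q p x) ^ N * cmod (F p x + G p x) \<le> C + D" if "p \<in> S" for p x
  proof -
    have "(1 + q p x) ^ N * cmod (F p x + G p x) \<le> (1 + q p x) ^ N * (cmod (F p x) + cmod (G p x))"
      by (intro mult_left_mono norm_triangle_ineq) (simp add: assms(1))
    also have "\<dots> \<le> C + D" using C[OF that, of x] D[OF that, of x] by (simp add: distrib_left)
    finally show ?thesis .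
  qed
  then show "\<exists>C. \<forall>p\<in>S. \<forall>x. (1 + q p x) ^ N * cmod (F p x + G p x) \<le> C" by blast
qed

lemma moderateD:
  assumes "\<And>p x. 0 \<le> q p x" "moderate S q F"
  obtains N C where "C \<ge> 0" "\<And>M p x. p \<in> S \<Longrightarrow> M \<ge> N \<Longrightarrow> cmod (F p x) \<le> C * (1 + q p x) ^ M"
proof -
  obtain N C where C: "\<And>p x. p \<in> S \<Longrightarrow> cmod (F p x) \<le> C * (1 + q p x) ^ N"
    using assms(2) unfolding moderate_def by blast
  have "cmod (F p x) \<le> \<bar>C\<bar> * (1 + q p x) ^ M" if "p \<in> S" "M \<ge> N" for M p x
  proof -
    have "C * (1 + q p x) ^ N \<le> \<bar>C\<bar> * (1 + q p x) ^ M"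
      using assms(1)[of p x] that by (intro mult_mono power_increasing) auto
    then show ?thesis using C[OF that(1), of x] by linarith
  qed
  then show ?thesis using that[of "\<bar>C\<bar>" N] by auto
qed

lemma moderate_add:
  assumes "\<And>p x. 0 \<le> q p x" "moderate S q F" "moderate S q G"
  shows "moderate S q (\<lambda>p x. F p x + G p x)"
proof -
  obtain N C where C: "\<And>M p x. p \<in> S \<Longrightarrow> M \<ge> N \<Longrightarrow> cmod (F p x) \<le> C * (1 + q p x) ^ M"
    using moderateD[OF assms(1,2)] by metis
  obtain N' C' where C': "\<And>M p x. p \<in> S \<Longrightarrow> M \<ge> N' \<Longrightarrow> cmod (G p x) \<le> C' * (1 + q p x) ^ M"
    using moderateD[OF assms(1,3)] by metis
  have "cmod (F p x + G p x) \<le> (C + C') * (1 + q p x) ^ max N N'" if "p \<in> S" for p x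
    using C[OF that, of "max N N'" x] C'[OF that, of "max N N'" x]
      norm_triangle_ineq[of "F p x" "G p x"] by (simp add: distrib_right)
  then show ?thesis unfolding moderate_def by blast
qed

lemma moderate_mult:
  assumes "\<And>p x. 0 \<le> q p x" "moderate S q F" "moderate S q G"
  shows "moderate S q (\<lambda>p x. F p x * G p x)"
proof -
  obtain N C where C: "C \<ge> 0" "\<And>M p x. p \<in> S \<Longrightarrow> M \<ge> N \<Longrightarrow> cmod (F p x) \<le> C * (1 + q p x) ^ M"
    using moderateD[OF assms(1,2)] by metis
  obtain N' C' where C': "C' \<ge> 0" "\<And>M p x. p \<in> S \<Longrightarrow> M \<ge> N' \<Longrightarrow> cmod (G p x) \<le> C' * (1 + q p x) ^ M"
    using moderateD[OF assms(1,3)] by metis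
  have "cmod (F p x * G p x) \<le> (C * C') * (1 + q p x) ^ (N + N')" if "p \<in> S" for p x
  proof -
    have "cmod (F p x * G p x) \<le> (C * (1 + q p x) ^ N) * (C' * (1 + q p x) ^ N')"
      unfolding norm_mult using C C' that assms(1)[of p x] by (intro mult_mono) auto
    then show ?thesis by (simp add: power_add mult_ac)
  qed
  then show ?thesis unfolding moderate_def by blast
qed

lemma rapid_moderate_mult:
  assumes "\<And>p x. 0 \<le> q p x" "rapid S q F" "moderate S q G"
  shows "rapid S q (\<lambda>p x. F p x * G p x)"
  unfolding rapid_def
proof
  fix N
  obtain M C where C: "C \<ge> 0" "\<And>p x. p \<in> S \<Longrightarrow> cmod (G p x) \<le> C * (1 + q p x) ^ M"
    using moderateD[OF assms(1,3)] by (metis order_refl)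
  obtain D where D: "\<And>p x. p \<in> S \<Longrightarrow> (1 + q p x) ^ (N + M) * cmod (F p x) \<le> D"
    using assms(2) unfolding rapid_def by metis
  have "(1 + q p x) ^ N * cmod (F p x * G p x) \<le> C * D" if "p \<in> S" for p x
  proof -
    have "(1 + q p x) ^ N * cmod (F p x * G p x) \<le>
       (1 + q p x) ^ N * (cmod (F p x) * (C * (1 + q p x) ^ M))"
      unfolding norm_mult using C that assms(1)[of p x] by (intro mult_left_mono) auto
    also have "\<dots> = C * ((1 + q p x) ^ (N + M) * cmod (F p x))" by (simp add: power_add mult_ac)
    also have "\<dots> \<le> C * D" using D[OF that] C by (intro mult_left_mono) auto
    finally show ?thesis .
  qed
  then show "\<exists>C. \<forall>p\<in>S. \<forall>x. (1 + q p x) ^ N * cmod (F p x * G p x) \<le> C" by blast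
qed

text \<open>Decay in \<open>q1\<close> and decay in \<open>q2\<close> multiply to decay in \<open>q1 + q2\<close>, since
\<open>1 + q1 + q2 \<le> (1 + q1) * (1 + q2)\<close>.\<close>
lemma rapid_mult:
  assumes "\<And>p x. 0 \<le> q1 p x" "\<And>p x. 0 \<le> q2 p x" "rapid S q1 F" "rapid S q2 G"
  shows "rapid S (\<lambda>p x. q1 p x + q2 p x) (\<lambda>p x. F p x * G p x)"
  unfolding rapid_def
proof
  fix N
  obtain C where C: "C \<ge> 0" "\<And>p x. p \<in> S \<Longrightarrow> (1 + q1 p x) ^ N * cmod (F p x) \<le> C"
    using rapidD[OF assms(3)] by metis
  obtain D where D: "D \<ge> 0" "\<And>p x. p \<in> S \<Longrightarrow> (1 + q2 p x) ^ N * cmod (G p x) \<le> D"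
    using rapidD[OF assms(4)] by metis
  have "(1 + (q1 p x + q2 p x)) ^ N * cmod (F p x * G p x) \<le> C * D" if "p \<in> S" for p x
  proof -
    have "1 + (q1 p x + q2 p x) \<le> (1 + q1 p x) * (1 + q2 p x)"
      using assms(1)[of p x] assms(2)[of p x] by (simp add: distrib_left distrib_right)
    then have "(1 + (q1 p x + q2 p x)) ^ N \<le> ((1 + q1 p x) * (1 + q2 p x)) ^ N"
      using assms(1)[of p x] assms(2)[of p x] by (intro power_mono) auto
    then have "(1 + (q1 p x + q2 p x)) ^ N * cmod (F p x * G p x) \<le>
        ((1 + q1 p x) * (1 + q2 p x)) ^ N * cmod (F p x * G p x)"
      by (intro mult_right_mono) auto
    also have "\<dots> = ((1 + q1 p x) ^ N * cmod (F p x)) * ((1 + q2 p x) ^ N * cmod (G p x))"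
      by (simp add: power_mult_distrib norm_mult mult_ac)
    also have "\<dots> \<le> C * D" using C D that assms(2)[of p x] by (intro mult_mono) auto
    finally show ?thesis .
  qed
  then show "\<exists>C. \<forall>p\<in>S. \<forall>x. (1 + (q1 p x + q2 p x)) ^ N * cmod (F p x * G p x) \<le> C" by blast
qed

lemma gauge_power_le:
  fixes q q' :: real
  assumes "0 \<le> q'" "0 \<le> q" "q' \<le> B * (1 + q)"
  shows "(1 + q') ^ N \<le> (1 + \<bar>B\<bar>) ^ N * (1 + q) ^ N"
proof -
  have "B * (1 + q) \<le> \<bar>B\<bar> * (1 + q)" using assms by (intro mult_right_mono) auto
  then have "1 + q' \<le> (1 + q) + \<bar>B\<bar> * (1 + q)" using assms by linarith
  then have "1 + q' \<le> (1 + \<bar>B\<bar>) * (1 + q)" by (simp add: distrib_right)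
  then have "(1 + q') ^ N \<le> ((1 + \<bar>B\<bar>) * (1 + q)) ^ N" using assms by (intro power_mono) auto
  then show ?thesis by (simp add: power_mult_distrib)
qed

lemma rapid_weaken:
  assumes "rapid S q F" "\<And>p x. 0 \<le> q p x" "\<And>p x. 0 \<le> q' p x" "S' \<subseteq> S"
    and "\<And>p x. p \<in> S' \<Longrightarrow> q' p x \<le> B * (1 + q p x)"
  shows "rapid S' q' F"
  unfolding rapid_def
proof
  fix N
  obtain C where C: "\<And>p x. p \<in> S \<Longrightarrow> (1 + q p x) ^ N * cmod (F p x) \<le> C"
    using assms(1) unfolding rapid_def by metis
  have "(1 + q' p x) ^ N * cmod (F p x) \<le> (1 + \<bar>B\<bar>) ^ N * C" if "p \<in> S'" for p x
  proof -
    have "(1 + q' p x) ^ N * cmod (F p x) \<le> ((1 + \<bar>B\<bar>) ^ N * (1 + q p x) ^ N) * cmod (F p x)"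
      using gauge_power_le[OF assms(3,2) assms(5)[OF that]] by (intro mult_right_mono) auto
    also have "\<dots> \<le> (1 + \<bar>B\<bar>) ^ N * C"
      using C[of p x] that assms(4) by (auto simp: mult.assoc intro!: mult_left_mono)
    finally show ?thesis .
  qed
  then show "\<exists>C. \<forall>p\<in>S'. \<forall>x. (1 + q' p x) ^ N * cmod (F p x) \<le> C" by blast
qed

lemma hrapid_weaken:
  assumes "hrapid S q F" "\<And>p x. 0 \<le> q p x" "\<And>p x. 0 \<le> q' p x" "S' \<subseteq> S"
    and "\<And>p x. p \<in> S' \<Longrightarrow> q' p x \<le> B * (1 + q p x)"
  shows "hrapid S' q' F"
  using assms(1) by (auto intro: hered_mono rapid_weaken[OF _ assms(2-5)])

lemma hrapid_mult:
  assumes "\<And>p x. 0 \<le> q1 p x" "\<And>p x. 0 \<le> q2 p x" "hrapid S q1 F" "hrapid S q2 G"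
  shows "hrapid S (\<lambda>p x. q1 p x + q2 p x) (\<lambda>p x. F p x * G p x)"
proof
  fix n
  show "hered (rapid S (\<lambda>p x. q1 p x + q2 p x)) n (\<lambda>p x. F p x * G p x)"
    by (rule hered_mult[where P="rapid S (\<lambda>p x. q1 p x + q2 p x)" and ?P1.0="rapid S q1" and ?P2.0="rapid S q2"])
      (use assms in \<open>auto intro: rapid_add rapid_mult\<close>)
qed

lemma hrapid_moderate_mult:
  assumes "\<And>p x. 0 \<le> q p x" "hrapid S q F" "hmoderate S q G"
  shows "hrapid S q (\<lambda>p x. F p x * G p x)"
proof
  fix n
  show "hered (rapid S q) n (\<lambda>p x. F p x * G p x)"
    by (rule hered_mult[where P="rapid S q" and ?P1.0="rapid S q" and ?P2.0="moderate S q"])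
      (use assms in \<open>auto intro: rapid_add rapid_moderate_mult\<close>)
qed

lemma hmoderate_mult:
  assumes "\<And>p x. 0 \<le> q p x" "hmoderate S q F" "hmoderate S q G"
  shows "hmoderate S q (\<lambda>p x. F p x * G p x)"
proof
  fix n
  show "hered (moderate S q) n (\<lambda>p x. F p x * G p x)"
    by (rule hered_mult[where P="moderate S q" and ?P1.0="moderate S q" and ?P2.0="moderate S q"])
      (use assms in \<open>auto intro: moderate_add moderate_mult\<close>)
qed

lemma hmoderate_add:
  assumes "\<And>p x. 0 \<le> q p x" "hmoderate S q F" "hmoderate S q G"
  shows "hmoderate S q (\<lambda>p x. F p x + G p x)"
proof
  fix n
  show "hered (moderate S q) n (\<lambda>p x. F p x + G p x)"
    by (rule hered_add[where P="moderate S q"]) (use assms in \<open>auto intro: moderate_add\<close>)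
qed

lemma hrapid_add:
  assumes "\<And>p x. 0 \<le> q p x" "hrapid S q F" "hrapid S q G"
  shows "hrapid S q (\<lambda>p x. F p x + G p x)"
proof
  fix n
  show "hered (rapid S q) n (\<lambda>p x. F p x + G p x)"
    by (rule hered_add[where P="rapid S q"]) (use assms in \<open>auto intro: rapid_add\<close>)
qed

lemma hrapid_cnj: "hrapid S q F \<Longrightarrow> hrapid S q (\<lambda>p x. cnj (F p x))"
  using hered_cnj[of "rapid S q"] by (simp add: rapid_def)

lemma hmoderate_const:
  assumes "\<And>p. p \<in> S \<Longrightarrow> cmod (c p) \<le> C"
  shows "hmoderate S q (\<lambda>p x. c p)"
proof
  fix n
  show "hered (moderate S q) n (\<lambda>p x. c p)"
  proof (rule hered_const)
    show "moderate S q (\<lambda>p x. c p)"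
      unfolding moderate_def by (rule exI[of _ 0], rule exI[of _ C]) (use assms in simp)
  qed (rule moderate_zero)
qed

lemma hrapid_cmult:
  assumes "\<And>p x. 0 \<le> q p x" "hrapid S q F"
  shows "hrapid S q (\<lambda>p x. c * F p x)"
proof -
  have "hmoderate S q (\<lambda>p x. c)" by (rule hmoderate_const) (rule order_refl)
  from hrapid_moderate_mult[OF assms this] show ?thesis by (simp add: mult.commute)
qed

lemma hmoderate_linear:
  fixes l :: "'p \<Rightarrow> 'a::euclidean_space \<Rightarrow> complex"
  assumes "\<And>p. bounded_linear (l p)" and q0: "\<And>p x. 0 \<le> q p x"
    and bound: "\<And>p x. p \<in> S \<Longrightarrow> cmod (l p x) \<le> B * norm x"
    and q: "\<And>p x. p \<in> S \<Longrightarrow> norm x \<le> D * (1 + q p x)"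
  shows "hmoderate S q l"
proof
  fix n
  show "hered (moderate S q) n l"
  proof (rule hered_linear[OF assms(1)])
    have "cmod (l p x) \<le> (\<bar>B\<bar> * D) * (1 + q p x) ^ 1" if "p \<in> S" for p x
    proof -
      have "cmod (l p x) \<le> \<bar>B\<bar> * norm x"
        using bound[OF that, of x] by (smt (verit) mult_right_mono norm_ge_zero)
      also have "\<dots> \<le> \<bar>B\<bar> * (D * (1 + q p x))" using q[OF that] by (intro mult_left_mono) auto
      finally show ?thesis by simp
    qed
    then show "moderate S q l" unfolding moderate_def by blast
    show "moderate S q (\<lambda>p x. l p b)" if "b \<in> Basis" for b
      unfolding moderate_def
      by (rule exI[of _ 0], rule exI[of _ B]) (use bound[of _ b] that in simp)
  qed (rule moderate_zero)
qed

lemma hmoderate_square_norm: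
  fixes q :: "'p \<Rightarrow> 'a::euclidean_space \<Rightarrow> real"
  assumes q0: "\<And>p x. 0 \<le> q p x" and q: "\<And>p x. p \<in> S \<Longrightarrow> norm x \<le> D * (1 + q p x)"
  shows "hmoderate S q (\<lambda>p x. of_real (c * (x \<bullet> x)))"
proof
  fix n
  have l: "hmoderate S q (\<lambda>p x::'a. complex_of_real (x \<bullet> b))" if "b \<in> Basis" for b
  proof (rule hmoderate_linear[OF _ q0 _ q])
    show "bounded_linear (\<lambda>x. complex_of_real (x \<bullet> b))"
      by (rule bounded_linear_compose[OF bounded_linear_of_real bounded_linear_inner_left])
    show "cmod (of_real (x \<bullet> b)) \<le> 1 * norm x" for x
      using that by (simp add: Basis_le_norm)
  qed
  have k: "hmoderate S q (\<lambda>p x::'a. complex_of_real c)" by (rule hmoderate_const) (rule order_refl)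
  have "hered (moderate S q) n (\<lambda>p x. \<Sum>b\<in>Basis. of_real c * (of_real (x \<bullet> b) * of_real (x \<bullet> b)))"
    by (rule hered_sum[where P="moderate S q"])
      (use hmoderate_mult[OF q0 k hmoderate_mult[OF q0 l l]] in \<open>auto intro: moderate_add[OF q0] moderate_zero\<close>)
  moreover have "complex_of_real (c * (x \<bullet> x)) =
      (\<Sum>b\<in>Basis. of_real c * (of_real (x \<bullet> b) * of_real (x \<bullet> b)))" for x :: 'a
    by (subst euclidean_inner) (simp add: sum_distrib_left)
  ultimately show "hered (moderate S q) n (\<lambda>p x. of_real (c * (x \<bullet> x)))" by simp
qed

text \<open>For an exponent of moderate growth, every derivative of the exponential is a polynomially bounded multiple of it.\<close>
lemma hrapid_exp:
  assumes "\<And>p x. 0 \<le> q p x" "hmoderate S q l" "rapid S q (\<lambda>p x. exp (l p x))"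
  shows "hrapid S q (\<lambda>p x. exp (l p x))"
proof
  fix n
  show "hered (rapid S q) n (\<lambda>p x. exp (l p x))"
  proof (rule hered_exp[where P="rapid S q" and ?P1.0="moderate S q"])
    show "rapid S q (\<lambda>p x. F p x * G p x)" if "moderate S q F" "rapid S q G" for F G
      using rapid_moderate_mult[OF assms(1) that(2,1)] by (simp add: mult.commute)
  qed (use assms in \<open>auto intro: rapid_add\<close>)
qed

lemma hmoderate_exp:
  assumes "\<And>p x. 0 \<le> q p x" "hmoderate S q l" "moderate S q (\<lambda>p x. exp (l p x))"
  shows "hmoderate S q (\<lambda>p x. exp (l p x))"
proof
  fix n
  show "hered (moderate S q) n (\<lambda>p x. exp (l p x))"
    by (rule hered_exp[where P="moderate S q" and ?P1.0="moderate S q"])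
      (use assms in \<open>auto intro: moderate_add moderate_mult\<close>)
qed

lemma hrapid_comp_affine:
  fixes A :: "'a::euclidean_space \<Rightarrow> 'b::euclidean_space"
  assumes "linear A" "hrapid S q F" "\<And>p x. 0 \<le> q p x" "\<And>p. p \<in> S' \<Longrightarrow> \<theta> p \<in> S"
  shows "hrapid S' (\<lambda>p x. q (\<theta> p) (A x + s p)) (\<lambda>p x. F (\<theta> p) (A x + s p))"
proof
  fix n
  show "hered (rapid S' (\<lambda>p x. q (\<theta> p) (A x + s p))) n (\<lambda>p x. F (\<theta> p) (A x + s p))"
  proof (rule hered_comp_affine[where P="rapid S q", OF assms(1)])
    fix G :: "_ \<Rightarrow> 'a \<Rightarrow> complex" and c
    assume G: "rapid S' (\<lambda>p x. q (\<theta> p) (A x + s p)) G"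
    have "moderate S' (\<lambda>p x. q (\<theta> p) (A x + s p)) (\<lambda>p x. c)"
      unfolding moderate_def by (rule exI[of _ 0], rule exI[of _ "cmod c"]) simp
    with G have "rapid S' (\<lambda>p x. q (\<theta> p) (A x + s p)) (\<lambda>p x. G p x * c)"
      by (intro rapid_moderate_mult assms)
    then show "rapid S' (\<lambda>p x. q (\<theta> p) (A x + s p)) (\<lambda>p x. c * G p x)"
      by (simp add: mult.commute)
  next
    fix F assume "rapid S q F"
    then show "rapid S' (\<lambda>p x. q (\<theta> p) (A x + s p)) (\<lambda>p x. F (\<theta> p) (A x + s p))"
      unfolding rapid_def using assms(4) by meson
  qed (use assms in \<open>auto intro: rapid_zero rapid_add\<close>)
qed

lemma hered_continuous_on: "hered P (Suc 0) F \<Longrightarrow> continuous_on UNIV (F p)"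
  by (auto intro: differentiable_imp_continuous_on)

text \<open>The definition of Schwartz functions by iterated derivatives and weights agrees with the recursive
one; all further work with Schwartz functions uses the recursive form.\<close>
lemma schwartz_iff:
  fixes f :: "'a::euclidean_space \<Rightarrow> complex"
  shows "schwartz f \<longleftrightarrow> hrapid UNIV (\<lambda>_ x. norm x) (\<lambda>_::unit. f)"
proof
  assume "schwartz f"
  then show "hrapid UNIV (\<lambda>_ x. norm x) (\<lambda>_::unit. f)"
  proof (intro allI)
    fix n assume "schwartz f"
    then show "hered (rapid UNIV (\<lambda>_ x. norm x)) n (\<lambda>_::unit. f)"
    proof (induction n arbitrary: f)
      case (Suc n f)
      have "schwartz (pd b f)" if "b \<in> Basis" for b
        using Suc.prems that
        unfolding schwartz_def smooth_def iter_pderiv_snoc[symmetric]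
        by (metis Un_subset_iff empty_subsetI insert_subset list.set(1) list.simps(15) set_append)
      moreover have "f differentiable_on UNIV"
        using Suc.prems unfolding schwartz_def smooth_def by (metis empty_subsetI iter_pderiv.simps(1) list.set(1))
      moreover have "rapid UNIV (\<lambda>_ x. norm x) (\<lambda>_::unit. f)"
        using Suc.IH[OF Suc.prems] hered_imp by blast
      ultimately show ?case using Suc.IH by simp
    next
      case (0 f)
      have "bounded (range (\<lambda>x. (1 + norm x) ^ N *\<^sub>R f x))" for N
        using 0 unfolding schwartz_def by (metis empty_subsetI iter_pderiv.simps(1) list.set(1))
      then show ?case by (auto simp: rapid_def bounded_iff abs_of_nonneg)
    qed
  qed
next
  assume *: "hrapid UNIV (\<lambda>_ x. norm x) (\<lambda>_::unit. f)"
  have "smooth f" unfolding smooth_iff using * by (auto intro: hered_mono)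
  moreover have "bounded (range (\<lambda>x. (1 + norm x) ^ N *\<^sub>R iter_pderiv bs f x))"
    if "set bs \<subseteq> Basis" for N bs
  proof -
    have "rapid UNIV (\<lambda>_ x. norm x) (\<lambda>_::unit. iter_pderiv bs f)"
      using hered_iter_pderiv[OF spec[OF *] that order_refl] .
    then obtain C where "\<And>x. (1 + norm x) ^ N * cmod (iter_pderiv bs f x) \<le> C"
      unfolding rapid_def by auto
    then show ?thesis by (auto simp: bounded_iff abs_of_nonneg)
  qed
  ultimately show "schwartz f" unfolding schwartz_def by blast
qed

lemma hrapid_imp_schwartz:
  assumes "hrapid S (\<lambda>_ x. norm x) F" "p \<in> S"
  shows "schwartz (F p)"
  unfolding schwartz_iff
proof
  fix n
  show "hered (rapid UNIV (\<lambda>_ x. norm x)) n (\<lambda>_::unit. F p)"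
  proof (rule hered_reparam[where P="rapid S (\<lambda>_ x. norm x)" and \<theta>="\<lambda>_. p" and F=F])
    show "rapid UNIV (\<lambda>_ x. norm x) (\<lambda>_. G p)" if "rapid S (\<lambda>_ x. norm x) G" for G
      using that assms(2) unfolding rapid_def by blast
  qed (use assms in blast)
qed

lemma power_le_fact_exp: "0 \<le> x \<Longrightarrow> x ^ n \<le> fact n * exp (x::real)"
proof -
  assume x: "0 \<le> x"
  have "(\<Sum>k\<in>{n}. x ^ k /\<^sub>R fact k) \<le> (\<Sum>k. x ^ k /\<^sub>R fact k)"
    by (rule sum_le_suminf[OF summable_exp_generic]) (use x in auto)
  then have "x ^ n /\<^sub>R fact n \<le> exp x" unfolding exp_def by simp
  then show ?thesis by (simp add: field_simps)
qed

text \<open>A Gaussian beats both a polynomial and an exponential of linear growth.  The linear term is what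
a complex shift of a Gaussian produces.\<close>
lemma poly_exp_bounded:
  fixes \<epsilon> M :: real
  assumes "\<epsilon> > 0"
  shows "\<exists>C. \<forall>r\<ge>0. (1 + r) ^ N * exp (M * r - \<epsilon> * r\<^sup>2) \<le> C"
proof (intro exI allI impI)
  fix r :: real assume "r \<ge> 0"
  have "(1 + r) ^ N \<le> fact N * exp (1 + r)"
    using power_le_fact_exp[of "1 + r" N] \<open>r \<ge> 0\<close> by simp
  then have "(1 + r) ^ N * exp (M * r - \<epsilon> * r\<^sup>2) \<le> fact N * exp (1 + r) * exp (M * r - \<epsilon> * r\<^sup>2)"
    by (intro mult_right_mono) auto
  also have "\<dots> = fact N * exp (1 + (M + 1) * r - \<epsilon> * r\<^sup>2)"
    by (simp add: exp_add[symmetric] algebra_simps mult_exp_exp)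
  also have "1 + (M + 1) * r - \<epsilon> * r\<^sup>2 \<le> 1 + (M + 1)\<^sup>2 / (4 * \<epsilon>)"
  proof -
    have "0 \<le> (\<epsilon> * r - (M + 1) / 2)\<^sup>2 / \<epsilon>" using assms by simp
    also have "\<dots> = \<epsilon> * r\<^sup>2 - (M + 1) * r + (M + 1)\<^sup>2 / (4 * \<epsilon>)"
      using assms by (simp add: field_simps power2_eq_square)
    finally show ?thesis by simp
  qed
  finally show "(1 + r) ^ N * exp (M * r - \<epsilon> * r\<^sup>2) \<le> fact N * exp (1 + (M + 1)\<^sup>2 / (4 * \<epsilon>))" by simp
qed

lemma hrapid_gaussian:
  fixes q :: "'p \<Rightarrow> 'a::euclidean_space \<Rightarrow> real"
  assumes "\<epsilon> > 0"
  shows "hrapid S (\<lambda>p x. norm x) (\<lambda>p x::'a. exp (of_real (- \<epsilon> * (x \<bullet> x))))"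
proof (rule hrapid_exp)
  show "hmoderate S (\<lambda>p x. norm x) (\<lambda>p x::'a. of_real (- \<epsilon> * (x \<bullet> x)))"
    by (rule hmoderate_square_norm[of _ _ 1]) auto
  have "\<exists>C. \<forall>x::'a. (1 + norm x) ^ N * exp (- \<epsilon> * (norm x)\<^sup>2) \<le> C" for N
    using poly_exp_bounded[OF assms, of N 0] by (metis diff_0 mult_minus_left mult_zero_left norm_ge_zero)
  then show "rapid S (\<lambda>p x. norm x) (\<lambda>p x::'a. exp (of_real (- \<epsilon> * (x \<bullet> x))))"
    unfolding rapid_def norm_exp_eq_Re by (simp add: power2_norm_eq_inner[symmetric])
qed simp

section \<open>Cutoff functions\<close>

text \<open>For \<open>m = 0\<close> this is the classical function \<open>exp (- 1 / t)\<close>, flat at the origin.  The powers of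
\<open>1 / t\<close> make the family closed under differentiation, which reduces smoothness to a formula for one
derivative.\<close>
definition flat_exp :: "nat \<Rightarrow> real \<Rightarrow> real" where
  "flat_exp m t = (if t > 0 then inverse t ^ m * exp (- inverse t) else 0)"

lemma flat_exp_nonneg: "0 \<le> flat_exp m t" by (simp add: flat_exp_def)

lemma flat_exp_bound: "flat_exp m t \<le> fact (m + 2) * t\<^sup>2"
proof (cases "t > 0")
  case True
  define s where "s = inverse t"
  have s: "s > 0" "t = inverse s" using True by (auto simp: s_def)
  have "s ^ (m + 2) \<le> fact (m + 2) * exp s"
    using power_le_fact_exp[of s "m+2"] s by simp
  then have "s ^ m * exp (- s) \<le> fact (m + 2) * (inverse s)\<^sup>2"
    using s by (simp add: field_simps exp_minus power2_eq_square)
  then show ?thesis using True by (simp add: flat_exp_def s_def)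
qed (simp add: flat_exp_def)

text \<open>Away from the origin this is calculus; at the origin the difference quotient is controlled by the
quadratic bound \<open>flat_exp_bound\<close>.\<close>
lemma flat_exp_deriv: "(flat_exp m has_real_derivative (- real m * flat_exp (Suc m) t + flat_exp (m + 2) t)) (at t)"
proof -
  consider "t > 0" | "t < 0" | "t = 0" by linarith
  then show ?thesis
  proof cases
    case 1
    have D: "((\<lambda>t. inverse t) has_real_derivative - (inverse t ^ 2)) (at t)"
      using 1 by (auto intro!: derivative_eq_intros simp: power2_eq_square)
    have "((\<lambda>t. inverse t ^ m * exp (- inverse t)) has_real_derivative
       (of_nat m * (- (inverse t ^ 2) * inverse t ^ (m - Suc 0))) * exp (- inverse t)
        + (exp (- inverse t) * - (- (inverse t ^ 2))) * inverse t ^ m) (at t)"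
      by (rule DERIV_mult[OF DERIV_power[OF D] DERIV_fun_exp[OF DERIV_minus[OF D]]])
    moreover have "(of_nat m * (- (inverse t ^ 2) * inverse t ^ (m - Suc 0))) * exp (- inverse t)
        + (exp (- inverse t) * - (- (inverse t ^ 2))) * inverse t ^ m =
       - real m * flat_exp (Suc m) t + flat_exp (m + 2) t"
    proof -
      have "real m * (inverse t ^ 2 * inverse t ^ (m - Suc 0)) = real m * inverse t ^ Suc m"
        by (cases m) (simp_all add: power2_eq_square)
      then show ?thesis using 1 by (simp add: flat_exp_def power_add power2_eq_square mult_ac)
    qed
    ultimately have "((\<lambda>t. inverse t ^ m * exp (- inverse t)) has_real_derivative
       (- real m * flat_exp (Suc m) t + flat_exp (m + 2) t)) (at t)" by (simp only:)
    moreover have "\<forall>\<^sub>F s in nhds t. inverse s ^ m * exp (- inverse s) = flat_exp m s"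
      using eventually_nhds_in_open[of "{0<..}" t] 1 by (auto elim!: eventually_mono simp: flat_exp_def)
    ultimately show ?thesis by (rule_tac DERIV_cong_ev[OF refl _ refl, THEN iffD1])
  next
    case 2
    have "((\<lambda>t. 0) has_real_derivative (- real m * flat_exp (Suc m) t + flat_exp (m + 2) t)) (at t)"
      using 2 by (simp add: flat_exp_def)
    moreover have "\<forall>\<^sub>F s in nhds t. 0 = flat_exp m s"
      using eventually_nhds_in_open[of "{..<0}" t] 2 by (auto elim!: eventually_mono simp: flat_exp_def)
    ultimately show ?thesis by (rule_tac DERIV_cong_ev[OF refl _ refl, THEN iffD1])
  next
    case 3
    have "((\<lambda>h. (flat_exp m (0 + h) - flat_exp m 0) / h) \<longlongrightarrow> 0) (at 0)"
    proof (rule Lim_null_comparison)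
      show "\<forall>\<^sub>F h in at 0. norm ((flat_exp m (0 + h) - flat_exp m 0) / h) \<le> fact (m + 2) * \<bar>h\<bar>"
      proof (rule eventually_at_filter[THEN iffD2], rule always_eventually, intro allI impI)
        fix h :: real assume "h \<noteq> 0"
        then show "norm ((flat_exp m (0 + h) - flat_exp m 0) / h) \<le> fact (m + 2) * \<bar>h\<bar>"
          using flat_exp_bound[of m h] flat_exp_nonneg[of m h]
          by (simp add: flat_exp_def[of m 0] divide_le_eq mult.assoc abs_mult_self power2_eq_square)
      qed
      show "((\<lambda>h::real. fact (m + 2) * \<bar>h\<bar>) \<longlongrightarrow> 0) (at 0)"
        by (rule tendsto_eq_intros refl)+ simp
    qed
    then show ?thesis using 3 by (simp add: DERIV_def flat_exp_def)
  qed
qed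

lemma hered_flat_exp: "hered (\<lambda>_. True) n (\<lambda>_::unit. \<lambda>t. complex_of_real (flat_exp m t))"
proof (induction n arbitrary: m)
  case (Suc n)
  have D: "((\<lambda>t. complex_of_real (flat_exp m t)) has_derivative
      (\<lambda>h. of_real (h * (- real m * flat_exp (Suc m) t + flat_exp (m + 2) t)))) (at t)" for t
    using bounded_linear.has_derivative[OF bounded_linear_of_real
        flat_exp_deriv[of m t, THEN has_field_derivative_imp_has_derivative]] by (simp add: mult.commute)
  have "hered (\<lambda>_. True) n
     (\<lambda>_::unit. \<lambda>t. - of_nat m * complex_of_real (flat_exp (Suc m) t) + complex_of_real (flat_exp (m + 2) t))"
    by (intro hered_add[where P="\<lambda>_. True"] hered_mult[where ?P1.0="\<lambda>_. True" and ?P2.0="\<lambda>_. True"]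
      hered_const Suc.IH) auto
  then have "hered (\<lambda>_. True) n (\<lambda>_::unit. pd 1 (\<lambda>t. complex_of_real (flat_exp m t)))"
    unfolding pd_eq[OF D, abs_def] by simp
  moreover have "(\<lambda>t. complex_of_real (flat_exp m t)) differentiable_on UNIV"
    using D by (auto simp: differentiable_on_def differentiable_def intro: has_derivative_at_withinI)
  ultimately show ?case by simp
qed simp

text \<open>The usual quotient of two flat exponentials, evaluated at the squared norm.\<close>
lemma exists_cutoff:
  fixes r :: real
  assumes "0 \<le> r"
  shows "\<exists>cut :: 'a::euclidean_space \<Rightarrow> complex. smooth cut \<and>
     (\<forall>x. norm x \<le> r \<longrightarrow> cut x = 1) \<and> (\<forall>x. r + 1 \<le> norm x \<longrightarrow> cut x = 0)"
proof -
  define a b where "a = r\<^sup>2" and "b = (r + 1)\<^sup>2"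
  have ab: "a < b" using assms by (auto simp: a_def b_def intro!: power_strict_mono)
  define h where "h = (\<lambda>t. complex_of_real (flat_exp 0 (b - t)) *
     inverse (of_real (flat_exp 0 (b - t)) + of_real (flat_exp 0 (t - a))))"
  have nz: "complex_of_real (flat_exp 0 (b - t)) + of_real (flat_exp 0 (t - a)) \<noteq> 0" for t
  proof -
    have "0 < flat_exp 0 (b - t) \<or> 0 < flat_exp 0 (t - a)" using ab by (auto simp: flat_exp_def)
    then have "0 < flat_exp 0 (b - t) + flat_exp 0 (t - a)"
      using flat_exp_nonneg[of 0 "b - t"] flat_exp_nonneg[of 0 "t - a"] by linarith
    then show ?thesis unfolding of_real_add[symmetric] by (metis less_irrefl of_real_eq_0_iff)
  qed
  have 1: "hered (\<lambda>_. True) n (\<lambda>_::unit. \<lambda>t. complex_of_real (flat_exp 0 (b - t)))" for n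
    using hered_comp_affine[where A="\<lambda>t::real. - t" and s="\<lambda>_::unit. b" and \<theta>="\<lambda>p::unit. p"
       and P="\<lambda>_. True" and P'="\<lambda>_. True" and F="\<lambda>_ t. complex_of_real (flat_exp 0 t)" and n=n]
      hered_flat_exp[of n 0]
    by (simp add: linear_uminus)
  have 2: "hered (\<lambda>_. True) n (\<lambda>_::unit. \<lambda>t. complex_of_real (flat_exp 0 (t - a)))" for n
    using hered_comp_affine[where A="\<lambda>t::real. t" and s="\<lambda>_::unit. - a" and \<theta>="\<lambda>p::unit. p"
       and P="\<lambda>_. True" and P'="\<lambda>_. True" and F="\<lambda>_ t. complex_of_real (flat_exp 0 t)" and n=n]
      hered_flat_exp[of n 0]
    by (simp add: linear_ident)
  have h: "hered (\<lambda>_. True) n (\<lambda>_::unit. h)" for n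
    unfolding h_def using nz
    by (intro hered_mult[where ?P1.0="\<lambda>_. True" and ?P2.0="\<lambda>_. True"] 1 2 hered_inverse
       hered_add[where P="\<lambda>_. True"]) auto
  show ?thesis
  proof (intro exI conjI allI impI)
    show "smooth (\<lambda>x::'a. h (x \<bullet> x))"
      unfolding smooth_iff using hered_norm_square[OF h] by blast
    fix x :: 'a
    show "h (x \<bullet> x) = 1" if "norm x \<le> r"
    proof -
      have "x \<bullet> x \<le> a" unfolding a_def power2_norm_eq_inner[symmetric] using that by (intro power_mono) auto
      then show ?thesis using nz[of "x \<bullet> x"] by (auto simp: h_def flat_exp_def)
    qed
    show "h (x \<bullet> x) = 0" if "r + 1 \<le> norm x"
    proof -
      have "b \<le> x \<bullet> x" unfolding b_def power2_norm_eq_inner[symmetric] using that assms by (intro power_mono) auto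
      then show ?thesis by (auto simp: h_def flat_exp_def)
    qed
  qed
qed

section \<open>Changes of variables and integrability over Euclidean space\<close>

lemma lborel_fubini:
  fixes F :: "'a::euclidean_space \<times> 'b::euclidean_space \<Rightarrow> 'c::{banach,second_countable_topology}"
  assumes "integrable lborel F"
  shows lborel_integral_fst: "(\<integral>x. (\<integral>y. F (x, y) \<partial>lborel) \<partial>lborel) = integral\<^sup>L lborel F"
    and lborel_integral_snd: "(\<integral>y. (\<integral>x. F (x, y) \<partial>lborel) \<partial>lborel) = integral\<^sup>L lborel F"
    and lborel_integrable_fst: "integrable lborel (\<lambda>x. \<integral>y. F (x, y) \<partial>lborel)"
    and lborel_integrable_snd: "integrable lborel (\<lambda>y. \<integral>x. F (x, y) \<partial>lborel)"
proof -
  have i: "integrable (lborel \<Otimes>\<^sub>M lborel) (\<lambda>(x, y). F (x, y))"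
    using assms by (simp add: lborel_prod)
  show "(\<integral>x. (\<integral>y. F (x, y) \<partial>lborel) \<partial>lborel) = integral\<^sup>L lborel F"
    using lborel_pair.integral_fst[OF i] by (simp add: lborel_prod)
  show "(\<integral>y. (\<integral>x. F (x, y) \<partial>lborel) \<partial>lborel) = integral\<^sup>L lborel F"
    using lborel_pair.integral_snd[OF i] by (simp add: lborel_prod)
  show "integrable lborel (\<lambda>x. \<integral>y. F (x, y) \<partial>lborel)"
    using lborel_pair.integrable_fst[OF i] by simp
  show "integrable lborel (\<lambda>y. \<integral>x. F (x, y) \<partial>lborel)"
    using lborel_pair.integrable_snd[OF i] by simp
qed

text \<open>Shears preserve Lebesgue measure, since for each fixed second coordinate they are translations in
the first one.  All changes of variables below are composed of shears, swaps, translations and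
dilations, so that no Jacobian determinant has to be computed.\<close>
lemma lborel_shear:
  fixes s :: "'b::euclidean_space \<Rightarrow> 'a::euclidean_space"
  assumes [measurable]: "s \<in> borel_measurable borel"
  shows "distr lborel borel (\<lambda>(x, y). (x + s y, y)) = lborel"
proof (rule measure_eqI)
  fix A :: "('a \<times> 'b) set" assume "A \<in> sets (distr lborel borel (\<lambda>(x, y). (x + s y, y)))"
  then have A[measurable]: "A \<in> sets borel" by simp
  have [measurable]: "A \<in> sets (borel \<Otimes>\<^sub>M borel)" using A by (simp only: borel_prod)
  have "(\<lambda>(x, y). (x + s y, y)) \<in> borel \<Otimes>\<^sub>M borel \<rightarrow>\<^sub>M (borel \<Otimes>\<^sub>M borel :: ('a \<times> 'b) measure)"
    by measurable
  then have T[measurable]: "(\<lambda>(x, y). (x + s y, y)) \<in> borel \<rightarrow>\<^sub>M (borel :: ('a \<times> 'b) measure)"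
    by (simp only: borel_prod)
  have tr: "(\<integral>\<^sup>+x. indicator A (x + c, y) \<partial>lborel) = (\<integral>\<^sup>+x. indicator A (x, y) \<partial>lborel)" for c y
  proof -
    have "(\<integral>\<^sup>+x. indicator A (x, y) \<partial>lborel) = (\<integral>\<^sup>+x. indicator A (x, y) \<partial>distr lborel borel ((+) c))"
      by (simp add: lborel_distr_plus)
    also have "\<dots> = (\<integral>\<^sup>+x. indicator A (c + x, y) \<partial>lborel)"
      by (subst nn_integral_distr) auto
    finally show ?thesis by (simp add: add.commute)
  qed
  have "emeasure (distr lborel borel (\<lambda>(x, y). (x + s y, y))) A =
      (\<integral>\<^sup>+z. indicator A (case z of (x, y) \<Rightarrow> (x + s y, y)) \<partial>(lborel \<Otimes>\<^sub>M lborel))"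
    by (subst nn_integral_indicator[symmetric], simp, subst nn_integral_distr) (auto simp: lborel_prod)
  also have "\<dots> = (\<integral>\<^sup>+y. (\<integral>\<^sup>+x. indicator A (x + s y, y) \<partial>lborel) \<partial>lborel)"
    by (subst lborel_pair.nn_integral_snd[symmetric]) (auto simp: case_prod_beta)
  also have "\<dots> = (\<integral>\<^sup>+y. (\<integral>\<^sup>+x. indicator A (x, y) \<partial>lborel) \<partial>lborel)"
    by (simp add: tr)
  also have "\<dots> = (\<integral>\<^sup>+z. indicator A z \<partial>(lborel \<Otimes>\<^sub>M lborel))"
    by (subst lborel_pair.nn_integral_snd[symmetric]) auto
  also have "\<dots> = emeasure lborel A" by (simp add: lborel_prod)
  finally show "emeasure (distr lborel borel (\<lambda>(x, y). (x + s y, y))) A = emeasure lborel A" .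
qed simp

lemma shear_integral:
  fixes F :: "'a::euclidean_space \<times> 'b::euclidean_space \<Rightarrow> complex"
  assumes [measurable]: "s \<in> borel_measurable borel" "F \<in> borel_measurable borel"
  shows integral_shear: "(\<integral>z. F (fst z + s (snd z), snd z) \<partial>lborel) = integral\<^sup>L lborel F"
    and integrable_shear: "integrable lborel (\<lambda>z. F (fst z + s (snd z), snd z)) = integrable lborel F"
proof -
  have "(\<lambda>(x, y). (x + s y, y)) \<in> borel \<Otimes>\<^sub>M borel \<rightarrow>\<^sub>M (borel \<Otimes>\<^sub>M borel :: ('a \<times> 'b) measure)"
    by measurable
  then have T: "(\<lambda>(x, y). (x + s y, y)) \<in> lborel \<rightarrow>\<^sub>M (borel :: ('a \<times> 'b) measure)"
    by (simp add: borel_prod)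
  show "(\<integral>z. F (fst z + s (snd z), snd z) \<partial>lborel) = integral\<^sup>L lborel F"
    using integral_distr[OF T assms(2)] by (simp add: lborel_shear case_prod_beta)
  show "integrable lborel (\<lambda>z. F (fst z + s (snd z), snd z)) = integrable lborel F"
    using integrable_distr_eq[OF T assms(2)] by (simp add: lborel_shear case_prod_beta)
qed

lemma swap_integral:
  fixes F :: "'a::euclidean_space \<times> 'b::euclidean_space \<Rightarrow> complex"
  assumes [measurable]: "F \<in> borel_measurable borel"
  shows integral_swap: "(\<integral>z. F (snd z, fst z) \<partial>lborel) = integral\<^sup>L lborel F"
    and integrable_swap: "integrable lborel (\<lambda>z. F (snd z, fst z)) = integrable lborel F"
proof -
  have F: "F \<in> borel_measurable (lborel \<Otimes>\<^sub>M lborel)" by (simp add: lborel_prod)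
  show "(\<integral>z. F (snd z, fst z) \<partial>lborel) = integral\<^sup>L lborel F"
    using lborel_pair.integral_product_swap[OF F] by (simp only: lborel_prod case_prod_beta')
  show "integrable lborel (\<lambda>z. F (snd z, fst z)) = integrable lborel F"
    using lborel_pair.integrable_product_swap_iff[of F] by (simp only: lborel_prod case_prod_beta')
qed

lemma affine_integral:
  fixes F :: "'a::euclidean_space \<Rightarrow> complex" and c :: real
  assumes [measurable]: "F \<in> borel_measurable borel" and c: "c \<noteq> 0"
  shows integral_affine: "(\<integral>x. F (t + c *\<^sub>R x) \<partial>lborel) = integral\<^sup>L lborel F / of_real (\<bar>c\<bar> ^ DIM('a))"
    and integrable_affine: "integrable lborel (\<lambda>x. F (t + c *\<^sub>R x)) = integrable lborel F"
proof -
  have "integral\<^sup>L lborel F = integral\<^sup>L (density (distr lborel borel (\<lambda>x. t + c *\<^sub>R x)) (\<lambda>_. \<bar>c\<bar> ^ DIM('a))) F"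
    by (simp only: lborel_affine[OF c, symmetric])
  also have "\<dots> = (\<bar>c\<bar> ^ DIM('a)) *\<^sub>R (\<integral>x. F (t + c *\<^sub>R x) \<partial>lborel)"
    by (simp add: integral_density integral_distr)
  finally show "(\<integral>x. F (t + c *\<^sub>R x) \<partial>lborel) = integral\<^sup>L lborel F / of_real (\<bar>c\<bar> ^ DIM('a))"
    using c by (simp add: scaleR_conv_of_real field_simps)
  have "integrable lborel F = integrable (density (distr lborel borel (\<lambda>x. t + c *\<^sub>R x)) (\<lambda>_. \<bar>c\<bar> ^ DIM('a))) F"
    by (simp only: lborel_affine[OF c, symmetric])
  also have "\<dots> = integrable lborel (\<lambda>x. (\<bar>c\<bar> ^ DIM('a)) *\<^sub>R F (t + c *\<^sub>R x))"
    by (simp add: integrable_density integrable_distr_eq)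
  also have "\<dots> = integrable lborel (\<lambda>x. F (t + c *\<^sub>R x))"
  proof
    assume "integrable lborel (\<lambda>x. (\<bar>c\<bar> ^ DIM('a)) *\<^sub>R F (t + c *\<^sub>R x))"
    then have "integrable lborel (\<lambda>x. inverse (\<bar>c\<bar> ^ DIM('a)) *\<^sub>R (\<bar>c\<bar> ^ DIM('a)) *\<^sub>R F (t + c *\<^sub>R x))"
      by (rule integrable_scaleR_right)
    then show "integrable lborel (\<lambda>x. F (t + c *\<^sub>R x))" using c by simp
  qed (rule integrable_scaleR_right)
  finally show "integrable lborel (\<lambda>x. F (t + c *\<^sub>R x)) = integrable lborel F" ..
qed

lemma integral_translate:
  fixes F :: "'a::euclidean_space \<Rightarrow> complex"
  assumes [measurable]: "F \<in> borel_measurable borel"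
  shows "(\<integral>x. F (x + t) \<partial>lborel) = integral\<^sup>L lborel F"
  using integral_affine[OF assms, of 1 t] by (simp add: add.commute)

lemma product_function_lborel:
  fixes f :: "'a::euclidean_space \<Rightarrow> real \<Rightarrow> real"
  assumes "\<And>b. b \<in> Basis \<Longrightarrow> integrable lborel (f b)"
  shows integrable_lborel_prod: "integrable lborel (\<lambda>x. \<Prod>b\<in>Basis. f b (x \<bullet> b))"
    and integral_lborel_prod: "(\<integral>x. (\<Prod>b\<in>Basis. f b (x \<bullet> b)) \<partial>lborel) = (\<Prod>b\<in>Basis. integral\<^sup>L lborel (f b))"
proof -
  interpret product_sigma_finite "\<lambda>_::'a. lborel :: real measure"
    by unfold_locales
  have m: "(\<lambda>g. \<Sum>b\<in>Basis. g b *\<^sub>R b) \<in> (\<Pi>\<^sub>M b\<in>(Basis :: 'a set). lborel) \<rightarrow>\<^sub>M borel"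
    by measurable
  have f: "f b \<in> borel_measurable borel" if "b \<in> Basis" for b
    using borel_measurable_integrable[OF assms[OF that]] by simp
  have f2: "(\<lambda>x::'a. \<Prod>b\<in>Basis. f b (x \<bullet> b)) \<in> borel_measurable borel"
    by (intro borel_measurable_prod measurable_compose[OF _ f]) auto
  have e: "(\<Prod>b\<in>Basis. f b ((\<Sum>b\<in>Basis. g b *\<^sub>R b) \<bullet> b)) = (\<Prod>b\<in>Basis. f b (g b))" for g :: "'a \<Rightarrow> real"
    by (intro prod.cong refl) (simp add: inner_sum_left_Basis)
  show "integrable lborel (\<lambda>x. \<Prod>b\<in>Basis. f b (x \<bullet> b))"
    unfolding lborel_eq[where 'a='a] integrable_distr_eq[OF m f2] e
    by (rule product_integrable_prod[OF finite_Basis assms])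
  show "(\<integral>x. (\<Prod>b\<in>Basis. f b (x \<bullet> b)) \<partial>lborel) = (\<Prod>b\<in>Basis. integral\<^sup>L lborel (f b))"
    unfolding lborel_eq[where 'a='a] integral_distr[OF m f2] e
    by (rule product_integral_prod[OF finite_Basis assms])
qed

text \<open>A fixed integrable majorant.  The exponent twice the dimension is larger than necessary but makes
the comparison with a product of one-dimensional functions immediate.\<close>
definition tail :: "'a::euclidean_space \<Rightarrow> real" where
  "tail x = inverse ((1 + norm x) ^ (2 * DIM('a)))"

lemma tail_pos: "0 < tail x"
  by (simp add: tail_def add_pos_nonneg)

lemma tail_measurable [measurable]: "tail \<in> borel_measurable borel"
  unfolding tail_def by measurable

text \<open>Distributing the exponent over the coordinates bounds \<open>tail\<close> by a product of functions
\<open>1 / (1 + t^2)\<close> of the coordinates.\<close>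
lemma integrable_tail: "integrable lborel (tail :: 'a::euclidean_space \<Rightarrow> real)"
proof (rule Bochner_Integration.integrable_bound)
  have "integrable lborel (\<lambda>t::real. inverse (1 + t\<^sup>2))"
    using integrable_inverse_1_plus_square by (simp add: set_integrable_def)
  then show "integrable lborel (\<lambda>x::'a. \<Prod>b\<in>Basis. inverse (1 + (x \<bullet> b)\<^sup>2))"
    by (rule integrable_lborel_prod)
  have "tail x \<le> (\<Prod>b\<in>Basis. inverse (1 + (x \<bullet> b)\<^sup>2))" for x :: 'a
  proof -
    have "tail x = (\<Prod>b\<in>(Basis::'a set). inverse ((1 + norm x)\<^sup>2))"
      by (simp add: tail_def power_mult power_inverse)
    also have "\<dots> \<le> (\<Prod>b\<in>Basis. inverse (1 + (x \<bullet> b)\<^sup>2))"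
    proof (rule prod_mono, safe)
      fix b :: 'a assume b: "b \<in> Basis"
      have "(x \<bullet> b)\<^sup>2 \<le> (norm x)\<^sup>2" using Basis_le_norm[OF b, of x] by (simp add: abs_le_square_iff[symmetric])
      also have "1 + (norm x)\<^sup>2 \<le> (1 + norm x)\<^sup>2" by (simp add: power2_eq_square algebra_simps)
      finally have "1 + (x \<bullet> b)\<^sup>2 \<le> (1 + norm x)\<^sup>2" by simp
      then show "inverse ((1 + norm x)\<^sup>2) \<le> inverse (1 + (x \<bullet> b)\<^sup>2)"
        by (intro le_imp_inverse_le) (auto simp: add_pos_nonneg)
    qed simp
    finally show ?thesis .
  qed
  then show "AE x::'a in lborel. norm (tail x) \<le> norm (\<Prod>b\<in>Basis. inverse (1 + (x \<bullet> b)\<^sup>2))"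
    by (auto simp: abs_of_pos[OF tail_pos] intro!: AE_I2 order_trans[OF _ abs_ge_self])
qed simp

lemma tail_bound:
  fixes F :: "'a::euclidean_space \<Rightarrow> complex"
  assumes "(1 + norm x) ^ (2 * DIM('a)) * cmod (F x) \<le> C"
  shows "cmod (F x) \<le> C * tail x"
proof -
  have "0 < (1 + norm x) ^ (2 * DIM('a))" by (simp add: add_pos_nonneg)
  then show ?thesis using assms by (simp add: tail_def field_simps)
qed

lemma integrable_tail_bound:
  fixes F :: "'a::euclidean_space \<Rightarrow> complex"
  assumes "F \<in> borel_measurable borel" "\<And>x. cmod (F x) \<le> C * tail x"
  shows "integrable lborel F"
  by (rule Bochner_Integration.integrable_bound[OF integrable_mult_right[OF integrable_tail, of C]])
    (use assms in \<open>auto intro!: AE_I2 order_trans[OF _ abs_ge_self]\<close>)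

lemma integrable_tensor:
  fixes f :: "'a::euclidean_space \<Rightarrow> real" and g :: "'b::euclidean_space \<Rightarrow> real"
  assumes "integrable lborel f" "integrable lborel g"
  shows "integrable lborel (\<lambda>z. f (fst z) * g (snd z))"
proof -
  have [measurable]: "f \<in> borel_measurable borel" "g \<in> borel_measurable borel"
    using assms[THEN borel_measurable_integrable] by auto
  have "integrable (lborel \<Otimes>\<^sub>M lborel) (\<lambda>z. f (fst z) * g (snd z))"
  proof (rule lborel_pair.Fubini_integrable)
    show "integrable lborel (\<lambda>x. \<integral>y. norm (f (fst (x, y)) * g (snd (x, y))) \<partial>lborel)"
      using assms by (simp add: abs_mult)
  qed (use assms in auto)
  then show ?thesis by (simp add: lborel_prod)
qed

lemma tail_translate:
  assumes "norm t \<le> 1"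
  shows "tail (x + t :: 'a::euclidean_space) \<le> 2 ^ (2 * DIM('a)) * tail x"
proof -
  have "norm x \<le> norm (x + t) + norm t" using norm_triangle_ineq4[of "x + t" t] by simp
  then have "1 + norm x \<le> 2 * (1 + norm (x + t))" using assms by (smt (verit) norm_ge_zero)
  then have "(1 + norm x) ^ (2 * DIM('a)) \<le> 2 ^ (2 * DIM('a)) * (1 + norm (x + t)) ^ (2 * DIM('a))"
    by (metis norm_ge_zero add_nonneg_nonneg power_mono power_mult_distrib zero_le_one)
  moreover have "0 < (1 + norm x) ^ (2 * DIM('a))" "0 < (1 + norm (x + t)) ^ (2 * DIM('a))"
    by (simp_all add: add_pos_nonneg)
  ultimately show ?thesis by (simp add: tail_def field_simps)
qed

section \<open>Decay of Fourier transforms, uniformly in a parameter\<close>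

text \<open>The integral of \<open>f (x + b) - f x\<close> over \<open>x\<close> vanishes by translation invariance; by the
fundamental theorem of calculus it is also the integral of the partial derivative over
the unit segment in direction \<open>b\<close>, and Fubini's theorem removes the segment.\<close>
lemma integral_pd_zero:
  fixes f :: "'a::euclidean_space \<Rightarrow> complex"
  assumes d: "f differentiable_on UNIV" and c: "continuous_on UNIV (pd b f)" and b: "b \<in> Basis"
    and f: "\<And>x. cmod (f x) \<le> C * tail x" and f': "\<And>x. cmod (pd b f x) \<le> C' * tail x"
  shows "(\<integral>x. pd b f x \<partial>lborel) = 0"
proof -
  have [measurable]: "f \<in> borel_measurable borel" "pd b f \<in> borel_measurable borel"
    using borel_measurable_continuous_onI[OF differentiable_imp_continuous_on[OF d]]
      borel_measurable_continuous_onI[OF c] .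
  \<comment> \<open>The derivative along the segment from x to x + b, parametrised by the first component.\<close>
  define G where "G = (\<lambda>z. indicat_real {0..1} (fst z) *\<^sub>R pd b f (snd z + fst z *\<^sub>R b))"
  have G: "integrable lborel G"
  proof (rule Bochner_Integration.integrable_bound)
    show "integrable lborel (\<lambda>z::real \<times> 'a. indicat_real {0..1} (fst z) * (\<bar>C'\<bar> * 2 ^ (2 * DIM('a)) * tail (snd z)))"
      by (rule integrable_tensor)
        (auto intro!: integrable_real_indicator integrable_mult_right integrable_tail)
    show "G \<in> borel_measurable lborel"
      unfolding G_def by (simp add: borel_prod[symmetric])
    have "norm (G z) \<le> norm (indicat_real {0..1} (fst z) * (\<bar>C'\<bar> * 2 ^ (2 * DIM('a)) * tail (snd z)))" for z
    proof (cases "fst z \<in> {0..1}")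
      case True
      have "cmod (pd b f (snd z + fst z *\<^sub>R b)) \<le> \<bar>C'\<bar> * tail (snd z + fst z *\<^sub>R b)"
        using f'[of "snd z + fst z *\<^sub>R b"] tail_pos[of "snd z + fst z *\<^sub>R b"]
        by (smt (verit) mult_right_mono)
      also have "\<dots> \<le> \<bar>C'\<bar> * (2 ^ (2 * DIM('a)) * tail (snd z))"
        using True b by (intro mult_left_mono tail_translate) auto
      finally show ?thesis using True tail_pos[of "snd z"] by (simp add: G_def abs_mult mult_ac)
    qed (simp add: G_def)
    then show "AE z in lborel. norm (G z) \<le> norm (indicat_real {0..1} (fst z) * (\<bar>C'\<bar> * 2 ^ (2 * DIM('a)) * tail (snd z)))"
      by simp
  qed
  have "(\<integral>s. G (s, x) \<partial>lborel) = f (x + b) - f x" for x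
  proof -
    have "(\<integral>s. indicat_real {0..1} s *\<^sub>R pd b f (x + s *\<^sub>R b) \<partial>lborel) =
        f (x + 1 *\<^sub>R b) - f (x + 0 *\<^sub>R b)"
    proof (rule integral_FTC_atLeastAtMost[where F="\<lambda>s. f (x + s *\<^sub>R b)"])
      fix s :: real
      have "((\<lambda>s. f (x + s *\<^sub>R b)) has_derivative (\<lambda>h. pd (h *\<^sub>R b) f (x + s *\<^sub>R b))) (at s within {0..1})"
        by (rule has_derivative_compose[OF _ has_derivative_pd[OF d]]) (auto intro!: derivative_eq_intros)
      then show "((\<lambda>s. f (x + s *\<^sub>R b)) has_vector_derivative pd b f (x + s *\<^sub>R b)) (at s within {0..1})"
        unfolding has_vector_derivative_def
        using linear_cmul[OF has_derivative_linear[OF has_derivative_pd[OF d]]] by simp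
    next
      show "continuous_on {0..1} (\<lambda>s. pd b f (x + s *\<^sub>R b))"
        by (rule continuous_on_compose2[OF c]) (auto intro!: continuous_intros)
    qed simp
    then show ?thesis by (simp add: G_def)
  qed
  then have "integral\<^sup>L lborel G = (\<integral>x. f (x + b) - f x \<partial>lborel)"
    using lborel_integral_snd[OF G] by simp
  also have "\<dots> = 0"
  proof -
    have i: "integrable lborel f" by (rule integrable_tail_bound[OF _ f]) simp
    have i2: "integrable lborel (\<lambda>x. f (x + b))"
      using integrable_affine[of f 1 b] i by (simp add: add.commute)
    show ?thesis using integral_translate[of f b] i i2 by simp
  qed
  finally have "0 = (\<integral>s. (\<integral>x. G (s, x) \<partial>lborel) \<partial>lborel)"
    using lborel_integral_fst[OF G] by simp
  also have "\<dots> = (\<integral>s. indicat_real {0..1} (s::real) *\<^sub>R (\<integral>x. pd b f x \<partial>lborel) \<partial>lborel)"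
  proof -
    have "(\<integral>x. G (s, x) \<partial>lborel) = indicat_real {0..1} s *\<^sub>R (\<integral>x. pd b f x \<partial>lborel)" for s
      by (simp add: G_def integral_translate)
    then show ?thesis by (simp only:)
  qed
  also have "\<dots> = (\<integral>x. pd b f x \<partial>lborel)"
    by (subst integral_scaleR_left) auto
  finally show ?thesis ..
qed

text \<open>Apply the preceding lemma to the product of \<open>f\<close> with the character, i.e. integrate by parts.\<close>
lemma fourier_pd:
  fixes f :: "'a::euclidean_space \<Rightarrow> complex"
  assumes d: "f differentiable_on UNIV" and c: "continuous_on UNIV (pd b f)" and b: "b \<in> Basis"
    and f: "\<And>x. cmod (f x) \<le> C * tail x" and f': "\<And>x. cmod (pd b f x) \<le> C' * tail x"
  shows "fourier (pd b f) \<eta> = 2 * pi * \<i> * of_real (\<eta> \<bullet> b) * fourier f \<eta>"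
proof -
  define e where "e = (\<lambda>x::'a. exp (- (2 * pi * \<i> * of_real (\<eta> \<bullet> x))))"
  have ne: "cmod (e x) = 1" for x by (simp add: e_def)
  have De: "(e has_derivative (\<lambda>h. - (2 * pi * \<i> * of_real (\<eta> \<bullet> h)) * e x)) (at x)" for x
  proof -
    have "((\<lambda>x. - (2 * pi * \<i> * of_real (\<eta> \<bullet> x))) has_derivative (\<lambda>h. - (2 * pi * \<i> * of_real (\<eta> \<bullet> h)))) (at x)"
      by (auto intro!: derivative_eq_intros)
    from has_derivative_compose[OF this DERIV_exp[THEN has_field_derivative_imp_has_derivative]]
    show ?thesis by (simp add: e_def mult_ac)
  qed
  have de: "e differentiable_on UNIV"
    using De by (auto simp: differentiable_on_def differentiable_def intro: has_derivative_at_withinI)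
  have pe: "pd b (\<lambda>x. e x * f x) = (\<lambda>x. - (2 * pi * \<i> * of_real (\<eta> \<bullet> b)) * (e x * f x) + e x * pd b f x)"
    unfolding pd_mult[OF de d] pd_eq[OF De] by (simp add: algebra_simps)
  have cf: "continuous_on UNIV f" "continuous_on UNIV e"
    using d de by (auto intro: differentiable_imp_continuous_on)
  have [measurable]: "f \<in> borel_measurable borel" "pd b f \<in> borel_measurable borel" "e \<in> borel_measurable borel"
    using cf c by (auto intro: borel_measurable_continuous_onI)
  have i1: "integrable lborel (\<lambda>x. e x * f x)"
    by (rule integrable_tail_bound[of _ C]) (simp_all add: norm_mult ne f)
  have i2: "integrable lborel (\<lambda>x. e x * pd b f x)"
    by (rule integrable_tail_bound[of _ C']) (simp_all add: norm_mult ne f')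
  have "(\<integral>x. pd b (\<lambda>x. e x * f x) x \<partial>lborel) = 0"
  proof (rule integral_pd_zero[OF _ _ b])
    show "(\<lambda>x. e x * f x) differentiable_on UNIV" using d de by (intro differentiable_on_mult)
    show "continuous_on UNIV (pd b (\<lambda>x. e x * f x))"
      unfolding pe using c cf by (intro continuous_intros)
    show "cmod (e x * f x) \<le> C * tail x" for x by (simp add: norm_mult ne f)
    show "cmod (pd b (\<lambda>x. e x * f x) x) \<le> (2 * pi * \<bar>\<eta> \<bullet> b\<bar> * C + C') * tail x" for x
    proof -
      have "cmod (pd b (\<lambda>x. e x * f x) x) \<le> 2 * pi * \<bar>\<eta> \<bullet> b\<bar> * cmod (f x) + cmod (pd b f x)"
        unfolding pe by (rule norm_triangle_le) (simp add: norm_mult ne)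
      also have "\<dots> \<le> 2 * pi * \<bar>\<eta> \<bullet> b\<bar> * (C * tail x) + C' * tail x"
        by (intro add_mono mult_left_mono f f') auto
      finally show ?thesis by (simp add: algebra_simps)
    qed
  qed
  then have "- (2 * pi * \<i> * of_real (\<eta> \<bullet> b)) * (\<integral>x. e x * f x \<partial>lborel) + (\<integral>x. e x * pd b f x \<partial>lborel) = 0"
    unfolding pe using i1 i2 by (simp del: mult_minus_left)
  then show ?thesis unfolding fourier_def
    by (simp add: add_eq_0_iff2 e_def)
qed

text \<open>One derivative of \<open>F\<close> gains one power of the frequency, so induction on \<open>N\<close> converts smoothness
into decay; the decay of \<open>F\<close> in the part \<open>q0 p\<close> of the gauge passes through the integral.  The joint
uniformity in parameter and frequency is what justifies the later exchanges of integrals.\<close>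
lemma rapid_fourier_decay:
  fixes F :: "'p \<Rightarrow> 'a::euclidean_space \<Rightarrow> complex"
  assumes "hrapid S (\<lambda>p x. q0 p + norm x) F" "\<And>p. 0 \<le> q0 p"
  shows "\<exists>C\<ge>0. \<forall>p\<in>S. \<forall>\<eta>. (1 + norm \<eta>) ^ N * (1 + q0 p) ^ M * cmod (fourier (F p) \<eta>) \<le> C"
  using assms(1)
proof (induction N arbitrary: F)
  case (0 F)
  obtain C where C: "C \<ge> 0" "\<And>p x. p \<in> S \<Longrightarrow> (1 + (q0 p + norm x)) ^ (M + 2 * DIM('a)) * cmod (F p x) \<le> C"
    using rapidD[OF hered_imp[OF spec[OF 0]]] by metis
  have "(1 + q0 p) ^ M * cmod (fourier (F p) \<eta>) \<le> C * integral\<^sup>L lborel (tail :: 'a \<Rightarrow> real)"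
    if p: "p \<in> S" for p \<eta>
  proof -
    have m: "F p \<in> borel_measurable borel"
      using hered_continuous_on[OF spec[OF 0]] by (rule borel_measurable_continuous_onI)
    have b: "(1 + q0 p) ^ M * cmod (F p x) \<le> C * tail x" for x
    proof -
      have "(1 + q0 p) ^ M * (1 + norm x) ^ (2 * DIM('a)) \<le> (1 + (q0 p + norm x)) ^ (M + 2 * DIM('a))"
        unfolding power_add using assms(2)[of p] by (intro mult_mono power_mono) auto
      then have "(1 + norm x) ^ (2 * DIM('a)) * cmod ((1 + q0 p) ^ M *\<^sub>R F p x) \<le> C"
        using C(2)[OF p, of x] assms(2)[of p] order_trans[OF mult_right_mono[of _ _ "cmod (F p x)"]]
        by (fastforce simp: mult_ac)
      from tail_bound[where F="\<lambda>x. (1 + q0 p) ^ M *\<^sub>R F p x", OF this] show ?thesis using assms(2)[of p] by simp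
    qed
    have i: "integrable lborel (\<lambda>x. (1 + q0 p) ^ M * cmod (F p x))"
      by (rule Bochner_Integration.integrable_bound[OF integrable_mult_right[OF integrable_tail, of C]])
        (use m b assms(2)[of p] C(1) in \<open>auto intro!: AE_I2 simp: abs_mult abs_of_pos[OF tail_pos]\<close>)
    have "cmod (fourier (F p) \<eta>) \<le> (\<integral>x. cmod (F p x) \<partial>lborel)"
      unfolding fourier_def by (rule order_trans[OF integral_norm_bound]) (simp add: norm_mult)
    then have "(1 + q0 p) ^ M * cmod (fourier (F p) \<eta>) \<le> (1 + q0 p) ^ M * (\<integral>x. cmod (F p x) \<partial>lborel)"
      using assms(2)[of p] by (intro mult_left_mono) auto
    also have "\<dots> = (\<integral>x. (1 + q0 p) ^ M * cmod (F p x) \<partial>lborel)" by simp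
    also have "\<dots> \<le> (\<integral>x. C * tail (x::'a) \<partial>lborel)"
      by (rule integral_mono[OF i]) (auto intro!: b integrable_tail)
    finally show ?thesis by simp
  qed
  moreover have "0 \<le> C * integral\<^sup>L lborel (tail :: 'a \<Rightarrow> real)"
    using C(1) tail_pos by (intro mult_nonneg_nonneg Bochner_Integration.integral_nonneg) (auto intro: less_imp_le)
  ultimately show ?case by (metis mult_1 power_0)
next
  case (Suc N F)
  obtain C0 where C0: "\<And>p \<eta>. p \<in> S \<Longrightarrow> (1 + norm \<eta>) ^ N * (1 + q0 p) ^ M * cmod (fourier (F p) \<eta>) \<le> C0"
    "C0 \<ge> 0"
    using Suc.IH[OF Suc.prems] by metis
  have pdF: "hrapid S (\<lambda>p x. q0 p + norm x) (\<lambda>p. pd b (F p))" if "b \<in> Basis" for b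
  proof
    fix n show "hered (rapid S (\<lambda>p x. q0 p + norm x)) n (\<lambda>p. pd b (F p))"
      using spec[OF Suc.prems, of "Suc n"] that by simp
  qed
  then have "\<forall>b\<in>Basis. \<exists>C\<ge>0. \<forall>p\<in>S. \<forall>\<eta>. (1 + norm \<eta>) ^ N * (1 + q0 p) ^ M * cmod (fourier (pd b (F p)) \<eta>) \<le> C"
    using Suc.IH by blast
  then obtain C1 where C1: "\<And>b p \<eta>. b \<in> Basis \<Longrightarrow> p \<in> S \<Longrightarrow>
      (1 + norm \<eta>) ^ N * (1 + q0 p) ^ M * cmod (fourier (pd b (F p)) \<eta>) \<le> C1 b"
    "\<And>b. b \<in> Basis \<Longrightarrow> 0 \<le> C1 b"
    by metis
  have "(1 + norm \<eta>) ^ Suc N * (1 + q0 p) ^ M * cmod (fourier (F p) \<eta>) \<le> C0 + (\<Sum>b\<in>Basis. C1 b)"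
    if p: "p \<in> S" for p \<eta>
  proof -
    define K where "K = (1 + norm \<eta>) ^ N * (1 + q0 p) ^ M"
    have K: "0 \<le> K" using assms(2)[of p] by (simp add: K_def)
    have R: "\<exists>C. \<forall>x. cmod (G p x) \<le> C * tail x" if G: "rapid S (\<lambda>p x. q0 p + norm x) G" for G :: "'p \<Rightarrow> 'a \<Rightarrow> complex"
    proof -
      have "rapid S (\<lambda>p x. norm x) G"
        by (rule rapid_weaken[OF G, of _ _ 1]) (use assms(2) in auto)
      then obtain C where "\<And>x. (1 + norm x) ^ (2 * DIM('a)) * cmod (G p x) \<le> C"
        using p unfolding rapid_def by metis
      then show ?thesis using tail_bound[where F="G p"] by blast
    qed
    \<comment> \<open>Each coordinate of the frequency is paid for by one derivative; summing over the basis gives the norm.\<close>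
    have eb: "\<bar>\<eta> \<bullet> b\<bar> * cmod (fourier (F p) \<eta>) \<le> cmod (fourier (pd b (F p)) \<eta>)" if b: "b \<in> Basis" for b
    proof -
      obtain C where C: "\<And>x. cmod (F p x) \<le> C * tail x"
        using R[OF hered_imp[OF spec[OF Suc.prems]]] by blast
      obtain C' where C': "\<And>x. cmod (pd b (F p) x) \<le> C' * tail x"
        using R[OF hered_imp[OF spec[OF pdF[OF b]]]] by blast
      have "fourier (pd b (F p)) \<eta> = 2 * pi * \<i> * of_real (\<eta> \<bullet> b) * fourier (F p) \<eta>"
      proof (rule fourier_pd[OF _ _ b C C'])
        show "F p differentiable_on UNIV" using spec[OF Suc.prems, of 1] by simp
        show "continuous_on UNIV (pd b (F p))"
          using hered_continuous_on[OF spec[OF pdF[OF b]]] .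
      qed
      then have "cmod (fourier (pd b (F p)) \<eta>) = 2 * pi * (\<bar>\<eta> \<bullet> b\<bar> * cmod (fourier (F p) \<eta>))"
        by (simp add: norm_mult)
      moreover have "1 * (\<bar>\<eta> \<bullet> b\<bar> * cmod (fourier (F p) \<eta>)) \<le> 2 * pi * (\<bar>\<eta> \<bullet> b\<bar> * cmod (fourier (F p) \<eta>))"
        using pi_ge_two by (intro mult_right_mono) auto
      ultimately show ?thesis by simp
    qed
    have "(1 + norm \<eta>) * cmod (fourier (F p) \<eta>) \<le>
        cmod (fourier (F p) \<eta>) + (\<Sum>b\<in>Basis. \<bar>\<eta> \<bullet> b\<bar>) * cmod (fourier (F p) \<eta>)"
      using mult_right_mono[OF norm_le_l1[of \<eta>], of "cmod (fourier (F p) \<eta>)"] by (simp add: distrib_right)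
    also have "\<dots> \<le> cmod (fourier (F p) \<eta>) + (\<Sum>b\<in>Basis. cmod (fourier (pd b (F p)) \<eta>))"
      unfolding sum_distrib_right by (intro add_left_mono sum_mono eb)
    finally have "K * ((1 + norm \<eta>) * cmod (fourier (F p) \<eta>)) \<le>
        K * (cmod (fourier (F p) \<eta>) + (\<Sum>b\<in>Basis. cmod (fourier (pd b (F p)) \<eta>)))"
      using K by (rule mult_left_mono)
    also have "\<dots> = K * cmod (fourier (F p) \<eta>) + (\<Sum>b\<in>Basis. K * cmod (fourier (pd b (F p)) \<eta>))"
      by (simp add: distrib_left sum_distrib_left)
    also have "\<dots> \<le> C0 + (\<Sum>b\<in>Basis. C1 b)"
      using C0(1)[OF p] C1(1)[OF _ p] unfolding K_def by (intro add_mono sum_mono) auto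
    finally show ?thesis by (simp add: K_def mult_ac)
  qed
  moreover have "0 \<le> C0 + (\<Sum>b\<in>Basis. C1 b)" using C0(2) C1(2) by (intro add_nonneg_nonneg sum_nonneg)
  ultimately show ?case by blast
qed

section \<open>Integrals depending on a parameter and contour shifts\<close>

lemma continuous_param_integral:
  fixes F :: "'b::metric_space \<Rightarrow> 'a::euclidean_space \<Rightarrow> complex"
  assumes m: "\<And>p. F p \<in> borel_measurable borel"
    and c: "\<And>x. continuous_on UNIV (\<lambda>p. F p x)"
    and b: "\<And>p. \<exists>e>0. \<exists>B. integrable lborel B \<and> (\<forall>q\<in>ball p e. \<forall>x. cmod (F q x) \<le> B x)"
  shows "continuous_on UNIV (\<lambda>p. \<integral>x. F p x \<partial>lborel)"
proof (rule continuous_on_sequentiallyI)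
  fix u :: "nat \<Rightarrow> 'b" and p assume u: "u \<longlonglongrightarrow> p"
  obtain e B where e: "e > 0" "integrable lborel B" "\<And>q x. q \<in> ball p e \<Longrightarrow> cmod (F q x) \<le> B x"
    using b by metis
  obtain N where N: "\<And>n. n \<ge> N \<Longrightarrow> u n \<in> ball p e"
    using metric_LIMSEQ_D[OF u e(1)] by (metis dist_commute mem_ball)
  show "(\<lambda>n. \<integral>x. F (u n) x \<partial>lborel) \<longlonglongrightarrow> (\<integral>x. F p x \<partial>lborel)"
  proof (rule LIMSEQ_offset[of _ N], rule integral_dominated_convergence[OF _ _ e(2)])
    show "AE x in lborel. (\<lambda>n. F (u (n + N)) x) \<longlonglongrightarrow> F p x"
    proof (rule AE_I2)
      fix x
      have "(\<lambda>n. F (u n) x) \<longlonglongrightarrow> F p x"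
        by (rule continuous_on_tendsto_compose[OF c[of x] u]) auto
      then show "(\<lambda>n. F (u (n + N)) x) \<longlonglongrightarrow> F p x" by (rule LIMSEQ_ignore_initial_segment)
    qed
    show "AE x in lborel. norm (F (u (n + N)) x) \<le> B x" for n
      using e(3)[OF N] by simp
  qed (use m in auto)
qed

text \<open>Cauchy's inequality bounds the derivative of the integrand by the same majorant as the integrand,
so difference quotients converge dominatedly.\<close>
lemma holomorphic_param_integral:
  fixes F :: "complex \<Rightarrow> 'a::euclidean_space \<Rightarrow> complex"
  assumes m: "\<And>w. F w \<in> borel_measurable borel"
    and hol: "\<And>x. (\<lambda>w. F w x) holomorphic_on UNIV"
    and b: "\<And>R. \<exists>B. integrable lborel B \<and> (\<forall>w x. cmod w \<le> R \<longrightarrow> cmod (F w x) \<le> B x)"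
  shows "(\<lambda>w. \<integral>x. F w x \<partial>lborel) holomorphic_on UNIV"
proof -
  have "((\<lambda>w. \<integral>x. F w x \<partial>lborel) has_field_derivative (\<integral>x. deriv (\<lambda>w. F w x) w0 \<partial>lborel)) (at w0)" for w0
  proof -
    obtain B where B: "integrable lborel B" "\<And>w x. cmod w \<le> cmod w0 + 2 \<Longrightarrow> cmod (F w x) \<le> B x"
      using b by metis
    have d: "((\<lambda>w. F w x) has_field_derivative deriv (\<lambda>w. F w x) w) (at w within S)" for w x S
      using hol[of x] by (metis UNIV_I has_field_derivative_at_within holomorphic_derivI open_UNIV)
    have d1: "cmod (deriv (\<lambda>w. F w x) w) \<le> B x" if "w \<in> ball w0 1" for w x
    proof -
      have "norm ((deriv ^^ 1) (\<lambda>w. F w x) w) \<le> fact 1 * B x / 1 ^ 1"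
      proof (rule Cauchy_inequality)
        show "(\<lambda>w. F w x) holomorphic_on ball w 1" using hol holomorphic_on_subset by blast
        show "continuous_on (cball w 1) (\<lambda>w. F w x)"
          using hol holomorphic_on_imp_continuous_on continuous_on_subset by blast
        fix y assume y: "cmod (w - y) = 1"
        have "cmod y \<le> cmod w0 + cmod (w - w0) + cmod (y - w)"
          using norm_triangle_ineq[of "w0 + (w - w0)" "y - w"] norm_triangle_ineq[of w0 "w - w0"] by simp
        then show "cmod (F y x) \<le> B x"
          using y that by (intro B) (auto simp: dist_norm norm_minus_commute)
      qed auto
      then show ?thesis by simp
    qed
    have lip: "cmod (F w x - F w0 x) \<le> B x * cmod (w - w0)" if "w \<in> ball w0 1" for w x
      by (rule field_differentiable_bound[of "ball w0 1" "\<lambda>w. F w x" "deriv (\<lambda>w. F w x)"])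
        (use that d d1 in auto)
    have i: "integrable lborel (F w)" if "w \<in> ball w0 1" for w
    proof (rule Bochner_Integration.integrable_bound[OF B(1)])
      have "cmod w \<le> cmod w0 + cmod (w - w0)" using norm_triangle_ineq[of w0 "w - w0"] by simp
      then have "cmod w \<le> cmod w0 + 2" using that by (simp add: dist_norm norm_minus_commute)
      then show "AE x in lborel. norm (F w x) \<le> norm (B x)" using B(2)[of w] by (auto intro: order_trans[OF _ abs_ge_self])
    qed (use m in simp)
    show ?thesis
      unfolding has_field_derivative_iff tendsto_at_iff_sequentially
    proof (intro allI impI)
      fix X :: "nat \<Rightarrow> complex" assume X: "\<forall>i. X i \<in> UNIV - {w0}" "X \<longlonglongrightarrow> w0"
      obtain N where N: "\<And>n. n \<ge> N \<Longrightarrow> X n \<in> ball w0 1"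
        using metric_LIMSEQ_D[OF X(2) zero_less_one] by (metis dist_commute mem_ball)
      have lim: "(\<lambda>n. (F (X (n + N)) x - F w0 x) / (X (n + N) - w0)) \<longlonglongrightarrow> deriv (\<lambda>w. F w x) w0" for x
        using d[of x w0 UNIV] X LIMSEQ_ignore_initial_segment[of "\<lambda>n. (F (X n) x - F w0 x) / (X n - w0)" _ N]
        unfolding has_field_derivative_iff tendsto_at_iff_sequentially by (auto simp: comp_def)
      have mq: "(\<lambda>x. (F (X (n + N)) x - F w0 x) / (X (n + N) - w0)) \<in> borel_measurable lborel" for n
        using m by simp
      have "(\<lambda>n. \<integral>x. (F (X (n + N)) x - F w0 x) / (X (n + N) - w0) \<partial>lborel) \<longlonglongrightarrow> (\<integral>x. deriv (\<lambda>w. F w x) w0 \<partial>lborel)"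
      proof (rule integral_dominated_convergence[OF _ _ B(1)])
        show "(\<lambda>x. deriv (\<lambda>w. F w x) w0) \<in> borel_measurable lborel"
          by (rule borel_measurable_LIMSEQ_metric[OF mq]) (rule lim)
        show "AE x in lborel. norm ((F (X (n + N)) x - F w0 x) / (X (n + N) - w0)) \<le> B x" for n
          using lip[OF N, of "n + N"] X(1) by (auto simp: norm_divide divide_le_eq)
      qed (use m lim in auto)
      moreover have "(\<integral>x. (F (X (n + N)) x - F w0 x) / (X (n + N) - w0) \<partial>lborel) =
         ((\<integral>x. F (X (n + N)) x \<partial>lborel) - (\<integral>x. F w0 x \<partial>lborel)) / (X (n + N) - w0)" for n
        using i[OF N, of "n + N"] i[of w0] X(1) by simp
      ultimately have "(\<lambda>n. ((\<integral>x. F (X (n + N)) x \<partial>lborel) - (\<integral>x. F w0 x \<partial>lborel)) / (X (n + N) - w0))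
         \<longlonglongrightarrow> (\<integral>x. deriv (\<lambda>w. F w x) w0 \<partial>lborel)" by (simp only:)
      then show "((\<lambda>y. ((\<integral>x. F y x \<partial>lborel) - (\<integral>x. F w0 x \<partial>lborel)) / (y - w0)) \<circ> X)
         \<longlonglongrightarrow> (\<integral>x. deriv (\<lambda>w. F w x) w0 \<partial>lborel)"
        by (rule_tac LIMSEQ_offset[of _ N]) (simp add: comp_def)
    qed
  qed
  then show ?thesis
    by (auto simp: holomorphic_on_def field_differentiable_def intro: has_field_derivative_at_within)
qed

text \<open>Here \<open>H w\<close> stands for an integrand translated by \<open>w\<close> times the direction \<open>\<eta>\<close>.  For real
\<open>w\<close> the integral is independent of \<open>w\<close> by translation invariance; being holomorphic in \<open>w\<close>, it is
constant by the identity theorem.  This avoids contours and is insensitive to the dimension.\<close>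
lemma integral_complex_translation:
  fixes H :: "complex \<Rightarrow> 'a::euclidean_space \<Rightarrow> complex"
  assumes m: "\<And>w. H w \<in> borel_measurable borel"
    and hol: "\<And>x. (\<lambda>w. H w x) holomorphic_on UNIV"
    and b: "\<And>R. \<exists>C. \<forall>w x. cmod w \<le> R \<longrightarrow> cmod (H w x) \<le> C * tail x"
    and tr: "\<And>r x. H (of_real r) x = H 0 (x + r *\<^sub>R \<eta>)"
  shows "integral\<^sup>L lborel (H w) = integral\<^sup>L lborel (H 0)"
proof -
  have "(\<lambda>w. \<integral>x. H w x \<partial>lborel) holomorphic_on UNIV"
  proof (rule holomorphic_param_integral[OF m hol])
    fix R
    obtain C where "\<forall>w x. cmod w \<le> R \<longrightarrow> cmod (H w x) \<le> C * tail x" using b by blast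
    then show "\<exists>B. integrable lborel B \<and> (\<forall>w x. cmod w \<le> R \<longrightarrow> cmod (H w x) \<le> B x)"
      by (intro exI[of _ "\<lambda>x. C * tail x"]) (auto intro: integrable_tail)
  qed
  then have h: "(\<lambda>w. integral\<^sup>L lborel (H w) - integral\<^sup>L lborel (H 0)) holomorphic_on UNIV"
    by (intro holomorphic_intros)
  have "integral\<^sup>L lborel (H w) - integral\<^sup>L lborel (H 0) = 0"
  proof (rule analytic_continuation[OF h open_UNIV connected_UNIV, of "range of_real" 0])
    show "0 islimpt range complex_of_real"
    proof (subst islimpt_sequential, intro exI conjI allI)
      show "(\<lambda>n. complex_of_real (inverse (real (Suc n)))) n \<in> range complex_of_real - {0}" for n
        by (simp del: of_real_inverse)
      show "(\<lambda>n. complex_of_real (inverse (real (Suc n)))) \<longlonglongrightarrow> 0"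
        using tendsto_of_real[OF LIMSEQ_inverse_real_of_nat, where 'a=complex] by simp
    qed
    fix z assume "z \<in> range complex_of_real"
    then obtain r where z: "z = of_real r" by auto
    show "integral\<^sup>L lborel (H z) - integral\<^sup>L lborel (H 0) = 0"
      unfolding z tr[abs_def] using integral_translate[OF m[of 0], of "r *\<^sub>R \<eta>"] by simp
  qed auto
  then show ?thesis by simp
qed

section \<open>Gaussians and Fourier inversion\<close>

lemma gaussian_integral:
  assumes s: "s > 0"
  shows integrable_gaussian: "integrable lborel (\<lambda>x::'a::euclidean_space. exp (- (pi * s * (x \<bullet> x))))"
    and integral_gaussian: "(\<integral>x. exp (- (pi * s * (x \<bullet> (x::'a)))) \<partial>lborel) = inverse (sqrt s) ^ DIM('a)"
proof -
  define \<sigma> where "\<sigma> = inverse (sqrt (2 * pi * s))"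
  have sg: "\<sigma> > 0" "\<sigma>\<^sup>2 = inverse (2 * pi * s)"
    using s by (auto simp: \<sigma>_def power_inverse)
  have n: "exp (- (pi * s * t\<^sup>2)) = inverse (sqrt s) * normal_density 0 \<sigma> t" for t
    using s unfolding normal_density_def sg(2) by (simp add: field_simps real_sqrt_divide)
  have 1: "integrable lborel (\<lambda>t. exp (- (pi * s * t\<^sup>2)))"
    "(\<integral>t. exp (- (pi * s * t\<^sup>2)) \<partial>lborel) = inverse (sqrt s)"
    unfolding n using sg(1) by auto
  have e: "exp (- (pi * s * (x \<bullet> x))) = (\<Prod>b\<in>Basis. exp (- (pi * s * (x \<bullet> b)\<^sup>2)))" for x :: 'a
    by (subst euclidean_inner) (simp add: exp_sum[symmetric] sum_distrib_left sum_negf power2_eq_square)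
  show "integrable lborel (\<lambda>x::'a. exp (- (pi * s * (x \<bullet> x))))"
    unfolding e by (rule integrable_lborel_prod) (rule 1)
  show "(\<integral>x. exp (- (pi * s * (x \<bullet> (x::'a)))) \<partial>lborel) = inverse (sqrt s) ^ DIM('a)"
    unfolding e by (subst integral_lborel_prod) (simp_all add: 1)
qed

text \<open>Completing the square is a translation by \<open>\<i>\<close> times \<open>\<xi> / s\<close>.\<close>
lemma fourier_gaussian:
  fixes \<xi> :: "'a::euclidean_space"
  assumes s: "s > 0"
  shows "fourier (\<lambda>x. of_real (exp (- (pi * s * (x \<bullet> x))))) \<xi> =
    of_real (inverse (sqrt s) ^ DIM('a) * exp (- (pi * inverse s * (\<xi> \<bullet> \<xi>))))"
proof -
  \<comment> \<open>The complex centre of the Gaussian after completing the square.\<close>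
  define \<eta> where "\<eta> = inverse s *\<^sub>R \<xi>"
  define H where "H = (\<lambda>(w::complex) (x::'a). exp (- (of_real (pi * s) *
     (of_real (x \<bullet> x) + 2 * w * of_real (x \<bullet> \<eta>) + w\<^sup>2 * of_real (\<eta> \<bullet> \<eta>)))))"
  have "integral\<^sup>L lborel (H \<i>) = integral\<^sup>L lborel (H 0)"
  proof (rule integral_complex_translation)
    show "H w \<in> borel_measurable borel" for w
      unfolding H_def by (intro borel_measurable_continuous_onI continuous_intros)
    show "(\<lambda>w. H w x) holomorphic_on UNIV" for x unfolding H_def by (intro holomorphic_intros)
    show "H (of_real r) x = H 0 (x + r *\<^sub>R \<eta>)" for r x
      by (simp add: H_def inner_add inner_commute algebra_simps power2_eq_square)
    fix R :: real
    obtain C where C: "\<And>r. r \<ge> 0 \<Longrightarrow>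
        (1 + r) ^ (2 * DIM('a)) * exp ((2 * pi * s * R * norm \<eta>) * r - (pi * s) * r\<^sup>2) \<le> C"
      using poly_exp_bounded[of "pi * s" "2 * DIM('a)" "2 * pi * s * R * norm \<eta>"] s by auto
    have "cmod (H w x) \<le> (exp (pi * s * R\<^sup>2 * (\<eta> \<bullet> \<eta>)) * C) * tail x" if w: "cmod w \<le> R" for w x
    proof (rule tail_bound)
      have "cmod (H w x) = exp (- (pi * s) * ((norm x)\<^sup>2 + 2 * Re w * (x \<bullet> \<eta>) + Re (w\<^sup>2) * (\<eta> \<bullet> \<eta>)))"
        by (simp add: H_def norm_exp_eq_Re power2_norm_eq_inner)
      also have "\<dots> \<le> exp (pi * s * R\<^sup>2 * (\<eta> \<bullet> \<eta>) + (2 * pi * s * R * norm \<eta> * norm x - pi * s * (norm x)\<^sup>2))"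
      proof -
        have "\<bar>Re w * (x \<bullet> \<eta>)\<bar> \<le> R * (norm x * norm \<eta>)"
          unfolding abs_mult using w abs_Re_le_cmod[of w] Cauchy_Schwarz_ineq2[of x \<eta>] by (intro mult_mono) auto
        moreover have "\<bar>Re (w\<^sup>2)\<bar> \<le> R\<^sup>2"
          using abs_Re_le_cmod[of "w\<^sup>2"] power_mono[OF w norm_ge_zero, of 2] by (simp add: norm_power)
        then have "\<bar>Re (w\<^sup>2) * (\<eta> \<bullet> \<eta>)\<bar> \<le> R\<^sup>2 * (\<eta> \<bullet> \<eta>)"
          unfolding abs_mult by (intro mult_mono) auto
        ultimately have "- ((norm x)\<^sup>2 + 2 * Re w * (x \<bullet> \<eta>) + Re (w\<^sup>2) * (\<eta> \<bullet> \<eta>)) \<le>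
            R\<^sup>2 * (\<eta> \<bullet> \<eta>) + 2 * R * norm \<eta> * norm x - (norm x)\<^sup>2"
          by (simp add: mult_ac abs_le_iff)
        from mult_left_mono[OF this, of "pi * s"] show ?thesis using s by (simp add: algebra_simps)
      qed
      finally have "(1 + norm x) ^ (2 * DIM('a)) * cmod (H w x) \<le> (1 + norm x) ^ (2 * DIM('a)) *
         exp (pi * s * R\<^sup>2 * (\<eta> \<bullet> \<eta>) + (2 * pi * s * R * norm \<eta> * norm x - pi * s * (norm x)\<^sup>2))"
        by (intro mult_left_mono) auto
      also have "\<dots> = exp (pi * s * R\<^sup>2 * (\<eta> \<bullet> \<eta>)) * ((1 + norm x) ^ (2 * DIM('a)) *
         exp (2 * pi * s * R * norm \<eta> * norm x - pi * s * (norm x)\<^sup>2))"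
        by (simp add: exp_add)
      also have "\<dots> \<le> exp (pi * s * R\<^sup>2 * (\<eta> \<bullet> \<eta>)) * C"
        by (intro mult_left_mono C) auto
      finally show "(1 + norm x) ^ (2 * DIM('a)) * cmod (H w x) \<le> exp (pi * s * R\<^sup>2 * (\<eta> \<bullet> \<eta>)) * C" .
    qed
    then show "\<exists>C. \<forall>w x. cmod w \<le> R \<longrightarrow> cmod (H w x) \<le> C * tail x" by blast
  qed
  moreover have "H 0 = (\<lambda>x. of_real (exp (- (pi * s * (x \<bullet> x)))))"
    by (simp add: H_def exp_of_real[symmetric])
  then have "integral\<^sup>L lborel (H 0) = of_real (inverse (sqrt s) ^ DIM('a))"
    using integral_gaussian[OF s, where 'a='a] by (simp only: integral_complex_of_real)
  moreover have "H \<i> = (\<lambda>x. of_real (exp (pi * inverse s * (\<xi> \<bullet> \<xi>))) *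
      (exp (- (2 * pi * \<i> * of_real (\<xi> \<bullet> x))) * of_real (exp (- (pi * s * (x \<bullet> x))))))"
  proof
    fix x
    have "- (of_real (pi * s) * (of_real (x \<bullet> x) + 2 * \<i> * of_real (x \<bullet> \<eta>) + \<i>\<^sup>2 * of_real (\<eta> \<bullet> \<eta>))) =
        complex_of_real (pi * inverse s * (\<xi> \<bullet> \<xi>)) +
        (- (2 * pi * \<i> * of_real (\<xi> \<bullet> x)) + of_real (- (pi * s * (x \<bullet> x))))"
      using s by (simp add: \<eta>_def inner_commute field_simps)
    then show "H \<i> x = of_real (exp (pi * inverse s * (\<xi> \<bullet> \<xi>))) *
        (exp (- (2 * pi * \<i> * of_real (\<xi> \<bullet> x))) * of_real (exp (- (pi * s * (x \<bullet> x)))))"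
      unfolding H_def by (simp only: exp_add exp_of_real)
  qed
  then have "integral\<^sup>L lborel (H \<i>) = of_real (exp (pi * inverse s * (\<xi> \<bullet> \<xi>))) *
      fourier (\<lambda>x. of_real (exp (- (pi * s * (x \<bullet> x))))) \<xi>"
    unfolding fourier_def by simp
  ultimately have *: "of_real (exp (pi * inverse s * (\<xi> \<bullet> \<xi>))) *
      fourier (\<lambda>x. of_real (exp (- (pi * s * (x \<bullet> x))))) \<xi> = of_real (inverse (sqrt s) ^ DIM('a))"
    by (simp only:)
  have "complex_of_real (exp (- (pi * inverse s * (\<xi> \<bullet> \<xi>)))) * of_real (exp (pi * inverse s * (\<xi> \<bullet> \<xi>))) = 1"
    unfolding of_real_mult[symmetric] by (simp add: exp_minus)
  moreover have "b = c * a'" if "a' * a = 1" "a * b = c" for a a' b c :: complex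
  proof -
    have "b = (a' * a) * b" using that(1) by (simp only: mult_1)
    also have "\<dots> = (a * b) * a'" by (simp only: mult_ac)
    finally show ?thesis using that(2) by (simp only:)
  qed
  ultimately show ?thesis using * unfolding of_real_mult by blast
qed

text \<open>Only integrability against one fixed Gaussian is required of \<open>f\<close>, so the lemma applies to
symbols of polynomial growth as well as to integrable functions.\<close>
lemma approximate_identity:
  fixes f :: "'a::euclidean_space \<Rightarrow> complex"
  assumes m: "f \<in> borel_measurable borel" and c: "isCont f x0"
    and i: "integrable lborel (\<lambda>x. of_real (exp (- (pi * ((x - x0) \<bullet> (x - x0))))) * f x)"
  shows "((\<lambda>s. \<integral>x. of_real (sqrt s ^ DIM('a) * exp (- (pi * s * ((x - x0) \<bullet> (x - x0))))) * f x \<partial>lborel)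
     \<longlongrightarrow> f x0) at_top"
proof -
  define K where "K = (\<lambda>s (x::'a). sqrt s ^ DIM('a) * exp (- (pi * s * ((x - x0) \<bullet> (x - x0)))))"
  have K0: "0 \<le> K s x" if "s \<ge> 0" for s x using that by (simp add: K_def)
  have iK: "integrable lborel (K s)" "integral\<^sup>L lborel (K s) = 1" if s: "s > 0" for s
  proof -
    define k where "k = (\<lambda>x::'a. complex_of_real (sqrt s ^ DIM('a) * exp (- (pi * s * (x \<bullet> x)))))"
    have [measurable]: "k \<in> borel_measurable borel" unfolding k_def by measurable
    have k: "integrable lborel k" "integral\<^sup>L lborel k = 1"
      unfolding k_def using integrable_gaussian[OF s, where 'a='a] integral_gaussian[OF s, where 'a='a] s
      by (auto simp del: of_real_mult of_real_power simp: power_mult_distrib[symmetric])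
    have "(\<lambda>x. complex_of_real (K s x)) = (\<lambda>x. k (- x0 + 1 *\<^sub>R x))" by (simp add: K_def k_def)
    then have "integrable lborel (\<lambda>x. complex_of_real (K s x))" "(\<integral>x. complex_of_real (K s x) \<partial>lborel) = 1"
      using integral_affine[of k 1 "- x0"] integrable_affine[of k 1 "- x0"] k by simp_all
    then show "integrable lborel (K s)" "integral\<^sup>L lborel (K s) = 1"
      by (simp_all add: complex_of_real_integrable_eq)
  qed
  define A where "A = (\<integral>x. K 1 x * (cmod (f x) + cmod (f x0)) \<partial>lborel)"
  have iA: "integrable lborel (\<lambda>x. K 1 x * (cmod (f x) + cmod (f x0)))"
    using integrable_norm[OF i] iK(1)[of 1] by (simp add: K_def distrib_left norm_mult)
  have A0: "0 \<le> A" unfolding A_def using K0[of 1] by (intro Bochner_Integration.integral_nonneg) auto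
  have iKf: "integrable lborel (\<lambda>x. of_real (K s x) * f x)" if "s \<ge> 1" for s
  proof (rule Bochner_Integration.integrable_bound[OF integrable_mult_right[OF iA, of "sqrt s ^ DIM('a)"]])
    show "(\<lambda>x. of_real (K s x) * f x) \<in> borel_measurable lborel" using m by (simp add: K_def)
    have "K s x * cmod (f x) \<le> sqrt s ^ DIM('a) * (K 1 x * (cmod (f x) + cmod (f x0)))" for x
    proof -
      have "exp (- (pi * s * ((x - x0) \<bullet> (x - x0)))) \<le> exp (- (pi * 1 * ((x - x0) \<bullet> (x - x0))))"
        using that mult_right_mono[OF that, of "(x - x0) \<bullet> (x - x0)"] by simp
      then have "K s x \<le> sqrt s ^ DIM('a) * K 1 x"
        unfolding K_def using that by (simp add: mult_left_mono)
      then have "K s x * cmod (f x) \<le> (sqrt s ^ DIM('a) * K 1 x) * cmod (f x)"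
        by (intro mult_right_mono) auto
      also have "\<dots> \<le> (sqrt s ^ DIM('a) * K 1 x) * (cmod (f x) + cmod (f x0))"
        using that K0[of 1 x] by (intro mult_left_mono) auto
      finally show ?thesis by (simp add: mult_ac)
    qed
    then show "AE x in lborel. norm (of_real (K s x) * f x) \<le>
        norm (sqrt s ^ DIM('a) * (K 1 x * (cmod (f x) + cmod (f x0))))"
      using that K0 by (auto simp: norm_mult intro!: AE_I2 order_trans[OF _ abs_ge_self])
  qed
  have "((\<lambda>s. \<integral>x. of_real (K s x) * f x \<partial>lborel) \<longlongrightarrow> f x0) at_top"
  proof (rule tendstoI)
    fix \<epsilon> :: real assume e: "\<epsilon> > 0"
    obtain \<delta> where d: "\<delta> > 0" "\<And>x. dist x x0 < \<delta> \<Longrightarrow> dist (f x) (f x0) < \<epsilon> / 2"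
      using c e unfolding continuous_at_eps_delta by (metis half_gt_zero)
    \<comment> \<open>Outside the ball of radius delta, the kernel K s is at most M s times the fixed kernel K 1.\<close>
    define M where "M = (\<lambda>s. s ^ DIM('a) * exp (- (pi * (s - 1) * \<delta>\<^sup>2)))"
    have M: "(M \<longlongrightarrow> 0) at_top"
    proof -
      define a where "a = pi * \<delta>\<^sup>2"
      have a: "a > 0" using d(1) by (simp add: a_def)
      have "filterlim (\<lambda>s. a * s) at_top at_top"
        using a by (simp add: filterlim_tendsto_pos_mult_at_top[OF tendsto_const _ filterlim_ident])
      then have "((\<lambda>s. (a * s) ^ DIM('a) / exp (a * s)) \<longlongrightarrow> 0) at_top"
        using filterlim_compose[OF tendsto_power_div_exp_0] by blast
      then have "((\<lambda>s. (exp a / a ^ DIM('a)) * ((a * s) ^ DIM('a) / exp (a * s))) \<longlongrightarrow> (exp a / a ^ DIM('a)) * 0) at_top"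
        by (intro tendsto_mult tendsto_const)
      moreover have "(exp a / a ^ DIM('a)) * ((a * s) ^ DIM('a) / exp (a * s)) = M s" for s
      proof -
        have "- (pi * (s - 1) * \<delta>\<^sup>2) = a - a * s" by (simp add: a_def algebra_simps)
        then have "M s = s ^ DIM('a) * (exp a / exp (a * s))" by (simp only: M_def exp_diff)
        then show ?thesis using a by (simp add: power_mult_distrib)
      qed
      ultimately show ?thesis by simp
    qed
    have "((\<lambda>s. M s * A) \<longlongrightarrow> 0 * A) at_top" using M by (intro tendsto_mult tendsto_const)
    then have "\<forall>\<^sub>F s in at_top. M s * A < \<epsilon> / 2"
      using e by (intro order_tendstoD(2)) auto
    then show "\<forall>\<^sub>F s in at_top. dist (\<integral>x. of_real (K s x) * f x \<partial>lborel) (f x0) < \<epsilon>"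
      using eventually_ge_at_top[of 1]
    proof eventually_elim
      case (elim s)
      have pw: "K s x * cmod (f x - f x0) \<le> \<epsilon> / 2 * K s x + M s * (K 1 x * (cmod (f x) + cmod (f x0)))" for x
      proof (cases "dist x x0 < \<delta>")
        case True
        have "K s x * cmod (f x - f x0) \<le> K s x * (\<epsilon> / 2)"
          using d(2)[OF True] elim K0[of s x] by (intro mult_left_mono) (auto simp: dist_norm)
        moreover have "0 \<le> M s * (K 1 x * (cmod (f x) + cmod (f x0)))"
          using elim K0[of 1 x] by (simp add: M_def)
        ultimately show ?thesis by (simp add: mult.commute)
      next
        case False
        have "\<delta>\<^sup>2 \<le> (x - x0) \<bullet> (x - x0)"
          using False d(1) by (auto simp: dist_norm power2_norm_eq_inner[symmetric] intro!: power_mono)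
        then have "pi * (s - 1) * \<delta>\<^sup>2 \<le> pi * (s - 1) * ((x - x0) \<bullet> (x - x0))"
          using elim by (intro mult_left_mono) auto
        then have "exp (- (pi * s * ((x - x0) \<bullet> (x - x0)))) \<le>
            exp (- (pi * (s - 1) * \<delta>\<^sup>2)) * exp (- (pi * 1 * ((x - x0) \<bullet> (x - x0))))"
          unfolding exp_add[symmetric] by (simp add: algebra_simps)
        moreover have "sqrt s ^ DIM('a) \<le> s ^ DIM('a)"
        proof (rule power_mono)
          have "s \<le> s\<^sup>2" using elim by (simp add: self_le_power)
          then show "sqrt s \<le> s" using elim by (intro real_le_lsqrt) auto
        qed (use elim in simp)
        ultimately have "K s x \<le> s ^ DIM('a) * (exp (- (pi * (s - 1) * \<delta>\<^sup>2)) * exp (- (pi * 1 * ((x - x0) \<bullet> (x - x0)))))"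
          unfolding K_def using elim by (intro mult_mono) auto
        then have "K s x \<le> M s * K 1 x" by (simp add: K_def M_def mult.assoc)
        then have "K s x * cmod (f x - f x0) \<le> M s * K 1 x * (cmod (f x) + cmod (f x0))"
          using K0[of s x] elim norm_triangle_ineq4[of "f x" "f x0"] by (intro mult_mono) auto
        moreover have "0 \<le> \<epsilon> / 2 * K s x" using K0[of s x] e elim by simp
        ultimately show ?thesis by (simp add: mult_ac)
      qed
      have s: "s > 0" "s \<ge> 1" using elim by auto
      have i3: "integrable lborel (\<lambda>x. of_real (K s x) * f x0)"
        using iK(1)[OF s(1)] by (intro integrable_mult_left) auto
      have i2: "integrable lborel (\<lambda>x. of_real (K s x) * f x - of_real (K s x) * f x0)"
        by (rule Bochner_Integration.integrable_diff[OF iKf[OF s(2)] i3])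
      have "(\<integral>x. of_real (K s x) * f x \<partial>lborel) - f x0 =
          (\<integral>x. of_real (K s x) * f x - of_real (K s x) * f x0 \<partial>lborel)"
        unfolding Bochner_Integration.integral_diff[OF iKf[OF s(2)] i3]
        using iK[OF s(1)] by simp
      also have "cmod \<dots> \<le> (\<integral>x. cmod (of_real (K s x) * f x - of_real (K s x) * f x0) \<partial>lborel)"
        by (rule integral_norm_bound)
      also have "\<dots> \<le> (\<integral>x. \<epsilon> / 2 * K s x + M s * (K 1 x * (cmod (f x) + cmod (f x0))) \<partial>lborel)"
      proof (rule integral_mono)
        show "integrable lborel (\<lambda>x. cmod (of_real (K s x) * f x - of_real (K s x) * f x0))"
          using i2 by (rule integrable_norm)
        show "integrable lborel (\<lambda>x. \<epsilon> / 2 * K s x + M s * (K 1 x * (cmod (f x) + cmod (f x0))))"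
          by (intro Bochner_Integration.integrable_add integrable_mult_right iK s iA)
        show "cmod (of_real (K s x) * f x - of_real (K s x) * f x0) \<le>
           \<epsilon> / 2 * K s x + M s * (K 1 x * (cmod (f x) + cmod (f x0)))" for x
          using pw[of x] K0[of s x] s unfolding right_diff_distrib[symmetric] norm_mult by simp
      qed
      also have "\<dots> = \<epsilon> / 2 * integral\<^sup>L lborel (K s) + M s * A"
        unfolding A_def using iK(1)[OF s(1)] iA by simp
      also have "\<dots> < \<epsilon>" using elim iK[OF s(1)] by simp
      finally show ?case by (simp add: dist_norm)
    qed
  qed
  then show ?thesis by (simp add: K_def)
qed

text \<open>Insert the Gaussian with parameter \<open>1 / s\<close> in the frequency integral.  As \<open>s\<close> grows, dominated
convergence gives the left-hand side; by Fubini's theorem the regularized integral is also \<open>h\<close>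
smoothed by the Fourier transform of the Gaussian, an approximate identity at \<open>x0\<close>.\<close>
lemma fourier_inversion:
  fixes h :: "'a::euclidean_space \<Rightarrow> complex"
  assumes i: "integrable lborel h" and c: "isCont h x0" and ih: "integrable lborel (fourier h)"
  shows "(\<integral>\<xi>. exp (2 * pi * \<i> * of_real (\<xi> \<bullet> x0)) * fourier h \<xi> \<partial>lborel) = h x0"
proof -
  have [measurable]: "h \<in> borel_measurable borel" "fourier h \<in> borel_measurable borel"
    using i ih by auto
  define e where "e = (\<lambda>\<xi>::'a. exp (2 * pi * \<i> * of_real (\<xi> \<bullet> x0)))"
  have [measurable]: "e \<in> borel_measurable borel"
    unfolding e_def by (intro borel_measurable_continuous_onI continuous_intros)
  define A where "A = (\<lambda>s. \<integral>\<xi>. of_real (exp (- (pi * inverse s * (\<xi> \<bullet> \<xi>)))) * (e \<xi> * fourier h \<xi>) \<partial>lborel)"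
  have "(A \<longlongrightarrow> (\<integral>\<xi>. e \<xi> * fourier h \<xi> \<partial>lborel)) at_top"
    unfolding A_def
  proof (rule integral_dominated_convergence_at_top)
    show "integrable lborel (\<lambda>\<xi>. cmod (fourier h \<xi>))" using ih by (rule integrable_norm)
    show "AE \<xi> in lborel. ((\<lambda>s. of_real (exp (- (pi * inverse s * (\<xi> \<bullet> \<xi>)))) * (e \<xi> * fourier h \<xi>)) \<longlongrightarrow> e \<xi> * fourier h \<xi>) at_top"
    proof (rule AE_I2)
      fix \<xi> :: 'a
      have "((\<lambda>s. of_real (exp (- (pi * inverse s * (\<xi> \<bullet> \<xi>)))) * (e \<xi> * fourier h \<xi>)) \<longlongrightarrow>
          of_real (exp (- (pi * 0 * (\<xi> \<bullet> \<xi>)))) * (e \<xi> * fourier h \<xi>)) at_top"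
        by (intro tendsto_intros tendsto_inverse_0_at_top filterlim_ident)
      then show "((\<lambda>s. of_real (exp (- (pi * inverse s * (\<xi> \<bullet> \<xi>)))) * (e \<xi> * fourier h \<xi>)) \<longlongrightarrow> e \<xi> * fourier h \<xi>) at_top"
        by simp
    qed
    show "\<forall>\<^sub>F s in at_top. AE \<xi> in lborel.
        norm (of_real (exp (- (pi * inverse s * (\<xi> \<bullet> \<xi>)))) * (e \<xi> * fourier h \<xi>)) \<le> cmod (fourier h \<xi>)"
      using eventually_ge_at_top[of 0]
      by eventually_elim (auto simp: norm_mult e_def intro!: AE_I2 mult_left_le_one_le)
  qed auto
  moreover have "(A \<longlongrightarrow> h x0) at_top"
  proof -
    have "integrable lborel (\<lambda>x. of_real (exp (- (pi * ((x - x0) \<bullet> (x - x0))))) * h x)"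
      by (rule Bochner_Integration.integrable_bound[OF i]) (auto simp: norm_mult intro!: AE_I2 mult_left_le_one_le)
    then have "((\<lambda>s. \<integral>x. of_real (sqrt s ^ DIM('a) * exp (- (pi * s * ((x - x0) \<bullet> (x - x0))))) * h x \<partial>lborel)
       \<longlongrightarrow> h x0) at_top"
      by (rule approximate_identity[OF _ c, rotated]) simp
    moreover have "\<forall>\<^sub>F s in at_top. A s =
       (\<integral>x. of_real (sqrt s ^ DIM('a) * exp (- (pi * s * ((x - x0) \<bullet> (x - x0))))) * h x \<partial>lborel)"
      using eventually_gt_at_top[of 0]
    proof eventually_elim
      case (elim s)
      define g where "g = (\<lambda>\<xi>::'a. exp (- (pi * inverse s * (\<xi> \<bullet> \<xi>))))"
      have [measurable]: "g \<in> borel_measurable borel" by (simp add: g_def)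
      have ig: "integrable lborel g" unfolding g_def by (rule integrable_gaussian) (use elim in simp)
      define G where "G = (\<lambda>z. of_real (g (fst z)) * (e (fst z) *
          (exp (- (2 * pi * \<i> * of_real (fst z \<bullet> snd z))) * h (snd z))))"
      have "integrable lborel G"
      proof (rule Bochner_Integration.integrable_bound[OF integrable_tensor[OF ig integrable_norm[OF i]]])
        have "(\<lambda>z. exp (- (2 * pi * \<i> * of_real (fst z \<bullet> (snd z :: 'a))))) \<in> borel_measurable borel"
          by (intro borel_measurable_continuous_onI continuous_intros)
        then show "G \<in> borel_measurable lborel"
          unfolding G_def by (simp add: borel_prod[symmetric])
        show "AE z in lborel. norm (G z) \<le> norm (g (fst z) * norm (h (snd z)))"
          by (auto simp: G_def norm_mult e_def)
      qed
      note fub = lborel_fubini[OF this]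
      have "A s = (\<integral>\<xi>. (\<integral>x. G (\<xi>, x) \<partial>lborel) \<partial>lborel)"
        by (simp add: A_def G_def fourier_def g_def)
      also have "\<dots> = (\<integral>x. (\<integral>\<xi>. G (\<xi>, x) \<partial>lborel) \<partial>lborel)" using fub by simp
      also have "\<dots> = (\<integral>x. fourier (\<lambda>\<xi>. of_real (g \<xi>)) (x - x0) * h x \<partial>lborel)"
      proof -
        have "(\<integral>\<xi>. G (\<xi>, x) \<partial>lborel) = fourier (\<lambda>\<xi>. of_real (g \<xi>)) (x - x0) * h x" for x
        proof -
          have "e \<xi> * exp (- (2 * pi * \<i> * of_real (\<xi> \<bullet> x))) = exp (- (2 * pi * \<i> * of_real ((x - x0) \<bullet> \<xi>)))" for \<xi>
            unfolding e_def mult_exp_exp by (simp add: inner_diff_left inner_commute algebra_simps)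
          then have "G (\<xi>, x) = exp (- (2 * pi * \<i> * of_real ((x - x0) \<bullet> \<xi>))) * of_real (g \<xi>) * h x" for \<xi>
            by (simp add: G_def mult.assoc[symmetric])
          then show ?thesis unfolding fourier_def by simp
        qed
        then show ?thesis by simp
      qed
      finally show ?case
        unfolding g_def using elim fourier_gaussian[of "inverse s", where 'a='a] by (simp add: real_sqrt_inverse)
    qed
    ultimately show ?thesis by (simp add: tendsto_cong)
  qed
  ultimately show ?thesis using tendsto_unique[OF _ \<open>(A \<longlongrightarrow> h x0) at_top\<close>] unfolding e_def by fastforce
qed

section \<open>Locally bounded and compactly supported families\<close>

definition loc_bdd :: "'p set \<Rightarrow> ('p \<Rightarrow> 'a::real_normed_vector \<Rightarrow> complex) \<Rightarrow> bool" where
  "loc_bdd S F \<longleftrightarrow> (\<forall>R. \<exists>C. \<forall>p\<in>S. \<forall>x. norm x \<le> R \<longrightarrow> cmod (F p x) \<le> C)"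

definition csupp :: "'p set \<Rightarrow> ('p \<Rightarrow> 'a::real_normed_vector \<Rightarrow> complex) \<Rightarrow> bool" where
  "csupp S F \<longleftrightarrow> loc_bdd S F \<and> (\<exists>R. \<forall>p x. R < norm x \<longrightarrow> F p x = 0)"

lemma loc_bdd_zero: "loc_bdd S (\<lambda>p x. 0)"
  by (auto simp: loc_bdd_def intro: exI[of _ 0])

lemma loc_bdd_add: "loc_bdd S F \<Longrightarrow> loc_bdd S G \<Longrightarrow> loc_bdd S (\<lambda>p x. F p x + G p x)"
  unfolding loc_bdd_def by (metis add_mono norm_triangle_le)

lemma loc_bdd_mult:
  assumes "loc_bdd S F" "loc_bdd S G" shows "loc_bdd S (\<lambda>p x. F p x * G p x)"
  unfolding loc_bdd_def
proof
  fix R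
  obtain C D where C: "\<And>p x. p \<in> S \<Longrightarrow> norm x \<le> R \<Longrightarrow> cmod (F p x) \<le> C"
    and D: "\<And>p x. p \<in> S \<Longrightarrow> norm x \<le> R \<Longrightarrow> cmod (G p x) \<le> D"
    using assms unfolding loc_bdd_def by metis
  have "cmod (F p x * G p x) \<le> C * D" if "p \<in> S" "norm x \<le> R" for p x
    unfolding norm_mult using C[OF that] D[OF that] by (intro mult_mono) (auto intro: order_trans[OF norm_ge_zero])
  then show "\<exists>C. \<forall>p\<in>S. \<forall>x. norm x \<le> R \<longrightarrow> cmod (F p x * G p x) \<le> C" by blast
qed

lemma csupp_add:
  assumes "csupp S F" "csupp S G" shows "csupp S (\<lambda>p x. F p x + G p x)"
proof -
  obtain A B where "\<And>p x. A < norm x \<Longrightarrow> F p x = 0" "\<And>p x. B < norm x \<Longrightarrow> G p x = 0"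
    using assms unfolding csupp_def by metis
  then have "\<forall>p x. max A B < norm x \<longrightarrow> F p x + G p x = 0" by simp
  then show ?thesis using assms loc_bdd_add[of S F G] unfolding csupp_def by blast
qed

lemma csupp_loc_bdd_mult: "csupp S F \<Longrightarrow> loc_bdd S G \<Longrightarrow> csupp S (\<lambda>p x. F p x * G p x)"
  using loc_bdd_mult[of S F G] unfolding csupp_def by (metis mult_zero_left)

lemma csupp_imp_rapid:
  assumes "csupp S F" shows "rapid S (\<lambda>_ x. norm x) F"
  unfolding rapid_def
proof
  fix N
  obtain R where R: "\<And>p x. R < norm x \<Longrightarrow> F p x = 0" using assms unfolding csupp_def by metis
  obtain C where C: "\<And>p x. p \<in> S \<Longrightarrow> norm x \<le> R \<Longrightarrow> cmod (F p x) \<le> C"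
    using assms unfolding csupp_def loc_bdd_def by metis
  have "(1 + norm x) ^ N * cmod (F p x) \<le> (1 + \<bar>R\<bar>) ^ N * \<bar>C\<bar>" if "p \<in> S" for p x
  proof (cases "norm x \<le> R")
    case True
    then show ?thesis using C[OF that True] by (intro mult_mono power_mono) auto
  qed (use R in auto)
  then show "\<exists>C. \<forall>p\<in>S. \<forall>x. (1 + norm x) ^ N * cmod (F p x) \<le> C" by blast
qed

lemma hered_loc_bdd_mult:
  "hered (loc_bdd S) n F \<Longrightarrow> hered (loc_bdd S) n G \<Longrightarrow> hered (loc_bdd S) n (\<lambda>p x. F p x * G p x)"
  by (rule hered_mult[where P="loc_bdd S" and ?P1.0="loc_bdd S" and ?P2.0="loc_bdd S"]) (auto intro: loc_bdd_add loc_bdd_mult)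

lemma hered_loc_bdd_const:
  assumes "\<And>p. p \<in> S \<Longrightarrow> cmod (c p) \<le> C"
  shows "hered (loc_bdd S) n (\<lambda>p x. c p)"
  by (rule hered_const) (use assms in \<open>auto simp: loc_bdd_def intro: exI[of _ 0]\<close>)

lemma smooth_pd:
  assumes "smooth f" "b \<in> Basis" shows "smooth (pd b f)"
  unfolding smooth_iff
proof
  fix n show "hered (\<lambda>_. True) n (\<lambda>_::unit. pd b f)"
    using assms(1)[unfolded smooth_iff, THEN spec, of "Suc n"] assms(2) by simp
qed

lemma smooth_differentiable: "smooth f \<Longrightarrow> f differentiable_on UNIV"
  using smooth_iff[of f] by (metis hered.simps(2))

lemma smooth_continuous: "smooth f \<Longrightarrow> continuous_on UNIV f"
  by (rule differentiable_imp_continuous_on[OF smooth_differentiable])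

lemma smooth_mult: "smooth f \<Longrightarrow> smooth g \<Longrightarrow> smooth (\<lambda>x. f x * g x)"
  unfolding smooth_iff
  by (intro allI hered_mult[where ?P1.0="\<lambda>_. True" and ?P2.0="\<lambda>_. True"]) auto

lemma hered_loc_bdd_smooth:
  assumes "smooth (f :: 'a::euclidean_space \<Rightarrow> complex)" shows "hered (loc_bdd S) n (\<lambda>_. f)"
  using assms
proof (induction n arbitrary: f)
  case (0 f)
  have "\<exists>C. \<forall>x. norm x \<le> R \<longrightarrow> cmod (f x) \<le> C" for R
  proof -
    have "bounded (f ` cball 0 R)"
      by (intro compact_imp_bounded compact_continuous_image
          continuous_on_subset[OF smooth_continuous[OF 0]]) auto
    then obtain C where "\<forall>x\<in>cball 0 R. cmod (f x) \<le> C" by (auto simp: bounded_iff)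
    then show ?thesis by (metis mem_cball_0)
  qed
  then show ?case by (auto simp: loc_bdd_def)
next
  case (Suc n f)
  then show ?case using hered_imp[of "loc_bdd S" n "\<lambda>_. f"] smooth_pd smooth_differentiable by auto
qed

lemma smooth_family: "(\<And>n. hered P n F) \<Longrightarrow> smooth (F p)"
  unfolding smooth_iff
  using hered_reparam[where P=P and P'="\<lambda>_. True" and \<theta>="\<lambda>_::unit. p"] by blast

definition bump :: "('a::euclidean_space \<Rightarrow> complex) \<Rightarrow> bool" where
  "bump c \<longleftrightarrow> smooth c \<and> (\<exists>R. \<forall>x. R < norm x \<longrightarrow> c x = 0)"

lemma bump_mult: "bump c \<Longrightarrow> smooth g \<Longrightarrow> bump (\<lambda>x. c x * g x)"
  unfolding bump_def by (metis mult_zero_left smooth_mult)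

lemma bump_pd:
  assumes "bump c" "b \<in> Basis" shows "bump (pd b c)"
proof -
  obtain R where R: "\<And>x. R < norm x \<Longrightarrow> c x = 0" using assms unfolding bump_def by blast
  have "pd b c x = 0" if "R < norm x" for x
  proof -
    have "open (- cball (0::'a) R)" by (rule open_Compl[OF closed_cball])
    then have "(c has_derivative (\<lambda>_. 0)) (at x)"
      by (rule has_derivative_transform_within_open[OF has_derivative_const[of 0]]) (use that R in auto)
    from pd_eq[OF this] show ?thesis .
  qed
  then show ?thesis using assms smooth_pd unfolding bump_def by blast
qed

lemma hered_csupp_bump:
  assumes "bump (c :: 'a::euclidean_space \<Rightarrow> complex)" shows "hered (csupp S) n (\<lambda>_. c)"
  using assms
proof (induction n arbitrary: c)
  case (0 c)
  then show ?case using hered_loc_bdd_smooth[of c S 0] by (auto simp: csupp_def bump_def)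
next
  case (Suc n c)
  have "csupp S (\<lambda>_. c)" by (rule hered_imp[OF Suc.IH[OF Suc.prems]])
  moreover have "c differentiable_on UNIV" using Suc.prems smooth_differentiable by (auto simp: bump_def)
  ultimately show ?case using Suc.IH[OF bump_pd[OF Suc.prems]] by simp
qed

lemma hered_csupp_mult:
  "bump c \<Longrightarrow> hered (loc_bdd S) n G \<Longrightarrow> hered (csupp S) n (\<lambda>p x. c x * G p x)"
  by (rule hered_mult[where P="csupp S" and ?P1.0="csupp S" and ?P2.0="loc_bdd S" and F="\<lambda>_. c"])
    (auto intro: csupp_add csupp_loc_bdd_mult hered_csupp_bump)

lemma bump_imp_schwartz: "bump c \<Longrightarrow> schwartz c"
  unfolding schwartz_iff
  by (auto intro: hered_mono[OF hered_csupp_bump] csupp_imp_rapid)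

text \<open>Only finitely many multi-indices enter a Schwartz seminorm of a given order, so uniform bounds for the
individual derivatives of a family add up to one bound for the seminorms.\<close>
lemma seminorm_csupp:
  fixes F :: "'p \<Rightarrow> 'a::euclidean_space \<Rightarrow> complex"
  assumes "hered (csupp S) N F"
  shows "\<exists>C. \<forall>p\<in>S. 0 \<le> schwartz_seminorm N (F p) \<and> schwartz_seminorm N (F p) \<le> C"
proof -
  define I where "I = {bs :: 'a list. set bs \<subseteq> Basis \<and> length bs \<le> N}"
  have I: "finite I" unfolding I_def by (rule finite_lists_length_le) simp
  have "\<exists>C\<ge>0. \<forall>p\<in>S. \<forall>x. (1 + norm x) ^ N * cmod (iter_pderiv bs (F p) x) \<le> C" if "bs \<in> I" for bs
  proof -
    have "csupp S (\<lambda>p. iter_pderiv bs (F p))"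
      using hered_iter_pderiv[OF assms] that by (auto simp: I_def)
    from rapidD[OF csupp_imp_rapid[OF this], of N] show ?thesis by metis
  qed
  then obtain C where C: "\<And>bs. bs \<in> I \<Longrightarrow> 0 \<le> C bs"
    "\<And>bs p x. bs \<in> I \<Longrightarrow> p \<in> S \<Longrightarrow> (1 + norm x) ^ N * cmod (iter_pderiv bs (F p) x) \<le> C bs"
    by metis
  have b: "(1 + norm x) ^ N * cmod (iter_pderiv bs (F p) x) \<le> sum C I" if "bs \<in> I" "p \<in> S" for bs p x
    using C(2)[OF that, of x] member_le_sum[OF that(1) _ I, of C] C(1) by fastforce
  have "0 \<le> schwartz_seminorm N (F p) \<and> schwartz_seminorm N (F p) \<le> sum C I" if p: "p \<in> S" for p
  proof
    let ?A = "{(1 + norm x) ^ N * cmod (iter_pderiv bs (F p) x) | x bs. set bs \<subseteq> Basis \<and> length bs \<le> N}"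
    have mem: "(1 + norm (0::'a)) ^ N * cmod (iter_pderiv [] (F p) 0) \<in> ?A" by fastforce
    have ub: "y \<le> sum C I" if "y \<in> ?A" for y using that b[OF _ p] by (auto simp: I_def)
    show "schwartz_seminorm N (F p) \<le> sum C I"
      unfolding schwartz_seminorm_def by (rule cSup_least) (use mem ub in blast)+
    have "(1 + norm (0::'a)) ^ N * cmod (iter_pderiv [] (F p) 0) \<le> Sup ?A"
      by (rule cSup_upper[OF mem]) (use ub in \<open>auto simp: bdd_above_def\<close>)
    then show "0 \<le> schwartz_seminorm N (F p)"
      unfolding schwartz_seminorm_def by (rule order_trans[rotated]) simp
  qed
  then show ?thesis by blast
qed

section \<open>Exponentials with complex frequency\<close>

definition cdot :: "(complex ^ 'n) \<times> (complex ^ 'n) \<Rightarrow> (real ^ 'n) \<times> (real ^ 'n) \<Rightarrow> complex" where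
  "cdot z \<zeta> = (\<Sum>i\<in>UNIV. fst z $ i * of_real (fst \<zeta> $ i)) + (\<Sum>i\<in>UNIV. snd z $ i * of_real (snd \<zeta> $ i))"

text \<open>The real phase space inside the complex one.\<close>
definition cvec2 :: "(real ^ 'n) \<times> (real ^ 'n) \<Rightarrow> (complex ^ 'n) \<times> (complex ^ 'n)" where
  "cvec2 p = (cvec (fst p), cvec (snd p))"

definition im_part :: "(complex ^ 'n) \<times> (complex ^ 'n) \<Rightarrow> (real ^ 'n) \<times> (real ^ 'n)" where
  "im_part z = ((\<chi> i. Im (fst z $ i)), (\<chi> i. Im (snd z $ i)))"

text \<open>Multiplication of a point of complex phase space by a complex scalar; the product type carries only a
real vector space structure.\<close>
definition cscale :: "complex \<Rightarrow> (complex ^ 'n) \<times> (complex ^ 'n) \<Rightarrow> (complex ^ 'n) \<times> (complex ^ 'n)" where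
  "cscale t z = (t *s fst z, t *s snd z)"

text \<open>With the sign convention of \<open>fourier\<close>: for a real point \<open>z\<close> this is the character that occurs in the
Fourier transform at \<open>z\<close>.\<close>
definition wave :: "(complex ^ ('n::finite)) \<times> (complex ^ 'n) \<Rightarrow> (real ^ 'n) \<times> (real ^ 'n) \<Rightarrow> complex" where
  "wave z \<zeta> = exp (- (2 * pi * \<i>) * cdot z \<zeta>)"

lemma cdot_cvec2: "cdot (cvec2 z) \<zeta> = of_real (z \<bullet> \<zeta>)"
  by (simp add: cdot_def cvec2_def cvec_def inner_prod_def inner_vec_def)

lemma cdot_cscale: "cdot (cscale t z) \<zeta> = t * cdot z \<zeta>"
  by (simp add: cdot_def cscale_def sum_distrib_left distrib_left mult.assoc)

lemma Im_cdot: "Im (cdot z \<zeta>) = im_part z \<bullet> \<zeta>"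
  by (simp add: cdot_def im_part_def inner_prod_def inner_vec_def Im_sum)

lemma norm_cvec: "norm (cvec x) = norm x"
  by (simp add: cvec_def norm_vec_def)

lemma norm_cvec2: "norm (cvec2 z) = norm z"
  by (simp add: cvec2_def norm_prod_def norm_cvec)

lemma im_part_cvec2 [simp]: "im_part (cvec2 z) = 0"
  by (simp add: im_part_def cvec2_def cvec_def vec_eq_iff prod_eq_iff)

lemma cdot_bounded_bilinear: "bounded_bilinear (cdot :: (complex ^ ('n::finite)) \<times> (complex ^ 'n) \<Rightarrow> _)"
proof (rule bounded_bilinear.intro)
  have b: "cmod (cdot z \<zeta>) \<le> norm z * norm \<zeta> * (2 * real CARD('n))" for z :: "(complex ^ 'n) \<times> (complex ^ 'n)" and \<zeta>
  proof -
    have 1: "cmod (a $ i * of_real (b $ i)) \<le> norm z * norm \<zeta>"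
      if "norm a \<le> norm z" "norm b \<le> norm \<zeta>" for a :: "complex ^ 'n" and b i
    proof -
      have "norm (a $ i) \<le> norm z" "norm (b $ i) \<le> norm \<zeta>"
        using Finite_Cartesian_Product.norm_nth_le[of a i] Finite_Cartesian_Product.norm_nth_le[of b i] that
        by linarith+
      then show ?thesis unfolding norm_mult norm_of_real by (intro mult_mono) auto
    qed
    have "cmod (cdot z \<zeta>) \<le> (\<Sum>i\<in>(UNIV::'n set). norm z * norm \<zeta>) + (\<Sum>i\<in>(UNIV::'n set). norm z * norm \<zeta>)"
      unfolding cdot_def
      by (intro order_trans[OF norm_triangle_ineq] add_mono order_trans[OF norm_sum] sum_mono 1)
        (metis norm_fst_le norm_snd_le prod.collapse)+
    then show ?thesis by (simp add: mult_ac)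
  qed
  then show "\<exists>K. \<forall>(a :: (complex ^ 'n) \<times> (complex ^ 'n)) b. norm (cdot a b) \<le> norm a * norm b * K" by blast
qed (simp_all add: cdot_def sum.distrib algebra_simps scaleR_sum_right sum_distrib_left scaleR_conv_of_real[where 'a=complex])

lemma cmod_wave: "cmod (wave z \<zeta>) = exp (2 * pi * (im_part z \<bullet> \<zeta>))"
  by (simp add: wave_def norm_exp_eq_Re Im_cdot)

lemma wave_add: "wave (z + h) \<zeta> = wave z \<zeta> * wave h \<zeta>"
  by (simp add: wave_def bounded_bilinear.add_left[OF cdot_bounded_bilinear] mult_exp_exp algebra_simps)

lemma pd_exp_linear:
  assumes "bounded_linear l"
  shows "((\<lambda>x. exp (l x)) has_derivative (\<lambda>h. l h * exp (l x))) (at x)"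
    "pd b (\<lambda>x. exp (l x :: complex)) = (\<lambda>x. l b * exp (l x))"
proof -
  show *: "((\<lambda>x. exp (l x)) has_derivative (\<lambda>h. l h * exp (l x))) (at x)" for x
    using has_derivative_compose[OF bounded_linear_imp_has_derivative[OF assms]
        DERIV_exp[THEN has_field_derivative_imp_has_derivative], of x] by (simp add: mult.commute)
  show "pd b (\<lambda>x. exp (l x)) = (\<lambda>x. l b * exp (l x))" by (rule ext, rule pd_eq, rule *)
qed

definition phase :: "(complex ^ ('n::finite)) \<times> (complex ^ 'n) \<Rightarrow> (real ^ 'n) \<times> (real ^ 'n) \<Rightarrow> complex" where
  "phase z \<zeta> = - (2 * pi * \<i>) * cdot z \<zeta>"

lemma bounded_linear_phase: "bounded_linear (phase z)"
  unfolding phase_def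
  by (intro bounded_linear_const_mult bounded_bilinear.bounded_linear_right[OF cdot_bounded_bilinear])

lemma bounded_linear_phase_left: "bounded_linear (\<lambda>z. phase z \<zeta>)"
  unfolding phase_def
  by (intro bounded_linear_const_mult bounded_bilinear.bounded_linear_left[OF cdot_bounded_bilinear])

lemma phase_bound:
  obtains B where "B \<ge> 0" "\<And>(z :: (complex ^ ('n::finite)) \<times> (complex ^ 'n)) \<zeta>. cmod (phase z \<zeta>) \<le> B * norm z * norm \<zeta>"
proof -
  obtain K where K: "K \<ge> 0" "\<And>(a :: (complex ^ 'n) \<times> (complex ^ 'n)) b. norm (cdot a b) \<le> norm a * norm b * K"
    using bounded_bilinear.nonneg_bounded[OF cdot_bounded_bilinear[where 'n='n]] by blast
  show ?thesis
    by (rule that[of "2 * pi * K"]) (use K in \<open>auto simp: phase_def norm_mult mult_ac intro!: mult_left_mono\<close>)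
qed

lemma wave_phase: "wave z \<zeta> = exp (phase z \<zeta>)"
  by (simp add: wave_def phase_def)

lemma wave_differentiable: "wave z differentiable_on UNIV"
  unfolding wave_phase[abs_def] differentiable_on_def differentiable_def
  using pd_exp_linear(1)[OF bounded_linear_phase] by (blast intro: has_derivative_at_withinI)

lemma pd_wave: "pd b (wave z) = (\<lambda>\<zeta>. phase z b * wave z \<zeta>)"
  unfolding wave_phase[abs_def] using pd_exp_linear(2)[OF bounded_linear_phase] by blast

lemma hered_wave_bounded:
  assumes "\<And>z. z \<in> S \<Longrightarrow> norm z \<le> B"
  shows "hered (loc_bdd S) n (wave :: (complex ^ ('n::finite)) \<times> (complex ^ 'n) \<Rightarrow> _)"
proof (induction n)
  obtain A where A: "A \<ge> 0" "\<And>(z :: (complex ^ 'n) \<times> (complex ^ 'n)) \<zeta>. cmod (phase z \<zeta>) \<le> A * norm z * norm \<zeta>"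
    using phase_bound by blast
  have ph: "cmod (phase z \<zeta>) \<le> A * \<bar>B\<bar> * \<bar>R\<bar>" if "z \<in> S" "norm \<zeta> \<le> R"
    for z :: "(complex ^ 'n) \<times> (complex ^ 'n)" and \<zeta> R
    using A(2)[of z \<zeta>] by (rule order_trans) (use assms[OF that(1)] A(1) that(2) in \<open>intro mult_mono; auto\<close>)
  {
    case 0
    have "cmod (wave z \<zeta>) \<le> exp (A * \<bar>B\<bar> * \<bar>R\<bar>)" if "z \<in> S" "norm \<zeta> \<le> R" for z \<zeta> R
      unfolding wave_phase using norm_exp[of "phase z \<zeta>"] ph[OF that] by (meson exp_le_cancel_iff order_trans)
    then show ?case unfolding hered.simps(1) loc_bdd_def by blast
  next
    case (Suc n)
    have "hered (loc_bdd S) n (\<lambda>z \<zeta>. phase z b * wave z \<zeta>)" if "b \<in> Basis" for b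
      by (rule hered_loc_bdd_mult[OF hered_loc_bdd_const Suc]) (use ph[of _ b 1] that in auto)
    then show ?case using hered_imp[OF Suc] by (simp add: pd_wave wave_differentiable)
  }
qed

lemma smooth_wave: "smooth (wave z)"
  using smooth_family[OF hered_wave_bounded[of "{z}" "norm z"], of z] by simp

text \<open>On a strip the modulus of \<open>wave z\<close> is bounded locally uniformly in \<open>\<zeta>\<close>, and every derivative
costs one factor of size \<open>norm z\<close>; the normalisation absorbs as many factors as derivatives are
taken.\<close>
lemma hered_wave_strip:
  "hered (loc_bdd {z :: (complex ^ ('n::finite)) \<times> (complex ^ 'n). norm (im_part z) \<le> M}) n
     (\<lambda>z \<zeta>. of_real (inverse ((1 + norm z) ^ n)) * wave z \<zeta>)"
proof (induction n)
  let ?S = "{z :: (complex ^ 'n) \<times> (complex ^ 'n). norm (im_part z) \<le> M}"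
  have w: "cmod (of_real (inverse ((1 + norm z) ^ n)) * wave z \<zeta>) \<le> exp (2 * pi * (\<bar>M\<bar> * \<bar>R\<bar>))"
    if "z \<in> ?S" "norm \<zeta> \<le> R" for z :: "(complex ^ 'n) \<times> (complex ^ 'n)" and \<zeta> R n
  proof -
    have "im_part z \<bullet> \<zeta> \<le> \<bar>M\<bar> * \<bar>R\<bar>"
      by (rule order_trans[OF norm_cauchy_schwarz]) (use that in \<open>intro mult_mono; auto\<close>)
    then have "cmod (wave z \<zeta>) \<le> exp (2 * pi * (\<bar>M\<bar> * \<bar>R\<bar>))" by (simp add: cmod_wave)
    moreover have "inverse ((1 + norm z) ^ n) \<le> 1" by (simp add: inverse_le_1_iff one_le_power)
    ultimately have "inverse ((1 + norm z) ^ n) * cmod (wave z \<zeta>) \<le> 1 * exp (2 * pi * (\<bar>M\<bar> * \<bar>R\<bar>))"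
      by (intro mult_mono) auto
    then show ?thesis by (simp add: norm_mult norm_inverse norm_power del: of_real_add flip: of_real_power of_real_inverse)
  qed
  have l: "loc_bdd ?S (\<lambda>z \<zeta>. of_real (inverse ((1 + norm z) ^ n)) * wave z \<zeta>)" for n
    unfolding loc_bdd_def using w by blast
  {
    case 0
    show ?case using l[of 0] by simp
  next
    case (Suc n)
    obtain A where A: "A \<ge> 0" "\<And>(z :: (complex ^ 'n) \<times> (complex ^ 'n)) \<zeta>. cmod (phase z \<zeta>) \<le> A * norm z * norm \<zeta>"
      using phase_bound by blast
    have d: "(\<lambda>\<zeta>. of_real (inverse ((1 + norm z) ^ Suc n)) * wave z \<zeta>) differentiable_on UNIV" for z
      by (intro differentiable_on_mult wave_differentiable) auto
    have "hered (loc_bdd ?S) n (\<lambda>z. pd b (\<lambda>\<zeta>. of_real (inverse ((1 + norm z) ^ Suc n)) * wave z \<zeta>))"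
      if b: "b \<in> Basis" for b
    proof -
      have "cmod (of_real (inverse (1 + norm z)) * phase z b) \<le> A" for z
      proof -
        have "inverse (1 + norm z) * cmod (phase z b) \<le> inverse (1 + norm z) * (A * norm z * norm b)"
          using A(2)[of z b] by (intro mult_left_mono) auto
        also have "\<dots> \<le> A" using A(1) b by (simp add: field_simps add_pos_nonneg)
        finally show ?thesis by (simp add: norm_mult norm_inverse del: of_real_add flip: of_real_inverse)
      qed
      then have "hered (loc_bdd ?S) n (\<lambda>z \<zeta>. (of_real (inverse (1 + norm z)) * phase z b) *
          (of_real (inverse ((1 + norm z) ^ n)) * wave z \<zeta>))"
        by (intro hered_loc_bdd_mult[OF hered_loc_bdd_const Suc]) auto
      moreover have "pd b (\<lambda>\<zeta>. of_real (inverse ((1 + norm z) ^ Suc n)) * wave z \<zeta>) =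
        (\<lambda>\<zeta>. (of_real (inverse (1 + norm z)) * phase z b) * (of_real (inverse ((1 + norm z) ^ n)) * wave z \<zeta>))" for z
        by (subst pd_mult) (auto simp: wave_differentiable pd_wave mult_ac)
      ultimately show ?thesis by simp
    qed
    then show ?case using l[of "Suc n"] d unfolding hered.simps(2) by blast
  }
qed

text \<open>The first and second order Taylor remainders of \<open>wave h\<close> at \<open>h = 0\<close>, divided by the matching power
of the norm of \<open>h\<close>, are bounded with all derivatives.  Differentiating the second
remainder produces the first one, which is why the statements are proved together.\<close>
lemma hered_wave_remainder:
  defines "S \<equiv> {h :: (complex ^ ('n::finite)) \<times> (complex ^ 'n). 0 < norm h \<and> norm h \<le> 1}"
  shows "hered (loc_bdd S) n (\<lambda>h \<zeta>. of_real (inverse (norm h)) * phase h \<zeta>)" (is ?A)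
    and "hered (loc_bdd S) n (\<lambda>h \<zeta>. of_real (inverse (norm h)) * (wave h \<zeta> - 1))" (is "?B n")
    and "hered (loc_bdd S) n (\<lambda>h \<zeta>. of_real (inverse (norm h ^ 2)) * (wave h \<zeta> - 1 - phase h \<zeta>))" (is "?C n")
proof -
  obtain A where A: "A \<ge> 0" "\<And>(z :: (complex ^ 'n) \<times> (complex ^ 'n)) \<zeta>. cmod (phase z \<zeta>) \<le> A * norm z * norm \<zeta>"
    using phase_bound by blast
  have p1: "cmod (of_real (inverse (norm h)) * phase h \<zeta>) \<le> A * norm \<zeta>" if "h \<in> S" for h \<zeta>
    using that A(2)[of h \<zeta>] unfolding S_def by (simp add: norm_mult norm_inverse norm_divide field_simps)
  have l1: "loc_bdd S (\<lambda>h \<zeta>. of_real (inverse (norm h)) * phase h \<zeta>)"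
    unfolding loc_bdd_def using p1 A(1) by (meson mult_left_mono order_trans)
  have c1: "hered (loc_bdd S) n (\<lambda>h (\<zeta> :: (real ^ 'n) \<times> (real ^ 'n)). of_real (inverse (norm h)) * phase h b)" if "b \<in> Basis" for b n
    by (rule hered_loc_bdd_const[of _ _ A]) (use p1[of _ b] that in auto)
  show ?A
  proof (rule hered_linear)
    show "bounded_linear (\<lambda>\<zeta>. of_real (inverse (norm h)) * phase h \<zeta>)" for h
      by (intro bounded_linear_const_mult bounded_linear_phase)
    show "loc_bdd S (\<lambda>h (\<zeta> :: (real ^ 'n) \<times> (real ^ 'n)). of_real (inverse (norm h)) * phase h b)" if "b \<in> Basis" for b
      using hered_imp[OF c1[OF that, of 0]] .
  qed (rule l1 loc_bdd_zero)+
  have T1: "cmod (wave h \<zeta> - 1) \<le> exp (A * \<bar>R\<bar>) * (A * \<bar>R\<bar> * norm h)"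
    and T2: "cmod (wave h \<zeta> - 1 - phase h \<zeta>) \<le> exp (A * \<bar>R\<bar>) * (A * \<bar>R\<bar> * norm h)\<^sup>2"
    if "h \<in> S" "norm \<zeta> \<le> R" for h \<zeta> R
  proof -
    have p: "cmod (phase h \<zeta>) \<le> A * \<bar>R\<bar> * norm h"
    proof -
      have "A * norm h * norm \<zeta> \<le> A * norm h * \<bar>R\<bar>" using that A(1) by (intro mult_left_mono) auto
      then show ?thesis using A(2)[of h \<zeta>] by (simp add: mult_ac)
    qed
    also have "\<dots> \<le> A * \<bar>R\<bar> * 1" using that A(1) unfolding S_def by (intro mult_left_mono) auto
    finally have r: "\<bar>Re (phase h \<zeta>)\<bar> \<le> A * \<bar>R\<bar>" using abs_Re_le_cmod order_trans by (metis mult.right_neutral)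
    have "cmod (wave h \<zeta> - 1) \<le> exp \<bar>Re (phase h \<zeta>)\<bar> * cmod (phase h \<zeta>)"
      using Taylor_exp[of "phase h \<zeta>" 0] by (simp add: wave_phase)
    also have "\<dots> \<le> exp (A * \<bar>R\<bar>) * (A * \<bar>R\<bar> * norm h)" using p r by (intro mult_mono) auto
    finally show "cmod (wave h \<zeta> - 1) \<le> exp (A * \<bar>R\<bar>) * (A * \<bar>R\<bar> * norm h)" .
    have "cmod (wave h \<zeta> - 1 - phase h \<zeta>) \<le> exp \<bar>Re (phase h \<zeta>)\<bar> * cmod (phase h \<zeta>) ^ 2"
      using Taylor_exp[of "phase h \<zeta>" 1] by (simp add: wave_phase numeral_2_eq_2 diff_diff_eq)
    also have "\<dots> \<le> exp (A * \<bar>R\<bar>) * (A * \<bar>R\<bar> * norm h)\<^sup>2" using p r by (intro mult_mono power_mono) auto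
    finally show "cmod (wave h \<zeta> - 1 - phase h \<zeta>) \<le> exp (A * \<bar>R\<bar>) * (A * \<bar>R\<bar> * norm h)\<^sup>2" .
  qed
  have lB: "loc_bdd S (\<lambda>h \<zeta>. of_real (inverse (norm h)) * (wave h \<zeta> - 1))"
  proof -
    have "cmod (of_real (inverse (norm h)) * (wave h \<zeta> - 1)) \<le> exp (A * \<bar>R\<bar>) * (A * \<bar>R\<bar>)"
      if "h \<in> S" "norm \<zeta> \<le> R" for h \<zeta> R
      using T1[OF that] that unfolding S_def by (simp add: norm_mult norm_inverse norm_divide field_simps)
    then show ?thesis unfolding loc_bdd_def by blast
  qed
  have lC: "loc_bdd S (\<lambda>h \<zeta>. of_real (inverse (norm h ^ 2)) * (wave h \<zeta> - 1 - phase h \<zeta>))"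
  proof -
    have "cmod (of_real (inverse (norm h ^ 2)) * (wave h \<zeta> - 1 - phase h \<zeta>)) \<le> exp (A * \<bar>R\<bar>) * (A * \<bar>R\<bar>)\<^sup>2"
      if "h \<in> S" "norm \<zeta> \<le> R" for h \<zeta> R
      using T2[OF that] that unfolding S_def
      by (simp add: norm_mult norm_inverse norm_divide norm_power power_mult_distrib field_simps)
    then show ?thesis unfolding loc_bdd_def by blast
  qed
  have w: "hered (loc_bdd S) n (wave :: (complex ^ 'n) \<times> (complex ^ 'n) \<Rightarrow> _)" for n
    by (rule hered_wave_bounded[of _ 1]) (auto simp: S_def)
  have dw: "(wave h has_derivative (\<lambda>b. phase h b * wave h x)) (at x)" for h :: "(complex ^ 'n) \<times> (complex ^ 'n)" and x
    unfolding wave_phase[abs_def] by (rule pd_exp_linear(1)[OF bounded_linear_phase])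
  have dB: "((\<lambda>\<zeta>. of_real (inverse (norm h)) * (wave h \<zeta> - 1)) has_derivative
     (\<lambda>b. (of_real (inverse (norm h)) * phase h b) * wave h x)) (at x)"
    for h :: "(complex ^ 'n) \<times> (complex ^ 'n)" and x
    by (rule derivative_eq_intros dw refl)+ (simp add: mult_ac)
  have dC: "((\<lambda>\<zeta>. of_real (inverse (norm h ^ 2)) * (wave h \<zeta> - 1 - phase h \<zeta>)) has_derivative
     (\<lambda>b. (of_real (inverse (norm h)) * phase h b) * (of_real (inverse (norm h)) * (wave h x - 1)))) (at x)"
    for h :: "(complex ^ 'n) \<times> (complex ^ 'n)" and x
    by (rule derivative_eq_intros dw refl bounded_linear_imp_has_derivative[OF bounded_linear_phase])+
      (simp add: algebra_simps power2_eq_square)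
  show B: "?B n" for n
  proof (cases n)
    case (Suc m)
    have "hered (loc_bdd S) m (\<lambda>h \<zeta>. (of_real (inverse (norm h)) * phase h b) * wave h \<zeta>)" if "b \<in> Basis" for b
      by (rule hered_loc_bdd_mult[OF c1[OF that] w])
    moreover have "(\<lambda>\<zeta>. of_real (inverse (norm h)) * (wave h \<zeta> - 1)) differentiable_on UNIV"
      for h :: "(complex ^ 'n) \<times> (complex ^ 'n)"
      unfolding differentiable_on_def differentiable_def using dB has_derivative_at_withinI by blast
    ultimately show ?thesis using lB unfolding Suc hered.simps(2) pd_eq[OF dB, abs_def] by blast
  qed (use lB in simp)
  show "?C n"
  proof (cases n)
    case (Suc m)
    have "hered (loc_bdd S) m (\<lambda>h \<zeta>. (of_real (inverse (norm h)) * phase h b) *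
        (of_real (inverse (norm h)) * (wave h \<zeta> - 1)))" if "b \<in> Basis" for b
      by (rule hered_loc_bdd_mult[OF c1[OF that] B])
    moreover have "(\<lambda>\<zeta>. of_real (inverse (norm h ^ 2)) * (wave h \<zeta> - 1 - phase h \<zeta>)) differentiable_on UNIV"
      for h :: "(complex ^ 'n) \<times> (complex ^ 'n)"
      unfolding differentiable_on_def differentiable_def using dC has_derivative_at_withinI by blast
    ultimately show ?thesis using lC unfolding Suc hered.simps(2) pd_eq[OF dC, abs_def] by blast
  qed (use lC in simp)
qed

text \<open>As \<open>s\<close> tends to zero, the Gaussian tends to one at the rate \<open>s\<close>, locally uniformly with all
derivatives.\<close>
lemma hered_gaussian_remainder:
  defines "S \<equiv> {s::real. 0 < s \<and> s \<le> 1}"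
  shows "hered (loc_bdd S) n (\<lambda>s (\<zeta>::'a::euclidean_space). of_real (inverse s) * (exp (of_real (- (pi * s) * (\<zeta> \<bullet> \<zeta>))) - 1))"
    (is "hered _ _ ?F")
proof (cases n)
  have l: "loc_bdd S ?F"
    unfolding loc_bdd_def
  proof
    fix R :: real
    have "cmod (?F s \<zeta>) \<le> pi * R\<^sup>2" if "s \<in> S" "norm \<zeta> \<le> R" for s \<zeta>
    proof -
      define t where "t = pi * s * (\<zeta> \<bullet> \<zeta>)"
      have t: "0 \<le> t" "t \<le> pi * s * R\<^sup>2"
        using that unfolding t_def S_def power2_norm_eq_inner[symmetric] by (auto intro!: mult_left_mono power_mono)
      have "cmod (exp (of_real (- t)) - 1) = \<bar>exp (- t) - 1\<bar>"
        by (metis exp_of_real norm_of_real of_real_1 of_real_diff)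
      also have "\<dots> \<le> t" using t(1) exp_ge_add_one_self[of "- t"] by (simp add: abs_if)
      finally have "cmod (exp (of_real (- t)) - 1) \<le> pi * s * R\<^sup>2" using t(2) by linarith
      then have "cmod (?F s \<zeta>) \<le> inverse s * (pi * s * R\<^sup>2)"
        using that unfolding S_def t_def by (simp only: norm_mult norm_of_real) (auto intro!: mult_left_mono)
      also have "inverse s * (pi * s * R\<^sup>2) = pi * R\<^sup>2" using that unfolding S_def by simp
      finally show ?thesis .
    qed
    then show "\<exists>C. \<forall>s\<in>S. \<forall>\<zeta>. norm \<zeta> \<le> R \<longrightarrow> cmod (?F s \<zeta>) \<le> C" by blast
  qed
  {
    case 0 then show ?thesis using l by simp
  next
    case (Suc m)
    have q: "hered (loc_bdd S) m (\<lambda>s (\<zeta>::'a). of_real (- (pi * s) * (\<zeta> \<bullet> \<zeta>)))" for m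
    proof -
      have 1: "smooth (\<lambda>\<zeta>::'a. complex_of_real (1 * (\<zeta> \<bullet> \<zeta>)))"
        using smooth_family[OF hmoderate_square_norm[of "\<lambda>_ \<zeta>. norm \<zeta>" UNIV 1 1, THEN spec]] by fastforce
      have "hered (loc_bdd S) m (\<lambda>s (\<zeta>::'a). of_real (- (pi * s)) * of_real (1 * (\<zeta> \<bullet> \<zeta>)))"
        by (rule hered_loc_bdd_mult[OF hered_loc_bdd_const[of _ _ pi] hered_loc_bdd_smooth[OF 1]])
          (auto simp: S_def norm_mult mult_left_le)
      then show ?thesis by (simp only: of_real_mult[symmetric] mult_1)
    qed
    have e: "hered (loc_bdd S) m (\<lambda>s (\<zeta>::'a). exp (of_real (- (pi * s) * (\<zeta> \<bullet> \<zeta>))))" for m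
    proof (rule hered_exp[where P="loc_bdd S" and ?P1.0="loc_bdd S"])
      have "cmod (exp (of_real (- (pi * s) * (\<zeta> \<bullet> \<zeta>)))) \<le> 1" if "s \<in> S" for s and \<zeta> :: 'a
        using that by (simp add: S_def norm_exp_eq_Re)
      then show "loc_bdd S (\<lambda>s (\<zeta>::'a). exp (of_real (- (pi * s) * (\<zeta> \<bullet> \<zeta>))))" unfolding loc_bdd_def by blast
      show "hered (loc_bdd S) m (\<lambda>s (\<zeta>::'a). of_real (- (pi * s) * (\<zeta> \<bullet> \<zeta>)))" by (rule q)
    qed (auto intro: loc_bdd_add loc_bdd_mult)
    have d: "(?F s has_derivative (\<lambda>h. of_real (inverse s) * (of_real (- (pi * s) * (2 * (\<zeta> \<bullet> h))) *
        exp (of_real (- (pi * s) * (\<zeta> \<bullet> \<zeta>)))))) (at \<zeta>)" for s and \<zeta> :: 'a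
    proof -
      have "((\<lambda>\<zeta>. complex_of_real (- (pi * s) * (\<zeta> \<bullet> \<zeta>))) has_derivative (\<lambda>h. of_real (- (pi * s) * (2 * (\<zeta> \<bullet> h))))) (at \<zeta>)"
        by (auto intro!: derivative_eq_intros simp: inner_commute)
      from has_derivative_compose[OF this DERIV_exp[THEN has_field_derivative_imp_has_derivative]]
      show ?thesis by (auto intro!: derivative_eq_intros simp: mult_ac)
    qed
    have "hered (loc_bdd S) m (\<lambda>s. pd b (?F s))" if "b \<in> Basis" for b
    proof -
      have li: "bounded_linear (\<lambda>\<zeta>::'a. complex_of_real (2 * (\<zeta> \<bullet> b)))"
        by (intro bounded_linear_compose[OF bounded_linear_of_real] bounded_linear_const_mult bounded_linear_inner_left)
      have "smooth (\<lambda>\<zeta>::'a. complex_of_real (2 * (\<zeta> \<bullet> b)))"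
        unfolding smooth_iff by (intro allI hered_linear li) auto
      have k: "hered (loc_bdd S) m (\<lambda>s (\<zeta>::'a). of_real (inverse s * (- (pi * s))))"
      proof (rule hered_loc_bdd_const[of _ _ pi])
        fix s assume "s \<in> S"
        then have "inverse s * (- (pi * s)) = - pi" by (simp add: S_def)
        then show "cmod (of_real (inverse s * (- (pi * s)))) \<le> pi" by (simp only: norm_of_real) simp
      qed
      have "hered (loc_bdd S) m (\<lambda>s (\<zeta>::'a). of_real (inverse s * (- (pi * s))) * of_real (2 * (\<zeta> \<bullet> b)) *
          exp (of_real (- (pi * s) * (\<zeta> \<bullet> \<zeta>))))"
        by (rule hered_loc_bdd_mult[OF hered_loc_bdd_mult[OF k hered_loc_bdd_smooth[OF \<open>smooth (\<lambda>\<zeta>::'a. complex_of_real (2 * (\<zeta> \<bullet> b)))\<close>]] e])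
      then show ?thesis unfolding pd_eq[OF d, abs_def] by (simp add: mult.assoc)
    qed
    then show ?thesis using l d unfolding Suc hered.simps(2)
      by (auto simp: differentiable_on_def differentiable_def intro: has_derivative_at_withinI)
  }
qed

section \<open>The entire symbol of a compactly supported distribution\<close>

lemma schwartz_scale: "schwartz \<phi> \<Longrightarrow> schwartz (\<lambda>x. c * \<phi> x)"
  using hrapid_cmult[of "\<lambda>_ x. norm x" UNIV "\<lambda>_::unit. \<phi>" c] by (simp add: schwartz_iff)

lemma schwartz_add: "schwartz \<phi> \<Longrightarrow> schwartz \<psi> \<Longrightarrow> schwartz (\<lambda>x. \<phi> x + \<psi> x)"
  using hrapid_add[of "\<lambda>_ x. norm x" UNIV "\<lambda>_::unit. \<phi>" "\<lambda>_::unit. \<psi>"] by (simp add: schwartz_iff)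

lemma schwartz_diff: "schwartz \<phi> \<Longrightarrow> schwartz \<psi> \<Longrightarrow> schwartz (\<lambda>x. \<phi> x - \<psi> x)"
  using schwartz_add[of \<phi> "\<lambda>x. -1 * \<psi> x"] schwartz_scale[of \<psi> "-1"] by simp

lemma smooth_const: "smooth (\<lambda>_::'a::euclidean_space. k)"
  unfolding smooth_iff by (intro allI hered_const) auto

lemma smooth_add: "smooth f \<Longrightarrow> smooth g \<Longrightarrow> smooth (\<lambda>x. f x + g x)"
  unfolding smooth_iff by (intro allI hered_add[where P="\<lambda>_. True"]) auto

lemma smooth_diff: "smooth f \<Longrightarrow> smooth g \<Longrightarrow> smooth (\<lambda>x. f x - g x)"
  using smooth_add[of f "\<lambda>x. -1 * g x"] smooth_mult[OF smooth_const, of g "-1"] by simp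

lemma phase_scaleR: "phase (r *\<^sub>R h) \<zeta> = of_real r * phase h \<zeta>"
proof -
  interpret bounded_linear "\<lambda>z. phase z \<zeta>" by (rule bounded_linear_phase_left)
  show ?thesis by (simp only: scaleR scaleR_conv_of_real[where 'a=complex])
qed

lemma phase_add: "phase (h + k) \<zeta> = phase h \<zeta> + phase k \<zeta>"
proof -
  interpret bounded_linear "\<lambda>z. phase z \<zeta>" by (rule bounded_linear_phase_left)
  show ?thesis by (simp only: add)
qed

lemma bump_wave: "bump c \<Longrightarrow> bump (\<lambda>\<zeta>. c \<zeta> * wave z \<zeta>)"
  by (rule bump_mult[OF _ smooth_wave])

lemma smooth_phase: "smooth (phase z)"
  unfolding smooth_iff by (intro allI hered_linear bounded_linear_phase) auto

text \<open>A tempered distribution with the constant and the order of one of its continuity estimates.\<close>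
context
  fixes v :: "((real ^ ('n::finite)) \<times> (real ^ 'n) \<Rightarrow> complex) \<Rightarrow> complex" and C0 :: real and N0 :: nat
  assumes v_add: "\<And>\<phi> \<psi>. schwartz \<phi> \<Longrightarrow> schwartz \<psi> \<Longrightarrow> v (\<lambda>x. \<phi> x + \<psi> x) = v \<phi> + v \<psi>"
    and v_scale: "\<And>c \<phi>. schwartz \<phi> \<Longrightarrow> v (\<lambda>x. c * \<phi> x) = c * v \<phi>"
    and v_bound: "\<And>\<phi>. schwartz \<phi> \<Longrightarrow> cmod (v \<phi>) \<le> C0 * schwartz_seminorm N0 \<phi>"
begin

lemma v_diff: "schwartz \<phi> \<Longrightarrow> schwartz \<psi> \<Longrightarrow> v (\<lambda>x. \<phi> x - \<psi> x) = v \<phi> - v \<psi>"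
  using v_add[of \<phi> "\<lambda>x. -1 * \<psi> x"] v_scale[of \<psi> "-1"] schwartz_scale[of \<psi> "-1"] by simp

text \<open>The form in which continuity of \<open>v\<close> is used: local bounds on the derivatives of a family, cut off by a
compactly supported factor, bound the pairings uniformly.\<close>
lemma dist_bound:
  assumes c: "bump c" and G: "hered (loc_bdd S) N0 G" and s: "\<And>p. p \<in> S \<Longrightarrow> smooth (G p)"
  shows "\<exists>C\<ge>0. \<forall>p\<in>S. cmod (v (\<lambda>\<zeta>. c \<zeta> * G p \<zeta>)) \<le> C"
proof -
  obtain C where C: "\<And>p. p \<in> S \<Longrightarrow> 0 \<le> schwartz_seminorm N0 (\<lambda>\<zeta>. c \<zeta> * G p \<zeta>)"
    "\<And>p. p \<in> S \<Longrightarrow> schwartz_seminorm N0 (\<lambda>\<zeta>. c \<zeta> * G p \<zeta>) \<le> C"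
    using seminorm_csupp[OF hered_csupp_mult[OF c G]] by blast
  have "cmod (v (\<lambda>\<zeta>. c \<zeta> * G p \<zeta>)) \<le> \<bar>C0\<bar> * \<bar>C\<bar>" if p: "p \<in> S" for p
  proof -
    have "cmod (v (\<lambda>\<zeta>. c \<zeta> * G p \<zeta>)) \<le> C0 * schwartz_seminorm N0 (\<lambda>\<zeta>. c \<zeta> * G p \<zeta>)"
      by (rule v_bound, rule bump_imp_schwartz, rule bump_mult[OF c s[OF p]])
    also have "\<dots> \<le> \<bar>C0\<bar> * \<bar>C\<bar>" using C[OF p] by (intro mult_mono) auto
    finally show ?thesis .
  qed
  then show ?thesis by (intro exI[of _ "\<bar>C0\<bar> * \<bar>C\<bar>"]) auto
qed

lemma pairing_strip_bound:
  assumes c: "bump c"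
  shows "\<exists>C\<ge>0. \<forall>z. norm (im_part z) \<le> M \<longrightarrow> cmod (v (\<lambda>\<zeta>. c \<zeta> * wave z \<zeta>)) \<le> C * (1 + norm z) ^ N0"
proof -
  have s: "smooth (\<lambda>\<zeta>. of_real (inverse ((1 + norm z) ^ N0)) * wave z \<zeta>)" for z :: "(complex ^ 'n) \<times> (complex ^ 'n)"
    by (rule smooth_mult[OF smooth_const smooth_wave])
  obtain C where C: "C \<ge> 0" "\<And>z. norm (im_part z) \<le> M \<Longrightarrow>
      cmod (v (\<lambda>\<zeta>. c \<zeta> * (of_real (inverse ((1 + norm z) ^ N0)) * wave z \<zeta>))) \<le> C"
    using dist_bound[OF c hered_wave_strip s, of M] by auto
  have "cmod (v (\<lambda>\<zeta>. c \<zeta> * wave z \<zeta>)) \<le> C * (1 + norm z) ^ N0" if "norm (im_part z) \<le> M" for z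
  proof -
    have "v (\<lambda>\<zeta>. c \<zeta> * (of_real (inverse ((1 + norm z) ^ N0)) * wave z \<zeta>)) =
        of_real (inverse ((1 + norm z) ^ N0)) * v (\<lambda>\<zeta>. c \<zeta> * wave z \<zeta>)"
      using v_scale[OF bump_imp_schwartz[OF bump_wave[OF c, of z]], of "of_real (inverse ((1 + norm z) ^ N0))"]
      by (simp add: mult_ac)
    then have "cmod (of_real (inverse ((1 + norm z) ^ N0)) * v (\<lambda>\<zeta>. c \<zeta> * wave z \<zeta>)) \<le> C"
      using C(2)[OF that] by simp
    then have "inverse ((1 + norm z) ^ N0) * cmod (v (\<lambda>\<zeta>. c \<zeta> * wave z \<zeta>)) \<le> C"
      unfolding norm_mult norm_of_real by simp
    moreover have "0 < (1 + norm z) ^ N0" by (simp add: add_pos_nonneg)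
    ultimately show ?thesis by (simp add: field_simps)
  qed
  then show ?thesis using C(1) by blast
qed

text \<open>The pairing commutes with differentiation in \<open>z\<close>, because the second order Taylor remainder of the
exponential is bounded, after division by the square of the increment, in the topology in which
\<open>v\<close> is continuous.\<close>
lemma pairing_has_derivative:
  assumes c: "bump c"
  shows "((\<lambda>z. v (\<lambda>\<zeta>. c \<zeta> * wave z \<zeta>)) has_derivative (\<lambda>h. v (\<lambda>\<zeta>. c \<zeta> * wave z \<zeta> * phase h \<zeta>))) (at z)"
proof -
  let ?S = "{h :: (complex ^ 'n) \<times> (complex ^ 'n). 0 < norm h \<and> norm h \<le> 1}"
  define e where "e = (\<lambda>\<zeta>. c \<zeta> * wave z \<zeta>)"
  have e: "bump e" unfolding e_def by (rule bump_wave[OF c])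
  have se: "schwartz (\<lambda>\<zeta>. e \<zeta> * g \<zeta>)" if "smooth g" for g
    by (rule bump_imp_schwartz[OF bump_mult[OF e that]])
  have s1: "smooth (\<lambda>\<zeta>. k * g \<zeta>)" if "smooth g" for k and g :: "(real ^ 'n) \<times> (real ^ 'n) \<Rightarrow> complex"
    by (rule smooth_mult[OF smooth_const that])
  define D where "D = (\<lambda>h. v (\<lambda>\<zeta>. e \<zeta> * phase h \<zeta>))"
  obtain A where A: "A \<ge> 0" "\<And>h. h \<in> ?S \<Longrightarrow> cmod (v (\<lambda>\<zeta>. e \<zeta> * (of_real (inverse (norm h)) * phase h \<zeta>))) \<le> A"
    using dist_bound[OF e hered_wave_remainder(1) s1[OF smooth_phase]] by blast
  have Dscale: "D (r *\<^sub>R h) = r *\<^sub>R D h" for r h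
  proof -
    have "(\<lambda>\<zeta>. e \<zeta> * phase (r *\<^sub>R h) \<zeta>) = (\<lambda>\<zeta>. of_real r * (e \<zeta> * phase h \<zeta>))"
      unfolding phase_scaleR by (simp only: mult_ac)
    then show ?thesis unfolding D_def using v_scale[OF se[OF smooth_phase]] by (simp add: scaleR_conv_of_real)
  qed
  have D: "bounded_linear D"
  proof (rule bounded_linear_intro[of _ A])
    show "D (x + y) = D x + D y" for x y
    proof -
      have "(\<lambda>\<zeta>. e \<zeta> * phase (x + y) \<zeta>) = (\<lambda>\<zeta>. e \<zeta> * phase x \<zeta> + e \<zeta> * phase y \<zeta>)"
        unfolding phase_add by (simp only: distrib_left)
      then show ?thesis unfolding D_def using v_add[OF se[OF smooth_phase] se[OF smooth_phase]] by simp
    qed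
    show "norm (D x) \<le> norm x * A" for x
    proof (cases "x = 0")
      case True
      then show ?thesis using Dscale[of 0 0] by simp
    next
      case False
      define h where "h = inverse (norm x) *\<^sub>R x"
      have h: "h \<in> ?S" "norm h = 1" "x = norm x *\<^sub>R h" using False by (auto simp: h_def)
      have "cmod (D h) \<le> A" using A(2)[OF h(1)] h(2) by (simp add: D_def)
      then show ?thesis using Dscale[of "norm x" h] h(3) by (metis abs_norm_cancel mult_left_mono norm_ge_zero norm_scaleR)
    qed
  qed (rule Dscale)
  obtain B where B: "B \<ge> 0" "\<And>h. h \<in> ?S \<Longrightarrow>
      cmod (v (\<lambda>\<zeta>. e \<zeta> * (of_real (inverse (norm h ^ 2)) * (wave h \<zeta> - 1 - phase h \<zeta>)))) \<le> B"
  proof -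
    have sm: "smooth (\<lambda>\<zeta>. wave h \<zeta> - 1 - phase h \<zeta>)" for h :: "(complex ^ 'n) \<times> (complex ^ 'n)"
      by (intro smooth_diff smooth_wave smooth_const smooth_phase)
    show ?thesis using dist_bound[OF e hered_wave_remainder(3) s1[OF sm]] that by blast
  qed
  have rem: "cmod (v (\<lambda>\<zeta>. c \<zeta> * wave (z + h) \<zeta>) - v (\<lambda>\<zeta>. c \<zeta> * wave z \<zeta>) - D h) \<le> B * (norm h)\<^sup>2"
    if h: "h \<in> ?S" for h
  proof -
    have 1: "schwartz (\<lambda>\<zeta>. e \<zeta> * wave h \<zeta>)" "schwartz e" "schwartz (\<lambda>\<zeta>. e \<zeta> * phase h \<zeta>)"
      using se[OF smooth_wave] se[OF smooth_phase] bump_imp_schwartz[OF e] by blast+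
    have "v (\<lambda>\<zeta>. e \<zeta> * wave h \<zeta>) - v e - D h = v (\<lambda>\<zeta>. e \<zeta> * wave h \<zeta> - e \<zeta> - e \<zeta> * phase h \<zeta>)"
      unfolding D_def using v_diff[OF 1(1,2)] v_diff[OF schwartz_diff[OF 1(1,2)] 1(3)] by simp
    also have "(\<lambda>\<zeta>. e \<zeta> * wave h \<zeta> - e \<zeta> - e \<zeta> * phase h \<zeta>) = (\<lambda>\<zeta>. of_real ((norm h)\<^sup>2) *
        (e \<zeta> * (of_real (inverse (norm h ^ 2)) * (wave h \<zeta> - 1 - phase h \<zeta>))))"
      using h by (auto simp: field_simps)
    also have "v \<dots> = of_real ((norm h)\<^sup>2) * v (\<lambda>\<zeta>. e \<zeta> * (of_real (inverse (norm h ^ 2)) * (wave h \<zeta> - 1 - phase h \<zeta>)))"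
    proof (rule v_scale)
      have "schwartz (\<lambda>\<zeta>. of_real (inverse (norm h ^ 2)) * (e \<zeta> * wave h \<zeta> - e \<zeta> - e \<zeta> * phase h \<zeta>))"
        by (intro schwartz_scale schwartz_diff 1)
      then show "schwartz (\<lambda>\<zeta>. e \<zeta> * (of_real (inverse (norm h ^ 2)) * (wave h \<zeta> - 1 - phase h \<zeta>)))"
        by (simp add: algebra_simps)
    qed
    finally have "cmod (v (\<lambda>\<zeta>. e \<zeta> * wave h \<zeta>) - v e - D h) \<le> (norm h)\<^sup>2 * B"
      using B(2)[OF h] by (simp only: norm_mult norm_of_real) (simp add: mult_left_mono)
    then show ?thesis by (simp add: e_def wave_add mult_ac)
  qed
  have "((\<lambda>h. norm (v (\<lambda>\<zeta>. c \<zeta> * wave (z + h) \<zeta>) - v (\<lambda>\<zeta>. c \<zeta> * wave z \<zeta>) - D h) / norm h) \<longlongrightarrow> 0) (at 0)"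
  proof (rule Lim_null_comparison)
    show "\<forall>\<^sub>F h in at 0. norm (norm (v (\<lambda>\<zeta>. c \<zeta> * wave (z + h) \<zeta>) - v (\<lambda>\<zeta>. c \<zeta> * wave z \<zeta>) - D h) / norm h) \<le> B * norm h"
      unfolding eventually_at
    proof (intro exI[of _ 1] conjI ballI impI)
      fix h :: "(complex ^ 'n) \<times> (complex ^ 'n)" assume "h \<noteq> 0 \<and> dist h 0 < 1"
      then have "h \<in> ?S" "norm h > 0" by auto
      then show "norm (norm (v (\<lambda>\<zeta>. c \<zeta> * wave (z + h) \<zeta>) - v (\<lambda>\<zeta>. c \<zeta> * wave z \<zeta>) - D h) / norm h) \<le> B * norm h"
        using rem[of h] by (simp add: divide_le_eq power2_eq_square mult.assoc)
    qed simp
    show "((\<lambda>h. B * norm h) \<longlongrightarrow> 0) (at 0)" by (rule tendsto_eq_intros refl)+ simp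
  qed
  then show ?thesis using D unfolding has_derivative_at D_def e_def by blast
qed

text \<open>The derivative of the pairing is complex linear in the direction, since \<open>phase\<close> is.\<close>
lemma pairing_holomorphic_line:
  assumes c: "bump c"
  shows "(\<lambda>t. v (\<lambda>\<zeta>. c \<zeta> * wave (z + cscale t h) \<zeta>)) holomorphic_on UNIV"
proof -
  have "((\<lambda>t. v (\<lambda>\<zeta>. c \<zeta> * wave (z + cscale t h) \<zeta>)) has_field_derivative
     v (\<lambda>\<zeta>. c \<zeta> * wave (z + cscale t h) \<zeta> * phase h \<zeta>)) (at t)" for t
  proof -
    have l: "bounded_linear (\<lambda>t. cscale t h)"
      unfolding linear_conv_bounded_linear[symmetric]
      by (rule linearI) (auto simp: cscale_def vec_eq_iff algebra_simps scaleR_conv_of_real[where 'a=complex])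
    have "((\<lambda>t. z + cscale t h) has_derivative (\<lambda>t. cscale t h)) (at t)"
      using bounded_linear_imp_has_derivative[OF l] by (auto intro!: derivative_eq_intros)
    from has_derivative_compose[OF this pairing_has_derivative[OF c]]
    have "((\<lambda>t. v (\<lambda>\<zeta>. c \<zeta> * wave (z + cscale t h) \<zeta>)) has_derivative
       (\<lambda>s. v (\<lambda>\<zeta>. c \<zeta> * wave (z + cscale t h) \<zeta> * phase (cscale s h) \<zeta>))) (at t)" .
    moreover have "v (\<lambda>\<zeta>. c \<zeta> * wave (z + cscale t h) \<zeta> * phase (cscale s h) \<zeta>) =
        v (\<lambda>\<zeta>. c \<zeta> * wave (z + cscale t h) \<zeta> * phase h \<zeta>) * s" for s
      using v_scale[OF bump_imp_schwartz[OF bump_mult[OF bump_wave[OF c] smooth_phase[of h]]], of s "z + cscale t h"]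
      by (simp add: phase_def cdot_cscale mult_ac)
    ultimately show ?thesis unfolding has_field_derivative_def by (simp add: fun_eq_iff[symmetric])
  qed
  then show ?thesis
    by (auto simp: holomorphic_on_def field_differentiable_def intro: has_field_derivative_at_within)
qed

text \<open>Differentiating in \<open>x\<close> multiplies the cutoff by a linear factor, so the derivatives have again the form
to which \<open>pairing_strip_bound\<close> applies, with the same exponent.\<close>
lemma pairing_real_moderate:
  assumes "bump c"
  shows "hered (\<lambda>F. \<exists>C\<ge>0. \<forall>x. cmod (F () x) \<le> C * (1 + norm x) ^ N0) n
     (\<lambda>_::unit. \<lambda>x. v (\<lambda>\<zeta>. c \<zeta> * wave (cvec2 x) \<zeta>))"
  using assms
proof (induction n arbitrary: c)
  case (0 c)
  obtain C where C: "C \<ge> 0" "\<And>z. norm (im_part z) \<le> 0 \<Longrightarrow> cmod (v (\<lambda>\<zeta>. c \<zeta> * wave z \<zeta>)) \<le> C * (1 + norm z) ^ N0"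
    using pairing_strip_bound[OF 0, of 0] by blast
  have "cmod (v (\<lambda>\<zeta>. c \<zeta> * wave (cvec2 x) \<zeta>)) \<le> C * (1 + norm x) ^ N0" for x
    using C(2)[of "cvec2 x"] by (simp add: norm_cvec2)
  then show ?case using C(1) unfolding hered.simps(1) by blast
next
  case (Suc n c)
  have l: "bounded_linear (cvec2 :: _ \<Rightarrow> (complex ^ 'n) \<times> (complex ^ 'n))"
    unfolding linear_conv_bounded_linear[symmetric]
    by (rule linearI) (auto simp: cvec2_def cvec_def vec_eq_iff scaleR_conv_of_real[where 'a=complex])
  have D: "((\<lambda>x. v (\<lambda>\<zeta>. c \<zeta> * wave (cvec2 x) \<zeta>)) has_derivative
      (\<lambda>b. v (\<lambda>\<zeta>. c \<zeta> * wave (cvec2 x) \<zeta> * phase (cvec2 b) \<zeta>))) (at x)" for x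
    by (rule has_derivative_compose[OF bounded_linear_imp_has_derivative[OF l] pairing_has_derivative[OF Suc.prems]])
  have "pd b (\<lambda>x. v (\<lambda>\<zeta>. c \<zeta> * wave (cvec2 x) \<zeta>)) = (\<lambda>x. v (\<lambda>\<zeta>. (c \<zeta> * phase (cvec2 b) \<zeta>) * wave (cvec2 x) \<zeta>))" for b
    by (rule ext) (simp add: pd_eq[OF D] mult_ac)
  moreover have "(\<lambda>x. v (\<lambda>\<zeta>. c \<zeta> * wave (cvec2 x) \<zeta>)) differentiable_on UNIV"
    using D has_derivative_at_withinI unfolding differentiable_on_def differentiable_def by blast
  moreover have "\<exists>C\<ge>0. \<forall>x. cmod (v (\<lambda>\<zeta>. c \<zeta> * wave (cvec2 x) \<zeta>)) \<le> C * (1 + norm x) ^ N0"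
    by (rule hered_imp[OF Suc.IH[OF Suc.prems]])
  ultimately show ?case using Suc.IH[OF bump_mult[OF Suc.prems smooth_phase]]
    unfolding hered.simps(2) by (simp only: simp_thms ball_triv)
qed

text \<open>Test the identity between the regular distribution of \<open>L\<close> and the Fourier transform of \<open>v\<close> on
normalised Gaussians that concentrate at \<open>x0\<close>.  On one side they are an approximate identity, on the other
side their Fourier transforms are \<open>wave (cvec2 x0)\<close> times Gaussians that spread out.
The cutoff may be inserted because \<open>v\<close> vanishes on functions supported away from \<open>K\<close>.\<close>
lemma pairing_eq_symbol:
  assumes \<kappa>: "smooth \<kappa>" "\<And>\<zeta>. norm \<zeta> \<le> r \<Longrightarrow> \<kappa> \<zeta> = 1" "\<And>\<zeta>. r + 1 \<le> norm \<zeta> \<Longrightarrow> \<kappa> \<zeta> = 0"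
    and K: "K \<subseteq> ball 0 r" and supp: "supported_in v K"
    and L: "is_fourier_transform_of L v"
  shows "L x0 = v (\<lambda>\<zeta>. \<kappa> \<zeta> * wave (cvec2 x0) \<zeta>)"
proof -
  let ?d = "DIM((real ^ 'n) \<times> (real ^ 'n))"
  have bc: "bump \<kappa>" using \<kappa> unfolding bump_def by (metis less_imp_le)
  have Lc: "continuous_on UNIV L" using L by (simp add: is_fourier_transform_of_def)
  define g where "g = (\<lambda>s x. complex_of_real (sqrt s ^ ?d * exp (- (pi * s * ((x - x0) \<bullet> (x - x0))))))"
  have sg: "schwartz (g s)" if s: "s > 0" for s
  proof -
    have gs: "hrapid UNIV (\<lambda>_ x. norm x) (\<lambda>(_::unit) x::(real ^ 'n) \<times> (real ^ 'n). exp (of_real (- (pi * s) * (x \<bullet> x))))"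
      by (rule hrapid_gaussian) (use s in simp)
    have "hrapid UNIV (\<lambda>(p::unit) x. norm (x + (- x0)))
       (\<lambda>(p::unit) x. exp (complex_of_real (- (pi * s) * ((x + (- x0)) \<bullet> (x + (- x0))))))"
      by (rule hrapid_comp_affine[OF linear_ident gs, where \<theta>="\<lambda>p. p" and s="\<lambda>_. - x0"]) auto
    then have "hrapid UNIV (\<lambda>_ x. norm x) (\<lambda>(p::unit) x. exp (complex_of_real (- (pi * s) * ((x + (- x0)) \<bullet> (x + (- x0))))))"
    proof (rule hrapid_weaken)
      show "norm x \<le> (1 + norm x0) * (1 + norm (x + - x0))" for x
      proof -
        have "norm x \<le> norm (x + - x0) + norm x0" using norm_triangle_ineq[of "x + - x0" x0] by simp
        moreover have "0 \<le> norm x0 * norm (x + - x0)" by simp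
        moreover have "(1 + norm x0) * (1 + norm (x + - x0)) = 1 + norm x0 + norm (x + - x0) + norm x0 * norm (x + - x0)"
          by (simp only: distrib_left distrib_right mult_1 mult_1_right add_ac)
        ultimately show ?thesis by linarith
      qed
    qed auto
    then have "schwartz (\<lambda>x. exp (complex_of_real (- (pi * s) * ((x + (- x0)) \<bullet> (x + (- x0))))))"
      by (rule schwartz_iff[THEN iffD2])
    from schwartz_scale[OF this, of "of_real (sqrt s ^ ?d)"] show ?thesis
      by (simp add: g_def exp_of_real[symmetric] del: of_real_power)
  qed
  have fg: "fourier (g s) = (\<lambda>\<xi>. wave (cvec2 x0) \<xi> * exp (of_real (- (pi * inverse s) * (\<xi> \<bullet> \<xi>))))"
    if s: "s > 0" for s
  proof
    fix \<xi> :: "(real ^ 'n) \<times> (real ^ 'n)"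
    define G where "G = (\<lambda>x::(real ^ 'n) \<times> (real ^ 'n). exp (- (2 * pi * \<i> * of_real (\<xi> \<bullet> x))) * of_real (exp (- (pi * s * (x \<bullet> x)))))"
    have [measurable]: "G \<in> borel_measurable borel"
      unfolding G_def by (intro borel_measurable_continuous_onI continuous_intros)
    have "exp (- (2 * pi * \<i> * of_real (\<xi> \<bullet> x))) * g s x =
        (of_real (sqrt s ^ ?d) * wave (cvec2 x0) \<xi>) * G (x + (- x0))" for x
    proof -
      have "exp (- (2 * pi * \<i> * of_real (\<xi> \<bullet> x))) = wave (cvec2 x0) \<xi> * exp (- (2 * pi * \<i> * of_real (\<xi> \<bullet> (x + (- x0)))))"
        unfolding wave_def cdot_cvec2 mult_exp_exp by (simp add: inner_diff_right inner_commute algebra_simps)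
      then show ?thesis by (simp add: g_def G_def)
    qed
    then have "fourier (g s) \<xi> = (of_real (sqrt s ^ ?d) * wave (cvec2 x0) \<xi>) * (\<integral>x. G (x + (- x0)) \<partial>lborel)"
      unfolding fourier_def by simp
    also have "(\<integral>x. G (x + (- x0)) \<partial>lborel) = fourier (\<lambda>x. of_real (exp (- (pi * s * (x \<bullet> x))))) \<xi>"
      unfolding integral_translate[OF \<open>G \<in> borel_measurable borel\<close>] by (simp add: G_def fourier_def)
    also have "\<dots> = of_real (inverse (sqrt s) ^ ?d * exp (- (pi * inverse s * (\<xi> \<bullet> \<xi>))))"
      by (rule fourier_gaussian[OF s])
    also have "(of_real (sqrt s ^ ?d) * wave (cvec2 x0) \<xi>) * \<dots> =
      of_real (sqrt s ^ ?d * inverse (sqrt s) ^ ?d) * (wave (cvec2 x0) \<xi> * of_real (exp (- (pi * inverse s * (\<xi> \<bullet> \<xi>)))))"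
      by (simp only: of_real_mult mult_ac)
    also have "sqrt s ^ ?d * inverse (sqrt s) ^ ?d = 1"
      using s by (simp add: power_mult_distrib[symmetric] del: DIM_prod)
    finally show "fourier (g s) \<xi> = wave (cvec2 x0) \<xi> * exp (of_real (- (pi * inverse s) * (\<xi> \<bullet> \<xi>)))"
      by (simp add: exp_of_real[symmetric])
  qed
  \<comment> \<open>The pairing of v with the spreading Gaussians times w is compared with the pairing with w alone.\<close>
  define w where "w = (\<lambda>\<zeta>. \<kappa> \<zeta> * wave (cvec2 x0) \<zeta>)"
  have w: "bump w" unfolding w_def by (rule bump_wave[OF bc])
  have pair: "(\<integral>z. of_real (sqrt s ^ ?d * exp (- (pi * s * ((z - x0) \<bullet> (z - x0))))) * L z \<partial>lborel) =
      v (\<lambda>\<zeta>. w \<zeta> * exp (of_real (- (pi * inverse s) * (\<zeta> \<bullet> \<zeta>))))" if s: "s > 0" for s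
  proof -
    have "(\<integral>z. of_real (sqrt s ^ ?d * exp (- (pi * s * ((z - x0) \<bullet> (z - x0))))) * L z \<partial>lborel) = v (fourier (g s))"
    proof -
      have "(\<integral>z. L z * g s z \<partial>lborel) = v (fourier (g s))"
        using L sg[OF s] unfolding is_fourier_transform_of_def regular_distribution_def fourier_distribution_def by blast
      moreover have "(\<lambda>z. L z * g s z) = (\<lambda>z. of_real (sqrt s ^ ?d * exp (- (pi * s * ((z - x0) \<bullet> (z - x0))))) * L z)"
        by (simp only: g_def mult.commute)
      ultimately show ?thesis by (simp only:)
    qed
    define F where "F = fourier (g s)"
    have F: "schwartz F"
    proof -
      have gs: "hrapid UNIV (\<lambda>_ x. norm x) (\<lambda>(_::unit) x::(real ^ 'n) \<times> (real ^ 'n). exp (of_real (- (pi * inverse s) * (x \<bullet> x))))"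
        by (rule hrapid_gaussian) (use s in simp)
      have 1: "hmoderate UNIV (\<lambda>_ x. norm x) (\<lambda>(_::unit) \<zeta>. exp (phase (cvec2 x0) \<zeta>))"
      proof (rule hmoderate_exp)
        obtain B where B: "\<And>(z :: (complex ^ 'n) \<times> (complex ^ 'n)) \<zeta>. cmod (phase z \<zeta>) \<le> B * norm z * norm \<zeta>"
          using phase_bound by blast
        show "hmoderate UNIV (\<lambda>_ x. norm x) (\<lambda>(_::unit). phase (cvec2 x0))"
          by (rule hmoderate_linear[OF bounded_linear_phase _ B, of _ _ 1]) auto
        show "moderate UNIV (\<lambda>_ x. norm x) (\<lambda>(_::unit) \<zeta>. exp (phase (cvec2 x0) \<zeta>))"
          unfolding moderate_def wave_phase[symmetric]
          by (rule exI[of _ 0], rule exI[of _ 1]) (simp add: cmod_wave)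
      qed simp
      have "hrapid UNIV (\<lambda>_ x. norm x) (\<lambda>(_::unit) \<zeta>. exp (of_real (- (pi * inverse s) * (\<zeta> \<bullet> \<zeta>))) * exp (phase (cvec2 x0) \<zeta>))"
        by (rule hrapid_moderate_mult[OF _ gs 1]) simp
      moreover have "F = (\<lambda>\<zeta>. exp (of_real (- (pi * inverse s) * (\<zeta> \<bullet> \<zeta>))) * exp (phase (cvec2 x0) \<zeta>))"
        unfolding F_def fg[OF s] wave_phase by (rule ext) (rule mult.commute)
      ultimately show ?thesis by (simp only:) (rule schwartz_iff[THEN iffD2])
    qed
    have cF: "schwartz (\<lambda>\<zeta>. \<kappa> \<zeta> * F \<zeta>)"
      by (intro bump_imp_schwartz bump_mult[OF bc]) (use F in \<open>simp add: schwartz_def\<close>)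
    have "v (\<lambda>\<zeta>. F \<zeta> - \<kappa> \<zeta> * F \<zeta>) = 0"
    proof -
      have "{\<zeta>. F \<zeta> - \<kappa> \<zeta> * F \<zeta> \<noteq> 0} \<subseteq> - ball 0 r" using \<kappa>(2) by auto
      then have "closure {\<zeta>. F \<zeta> - \<kappa> \<zeta> * F \<zeta> \<noteq> 0} \<subseteq> - ball 0 r"
        by (rule closure_minimal) (intro closed_Compl open_ball)
      then have "closure {\<zeta>. F \<zeta> - \<kappa> \<zeta> * F \<zeta> \<noteq> 0} \<inter> K = {}" using K by blast
      then show ?thesis using supp schwartz_diff[OF F cF] unfolding supported_in_def by blast
    qed
    then have "v F = v (\<lambda>\<zeta>. \<kappa> \<zeta> * F \<zeta>)" using v_diff[OF F cF] by simp
    then show ?thesis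
      using \<open>_ = v (fourier (g s))\<close> unfolding F_def fg[OF s] w_def by (simp add: mult.assoc)
  qed
  have lim1: "((\<lambda>s. \<integral>z. of_real (sqrt s ^ ?d * exp (- (pi * s * ((z - x0) \<bullet> (z - x0))))) * L z \<partial>lborel) \<longlongrightarrow> L x0) at_top"
  proof (rule approximate_identity)
    show "L \<in> borel_measurable borel" using Lc by (rule borel_measurable_continuous_onI)
    show "isCont L x0" using Lc by (rule continuous_on_interior) simp
    have "integrable lborel (\<lambda>z. L z * g 1 z)"
      using L sg[of 1] unfolding is_fourier_transform_of_def by simp
    then show "integrable lborel (\<lambda>z. of_real (exp (- (pi * ((z - x0) \<bullet> (z - x0))))) * L z)"
      by (simp add: g_def mult.commute)
  qed
  have lim2: "((\<lambda>s. v (\<lambda>\<zeta>. w \<zeta> * exp (of_real (- (pi * inverse s) * (\<zeta> \<bullet> \<zeta>))))) \<longlongrightarrow> v w) at_top"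
  proof -
    let ?R = "\<lambda>s \<zeta>. of_real (inverse s) * (exp (of_real (- (pi * s) * (\<zeta> \<bullet> \<zeta>))) - 1)"
    have sm: "smooth (?R s)" if "s \<in> {s. 0 < s \<and> s \<le> 1}" for s
      using smooth_family[OF hered_gaussian_remainder] by fast
    obtain A where A: "A \<ge> 0" "\<And>s. 0 < s \<Longrightarrow> s \<le> 1 \<Longrightarrow> cmod (v (\<lambda>\<zeta>. w \<zeta> * ?R s \<zeta>)) \<le> A"
      using dist_bound[OF w hered_gaussian_remainder sm] by auto
    have "cmod (v (\<lambda>\<zeta>. w \<zeta> * exp (of_real (- (pi * inverse s) * (\<zeta> \<bullet> \<zeta>)))) - v w) \<le> A * inverse s" if "s \<ge> 1" for s
    proof -
      have i: "0 < inverse s" "inverse s \<le> 1" using that by (auto simp: inverse_le_1_iff)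
      have s: "schwartz (\<lambda>\<zeta>. w \<zeta> * ?R (inverse s) \<zeta>)"
        by (rule bump_imp_schwartz[OF bump_mult[OF w sm]]) (use i in simp)
      have "(\<lambda>\<zeta>. w \<zeta> * exp (of_real (- (pi * inverse s) * (\<zeta> \<bullet> \<zeta>)))) =
          (\<lambda>\<zeta>. w \<zeta> + of_real (inverse s) * (w \<zeta> * ?R (inverse s) \<zeta>))"
        using that by (auto simp: field_simps)
      then have "v (\<lambda>\<zeta>. w \<zeta> * exp (of_real (- (pi * inverse s) * (\<zeta> \<bullet> \<zeta>)))) - v w =
          of_real (inverse s) * v (\<lambda>\<zeta>. w \<zeta> * ?R (inverse s) \<zeta>)"
        using v_add[OF bump_imp_schwartz[OF w] schwartz_scale[OF s]] v_scale[OF s] by simp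
      then show ?thesis using A(2)[OF i] i by (simp add: norm_mult norm_inverse mult.commute mult_left_mono divide_right_mono divide_inverse)
    qed
    then have "\<forall>\<^sub>F s in at_top. cmod (v (\<lambda>\<zeta>. w \<zeta> * exp (of_real (- (pi * inverse s) * (\<zeta> \<bullet> \<zeta>)))) - v w) \<le> A * inverse s"
      using eventually_ge_at_top by (rule eventually_mono[rotated]) blast
    moreover have "((\<lambda>s. A * inverse s) \<longlongrightarrow> 0) at_top"
      by (intro tendsto_mult_right_zero tendsto_inverse_0_at_top filterlim_ident)
    ultimately have "((\<lambda>s. v (\<lambda>\<zeta>. w \<zeta> * exp (of_real (- (pi * inverse s) * (\<zeta> \<bullet> \<zeta>)))) - v w) \<longlongrightarrow> 0) at_top"
      by (rule Lim_null_comparison)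
    then show ?thesis by (rule LIM_zero_cancel)
  qed
  have "\<forall>\<^sub>F s in at_top. (\<integral>z. of_real (sqrt s ^ ?d * exp (- (pi * s * ((z - x0) \<bullet> (z - x0))))) * L z \<partial>lborel) =
      v (\<lambda>\<zeta>. w \<zeta> * exp (of_real (- (pi * inverse s) * (\<zeta> \<bullet> \<zeta>))))"
    using eventually_gt_at_top[of 0] by eventually_elim (rule pair)
  from tendsto_cong[THEN iffD1, OF this lim1] lim2 have "L x0 = v w"
    by (rule tendsto_unique[OF trivial_limit_at_top_linorder])
  then show ?thesis by (simp add: w_def)
qed

end

section \<open>Operations on Schwartz functions\<close>

lemma hrapid_schwartz_affine:
  assumes "schwartz h" "linear A"
  shows "hrapid S (\<lambda>p z. norm (A z + s p)) (\<lambda>p z. h (A z + s p))"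
  using hrapid_comp_affine[OF assms(2) assms(1)[unfolded schwartz_iff], where \<theta>="\<lambda>_. ()" and s=s and S'=S]
  by simp

lemma schwartz_gaussian:
  assumes "\<epsilon> > 0"
  shows "schwartz (\<lambda>x::'a::euclidean_space. exp (of_real (- \<epsilon> * (x \<bullet> x))))"
  using hrapid_gaussian[OF assms] by (rule schwartz_iff[THEN iffD2])

lemma schwartz_cnj:
  assumes "schwartz h" shows "schwartz (\<lambda>x. cnj (h x))"
  using hrapid_cnj[OF assms[unfolded schwartz_iff]] by (rule schwartz_iff[THEN iffD2])

lemma schwartz_continuous: "schwartz h \<Longrightarrow> continuous_on UNIV h"
  by (simp add: schwartz_def smooth_continuous)

lemma hrapid_freeze:
  fixes F :: "'a::euclidean_space \<times> 'b::euclidean_space \<Rightarrow> complex"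
  assumes "schwartz F"
  shows "hrapid UNIV (\<lambda>p x. norm p + norm x) (\<lambda>p x. F (p, x))"
proof -
  have l: "linear (\<lambda>x::'b. (0::'a, x))" by (rule linearI) auto
  have "hrapid UNIV (\<lambda>p x. norm ((0, x) + (p, 0 :: 'b))) (\<lambda>p x. F ((0, x) + (p, 0)))"
    by (rule hrapid_schwartz_affine[OF assms l])
  then have "hrapid UNIV (\<lambda>p x. norm (p, x)) (\<lambda>p x. F (p, x))" by simp
  then show ?thesis
  proof (rule hrapid_weaken)
    show "norm p + norm x \<le> 2 * (1 + norm (p, x))" for p :: 'a and x :: 'b
      using norm_fst_le[of p x] norm_snd_le[of x p] by simp
  qed auto
qed

lemma schwartz_linear:
  fixes F :: "'a::euclidean_space \<Rightarrow> complex"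
  assumes "schwartz F" "linear A" "\<And>x. norm x \<le> B * (1 + norm (A x))"
  shows "schwartz (\<lambda>x. F (A x))"
proof (rule schwartz_iff[THEN iffD2])
  have "hrapid UNIV (\<lambda>(p::unit) z. norm (A z + 0)) (\<lambda>(p::unit) z. F (A z + 0))"
    by (rule hrapid_schwartz_affine[OF assms(1,2)])
  then have "hrapid UNIV (\<lambda>(p::unit) z. norm (A z)) (\<lambda>(p::unit) z. F (A z))" by simp
  then show "hrapid UNIV (\<lambda>_ x. norm x) (\<lambda>(p::unit) z. F (A z))"
    by (rule hrapid_weaken[where B=B]) (use assms(3) in auto)
qed

lemma schwartz_char_mult:
  fixes F :: "'a::euclidean_space \<Rightarrow> complex"
  assumes "schwartz F" "bounded_linear l"
  shows "schwartz (\<lambda>x. F x * exp (\<i> * of_real (l x)))"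
proof (rule schwartz_iff[THEN iffD2], rule hrapid_moderate_mult)
  show "hrapid UNIV (\<lambda>_ x. norm x) (\<lambda>(p::unit). F)" using assms(1) by (rule schwartz_iff[THEN iffD1])
  obtain B where B: "\<And>x. norm (l x) \<le> B * norm x"
    using bounded_linear.bounded[OF assms(2)] by (metis mult.commute)
  have bl: "bounded_linear (\<lambda>x. \<i> * complex_of_real (l x))"
    by (intro bounded_linear_const_mult bounded_linear_compose[OF bounded_linear_of_real assms(2)])
  show "hmoderate UNIV (\<lambda>_ x. norm x) (\<lambda>(p::unit) x. exp (\<i> * complex_of_real (l x)))"
  proof (rule hmoderate_exp)
    show "hmoderate UNIV (\<lambda>_ x. norm x) (\<lambda>(p::unit) x. \<i> * complex_of_real (l x))"
      by (rule hmoderate_linear[OF bl, of _ _ B 1]) (use B in \<open>auto simp: norm_mult\<close>)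
    show "moderate UNIV (\<lambda>_ x. norm x) (\<lambda>(p::unit) x. exp (\<i> * complex_of_real (l x)))"
      unfolding moderate_def by (rule exI[of _ 0], rule exI[of _ 1]) (simp add: norm_exp_eq_Re)
  qed simp
qed simp

section \<open>The entire extension of the smoothed Wigner transform\<close>

text \<open>Separating modulus and argument lets products of Gaussians and characters be compared by
comparing two real quadratic forms.\<close>
definition cexp :: "real \<Rightarrow> real \<Rightarrow> complex" where
  "cexp A B = exp (of_real A + \<i> * of_real B)"

lemma cexp_mult: "cexp A B * cexp C D = cexp (A + C) (B + D)"
  by (simp add: cexp_def mult_exp_exp algebra_simps)

lemma cexp_mult_assoc: "cexp A B * (cexp C D * z) = cexp (A + C) (B + D) * z"
  by (simp only: mult.assoc[symmetric] cexp_mult)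

lemma norm_cexp [simp]: "cmod (cexp A B) = exp A"
  by (simp add: cexp_def norm_exp_eq_Re)

lemma continuous_on_cexp [continuous_intros]:
  "continuous_on S a \<Longrightarrow> continuous_on S b \<Longrightarrow> continuous_on S (\<lambda>x. cexp (a x) (b x))"
  unfolding cexp_def by (intro continuous_intros)

definition re_part :: "(complex ^ 'n) \<times> (complex ^ 'n) \<Rightarrow> (real ^ 'n) \<times> (real ^ 'n)" where
  "re_part z = ((\<chi> i. Re (fst z $ i)), (\<chi> i. Re (snd z $ i)))"

text \<open>The point \<open>(x, k)\<close> at which the theorem is stated stays fixed throughout.\<close>
locale wigner =
  fixes sx sk :: real and f g :: "real ^ ('n::finite) \<Rightarrow> complex" and x k :: "real ^ 'n"
  assumes sx: "sx > 0" and sk: "sk > 0" and f: "schwartz f" and g: "schwartz g"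
begin

definition gx :: "real ^ 'n \<Rightarrow> complex" where "gx u = exp (of_real (- (2 * pi / sx\<^sup>2) * (u \<bullet> u)))"

definition gk :: "real ^ 'n \<Rightarrow> complex" where "gk u = exp (of_real (- (pi * sk\<^sup>2 / 2) * (u \<bullet> u)))"

lemma gx_schwartz: "schwartz gx"
  unfolding gx_def[abs_def] by (rule schwartz_gaussian) (use sx in simp)

lemma gk_schwartz: "schwartz gk"
  unfolding gk_def[abs_def] by (rule schwartz_gaussian) (use sk in simp)

lemma gx_cexp: "gx u = cexp (- (2 * pi / sx\<^sup>2) * (u \<bullet> u)) 0"
  by (simp add: gx_def cexp_def)

lemma gk_cexp: "gk u = cexp (- (pi * sk\<^sup>2 / 2) * (u \<bullet> u)) 0"
  by (simp add: gk_def cexp_def)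

text \<open>\<open>Q a T y\<close> is the integrand of the Wigner transform in the variables adapted to both operators:
\<open>f\<close> is evaluated at \<open>a + T / 2\<close>, so that \<open>a\<close> and \<open>T\<close> are the midpoint and the difference of
the two arguments of the Weyl kernel.\<close>
definition Q :: "real ^ 'n \<Rightarrow> real ^ 'n \<Rightarrow> real ^ 'n \<Rightarrow> complex" where
  "Q a T y = f (a + (1/2) *\<^sub>R T) * cnj (g (a - y - (1/2) *\<^sub>R T)) * gk y *
     gx (a - (1/2) *\<^sub>R y - (1/2) *\<^sub>R T - x) * exp (\<i> * of_real (- (2 * pi * (k \<bullet> y))))"

text \<open>The same product of functions in the variables that arise after the contour shift; \<open>Q2_diagonal\<close> relates
the two.\<close>
definition Q2 :: "real ^ 'n \<Rightarrow> real ^ 'n \<Rightarrow> real ^ 'n \<Rightarrow> real ^ 'n \<Rightarrow> complex" where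
  "Q2 a K q y = f (q + y - 2 *\<^sub>R K) * cnj (g q) * gk y *
     gx (q + (1/2) *\<^sub>R y - 2 *\<^sub>R K - 2 *\<^sub>R a + x) * exp (\<i> * of_real (2 * pi * (k \<bullet> y)))"

text \<open>The four affine forms at which \<open>f\<close>, \<open>g\<close> and the Gaussians are evaluated control all three variables.\<close>
lemma Q_schwartz: "schwartz (\<lambda>z. Q (fst (fst z)) (snd (fst z)) (snd z))"
proof -
  let ?A1 = "\<lambda>z::((real ^ 'n) \<times> (real ^ 'n)) \<times> (real ^ 'n). fst (fst z) + (1/2) *\<^sub>R snd (fst z)"
  let ?A2 = "\<lambda>z::((real ^ 'n) \<times> (real ^ 'n)) \<times> (real ^ 'n). fst (fst z) - snd z - (1/2) *\<^sub>R snd (fst z)"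
  let ?A3 = "\<lambda>z::((real ^ 'n) \<times> (real ^ 'n)) \<times> (real ^ 'n). snd z"
  let ?A4 = "\<lambda>z::((real ^ 'n) \<times> (real ^ 'n)) \<times> (real ^ 'n). fst (fst z) - (1/2) *\<^sub>R snd z - (1/2) *\<^sub>R snd (fst z)"
  have l: "linear ?A1" "linear ?A2" "linear ?A3" "linear ?A4"
    by (auto intro!: linearI simp: algebra_simps)
  note h = hrapid_schwartz_affine[where S="UNIV :: unit set"]
  have "hrapid UNIV (\<lambda>(p::unit) z. norm (?A1 z + 0) + norm (?A2 z + 0) + norm (?A3 z + 0) + norm (?A4 z + (- x)))
     (\<lambda>(p::unit) z. f (?A1 z + 0) * cnj (g (?A2 z + 0)) * gk (?A3 z + 0) * gx (?A4 z + (- x)))"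
    by (intro hrapid_mult h l f gk_schwartz gx_schwartz schwartz_cnj[OF g]) auto
  then have "hrapid UNIV (\<lambda>(p::unit) z. norm z)
     (\<lambda>(p::unit) z. f (?A1 z + 0) * cnj (g (?A2 z + 0)) * gk (?A3 z + 0) * gx (?A4 z + (- x)))"
  proof (rule hrapid_weaken)
    fix z :: "((real ^ 'n) \<times> (real ^ 'n)) \<times> (real ^ 'n)"
    obtain a T y where z: "z = ((a, T), y)" by (metis prod.collapse)
    have T: "norm T \<le> norm (?A1 z) + norm (?A2 z) + norm (?A3 z)"
    proof -
      have "T = (?A1 z - ?A2 z) - ?A3 z" by (simp add: z scaleR_add_left[symmetric])
      then show ?thesis
        using norm_triangle_ineq4[of "?A1 z - ?A2 z" "?A3 z"] norm_triangle_ineq4[of "?A1 z" "?A2 z"] by simp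
    qed
    have "a = ?A1 z - (1/2) *\<^sub>R T" by (simp add: z)
    then have a: "norm a \<le> norm (?A1 z) + norm T"
      using norm_triangle_ineq4[of "?A1 z" "(1/2) *\<^sub>R T"] norm_ge_zero[of T] by (simp del: norm_ge_zero)
    have "norm z \<le> norm a + norm T + norm (?A3 z)"
      unfolding z using norm_Pair_le[of "(a, T)" y] norm_Pair_le[of a T] by simp
    then show "norm z \<le> 4 * (1 + (norm (?A1 z + 0) + norm (?A2 z + 0) + norm (?A3 z + 0) + norm (?A4 z + (- x))))"
      using a T norm_ge_zero[of "?A1 z"] norm_ge_zero[of "?A2 z"] norm_ge_zero[of "?A3 z"] norm_ge_zero[of "?A4 z + (- x)"]
      unfolding add_0_right by argo
  qed auto
  then have 1: "schwartz (\<lambda>z. f (?A1 z) * cnj (g (?A2 z)) * gk (?A3 z) * gx (?A4 z - x))"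
    by (intro schwartz_iff[THEN iffD2]) simp
  have 2: "bounded_linear (\<lambda>z::((real ^ 'n) \<times> (real ^ 'n)) \<times> (real ^ 'n). - (2 * pi * (k \<bullet> snd z)))"
    by (auto intro!: bounded_linear_minus bounded_linear_const_mult bounded_linear_inner_right_comp bounded_linear_snd)
  show ?thesis using schwartz_char_mult[OF 1 2] by (simp add: Q_def)
qed

lemma Q2_schwartz: "schwartz (\<lambda>z. Q2 (fst (fst z)) (snd (fst z)) (fst (snd z)) (snd (snd z)))"
proof -
  let ?A1 = "\<lambda>z::((real ^ 'n) \<times> (real ^ 'n)) \<times> ((real ^ 'n) \<times> (real ^ 'n)). fst (snd z) + snd (snd z) - 2 *\<^sub>R snd (fst z)"
  let ?A2 = "\<lambda>z::((real ^ 'n) \<times> (real ^ 'n)) \<times> ((real ^ 'n) \<times> (real ^ 'n)). fst (snd z)"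
  let ?A3 = "\<lambda>z::((real ^ 'n) \<times> (real ^ 'n)) \<times> ((real ^ 'n) \<times> (real ^ 'n)). snd (snd z)"
  let ?A4 = "\<lambda>z::((real ^ 'n) \<times> (real ^ 'n)) \<times> ((real ^ 'n) \<times> (real ^ 'n)).
     fst (snd z) + (1/2) *\<^sub>R snd (snd z) - 2 *\<^sub>R snd (fst z) - 2 *\<^sub>R fst (fst z)"
  have l: "linear ?A1" "linear ?A2" "linear ?A3" "linear ?A4"
    by (auto intro!: linearI simp: algebra_simps)
  note h = hrapid_schwartz_affine[where S="UNIV :: unit set"]
  have "hrapid UNIV (\<lambda>(p::unit) z. norm (?A1 z + 0) + norm (?A2 z + 0) + norm (?A3 z + 0) + norm (?A4 z + x))
     (\<lambda>(p::unit) z. f (?A1 z + 0) * cnj (g (?A2 z + 0)) * gk (?A3 z + 0) * gx (?A4 z + x))"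
    by (intro hrapid_mult h l f gk_schwartz gx_schwartz schwartz_cnj[OF g]) auto
  then have "hrapid UNIV (\<lambda>(p::unit) z. norm z)
     (\<lambda>(p::unit) z. f (?A1 z + 0) * cnj (g (?A2 z + 0)) * gk (?A3 z + 0) * gx (?A4 z + x))"
  proof (rule hrapid_weaken)
    fix z :: "((real ^ 'n) \<times> (real ^ 'n)) \<times> ((real ^ 'n) \<times> (real ^ 'n))"
    obtain a K q y where z: "z = ((a, K), (q, y))" by (metis prod.collapse)
    have "2 *\<^sub>R K = (q + y) - ?A1 z" by (simp add: z)
    then have "norm (2 *\<^sub>R K) \<le> norm q + norm y + norm (?A1 z)"
      using norm_triangle_ineq4[of "q + y" "?A1 z"] norm_triangle_ineq[of q y] by simp
    then have K: "2 * norm K \<le> norm q + norm y + norm (?A1 z)" by simp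
    have "2 *\<^sub>R a = (q + (1/2) *\<^sub>R y) - ((?A4 z + x) + (2 *\<^sub>R K - x))" by (simp add: z)
    from arg_cong[OF this, of norm] have "norm (2 *\<^sub>R a) \<le> norm q + norm ((1/2) *\<^sub>R y) + (norm (?A4 z + x) + (norm (2 *\<^sub>R K) + norm x))"
      using norm_triangle_ineq4[of "q + (1/2) *\<^sub>R y" "(?A4 z + x) + (2 *\<^sub>R K - x)"]
        norm_triangle_ineq[of q "(1/2) *\<^sub>R y"] norm_triangle_ineq[of "?A4 z + x" "2 *\<^sub>R K - x"]
        norm_triangle_ineq4[of "2 *\<^sub>R K" x] by linarith
    then have a: "2 * norm a \<le> norm q + norm y / 2 + (norm (?A4 z + x) + (2 * norm K + norm x))" by simp
    have "norm z \<le> norm a + norm K + norm q + norm y"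
      unfolding z using norm_Pair_le[of "(a, K)" "(q, y)"] norm_Pair_le[of a K] norm_Pair_le[of q y] by simp
    moreover have "norm q = norm (?A2 z)" "norm y = norm (?A3 z)" by (simp_all add: z)
    ultimately have "norm z \<le> (4 + norm x) + 4 * (norm (?A1 z) + norm (?A2 z) + norm (?A3 z) + norm (?A4 z + x))"
      using a K norm_ge_zero[of "?A1 z"] norm_ge_zero[of "?A2 z"] norm_ge_zero[of "?A3 z"] norm_ge_zero[of "?A4 z + x"] norm_ge_zero[of x]
      by argo
    also have "\<dots> \<le> (4 + norm x) * (1 + (norm (?A1 z) + norm (?A2 z) + norm (?A3 z) + norm (?A4 z + x)))"
      unfolding distrib_left[of "4 + norm x" 1] by (intro add_mono mult_right_mono) auto
    finally show "norm z \<le> (4 + norm x) * (1 + (norm (?A1 z + 0) + norm (?A2 z + 0) + norm (?A3 z + 0) + norm (?A4 z + x)))"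
      by simp
  qed auto
  then have 1: "schwartz (\<lambda>z. f (?A1 z) * cnj (g (?A2 z)) * gk (?A3 z) * gx (?A4 z + x))"
    by (intro schwartz_iff[THEN iffD2]) simp
  have 2: "bounded_linear (\<lambda>z::((real ^ 'n) \<times> (real ^ 'n)) \<times> ((real ^ 'n) \<times> (real ^ 'n)). 2 * pi * (k \<bullet> snd (snd z)))"
    by (auto intro!: bounded_linear_const_mult bounded_linear_inner_right_comp bounded_linear_compose[OF bounded_linear_snd] bounded_linear_snd)
  show ?thesis using schwartz_char_mult[OF 1 2] by (simp add: Q2_def)
qed

text \<open>The integrand of the smoothed Wigner transform at the complex point with real part \<open>(a, b)\<close> and
imaginary part \<open>(\<alpha>, \<beta>)\<close>, with the complex exponential split into modulus and argument;
\<open>wigner_integrand_complex\<close> is the holomorphic form.\<close>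
definition wigner_integrand :: "real ^ 'n \<Rightarrow> real ^ 'n \<Rightarrow> real ^ 'n \<Rightarrow> real ^ 'n \<Rightarrow> (real ^ 'n) \<times> (real ^ 'n) \<Rightarrow> complex" where
  "wigner_integrand a \<alpha> b \<beta> = (\<lambda>z. cexp
      (2 * pi * (\<beta> \<bullet> snd z) + 2 * pi / sx\<^sup>2 * (\<alpha> \<bullet> \<alpha>) - pi * sk\<^sup>2 / 2 * (snd z \<bullet> snd z)
        - 2 * pi / sx\<^sup>2 * ((fst z - a) \<bullet> (fst z - a)))
      (4 * pi / sx\<^sup>2 * (\<alpha> \<bullet> (fst z - a)) - 2 * pi * (b \<bullet> snd z)) *
     (f (fst z + (1/2) *\<^sub>R snd z) * cnj (g (fst z - (1/2) *\<^sub>R snd z))))"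

definition wigner_const :: complex where "wigner_const = of_real ((sqrt 2 / sx) ^ CARD('n))"

definition wigner_ext :: "(complex ^ 'n) \<times> (complex ^ 'n) \<Rightarrow> complex" where
  "wigner_ext z = wigner_const * (\<integral>p. wigner_integrand (fst (re_part z)) (fst (im_part z)) (snd (re_part z)) (snd (im_part z)) p \<partial>lborel)"

lemma wigner_integrand_continuous: "continuous_on UNIV (wigner_integrand a \<alpha> b \<beta>)"
  unfolding wigner_integrand_def
  by (intro continuous_intros continuous_on_compose2[OF schwartz_continuous[OF f]]
      continuous_on_compose2[OF schwartz_continuous[OF g]]) auto

lemma smoothed_wigner_eq: "smoothed_wigner sx sk f g p = wigner_ext (cvec2 p)"
proof -
  obtain a b where p: "p = (a, b)" by (cases p)
  have r: "re_part (cvec2 p) = p" by (simp add: re_part_def cvec2_def cvec_def prod_eq_iff vec_eq_iff)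
  have "exp (- (2 * pi * \<i> * of_real (b \<bullet> y)) - of_real (pi * sk\<^sup>2 * (y \<bullet> y) / 2)
      - of_real (2 * pi * ((u - a) \<bullet> (u - a)) / sx\<^sup>2)) * f (u + (1/2) *\<^sub>R y) * cnj (g (u - (1/2) *\<^sub>R y)) =
    wigner_integrand a 0 b 0 (u, y)" for u y
  proof -
    have "- (2 * pi * \<i> * of_real (b \<bullet> y)) - of_real (pi * sk\<^sup>2 * (y \<bullet> y) / 2)
        - of_real (2 * pi * ((u - a) \<bullet> (u - a)) / sx\<^sup>2) =
      of_real (- (pi * sk\<^sup>2 / 2 * (y \<bullet> y)) - 2 * pi / sx\<^sup>2 * ((u - a) \<bullet> (u - a))) +
        \<i> * of_real (- (2 * pi * (b \<bullet> y)))"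
      by simp
    then show ?thesis by (simp only: wigner_integrand_def cexp_def fst_conv snd_conv) simp
  qed
  then show ?thesis
    unfolding smoothed_wigner_def wigner_ext_def wigner_const_def im_part_cvec2 r unfolding p by (simp add: case_prod_beta)
qed

end

lemma one_plus_le_mult:
  fixes a b c :: real
  assumes "c \<le> a + b" "0 \<le> a" "0 \<le> b"
  shows "1 + c \<le> (1 + a) * (1 + b)"
proof -
  have "(1 + a) * (1 + b) = 1 + a + b + a * b" by algebra
  then show ?thesis using assms mult_nonneg_nonneg[OF assms(2,3)] by linarith
qed

lemma norm_smult: "norm (t *s v) = cmod t * norm (v :: complex ^ 'n)"
  by (simp add: norm_vec_def norm_mult L2_set_right_distrib)

lemma norm_cscale: "norm (cscale t z) = cmod t * norm z"
  by (simp add: cscale_def norm_prod_def norm_smult power_mult_distrib distrib_left[symmetric] real_sqrt_mult)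

lemma bounded_linear_im_part: "bounded_linear im_part"
  unfolding linear_conv_bounded_linear[symmetric]
  by (rule linearI) (auto simp: im_part_def vec_eq_iff)

lemma bounded_linear_re_part: "bounded_linear re_part"
  unfolding linear_conv_bounded_linear[symmetric]
  by (rule linearI) (auto simp: re_part_def vec_eq_iff)

lemma norm_vec_component_le: "(\<And>i. norm (v $ i) \<le> norm (w $ i)) \<Longrightarrow> norm v \<le> norm w"
  unfolding norm_vec_def by (rule L2_set_mono) auto

lemma norm_im_part_le: "norm (im_part z) \<le> norm z"
  unfolding norm_prod_def im_part_def fst_conv snd_conv
  by (intro real_sqrt_le_mono add_mono power_mono norm_vec_component_le) (auto simp: abs_Im_le_cmod)

lemma norm_re_part_le: "norm (re_part z) \<le> norm z"
  unfolding norm_prod_def re_part_def fst_conv snd_conv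
  by (intro real_sqrt_le_mono add_mono power_mono norm_vec_component_le) (auto simp: abs_Re_le_cmod)

text \<open>A Gaussian with a complex linear exponent added decays uniformly as long as the linear coefficients
stay bounded.\<close>
lemma hrapid_gauss_lin:
  fixes M \<epsilon> :: real
  assumes "\<epsilon> > 0"
  shows "hrapid {p. norm (fst p) \<le> M \<and> norm (snd p) \<le> M} (\<lambda>p y. norm y)
    (\<lambda>p y::'a::euclidean_space. exp (of_real (fst p \<bullet> y) + \<i> * of_real (snd p \<bullet> y) + of_real (- \<epsilon> * (y \<bullet> y))))"
    (is "hrapid ?S _ _")
proof (rule hrapid_exp)
  have bl: "bounded_linear (\<lambda>y. complex_of_real (fst p \<bullet> y) + \<i> * of_real (snd p \<bullet> y))" for p :: "'a \<times> 'a"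
    by (intro bounded_linear_add bounded_linear_const_mult bounded_linear_compose[OF bounded_linear_of_real]
        bounded_linear_inner_right)
  have 1: "hmoderate ?S (\<lambda>p y. norm y) (\<lambda>p y. complex_of_real (fst p \<bullet> y) + \<i> * of_real (snd p \<bullet> y))"
  proof (rule hmoderate_linear[OF bl, where B="2 * M" and D=1])
    fix p :: "'a \<times> 'a" and y :: 'a assume p: "p \<in> ?S"
    have "\<bar>fst p \<bullet> y\<bar> \<le> M * norm y" "\<bar>snd p \<bullet> y\<bar> \<le> M * norm y"
      using p Cauchy_Schwarz_ineq2[of "fst p" y] Cauchy_Schwarz_ineq2[of "snd p" y]
        mult_right_mono[of "norm (fst p)" M "norm y"] mult_right_mono[of "norm (snd p)" M "norm y"]
      by auto
    then show "cmod (complex_of_real (fst p \<bullet> y) + \<i> * of_real (snd p \<bullet> y)) \<le> 2 * M * norm y"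
      by (intro order_trans[OF norm_triangle_ineq]) (simp add: norm_mult)
  qed auto
  show "hmoderate ?S (\<lambda>p y. norm y) (\<lambda>p y. complex_of_real (fst p \<bullet> y) + \<i> * of_real (snd p \<bullet> y) + of_real (- \<epsilon> * (y \<bullet> y)))"
    by (rule hmoderate_add[OF _ 1 hmoderate_square_norm[of _ _ 1]]) auto
  show "rapid ?S (\<lambda>p y. norm y) (\<lambda>p y. exp (complex_of_real (fst p \<bullet> y) + \<i> * of_real (snd p \<bullet> y) + of_real (- \<epsilon> * (y \<bullet> y))))"
    unfolding rapid_def
  proof
    fix N
    obtain C where C: "\<And>r. 0 \<le> r \<Longrightarrow> (1 + r) ^ N * exp (M * r - \<epsilon> * r\<^sup>2) \<le> C"
      using poly_exp_bounded[OF assms, of N M] by blast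
    have "(1 + norm y) ^ N * cmod (exp (complex_of_real (fst p \<bullet> y) + \<i> * of_real (snd p \<bullet> y) + of_real (- \<epsilon> * (y \<bullet> y)))) \<le> C"
      if p: "p \<in> ?S" for p :: "'a \<times> 'a" and y
    proof -
      have "fst p \<bullet> y \<le> M * norm y"
        using p norm_cauchy_schwarz[of "fst p" y] mult_right_mono[of "norm (fst p)" M "norm y"] by auto
      then have "(1 + norm y) ^ N * exp (fst p \<bullet> y - \<epsilon> * (norm y)\<^sup>2) \<le> (1 + norm y) ^ N * exp (M * norm y - \<epsilon> * (norm y)\<^sup>2)"
        by (intro mult_left_mono) auto
      then show ?thesis using C[of "norm y"] by (simp add: norm_exp_eq_Re power2_norm_eq_inner)
    qed
    then show "\<exists>C. \<forall>p\<in>?S. \<forall>y. (1 + norm y) ^ N * cmod (exp (complex_of_real (fst p \<bullet> y) + \<i> * of_real (snd p \<bullet> y) + of_real (- \<epsilon> * (y \<bullet> y)))) \<le> C"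
      by blast
  qed
qed auto

context wigner
begin

lemma fg_schwartz: "schwartz (\<lambda>z. f (fst z + (1/2) *\<^sub>R snd z) * cnj (g (fst z - (1/2) *\<^sub>R snd z)))"
proof -
  let ?A1 = "\<lambda>z::(real ^ 'n) \<times> (real ^ 'n). fst z + (1/2) *\<^sub>R snd z"
  let ?A2 = "\<lambda>z::(real ^ 'n) \<times> (real ^ 'n). fst z - (1/2) *\<^sub>R snd z"
  have l: "linear ?A1" "linear ?A2" by (auto intro!: linearI simp: algebra_simps)
  note h = hrapid_schwartz_affine[where S="UNIV :: unit set" and s="\<lambda>_. 0"]
  have "hrapid UNIV (\<lambda>(p::unit) z. norm (?A1 z + 0) + norm (?A2 z + 0)) (\<lambda>(p::unit) z. f (?A1 z + 0) * cnj (g (?A2 z + 0)))"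
    by (intro hrapid_mult h l f schwartz_cnj[OF g]) auto
  then have "hrapid UNIV (\<lambda>(p::unit) z. norm z) (\<lambda>(p::unit) z. f (?A1 z + 0) * cnj (g (?A2 z + 0)))"
  proof (rule hrapid_weaken)
    fix z :: "(real ^ 'n) \<times> (real ^ 'n)"
    obtain u y where z: "z = (u, y)" by (cases z)
    have "y = ?A1 z - ?A2 z" by (simp add: z scaleR_add_left[symmetric])
    then have y: "norm y \<le> norm (?A1 z) + norm (?A2 z)" using norm_triangle_ineq4 by metis
    have "2 *\<^sub>R u = ?A1 z + ?A2 z" by (simp add: z scaleR_2)
    from arg_cong[OF this, of norm] have u: "2 * norm u \<le> norm (?A1 z) + norm (?A2 z)"
      using norm_triangle_ineq[of "?A1 z" "?A2 z"] by simp
    have "norm z \<le> norm u + norm y" unfolding z by (rule norm_Pair_le)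
    then show "norm z \<le> 2 * (1 + (norm (?A1 z + 0) + norm (?A2 z + 0)))"
      unfolding add_0_right using u y norm_ge_zero[of "?A1 z"] norm_ge_zero[of "?A2 z"] by argo
  qed auto
  then show ?thesis by (intro schwartz_iff[THEN iffD2]) simp
qed

lemma fg_bound: "\<exists>C\<ge>0. \<forall>z. cmod (f (fst z + (1/2) *\<^sub>R snd z) * cnj (g (fst z - (1/2) *\<^sub>R snd z))) \<le> C * tail z"
proof -
  obtain C where C: "C \<ge> 0" "\<And>z. (1 + norm z) ^ (2 * DIM((real ^ 'n) \<times> (real ^ 'n))) *
      cmod (f (fst z + (1/2) *\<^sub>R snd z) * cnj (g (fst z - (1/2) *\<^sub>R snd z))) \<le> C"
    using rapidD[OF hered_imp[OF spec[OF schwartz_iff[THEN iffD1, OF fg_schwartz]]]] by (metis UNIV_I)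
  show ?thesis
    using C tail_bound[where F="\<lambda>z. f (fst z + (1/2) *\<^sub>R snd z) * cnj (g (fst z - (1/2) *\<^sub>R snd z))"] by blast
qed

text \<open>The Gaussian in \<open>y\<close> dominates the exponential growth caused by \<open>\<beta>\<close>, after completing the square.
The bound does not depend on the real part of the point.\<close>
lemma wigner_integrand_bound: "cmod (wigner_integrand a \<alpha> b \<beta> z) \<le> exp (2 * pi / sk\<^sup>2 * (norm \<beta>)\<^sup>2 + 2 * pi / sx\<^sup>2 * (norm \<alpha>)\<^sup>2) *
    cmod (f (fst z + (1/2) *\<^sub>R snd z) * cnj (g (fst z - (1/2) *\<^sub>R snd z)))"
proof -
  have "0 \<le> pi * sk\<^sup>2 / 2 * (norm (snd z) - 2 * norm \<beta> / sk\<^sup>2)\<^sup>2" by simp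
  also have "\<dots> = pi * sk\<^sup>2 / 2 * (norm (snd z))\<^sup>2 - 2 * pi * (norm \<beta> * norm (snd z)) + 2 * pi / sk\<^sup>2 * (norm \<beta>)\<^sup>2"
    using sk by (simp add: power2_eq_square field_simps)
  finally have "2 * pi * (norm \<beta> * norm (snd z)) - pi * sk\<^sup>2 / 2 * (norm (snd z))\<^sup>2 \<le> 2 * pi / sk\<^sup>2 * (norm \<beta>)\<^sup>2" by simp
  moreover have "2 * pi * (\<beta> \<bullet> snd z) \<le> 2 * pi * (norm \<beta> * norm (snd z))"
    by (intro mult_left_mono norm_cauchy_schwarz) auto
  moreover have "0 \<le> 2 * pi / sx\<^sup>2 * ((fst z - a) \<bullet> (fst z - a))" by simp
  ultimately have "2 * pi * (\<beta> \<bullet> snd z) + 2 * pi / sx\<^sup>2 * (\<alpha> \<bullet> \<alpha>) - pi * sk\<^sup>2 / 2 * (snd z \<bullet> snd z)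
        - 2 * pi / sx\<^sup>2 * ((fst z - a) \<bullet> (fst z - a)) \<le> 2 * pi / sk\<^sup>2 * (norm \<beta>)\<^sup>2 + 2 * pi / sx\<^sup>2 * (norm \<alpha>)\<^sup>2"
    unfolding power2_norm_eq_inner by linarith
  then show ?thesis unfolding wigner_integrand_def norm_mult[of "cexp _ _"] norm_cexp by (intro mult_right_mono) auto
qed

lemma wigner_integrand_dominated:
  "\<exists>B. integrable lborel B \<and> (\<forall>z. norm z \<le> R \<longrightarrow>
     (\<forall>p. cmod (wigner_integrand (fst (re_part z)) (fst (im_part z)) (snd (re_part z)) (snd (im_part z)) p) \<le> B p))"
proof -
  obtain C where C: "C \<ge> 0" "\<And>p. cmod (f (fst p + (1/2) *\<^sub>R snd p) * cnj (g (fst p - (1/2) *\<^sub>R snd p))) \<le> C * tail p"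
    using fg_bound by blast
  define E where "E = exp (2 * pi / sk\<^sup>2 * R\<^sup>2 + 2 * pi / sx\<^sup>2 * R\<^sup>2)"
  have "cmod (wigner_integrand (fst (re_part z)) (fst (im_part z)) (snd (re_part z)) (snd (im_part z)) p) \<le> E * (C * tail p)"
    if z: "norm z \<le> R" for z p
  proof -
    have n: "norm (fst (im_part z)) \<le> R" "norm (snd (im_part z)) \<le> R"
      using norm_fst_le[of "fst (im_part z)" "snd (im_part z)"] norm_snd_le[of "snd (im_part z)" "fst (im_part z)"] norm_im_part_le[of z] z by auto
    have "exp (2 * pi / sk\<^sup>2 * (norm (snd (im_part z)))\<^sup>2 + 2 * pi / sx\<^sup>2 * (norm (fst (im_part z)))\<^sup>2) \<le> E"
      unfolding E_def exp_le_cancel_iff using n by (intro add_mono mult_left_mono power_mono) auto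
    then show ?thesis using C(2)[of p] by (intro order_trans[OF wigner_integrand_bound] mult_mono) (auto simp: E_def)
  qed
  then show ?thesis by (intro exI[of _ "\<lambda>p. E * (C * tail p)"]) (auto intro: integrable_tail)
qed

lemma wigner_integrand_measurable: "wigner_integrand a \<alpha> b \<beta> \<in> borel_measurable borel"
  by (rule borel_measurable_continuous_onI[OF wigner_integrand_continuous])

lemma wigner_ext_continuous: "continuous_on UNIV wigner_ext"
  unfolding wigner_ext_def
proof (intro continuous_on_mult continuous_on_const continuous_param_integral wigner_integrand_measurable)
  note c = linear_continuous_on[OF bounded_linear_im_part] linear_continuous_on[OF bounded_linear_re_part]
  show "continuous_on UNIV (\<lambda>z. wigner_integrand (fst (re_part z)) (fst (im_part z)) (snd (re_part z)) (snd (im_part z)) p)" for p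
    unfolding wigner_integrand_def by (intro continuous_intros c)
  fix z :: "(complex ^ 'n) \<times> (complex ^ 'n)"
  have "norm q \<le> norm z + 1" if "q \<in> ball z 1" for q
    using that norm_triangle_ineq[of z "q - z"] by (simp add: dist_norm norm_minus_commute)
  then show "\<exists>e>0. \<exists>B. integrable lborel B \<and> (\<forall>q\<in>ball z e. \<forall>x.
      cmod (wigner_integrand (fst (re_part q)) (fst (im_part q)) (snd (re_part q)) (snd (im_part q)) x) \<le> B x)"
    using wigner_integrand_dominated[of "norm z + 1"] zero_less_one by meson
qed

lemma wigner_integrand_complex:
  "wigner_integrand (fst (re_part z)) (fst (im_part z)) (snd (re_part z)) (snd (im_part z)) p =
   exp (- (2 * pi * \<i>) * (\<Sum>i\<in>UNIV. snd z $ i * of_real (snd p $ i)) - of_real (pi * sk\<^sup>2 / 2 * (snd p \<bullet> snd p))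
      - of_real (2 * pi / sx\<^sup>2) * (\<Sum>i\<in>UNIV. (of_real (fst p $ i) - fst z $ i)\<^sup>2)) *
   (f (fst p + (1/2) *\<^sub>R snd p) * cnj (g (fst p - (1/2) *\<^sub>R snd p)))"
proof -
  define a \<alpha> b \<beta> where "a = fst (re_part z)" and "\<alpha> = fst (im_part z)" and "b = snd (re_part z)" and "\<beta> = snd (im_part z)"
  have fz: "fst z $ i = of_real (a $ i) + \<i> * of_real (\<alpha> $ i)" and sz: "snd z $ i = of_real (b $ i) + \<i> * of_real (\<beta> $ i)" for i
    by (simp_all add: a_def \<alpha>_def b_def \<beta>_def re_part_def im_part_def complex_eq_iff)
  have 1: "(\<Sum>i\<in>UNIV. snd z $ i * of_real (snd p $ i)) = of_real (b \<bullet> snd p) + \<i> * of_real (\<beta> \<bullet> snd p)"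
    by (simp add: sz inner_vec_def distrib_right sum.distrib sum_distrib_left mult.assoc)
  have 2: "(\<Sum>i\<in>UNIV. (of_real (fst p $ i) - fst z $ i)\<^sup>2) =
      of_real ((fst p - a) \<bullet> (fst p - a)) - 2 * \<i> * of_real (\<alpha> \<bullet> (fst p - a)) - of_real (\<alpha> \<bullet> \<alpha>)"
  proof -
    have "(of_real (fst p $ i) - fst z $ i)\<^sup>2 = of_real ((fst p $ i - a $ i) * (fst p $ i - a $ i))
        - 2 * \<i> * of_real (\<alpha> $ i * (fst p $ i - a $ i)) - of_real (\<alpha> $ i * \<alpha> $ i)" for i
      by (simp add: fz power2_eq_square algebra_simps)
    then show ?thesis by (simp add: inner_vec_def sum_subtractf sum_distrib_left)
  qed
  have "- (2 * pi * \<i>) * (of_real (b \<bullet> snd p) + \<i> * of_real (\<beta> \<bullet> snd p)) - of_real (pi * sk\<^sup>2 / 2 * (snd p \<bullet> snd p))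
      - of_real (2 * pi / sx\<^sup>2) * (of_real ((fst p - a) \<bullet> (fst p - a)) - 2 * \<i> * of_real (\<alpha> \<bullet> (fst p - a)) - of_real (\<alpha> \<bullet> \<alpha>)) =
     of_real (2 * pi * (\<beta> \<bullet> snd p) + 2 * pi / sx\<^sup>2 * (\<alpha> \<bullet> \<alpha>) - pi * sk\<^sup>2 / 2 * (snd p \<bullet> snd p)
        - 2 * pi / sx\<^sup>2 * ((fst p - a) \<bullet> (fst p - a))) +
     \<i> * of_real (4 * pi / sx\<^sup>2 * (\<alpha> \<bullet> (fst p - a)) - 2 * pi * (b \<bullet> snd p))"
  proof -
    define r where "r = 2 * pi / sx\<^sup>2"
    have r: "4 * pi / sx\<^sup>2 = 2 * r" by (simp add: r_def)
    show ?thesis unfolding r r_def[symmetric] complex_eq_iff by (simp add: algebra_simps)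
  qed
  then show ?thesis unfolding 1 2 wigner_integrand_def cexp_def a_def[symmetric] \<alpha>_def[symmetric] b_def[symmetric] \<beta>_def[symmetric]
    by (simp only:)
qed

lemma wigner_ext_holomorphic_line: "(\<lambda>t. wigner_ext (z + cscale t h)) holomorphic_on UNIV"
  unfolding wigner_ext_def
proof (intro holomorphic_on_mult holomorphic_on_const holomorphic_param_integral wigner_integrand_measurable)
  show "(\<lambda>t. wigner_integrand (fst (re_part (z + cscale t h))) (fst (im_part (z + cscale t h))) (snd (re_part (z + cscale t h)))
     (snd (im_part (z + cscale t h))) p) holomorphic_on UNIV" for p
    unfolding wigner_integrand_complex by (simp add: cscale_def) (intro holomorphic_intros, use sx in auto)
  fix R
  have "norm (z + cscale t h) \<le> norm z + R * norm h" if "cmod t \<le> R" for t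
    using norm_triangle_ineq[of z "cscale t h"] mult_right_mono[OF that norm_ge_zero[of h]] by (simp add: norm_cscale)
  then show "\<exists>B. integrable lborel B \<and> (\<forall>t p. cmod t \<le> R \<longrightarrow> cmod (wigner_integrand (fst (re_part (z + cscale t h))) (fst (im_part (z + cscale t h)))
     (snd (re_part (z + cscale t h))) (snd (im_part (z + cscale t h))) p) \<le> B p)"
    using wigner_integrand_dominated[of "norm z + R * norm h"] by meson
qed

text \<open>Translating \<open>u\<close> by the real position \<open>a\<close> turns the integral into a Fourier transform at the real
momentum \<open>b\<close> of a family that decays rapidly in \<open>a\<close>; the imaginary part enters only
through bounded parameters.\<close>
lemma wigner_ext_decay: "\<exists>C\<ge>0. \<forall>z. norm (im_part z) \<le> M \<longrightarrow> (1 + norm (re_part z)) ^ N * cmod (wigner_ext z) \<le> C"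
proof -
  define S where "S = {p :: (real ^ 'n) \<times> ((real ^ 'n) \<times> (real ^ 'n)). norm (fst (snd p)) \<le> M \<and> norm (snd (snd p)) \<le> M}"
  define G1 where "G1 = (\<lambda>(p :: (real ^ 'n) \<times> (real ^ 'n)) y::real ^ 'n.
     exp (of_real (fst p \<bullet> y) + \<i> * of_real (snd p \<bullet> y) + of_real (- (pi * sk\<^sup>2 / 2) * (y \<bullet> y))))"
  define G2 where "G2 = (\<lambda>(p :: (real ^ 'n) \<times> (real ^ 'n)) y::real ^ 'n.
     exp (of_real (fst p \<bullet> y) + \<i> * of_real (snd p \<bullet> y) + of_real (- (2 * pi / sx\<^sup>2) * (y \<bullet> y))))"
  \<comment> \<open>The parameter p consists of the real position and the two imaginary parts.\<close>
  define F where "F = (\<lambda>(p :: (real ^ 'n) \<times> ((real ^ 'n) \<times> (real ^ 'n))) z :: (real ^ 'n) \<times> (real ^ 'n).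
     G1 ((2 * pi) *\<^sub>R snd (snd p), 0) (snd z + 0) * G2 (0, (4 * pi / sx\<^sup>2) *\<^sub>R fst (snd p)) (fst z + 0) *
     f ((fst z + (1/2) *\<^sub>R snd z) + fst p) * cnj (g ((fst z - (1/2) *\<^sub>R snd z) + fst p)))"
  define M' where "M' = (2 * pi + 4 * pi / sx\<^sup>2) * \<bar>M\<bar>"
  have M': "2 * pi * r \<le> M'" "4 * pi / sx\<^sup>2 * r \<le> M'" "0 \<le> M'" if "r \<le> M" for r
  proof -
    have "2 * pi * r \<le> 2 * pi * \<bar>M\<bar>" "4 * pi / sx\<^sup>2 * r \<le> 4 * pi / sx\<^sup>2 * \<bar>M\<bar>"
      using mult_left_mono[of r "\<bar>M\<bar>" "2 * pi"] mult_left_mono[of r "\<bar>M\<bar>" "4 * pi / sx\<^sup>2"] that by auto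
    moreover have "0 \<le> 2 * pi * \<bar>M\<bar>" "0 \<le> 4 * pi / sx\<^sup>2 * \<bar>M\<bar>" by auto
    ultimately show "2 * pi * r \<le> M'" "4 * pi / sx\<^sup>2 * r \<le> M'" "0 \<le> M'"
      unfolding M'_def distrib_right by linarith+
  qed
  have l: "linear (\<lambda>z::(real ^ 'n) \<times> (real ^ 'n). fst z + (1/2) *\<^sub>R snd z)"
    "linear (\<lambda>z::(real ^ 'n) \<times> (real ^ 'n). fst z - (1/2) *\<^sub>R snd z)"
    "linear (\<lambda>z::(real ^ 'n) \<times> (real ^ 'n). fst z)" "linear (\<lambda>z::(real ^ 'n) \<times> (real ^ 'n). snd z)"
    by (auto intro!: linearI simp: algebra_simps)
  have h1: "hrapid S (\<lambda>p (z :: (real ^ 'n) \<times> (real ^ 'n)). norm (snd z + 0)) (\<lambda>p z. G1 ((2 * pi) *\<^sub>R snd (snd p), 0) (snd z + 0))"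
  proof -
    have g: "hrapid {p. norm (fst p) \<le> M' \<and> norm (snd p) \<le> M'} (\<lambda>p y. norm y) G1"
      unfolding G1_def by (rule hrapid_gauss_lin) (use sk in simp)
    have m: "((2 * pi) *\<^sub>R snd (snd p), 0) \<in> {p. norm (fst p) \<le> M' \<and> norm (snd p) \<le> M'}" if "p \<in> S" for p
      using that M' by (auto simp: S_def)
    show ?thesis
      using hrapid_comp_affine[OF l(4) g, where \<theta>="\<lambda>p. ((2 * pi) *\<^sub>R snd (snd p), 0)" and s="\<lambda>_. 0" and S'=S, OF _ m] by simp
  qed
  have h2: "hrapid S (\<lambda>p (z :: (real ^ 'n) \<times> (real ^ 'n)). norm (fst z + 0)) (\<lambda>p z. G2 (0, (4 * pi / sx\<^sup>2) *\<^sub>R fst (snd p)) (fst z + 0))"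
  proof -
    have g: "hrapid {p. norm (fst p) \<le> M' \<and> norm (snd p) \<le> M'} (\<lambda>p y. norm y) G2"
      unfolding G2_def by (rule hrapid_gauss_lin) (use sx in simp)
    have m: "(0, (4 * pi / sx\<^sup>2) *\<^sub>R fst (snd p)) \<in> {p. norm (fst p) \<le> M' \<and> norm (snd p) \<le> M'}" if "p \<in> S" for p
      using that M' by (auto simp: S_def)
    show ?thesis
      using hrapid_comp_affine[OF l(3) g, where \<theta>="\<lambda>p. (0, (4 * pi / sx\<^sup>2) *\<^sub>R fst (snd p))" and s="\<lambda>_. 0" and S'=S, OF _ m] by simp
  qed
  have "hrapid S (\<lambda>p z. norm (snd z + 0) + norm (fst z + 0) + norm ((fst z + (1/2) *\<^sub>R snd z) + fst p)
      + norm ((fst z - (1/2) *\<^sub>R snd z) + fst p)) F"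
    unfolding F_def
    by (intro hrapid_mult h1 h2 hrapid_schwartz_affine[OF f l(1)] hrapid_schwartz_affine[OF schwartz_cnj[OF g] l(2)]) auto
  then have hF: "hrapid S (\<lambda>p z. norm (fst p) + norm z) F"
  proof (rule hrapid_weaken)
    fix p :: "(real ^ 'n) \<times> ((real ^ 'n) \<times> (real ^ 'n))" and z :: "(real ^ 'n) \<times> (real ^ 'n)"
    obtain u y where z: "z = (u, y)" by (cases z)
    have "fst p = ((u + (1/2) *\<^sub>R y) + fst p) - (u + (1/2) *\<^sub>R y)" by simp
    from arg_cong[OF this, of norm] have "norm (fst p) \<le> norm ((u + (1/2) *\<^sub>R y) + fst p) + (norm u + norm ((1/2) *\<^sub>R y))"
      using norm_triangle_ineq4[of "(u + (1/2) *\<^sub>R y) + fst p" "u + (1/2) *\<^sub>R y"] norm_triangle_ineq[of u "(1/2) *\<^sub>R y"] by linarith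
    moreover have "norm ((1/2) *\<^sub>R y) = norm y / 2" by simp
    moreover have "norm z \<le> norm u + norm y" unfolding z by (rule norm_Pair_le)
    ultimately show "norm (fst p) + norm z \<le> 2 * (1 + (norm (snd z + 0) + norm (fst z + 0) + norm ((fst z + (1/2) *\<^sub>R snd z) + fst p)
      + norm ((fst z - (1/2) *\<^sub>R snd z) + fst p)))"
      unfolding z fst_conv snd_conv add_0_right
      using norm_ge_zero[of u] norm_ge_zero[of y] norm_ge_zero[of "u + (1/2) *\<^sub>R y + fst p"] norm_ge_zero[of "u - (1/2) *\<^sub>R y + fst p"]
      by argo
  qed auto
  obtain C where C: "C \<ge> 0" "\<And>p \<eta>. p \<in> S \<Longrightarrow> (1 + norm \<eta>) ^ N * (1 + norm (fst p)) ^ N * cmod (fourier (F p) \<eta>) \<le> C"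
    using rapid_fourier_decay[OF hF norm_ge_zero, of N N] by blast
  define E where "E = exp (2 * pi / sx\<^sup>2 * M\<^sup>2)"
  have "(1 + norm (re_part z)) ^ N * cmod (wigner_ext z) \<le> cmod wigner_const * E * C" if z: "norm (im_part z) \<le> M" for z
  proof -
    define a \<alpha> b \<beta> where "a = fst (re_part z)" and "\<alpha> = fst (im_part z)" and "b = snd (re_part z)" and "\<beta> = snd (im_part z)"
    define p where "p = (a, (\<alpha>, \<beta>))"
    have n: "norm \<alpha> \<le> M" "norm \<beta> \<le> M"
      using norm_fst_le[of \<alpha> \<beta>] norm_snd_le[of \<beta> \<alpha>] z by (auto simp: \<alpha>_def \<beta>_def)
    have p: "p \<in> S" using n by (simp add: S_def p_def)
    have pw: "wigner_integrand a \<alpha> b \<beta> (q + (a, 0)) = cexp (2 * pi / sx\<^sup>2 * (\<alpha> \<bullet> \<alpha>)) 0 *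
        (exp (- (2 * pi * \<i> * of_real ((0, b) \<bullet> q))) * F p q)" for q
    proof -
      have e: "exp (- (2 * pi * \<i> * of_real ((0, b) \<bullet> q))) = cexp 0 (- (2 * pi * (b \<bullet> snd q)))"
        by (simp add: cexp_def inner_prod_def mult_ac)
      have g1: "G1 ((2 * pi) *\<^sub>R \<beta>, 0) (snd q + 0) = cexp (2 * pi * (\<beta> \<bullet> snd q) - pi * sk\<^sup>2 / 2 * (snd q \<bullet> snd q)) 0"
        by (simp add: G1_def cexp_def)
      have g2: "G2 (0, (4 * pi / sx\<^sup>2) *\<^sub>R \<alpha>) (fst q + 0) = cexp (- (2 * pi / sx\<^sup>2) * (fst q \<bullet> fst q)) (4 * pi / sx\<^sup>2 * (\<alpha> \<bullet> fst q))"
        by (simp add: G2_def cexp_def add.commute)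
      have r: "fst q + (1/2) *\<^sub>R snd q + a = fst q + a + (1/2) *\<^sub>R snd q" "fst q - (1/2) *\<^sub>R snd q + a = fst q + a - (1/2) *\<^sub>R snd q"
        by (simp_all add: algebra_simps)
      show ?thesis
        unfolding F_def p_def fst_conv snd_conv e g1 g2 r unfolding mult.assoc[of "cexp _ _"] mult.assoc[of _ "f _"] cexp_mult cexp_mult_assoc unfolding wigner_integrand_def fst_add snd_add fst_conv snd_conv add_0_right
        by (intro arg_cong2[where f="(*)"] arg_cong2[where f=cexp] refl) (simp_all add: algebra_simps)
    qed
    have "(\<integral>q. wigner_integrand a \<alpha> b \<beta> q \<partial>lborel) = (\<integral>q. wigner_integrand a \<alpha> b \<beta> (q + (a, 0)) \<partial>lborel)"
      by (rule integral_translate[OF wigner_integrand_measurable, symmetric])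
    also have "\<dots> = cexp (2 * pi / sx\<^sup>2 * (\<alpha> \<bullet> \<alpha>)) 0 * fourier (F p) (0, b)"
      unfolding pw fourier_def by simp
    finally have W: "cmod (wigner_ext z) = cmod wigner_const * (exp (2 * pi / sx\<^sup>2 * (\<alpha> \<bullet> \<alpha>)) * cmod (fourier (F p) (0, b)))"
      unfolding wigner_ext_def a_def[symmetric] \<alpha>_def[symmetric] b_def[symmetric] \<beta>_def[symmetric] by (simp add: norm_mult)
    have "\<alpha> \<bullet> \<alpha> \<le> M\<^sup>2" unfolding power2_norm_eq_inner[symmetric] using n(1) by (intro power_mono) auto
    then have E: "exp (2 * pi / sx\<^sup>2 * (\<alpha> \<bullet> \<alpha>)) \<le> E"
      unfolding E_def exp_le_cancel_iff by (rule mult_left_mono) simp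
    have "norm (re_part z) \<le> norm a + norm b"
      using norm_Pair_le[of a b] by (simp add: a_def b_def)
    then have "1 + norm (re_part z) \<le> (1 + norm b) * (1 + norm a)"
      by (intro one_plus_le_mult) auto
    then have "(1 + norm (re_part z)) ^ N \<le> (1 + norm b) ^ N * (1 + norm a) ^ N"
      unfolding power_mult_distrib[symmetric] by (intro power_mono) auto
    then have "(1 + norm (re_part z)) ^ N * cmod (fourier (F p) (0, b)) \<le> (1 + norm b) ^ N * (1 + norm a) ^ N * cmod (fourier (F p) (0, b))"
      by (intro mult_right_mono) auto
    also have "\<dots> \<le> C" using C(2)[OF p, of "(0, b)"] by (simp add: p_def)
    finally have "cmod wigner_const * exp (2 * pi / sx\<^sup>2 * (\<alpha> \<bullet> \<alpha>)) * ((1 + norm (re_part z)) ^ N * cmod (fourier (F p) (0, b))) \<le> cmod wigner_const * E * C"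
      using E by (intro mult_mono) (auto simp: E_def)
    then show ?thesis unfolding W by (simp add: mult_ac)
  qed
  moreover have "0 \<le> cmod wigner_const * E * C" using C(1) by (simp add: E_def)
  ultimately show ?thesis by blast
qed

end

section \<open>Slices of Schwartz functions and their Fourier transforms\<close>

lemma measurable_param_integral:
  fixes F :: "'a::euclidean_space \<times> 'b::euclidean_space \<Rightarrow> complex"
  assumes "F \<in> borel_measurable borel"
  shows "(\<lambda>x. \<integral>y. F (x, y) \<partial>lborel) \<in> borel_measurable borel"
proof -
  have "(\<lambda>(x, y). F (x, y)) \<in> borel_measurable (borel \<Otimes>\<^sub>M lborel)"
    using assms by (simp add: borel_prod[symmetric] cong: measurable_cong_sets)
  then show ?thesis by (rule lborel.borel_measurable_lebesgue_integral)
qed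

text \<open>Decay separately in each of two variables gives joint decay, as \<open>1 + norm (a, b)\<close> is at most the product
of \<open>1 + norm a\<close> and \<open>1 + norm b\<close>.\<close>
lemma prod_decay_tail:
  fixes F :: "'a::euclidean_space \<times> 'b::euclidean_space \<Rightarrow> complex"
  assumes "\<And>a b. (1 + norm a) ^ (2 * DIM('a \<times> 'b)) * (1 + norm b) ^ (2 * DIM('a \<times> 'b)) * cmod (F (a, b)) \<le> C"
  shows "cmod (F z) \<le> C * tail z"
proof (rule tail_bound)
  obtain a b where z: "z = (a, b)" by (cases z)
  have "1 + norm z \<le> (1 + norm a) * (1 + norm b)"
    using norm_Pair_le[of a b] by (intro one_plus_le_mult) (auto simp: z)
  then have "(1 + norm z) ^ (2 * DIM('a \<times> 'b)) \<le> (1 + norm a) ^ (2 * DIM('a \<times> 'b)) * (1 + norm b) ^ (2 * DIM('a \<times> 'b))"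
    unfolding power_mult_distrib[symmetric] by (intro power_mono) auto
  then show "(1 + norm z) ^ (2 * DIM('a \<times> 'b)) * cmod (F z) \<le> C"
    using assms[of a b] unfolding z by (meson mult_right_mono norm_ge_zero order_trans)
qed

lemma schwartz_tail:
  assumes "schwartz (F :: 'a::euclidean_space \<Rightarrow> complex)"
  obtains C where "C \<ge> 0" "\<And>z. cmod (F z) \<le> C * tail z"
proof -
  obtain C where C: "C \<ge> 0" "\<And>z. (1 + norm z) ^ (2 * DIM('a)) * cmod (F z) \<le> C"
    using rapidD[OF hered_imp[OF spec[OF schwartz_iff[THEN iffD1, OF assms]]]] by (metis UNIV_I)
  show ?thesis using that[OF C(1)] tail_bound[where F=F, OF C(2)] by blast
qed

lemma schwartz_integrable: "schwartz F \<Longrightarrow> integrable lborel F"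
  using schwartz_tail[of F] integrable_tail_bound[of F]
    borel_measurable_continuous_onI[OF schwartz_continuous] by metis

lemma schwartz_slice_tail:
  fixes F :: "'a::euclidean_space \<times> 'b::euclidean_space \<Rightarrow> complex"
  assumes "schwartz F"
  obtains C where "C \<ge> 0" "\<And>p q. cmod (F (p, q)) \<le> C * tail q"
proof -
  obtain C where C: "C \<ge> 0" "\<And>p q. (1 + (norm p + norm q)) ^ (2 * DIM('b)) * cmod (F (p, q)) \<le> C"
    using rapidD[OF hered_imp[OF spec[OF hrapid_freeze[OF assms]]]] by (metis UNIV_I)
  have "cmod (F (p, q)) \<le> C * tail q" for p q
  proof (rule tail_bound[where F="\<lambda>q. F (p, q)"])
    have "(1 + norm q) ^ (2 * DIM('b)) * cmod (F (p, q)) \<le> (1 + (norm p + norm q)) ^ (2 * DIM('b)) * cmod (F (p, q))"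
      by (intro mult_right_mono power_mono) auto
    then show "(1 + norm q) ^ (2 * DIM('b)) * cmod (F (p, q)) \<le> C" using C(2)[of p q] by linarith
  qed
  then show ?thesis using that C(1) by blast
qed

lemma schwartz_slice_continuous:
  fixes F :: "'a::euclidean_space \<times> 'b::euclidean_space \<Rightarrow> complex"
  assumes "schwartz F"
  shows "continuous_on UNIV (\<lambda>p. \<integral>q. F (p, q) \<partial>lborel)"
proof (rule continuous_param_integral)
  note c = continuous_on_compose2[OF schwartz_continuous[OF assms]]
  show "(\<lambda>q. F (p, q)) \<in> borel_measurable borel" for p
    by (intro borel_measurable_continuous_onI c continuous_intros) auto
  show "continuous_on UNIV (\<lambda>p. F (p, q))" for q by (intro c continuous_intros) auto
  obtain C where C: "C \<ge> 0" "\<And>p q. cmod (F (p, q)) \<le> C * tail q" using schwartz_slice_tail[OF assms] by blast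
  show "\<exists>e>0. \<exists>B. integrable lborel B \<and> (\<forall>p'\<in>ball p e. \<forall>q. cmod (F (p', q)) \<le> B q)" for p
    using C(2) by (intro exI[of _ 1] conjI exI[of _ "\<lambda>q. C * tail q"]) (auto intro: integrable_tail)
qed

lemma fourier_fst_slice:
  fixes F :: "'a::euclidean_space \<times> 'b::euclidean_space \<Rightarrow> complex"
  assumes "integrable lborel F"
  shows "fourier F (\<xi>, 0) = fourier (\<lambda>p. \<integral>q. F (p, q) \<partial>lborel) \<xi>"
proof -
  have [measurable]: "F \<in> borel_measurable borel" using assms by auto
  have "integrable lborel (\<lambda>z. exp (- (2 * pi * \<i> * of_real ((\<xi>, 0) \<bullet> z))) * F z)"
  proof (rule Bochner_Integration.integrable_bound[OF assms])
    have "(\<lambda>z::'a \<times> 'b. exp (- (2 * pi * \<i> * of_real ((\<xi>, 0) \<bullet> z)))) \<in> borel_measurable borel"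
      by (intro borel_measurable_continuous_onI continuous_intros)
    then show "(\<lambda>z. exp (- (2 * pi * \<i> * of_real ((\<xi>, 0) \<bullet> z))) * F z) \<in> borel_measurable lborel" by simp
  qed (simp add: norm_mult)
  from lborel_integral_fst[OF this] show ?thesis unfolding fourier_def by simp
qed

lemma fourier_inversion_reflected:
  fixes h :: "'a::euclidean_space \<Rightarrow> complex"
  assumes "integrable lborel h" "isCont h a" "integrable lborel (\<lambda>S. fourier h (- S))"
  shows "(\<integral>S. exp (- (2 * pi * \<i> * of_real (a \<bullet> S))) * fourier h (- S) \<partial>lborel) = h a"
proof -
  have [measurable]: "(\<lambda>S. fourier h (- S)) \<in> borel_measurable borel" using assms(3) by auto
  have "(\<lambda>S. fourier h (- (- S))) \<in> borel_measurable borel"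
    by (rule measurable_compose[of uminus borel borel "\<lambda>S. fourier h (- S)", simplified comp_def]) auto
  then have [measurable]: "fourier h \<in> borel_measurable borel" by simp
  have ih: "integrable lborel (fourier h)"
    using integrable_affine[of "fourier h" "-1" 0] assms(3) by simp
  define G where "G = (\<lambda>\<xi>. exp (2 * pi * \<i> * of_real (\<xi> \<bullet> a)) * fourier h \<xi>)"
  have "(\<lambda>\<xi>::'a. exp (2 * pi * \<i> * of_real (\<xi> \<bullet> a))) \<in> borel_measurable borel"
    by (intro borel_measurable_continuous_onI continuous_intros)
  then have "G \<in> borel_measurable borel" unfolding G_def by simp
  from integral_affine[OF this, of "-1" 0] have "(\<integral>S. G (- S) \<partial>lborel) = integral\<^sup>L lborel G" by simp
  also have "\<dots> = h a" unfolding G_def by (rule fourier_inversion[OF assms(1,2) ih])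
  finally show ?thesis by (simp add: G_def inner_commute)
qed

lemma schwartz_slice:
  fixes F :: "'a::euclidean_space \<times> 'b::euclidean_space \<Rightarrow> complex"
  assumes "schwartz F"
  shows "schwartz (\<lambda>q. F (p, q))"
proof (rule hrapid_imp_schwartz[where S=UNIV and F="\<lambda>p q. F (p, q)"])
  show "hrapid UNIV (\<lambda>_ q. norm q) (\<lambda>p q. F (p, q))"
    by (rule hrapid_weaken[OF hrapid_freeze[OF assms], where B=1]) auto
qed simp

lemma cexp_collect: "u * v * cexp A 0 * cexp B 0 * cexp 0 D = cexp (A + B) D * (u * v)"
proof -
  have "cexp (A + B) D = cexp A 0 * cexp B 0 * cexp 0 D" by (simp add: cexp_mult)
  then show ?thesis by (simp only: mult_ac)
qed

section \<open>The test function of the phase-space operator\<close>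

context wigner
begin

text \<open>The function of \<open>(S, T)\<close> that \<open>tilde_op\<close> pairs with the Fourier transform of the symbol
(\<open>tilde_integrand\<close>).\<close>
definition test_fun :: "real ^ 'n \<Rightarrow> real ^ 'n \<Rightarrow> complex" where
  "test_fun S T = wigner_const * fourier (\<lambda>p. Q (fst p) T (snd p)) (- S, 0)"

text \<open>The Fourier transform of \<open>test_fun\<close> (\<open>fourier_test_fun\<close>).\<close>
definition test_fun_hat :: "real ^ 'n \<Rightarrow> real ^ 'n \<Rightarrow> complex" where
  "test_fun_hat a b = wigner_const * fourier (\<lambda>p. Q a (fst p) (snd p)) (b, 0)"

lemma Q_schwartz_T: "schwartz (\<lambda>z. Q (fst (snd z)) (fst z) (snd (snd z)))"
proof -
  let ?A = "\<lambda>z::(real ^ 'n) \<times> ((real ^ 'n) \<times> (real ^ 'n)). ((fst (snd z), fst z), snd (snd z))"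
  have "norm z \<le> 3 * (1 + norm (?A z))" for z
  proof -
    have "norm z \<le> norm (fst z) + (norm (fst (snd z)) + norm (snd (snd z)))"
      using norm_Pair_le[of "fst z" "snd z"] norm_Pair_le[of "fst (snd z)" "snd (snd z)"] by simp
    moreover have "norm (fst (snd z)) \<le> norm (?A z)" "norm (fst z) \<le> norm (?A z)" "norm (snd (snd z)) \<le> norm (?A z)"
      using norm_fst_le[of "(fst (snd z), fst z)" "snd (snd z)"] norm_snd_le[of "snd (snd z)" "(fst (snd z), fst z)"]
        norm_fst_le[of "fst (snd z)" "fst z"] norm_snd_le[of "fst z" "fst (snd z)"] by linarith+
    ultimately show ?thesis by argo
  qed
  moreover have "linear ?A" by (rule linearI) auto
  ultimately show ?thesis using schwartz_linear[OF Q_schwartz, of ?A 3] by simp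
qed

lemma Q_schwartz_a: "schwartz (\<lambda>z. Q (fst z) (fst (snd z)) (snd (snd z)))"
proof -
  let ?A = "\<lambda>z::(real ^ 'n) \<times> ((real ^ 'n) \<times> (real ^ 'n)). ((fst z, fst (snd z)), snd (snd z))"
  have "norm z \<le> 3 * (1 + norm (?A z))" for z
  proof -
    have "norm z \<le> norm (fst z) + (norm (fst (snd z)) + norm (snd (snd z)))"
      using norm_Pair_le[of "fst z" "snd z"] norm_Pair_le[of "fst (snd z)" "snd (snd z)"] by simp
    moreover have "norm (fst (snd z)) \<le> norm (?A z)" "norm (fst z) \<le> norm (?A z)" "norm (snd (snd z)) \<le> norm (?A z)"
      using norm_fst_le[of "(fst z, fst (snd z))" "snd (snd z)"] norm_snd_le[of "snd (snd z)" "(fst z, fst (snd z))"]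
        norm_fst_le[of "fst z" "fst (snd z)"] norm_snd_le[of "fst (snd z)" "fst z"] by linarith+
    ultimately show ?thesis by argo
  qed
  moreover have "linear ?A" by (rule linearI) auto
  ultimately show ?thesis using schwartz_linear[OF Q_schwartz, of ?A 3] by simp
qed

lemma slice_fourier_decay:
  assumes "schwartz (F :: (real ^ 'n) \<times> ((real ^ 'n) \<times> (real ^ 'n)) \<Rightarrow> complex)"
  shows "\<exists>C\<ge>0. \<forall>p \<eta>. (1 + norm \<eta>) ^ N * (1 + norm p) ^ N * cmod (wigner_const * fourier (\<lambda>q. F (p, q)) (\<eta>, 0)) \<le> C"
proof -
  obtain C where C: "C \<ge> 0" "\<And>p \<eta>. (1 + norm \<eta>) ^ N * (1 + norm p) ^ N * cmod (fourier (\<lambda>q. F (p, q)) \<eta>) \<le> C"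
    using rapid_fourier_decay[OF hrapid_freeze[OF assms] norm_ge_zero, of N N] by blast
  have "(1 + norm \<eta>) ^ N * (1 + norm p) ^ N * cmod (wigner_const * fourier (\<lambda>q. F (p, q)) (\<eta>, 0)) \<le> cmod wigner_const * C" for p \<eta>
    using mult_left_mono[OF C(2)[of "(\<eta>, 0)" p] norm_ge_zero[of wigner_const]] by (simp add: norm_mult mult_ac norm_Pair)
  then show ?thesis using C(1) by (intro exI[of _ "cmod wigner_const * C"]) auto
qed

lemma test_fun_decay: "\<exists>C\<ge>0. \<forall>S T. (1 + norm S) ^ N * (1 + norm T) ^ N * cmod (test_fun S T) \<le> C"
proof -
  obtain C where C: "C \<ge> 0" "\<And>T \<eta>. (1 + norm \<eta>) ^ N * (1 + norm T) ^ N * cmod (wigner_const * fourier (\<lambda>q. Q (fst q) T (snd q)) (\<eta>, 0)) \<le> C"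
    using slice_fourier_decay[OF Q_schwartz_T, of N, unfolded fst_conv snd_conv] by blast
  have "(1 + norm S) ^ N * (1 + norm T) ^ N * cmod (test_fun S T) \<le> C" for S T
    using C(2)[of "- S" T] unfolding test_fun_def norm_minus_cancel .
  then show ?thesis using C(1) by blast
qed

lemma test_fun_hat_decay: "\<exists>C\<ge>0. \<forall>a b. (1 + norm a) ^ N * (1 + norm b) ^ N * cmod (test_fun_hat a b) \<le> C"
proof -
  obtain C where C: "C \<ge> 0" "\<And>a \<eta>. (1 + norm \<eta>) ^ N * (1 + norm a) ^ N * cmod (wigner_const * fourier (\<lambda>q. Q a (fst q) (snd q)) (\<eta>, 0)) \<le> C"
    using slice_fourier_decay[OF Q_schwartz_a, of N, unfolded fst_conv snd_conv] by blast
  have "(1 + norm a) ^ N * (1 + norm b) ^ N * cmod (test_fun_hat a b) \<le> C" for a b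
    using C(2)[of b a] unfolding test_fun_hat_def by (simp only: mult_ac)
  then show ?thesis using C(1) by blast
qed

lemma test_fun_measurable: "(\<lambda>z. test_fun (fst z) (snd z)) \<in> borel_measurable borel"
proof -
  have "(\<lambda>w. exp (- (2 * pi * \<i> * of_real ((- fst (fst w), 0) \<bullet> snd w))) * Q (fst (snd w)) (snd (fst w)) (snd (snd w))) \<in> borel_measurable borel"
    by (intro borel_measurable_continuous_onI continuous_intros
        continuous_on_compose2[OF schwartz_continuous[OF Q_schwartz_T], of _ "\<lambda>w. (snd (fst w), snd w)", simplified])
  from measurable_param_integral[OF this] show ?thesis
    unfolding test_fun_def fourier_def by simp
qed

lemma test_fun_integrable: "integrable lborel (\<lambda>z. test_fun (fst z) (snd z))"
proof -
  obtain C where C: "C \<ge> 0" "\<And>S T. (1 + norm S) ^ (2 * DIM((real ^ 'n) \<times> (real ^ 'n))) *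
      (1 + norm T) ^ (2 * DIM((real ^ 'n) \<times> (real ^ 'n))) * cmod (test_fun S T) \<le> C"
    using test_fun_decay by blast
  show ?thesis
  proof (rule integrable_tail_bound[OF test_fun_measurable])
    show "cmod (test_fun (fst z) (snd z)) \<le> C * tail z" for z
      by (rule prod_decay_tail[where F="\<lambda>z. test_fun (fst z) (snd z)"]) (use C(2) in simp)
  qed
qed

text \<open>For fixed \<open>T\<close>, \<open>test_fun\<close> is the reflected Fourier transform in \<open>a\<close> of the \<open>y\<close>-integral of \<open>Q\<close>, so
Fourier inversion in \<open>S\<close> restores that integral; the transform in \<open>T\<close> remains.\<close>
lemma fourier_test_fun: "fourier (\<lambda>z. test_fun (fst z) (snd z)) (a, b) = test_fun_hat a b"
proof -
  define R where "R = (\<lambda>T a. wigner_const * (\<integral>y. Q a T y \<partial>lborel))"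
  have sT: "schwartz (\<lambda>p. Q (fst p) T (snd p))" for T
    using schwartz_slice[OF Q_schwartz_T, of T] by simp
  have sa: "schwartz (\<lambda>p. Q a (fst p) (snd p))"
    using schwartz_slice[OF Q_schwartz_a, of a] by simp
  have phiR: "test_fun S T = fourier (R T) (- S)" for S T
    unfolding test_fun_def fourier_fst_slice[OF schwartz_integrable[OF sT]] unfolding R_def fourier_def
    by (simp add: mult.left_commute[of _ wigner_const])
  have R1: "integrable lborel (R T)" for T
    unfolding R_def using lborel_integrable_fst[OF schwartz_integrable[OF sT]] by simp
  have R2: "isCont (R T) a" for T
  proof -
    have "continuous_on UNIV (R T)" unfolding R_def
      using schwartz_slice_continuous[OF sT] by (intro continuous_intros) simp
    then show ?thesis by (rule continuous_on_interior) simp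
  qed
  obtain C where C: "C \<ge> 0" "\<And>S T. (1 + norm S) ^ (2 * DIM(real ^ 'n)) * (1 + norm T) ^ (2 * DIM(real ^ 'n)) * cmod (test_fun S T) \<le> C"
    using test_fun_decay by blast
  have R3: "integrable lborel (\<lambda>S. fourier (R T) (- S))" for T
  proof (rule integrable_tail_bound)
    have "(\<lambda>z. test_fun (fst z) (snd z)) \<in> borel_measurable (borel \<Otimes>\<^sub>M borel)" using test_fun_measurable by (simp add: borel_prod)
    then show "(\<lambda>S. fourier (R T) (- S)) \<in> borel_measurable borel"
      unfolding phiR[symmetric] using measurable_compose[of "\<lambda>S. (S, T)" borel "borel \<Otimes>\<^sub>M borel" "\<lambda>z. test_fun (fst z) (snd z)" borel] by simp
    show "cmod (fourier (R T) (- S)) \<le> C * tail S" for S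
    proof (rule tail_bound[where F="\<lambda>S. fourier (R T) (- S)"])
      have "1 \<le> (1 + norm T) ^ (2 * DIM(real ^ 'n))" by (rule one_le_power) simp
      then have "(1 + norm S) ^ (2 * DIM(real ^ 'n)) * cmod (test_fun S T) * 1 \<le>
          (1 + norm S) ^ (2 * DIM(real ^ 'n)) * cmod (test_fun S T) * (1 + norm T) ^ (2 * DIM(real ^ 'n))"
        by (rule mult_left_mono) auto
      then show "(1 + norm S) ^ (2 * DIM(real ^ 'n)) * cmod (fourier (R T) (- S)) \<le> C"
        using C(2)[of S T] unfolding phiR[symmetric] by (simp add: mult_ac)
    qed
  qed
  have inv: "(\<integral>S. exp (- (2 * pi * \<i> * of_real (a \<bullet> S))) * test_fun S T \<partial>lborel) = R T a" for T
    unfolding phiR by (rule fourier_inversion_reflected[OF R1 R2 R3])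
  have inner: "(\<integral>S. exp (- (2 * pi * \<i> * of_real ((a, b) \<bullet> (S, T)))) * test_fun S T \<partial>lborel) =
      exp (- (2 * pi * \<i> * of_real (b \<bullet> T))) * R T a" for T
  proof -
    have "exp (- (2 * pi * \<i> * of_real ((a, b) \<bullet> (S, T)))) * test_fun S T =
        exp (- (2 * pi * \<i> * of_real (b \<bullet> T))) * (exp (- (2 * pi * \<i> * of_real (a \<bullet> S))) * test_fun S T)" for S
      unfolding mult.assoc[symmetric] mult_exp_exp by (simp add: algebra_simps)
    then have "(\<integral>S. exp (- (2 * pi * \<i> * of_real ((a, b) \<bullet> (S, T)))) * test_fun S T \<partial>lborel) =
        (\<integral>S. exp (- (2 * pi * \<i> * of_real (b \<bullet> T))) * (exp (- (2 * pi * \<i> * of_real (a \<bullet> S))) * test_fun S T) \<partial>lborel)"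
      by (simp only:)
    also have "\<dots> = exp (- (2 * pi * \<i> * of_real (b \<bullet> T))) * (\<integral>S. exp (- (2 * pi * \<i> * of_real (a \<bullet> S))) * test_fun S T \<partial>lborel)"
      by (rule integral_mult_right_zero)
    finally show ?thesis unfolding inv .
  qed
  have "integrable lborel (\<lambda>z. exp (- (2 * pi * \<i> * of_real ((a, b) \<bullet> z))) * test_fun (fst z) (snd z))"
  proof (rule Bochner_Integration.integrable_bound[OF test_fun_integrable])
    have "(\<lambda>z::(real ^ 'n) \<times> (real ^ 'n). exp (- (2 * pi * \<i> * of_real ((a, b) \<bullet> z)))) \<in> borel_measurable borel"
      by (intro borel_measurable_continuous_onI continuous_intros)
    then show "(\<lambda>z. exp (- (2 * pi * \<i> * of_real ((a, b) \<bullet> z))) * test_fun (fst z) (snd z)) \<in> borel_measurable lborel"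
      using test_fun_measurable by simp
  qed (simp add: norm_mult)
  from lborel_integral_snd[OF this]
  have "fourier (\<lambda>z. test_fun (fst z) (snd z)) (a, b) =
      (\<integral>T. (\<integral>S. exp (- (2 * pi * \<i> * of_real ((a, b) \<bullet> (S, T)))) * test_fun S T \<partial>lborel) \<partial>lborel)"
    unfolding fourier_def by simp
  also have "\<dots> = (\<integral>T. exp (- (2 * pi * \<i> * of_real (b \<bullet> T))) * R T a \<partial>lborel)"
    by (simp only: inner)
  also have "(\<integral>T. exp (- (2 * pi * \<i> * of_real (b \<bullet> T))) * R T a \<partial>lborel) = test_fun_hat a b"
    unfolding test_fun_hat_def fourier_fst_slice[OF schwartz_integrable[OF sa]] unfolding fourier_def R_def
    by (simp add: mult.left_commute[of _ wigner_const])
  finally show ?thesis .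
qed

lemma half_simps:
  fixes a y T :: "real ^ 'n"
  shows "(a - (1/2) *\<^sub>R y) + (1/2) *\<^sub>R (y + T) = a + (1/2) *\<^sub>R T"
    "(a - (1/2) *\<^sub>R y) - (1/2) *\<^sub>R (y + T) = a - y - (1/2) *\<^sub>R T"
  by (simp_all add: vec_eq_iff field_simps)

text \<open>Translating \<open>y\<close> by \<open>T\<close> completes the square: the quadratic weight in \<open>S\<close> and \<open>T\<close> cancels exactly the
real exponents produced by the imaginary part of the argument, and what is left is \<open>Q\<close> times
a character.\<close>
lemma tilde_integrand:
  "exp (2 * pi * \<i> * of_real (S \<bullet> x + T \<bullet> k) - of_real (pi / 2 * (sx\<^sup>2 * (S \<bullet> S) + sk\<^sup>2 * (T \<bullet> T)))) *
     wigner_ext (cvec x + (1/2) *s (cvec T + (\<i> * of_real (sx\<^sup>2)) *s cvec S),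
         cvec k - (1/2) *s (cvec S - (\<i> * of_real (sk\<^sup>2)) *s cvec T)) = test_fun S T"
proof -
  let ?z = "(cvec x + (1/2) *s (cvec T + (\<i> * of_real (sx\<^sup>2)) *s cvec S),
         cvec k - (1/2) *s (cvec S - (\<i> * of_real (sk\<^sup>2)) *s cvec T))"
  define \<alpha> \<beta> where "\<alpha> = (sx\<^sup>2 / 2) *\<^sub>R S" and "\<beta> = (sk\<^sup>2 / 2) *\<^sub>R T"
  have z: "re_part ?z = (x + (1/2) *\<^sub>R T, k - (1/2) *\<^sub>R S)" "im_part ?z = (\<alpha>, \<beta>)"
    by (simp_all add: re_part_def im_part_def cvec_def vec_eq_iff \<alpha>_def \<beta>_def field_simps)
  define w where "w = wigner_integrand (x + (1/2) *\<^sub>R T) \<alpha> (k - (1/2) *\<^sub>R S) \<beta>"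
  have wm: "w \<in> borel_measurable borel" unfolding w_def by (rule wigner_integrand_measurable)
  have wc: "continuous_on UNIV w" unfolding w_def by (rule wigner_integrand_continuous)
  have m2: "(\<lambda>q. w (q + (0, T))) \<in> borel_measurable borel"
    by (intro borel_measurable_continuous_onI continuous_on_compose2[OF wc] continuous_intros) auto
  have "integral\<^sup>L lborel w = (\<integral>q. w (q + (0, T)) \<partial>lborel)"
    by (rule integral_translate[OF wm, symmetric])
  also have "\<dots> = (\<integral>q. w ((fst q + - ((1/2) *\<^sub>R snd q), snd q) + (0, T)) \<partial>lborel)"
    by (rule integral_shear[where s="\<lambda>y. - ((1/2) *\<^sub>R y)", OF _ m2, symmetric]) simp
  finally have W: "wigner_ext ?z = wigner_const * (\<integral>q. w (fst q - (1/2) *\<^sub>R snd q, snd q + T) \<partial>lborel)"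
    unfolding wigner_ext_def z fst_conv snd_conv w_def by simp
  define E where "E = exp (2 * pi * \<i> * of_real (S \<bullet> x + T \<bullet> k) - of_real (pi / 2 * (sx\<^sup>2 * (S \<bullet> S) + sk\<^sup>2 * (T \<bullet> T))))"
  have E: "E = cexp (- (pi / 2 * (sx\<^sup>2 * (S \<bullet> S) + sk\<^sup>2 * (T \<bullet> T)))) (2 * pi * (S \<bullet> x + T \<bullet> k))"
    by (simp add: E_def cexp_def algebra_simps)
  have pw: "E * w (fst q - (1/2) *\<^sub>R snd q, snd q + T) =
      exp (- (2 * pi * \<i> * of_real ((- S, 0) \<bullet> q))) * Q (fst q) T (snd q)" for q
  proof -
    obtain a y where q: "q = (a, y)" by (cases q)
    define V where "V = a - (1/2) *\<^sub>R y - (1/2) *\<^sub>R T - x"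
    have V: "a - (1/2) *\<^sub>R y - (x + (1/2) *\<^sub>R T) = V" by (simp add: V_def algebra_simps)
    have V2: "S \<bullet> V = S \<bullet> a - (S \<bullet> y) / 2 - (S \<bullet> T) / 2 - S \<bullet> x" by (simp add: V_def inner_diff_right)
    have sx2: "sx\<^sup>2 \<noteq> 0" using sx by simp
    have re: "- (pi / 2 * (sx\<^sup>2 * (S \<bullet> S) + sk\<^sup>2 * (T \<bullet> T))) + (2 * pi * (\<beta> \<bullet> (y + T)) + 2 * pi / sx\<^sup>2 * (\<alpha> \<bullet> \<alpha>)
        - pi * sk\<^sup>2 / 2 * ((y + T) \<bullet> (y + T)) - 2 * pi / sx\<^sup>2 * (V \<bullet> V)) =
      - (pi * sk\<^sup>2 / 2) * (y \<bullet> y) + - (2 * pi / sx\<^sup>2) * (V \<bullet> V)"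
    proof -
      have "2 * pi / sx\<^sup>2 * (\<alpha> \<bullet> \<alpha>) = pi / 2 * (sx\<^sup>2 * (S \<bullet> S))"
        using sx2 by (simp add: \<alpha>_def field_simps power2_eq_square)
      then show ?thesis unfolding \<open>_ = pi / 2 * (sx\<^sup>2 * (S \<bullet> S))\<close> by (simp add: \<beta>_def inner_add_left inner_add_right inner_commute[of T y] algebra_simps)
    qed
    have im: "2 * pi * (S \<bullet> x + T \<bullet> k) + (4 * pi / sx\<^sup>2 * (\<alpha> \<bullet> V) - 2 * pi * ((k - (1/2) *\<^sub>R S) \<bullet> (y + T))) =
        2 * pi * (S \<bullet> a) + - (2 * pi * (k \<bullet> y))"
    proof -
      have "4 * pi / sx\<^sup>2 * (\<alpha> \<bullet> V) = 2 * pi * (S \<bullet> V)" using sx2 by (simp add: \<alpha>_def)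
      then show ?thesis unfolding \<open>_ = 2 * pi * (S \<bullet> V)\<close> by (simp add: V2 inner_add_right inner_diff_left inner_commute[of T k] algebra_simps)
    qed
    have 1: "exp (- (2 * pi * \<i> * of_real ((- S, 0) \<bullet> q))) = cexp 0 (2 * pi * (S \<bullet> a))"
      by (simp add: cexp_def q inner_prod_def algebra_simps)
    have 2: "exp (\<i> * of_real (- (2 * pi * (k \<bullet> y)))) = cexp 0 (- (2 * pi * (k \<bullet> y)))"
      by (simp add: cexp_def)
    have "E * w (a - (1/2) *\<^sub>R y, y + T) = cexp (- (pi * sk\<^sup>2 / 2) * (y \<bullet> y) + - (2 * pi / sx\<^sup>2) * (V \<bullet> V)) (2 * pi * (S \<bullet> a) + - (2 * pi * (k \<bullet> y))) *
        (f (a + (1/2) *\<^sub>R T) * cnj (g (a - y - (1/2) *\<^sub>R T)))"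
      unfolding E w_def wigner_integrand_def fst_conv snd_conv V half_simps mult.assoc[symmetric] cexp_mult re im by (simp only: mult.assoc)
    also have "\<dots> = cexp 0 (2 * pi * (S \<bullet> a)) * Q a T y"
      unfolding Q_def V_def[symmetric] gk_cexp gx_cexp 2 cexp_collect mult.assoc[symmetric] cexp_mult
      by (simp only: add_0_left)
    finally show ?thesis unfolding 1[unfolded q] q fst_conv snd_conv .
  qed
  have "E * wigner_ext ?z = wigner_const * (\<integral>q. E * w (fst q - (1/2) *\<^sub>R snd q, snd q + T) \<partial>lborel)"
    unfolding W by simp
  then have "E * wigner_ext ?z = test_fun S T" unfolding pw test_fun_def fourier_def .
  then show ?thesis unfolding E_def .
qed

end

section \<open>The smoothed Wigner transform of a Weyl operator\<close>

lemma shear_snd: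
  fixes F :: "'a::euclidean_space \<times> 'b::euclidean_space \<Rightarrow> complex"
  assumes [measurable]: "s \<in> borel_measurable borel" and F: "F \<in> borel_measurable borel"
  shows integral_shear_snd: "(\<integral>z. F (fst z, snd z + s (fst z)) \<partial>lborel) = integral\<^sup>L lborel F"
    and integrable_shear_snd: "integrable lborel (\<lambda>z. F (fst z, snd z + s (fst z))) = integrable lborel F"
proof -
  have sw: "(\<lambda>z. (snd z, fst z)) \<in> borel \<rightarrow>\<^sub>M (borel :: ('x::euclidean_space \<times> 'y::euclidean_space) measure)"
    by (intro borel_measurable_continuous_onI continuous_intros)
  define F' where "F' = (\<lambda>z. F (snd z, fst z))"
  have F': "F' \<in> borel_measurable borel"
    unfolding F'_def using measurable_compose[OF sw F] by simp
  have "(\<lambda>z. (fst z + s (snd z), snd z)) \<in> borel \<Otimes>\<^sub>M borel \<rightarrow>\<^sub>M (borel \<Otimes>\<^sub>M borel :: ('b \<times> 'a) measure)"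
    by measurable
  then have "(\<lambda>z. (fst z + s (snd z), snd z)) \<in> borel \<rightarrow>\<^sub>M (borel :: ('b \<times> 'a) measure)"
    by (simp only: borel_prod)
  from measurable_compose[OF this F'] have F'': "(\<lambda>z. F' (fst z + s (snd z), snd z)) \<in> borel_measurable borel" .
  show "(\<integral>z. F (fst z, snd z + s (fst z)) \<partial>lborel) = integral\<^sup>L lborel F"
    using integral_swap[OF F''] integral_shear[OF assms(1) F'] integral_swap[OF F] by (simp add: F'_def)
  show "integrable lborel (\<lambda>z. F (fst z, snd z + s (fst z))) = integrable lborel F"
    using integrable_swap[OF F''] integrable_shear[OF assms(1) F'] integrable_swap[OF F] by (simp add: F'_def)
qed

lemma tail_power_bound:
  assumes "(1 + norm x) ^ (N + 2 * DIM('a)) * cmod (F x) \<le> C"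
  shows "(1 + norm (x :: 'a::euclidean_space)) ^ N * cmod (F x) \<le> C * tail x"
  using assms unfolding tail_def
  by (simp add: power_add field_simps add_pos_nonneg)

text \<open>The analytic properties of the symbol on which the argument rests; they hold for Fourier transforms of
compactly supported distributions.\<close>
locale wigner_symbol = wigner sx sk f g x k
  for sx sk :: real and f g :: "real ^ ('n::finite) \<Rightarrow> complex" and x k :: "real ^ 'n" +
  fixes L :: "(real ^ 'n) \<times> (real ^ 'n) \<Rightarrow> complex" and Lext :: "(complex ^ 'n) \<times> (complex ^ 'n) \<Rightarrow> complex"
    and N0 :: nat
  assumes L_moderate: "\<And>n. hered (\<lambda>F. \<exists>C\<ge>0. \<forall>z. cmod (F () z) \<le> C * (1 + norm z) ^ N0) n (\<lambda>_::unit. L)"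
    and Lext_real: "\<And>p. Lext (cvec2 p) = L p"
    and Lext_continuous: "continuous_on UNIV Lext"
    and Lext_line: "\<And>z h. (\<lambda>t. Lext (z + cscale t h)) holomorphic_on UNIV"
    and Lext_bound: "\<And>M. \<exists>C\<ge>0. \<forall>z. norm (im_part z) \<le> M \<longrightarrow> cmod (Lext z) \<le> C * (1 + norm z) ^ N0"
begin

lemma L_continuous: "continuous_on UNIV L"
  using hered_continuous_on[OF L_moderate] .

lemma L_bound: obtains C where "C \<ge> 0" "\<And>z. cmod (L z) \<le> C * (1 + norm z) ^ N0"
  using hered_imp[OF L_moderate[of 0]] by blast

definition I :: "real ^ 'n \<Rightarrow> real ^ 'n \<Rightarrow> complex" where
  "I p \<xi> = (\<integral>y. weyl_integrand L f p \<xi> y \<partial>lborel)"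

text \<open>The inner integral is a Fourier transform at the frequency \<open>\<xi>\<close> of a product of \<open>f\<close> with the symbol.
The symbol depends on \<open>p\<close> and \<open>\<xi>\<close> as well; dividing by \<open>(1 + norm (p, \<xi>)) ^ N0\<close> makes
the family rapidly decaying with uniform constants, and choosing the decay of the Fourier transform
large enough compensates the powers of \<open>\<xi>\<close> lost in the division.\<close>
lemma I_bound: "\<exists>C\<ge>0. \<forall>p \<xi>. cmod (I p \<xi>) \<le> C * (1 + norm p) ^ N0 * tail \<xi>"
proof -
  let ?q = "\<lambda>(p :: (real ^ 'n) \<times> (real ^ 'n)) (y :: real ^ 'n). norm y"
  define P' where "P' = (\<lambda>F :: (real ^ 'n) \<times> (real ^ 'n) \<Rightarrow> real ^ 'n \<Rightarrow> complex.
    \<exists>C\<ge>0. \<forall>p y. cmod (F p y) \<le> C * (1 + norm p) ^ N0 * (1 + norm y) ^ N0)"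
  have P'_add: "P' (\<lambda>p y. F p y + G p y)" if PF: "P' F" and PG: "P' G" for F G
  proof -
      obtain C where "C \<ge> 0" and C: "\<And>p y. cmod (F p y) \<le> C * (1 + norm p) ^ N0 * (1 + norm y) ^ N0"
      using PF unfolding P'_def by blast
    obtain D where "D \<ge> 0" and D: "\<And>p y. cmod (G p y) \<le> D * (1 + norm p) ^ N0 * (1 + norm y) ^ N0"
      using PG unfolding P'_def by blast
    have "cmod (F p y + G p y) \<le> (C + D) * (1 + norm p) ^ N0 * (1 + norm y) ^ N0" for p y
      using norm_triangle_ineq[of "F p y" "G p y"] C[of p y] D[of p y] by (simp add: distrib_right)
    then show ?thesis unfolding P'_def using \<open>C \<ge> 0\<close> \<open>D \<ge> 0\<close> by (intro exI[of _ "C + D"]) auto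
  qed
  have A: "linear (\<lambda>y::real ^ 'n. ((1/2) *\<^sub>R y, 0 :: real ^ 'n))" by (rule linearI) (auto simp: algebra_simps)
  have hL: "hered P' n (\<lambda>p y. L (((1/2) *\<^sub>R y, 0) + ((1/2) *\<^sub>R fst p, snd p)))" for n
  proof (rule hered_comp_affine[where P="\<lambda>F. \<exists>C\<ge>0. \<forall>z. cmod (F () z) \<le> C * (1 + norm z) ^ N0" and P'=P'
        and A="\<lambda>y. ((1/2) *\<^sub>R y, 0)" and F="\<lambda>_::unit. L" and \<theta>="\<lambda>_. ()" and s="\<lambda>p. ((1/2) *\<^sub>R fst p, snd p)"])
    show "linear (\<lambda>y::real ^ 'n. ((1/2) *\<^sub>R y, 0 :: real ^ 'n))" by (rule A)
    show "P' (\<lambda>p y. F p y + G p y)" if "P' F" "P' G" for F G using that by (rule P'_add)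
    show "hered (\<lambda>F. \<exists>C\<ge>0. \<forall>z. cmod (F () z) \<le> C * (1 + norm z) ^ N0) n (\<lambda>_::unit. L)" by (rule L_moderate)
    show "P' (\<lambda>p y. 0)" unfolding P'_def by (intro exI[of _ 0]) auto
    show "P' (\<lambda>p y. c * F p y)" if F: "P' F" for F c
    proof -
      obtain C where C: "C \<ge> 0" "\<And>p y. cmod (F p y) \<le> C * (1 + norm p) ^ N0 * (1 + norm y) ^ N0"
        using F unfolding P'_def by blast
      have "cmod (c * F p y) \<le> (cmod c * C) * (1 + norm p) ^ N0 * (1 + norm y) ^ N0" for p y
        using mult_left_mono[OF C(2)[of p y] norm_ge_zero[of c]] by (simp add: norm_mult mult.assoc)
      then show ?thesis unfolding P'_def using C(1) by (intro exI[of _ "cmod c * C"]) auto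
    qed
    fix F :: "unit \<Rightarrow> (real ^ 'n) \<times> (real ^ 'n) \<Rightarrow> complex" assume "\<exists>C\<ge>0. \<forall>z. cmod (F () z) \<le> C * (1 + norm z) ^ N0"
    then obtain C where C: "C \<ge> 0" "\<And>z. cmod (F () z) \<le> C * (1 + norm z) ^ N0" by blast
    have "cmod (F () (((1/2) *\<^sub>R y, 0) + ((1/2) *\<^sub>R fst p, snd p))) \<le> (C * 2 ^ N0) * (1 + norm p) ^ N0 * (1 + norm y) ^ N0" for p y
    proof -
      let ?z = "((1/2) *\<^sub>R y, 0) + ((1/2) *\<^sub>R fst p, snd p)"
      have "norm ?z \<le> norm ((1/2) *\<^sub>R y, 0 :: real ^ 'n) + norm ((1/2) *\<^sub>R fst p, snd p)" by (rule norm_triangle_ineq)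
      also have "norm ((1/2) *\<^sub>R fst p, snd p) \<le> norm ((1/2) *\<^sub>R fst p) + norm (snd p)" by (rule norm_Pair_le)
      finally have "norm ?z \<le> norm y + (norm p + norm p)"
        using norm_fst_le[of "fst p" "snd p"] norm_snd_le[of "snd p" "fst p"] norm_ge_zero[of y] norm_ge_zero[of "fst p"]
        by (simp del: norm_ge_zero)
      then have "1 + norm ?z \<le> (1 + norm y) * (1 + (norm p + norm p))" by (intro one_plus_le_mult) auto
      also have "\<dots> \<le> (1 + norm y) * (2 * (1 + norm p))" by (intro mult_left_mono) auto
      finally have "(1 + norm ?z) ^ N0 \<le> ((1 + norm y) * (2 * (1 + norm p))) ^ N0" by (intro power_mono) auto
      then have "C * (1 + norm ?z) ^ N0 \<le> C * ((1 + norm y) * (2 * (1 + norm p))) ^ N0" by (intro mult_left_mono C(1))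
      then show ?thesis using C(2)[of ?z] by (simp only: power_mult_distrib mult_ac)
    qed
    then show "P' (\<lambda>p y. F () (((1/2) *\<^sub>R y, 0) + ((1/2) *\<^sub>R fst p, snd p)))"
      unfolding P'_def using C(1) by (intro exI[of _ "C * 2 ^ N0"]) auto
  qed
  \<comment> \<open>The normalising factor that makes the symbol of moderate growth in y uniformly in p.\<close>
  define c where "c = (\<lambda>p :: (real ^ 'n) \<times> (real ^ 'n). complex_of_real (inverse ((1 + norm p) ^ N0)))"
  have nc: "cmod (c p) = inverse ((1 + norm p) ^ N0)" for p unfolding c_def norm_of_real by simp
  have pos: "0 < (1 + norm p) ^ N0" for p :: "(real ^ 'n) \<times> (real ^ 'n)" by (simp add: add_pos_nonneg)
  have m: "hmoderate UNIV ?q (\<lambda>p y. c p * L (((1/2) *\<^sub>R y, 0) + ((1/2) *\<^sub>R fst p, snd p)))"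
  proof
    fix n
    show "hered (moderate UNIV ?q) n (\<lambda>p y. c p * L (((1/2) *\<^sub>R y, 0) + ((1/2) *\<^sub>R fst p, snd p)))"
    proof (rule hered_mult[where ?P1.0="\<lambda>F. \<forall>p y. cmod (F p y) \<le> cmod (c p)" and ?P2.0=P' and P="moderate UNIV ?q"])
      show "hered (\<lambda>F. \<forall>p (y::real ^ 'n). cmod (F p y) \<le> cmod (c p)) n (\<lambda>p y. c p)"
        by (rule hered_const) auto
      show "moderate UNIV ?q (\<lambda>p y. F p y * G p y)" if F: "\<forall>p y. cmod (F p y) \<le> cmod (c p)" and G: "P' G" for F G
      proof -
        obtain C where C: "C \<ge> 0" "\<And>p y. cmod (G p y) \<le> C * (1 + norm p) ^ N0 * (1 + norm y) ^ N0"
          using G unfolding P'_def by blast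
        have "cmod (F p y * G p y) \<le> C * (1 + norm y) ^ N0" for p y
        proof -
          have "cmod (F p y * G p y) \<le> inverse ((1 + norm p) ^ N0) * (C * (1 + norm p) ^ N0 * (1 + norm y) ^ N0)"
            unfolding norm_mult using spec[OF spec[OF F, of p], of y, unfolded nc] pos[of p]
            by (intro mult_mono C(2)) (simp_all add: less_imp_le)
          also have "\<dots> = (inverse ((1 + norm p) ^ N0) * (1 + norm p) ^ N0) * (C * (1 + norm y) ^ N0)" by (simp only: mult_ac)
          also have "\<dots> = C * (1 + norm y) ^ N0" using left_inverse[OF less_imp_neq[OF pos[of p], symmetric]] by (simp only: mult_1_left)
          finally show ?thesis .
        qed
        then show ?thesis unfolding moderate_def by blast
      qed
    qed (use hL in \<open>auto intro: moderate_add\<close>)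
  qed
  have "hrapid UNIV (\<lambda>p y. norm (y + 0)) (\<lambda>(p :: (real ^ 'n) \<times> (real ^ 'n)) y. f (y + 0))"
    by (rule hrapid_schwartz_affine[OF f linear_ident])
  then have hf: "hrapid UNIV ?q (\<lambda>p. f)" by simp
  define F where "F = (\<lambda>p y. f y * (c p * L (((1/2) *\<^sub>R y, 0) + ((1/2) *\<^sub>R fst p, snd p))))"
  have "hrapid UNIV ?q F" unfolding F_def by (rule hrapid_moderate_mult[OF _ hf m]) simp
  then have hF: "hrapid UNIV (\<lambda>p y. 0 + norm y) F" by simp
  obtain C where C: "C \<ge> 0" "\<And>p \<eta>. (1 + norm \<eta>) ^ (N0 + 2 * DIM(real ^ 'n)) * cmod (fourier (F p) \<eta>) \<le> C"
    using rapid_fourier_decay[OF hF, of "N0 + 2 * DIM(real ^ 'n)" 0] by auto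
  have "cmod (I p \<xi>) \<le> C * (1 + norm p) ^ N0 * tail \<xi>" for p \<xi>
  proof -
    have pw: "weyl_integrand L f p \<xi> y = (exp (2 * pi * \<i> * of_real (\<xi> \<bullet> p)) * of_real ((1 + norm (p, \<xi>)) ^ N0)) *
        (exp (- (2 * pi * \<i> * of_real (\<xi> \<bullet> y))) * F (p, \<xi>) y)" for y
    proof -
      have "exp (2 * pi * \<i> * of_real (\<xi> \<bullet> (p - y))) = exp (2 * pi * \<i> * of_real (\<xi> \<bullet> p)) * exp (- (2 * pi * \<i> * of_real (\<xi> \<bullet> y)))"
        unfolding mult_exp_exp by (simp add: inner_diff_right algebra_simps)
      moreover have "of_real ((1 + norm (p, \<xi>)) ^ N0) * c (p, \<xi>) = 1"
        unfolding c_def of_real_mult[symmetric] right_inverse[OF less_imp_neq[OF pos[of "(p, \<xi>)"], symmetric]] by (rule of_real_1)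
      ultimately show ?thesis
        unfolding weyl_integrand_def F_def by (simp add: scaleR_add_right add.commute mult_ac)
    qed
    have "I p \<xi> = (exp (2 * pi * \<i> * of_real (\<xi> \<bullet> p)) * of_real ((1 + norm (p, \<xi>)) ^ N0)) * fourier (F (p, \<xi>)) \<xi>"
      unfolding I_def pw fourier_def by (rule integral_mult_right_zero)
    then have "cmod (I p \<xi>) = (1 + norm (p, \<xi>)) ^ N0 * cmod (fourier (F (p, \<xi>)) \<xi>)"
      by (simp add: norm_mult norm_power del: of_real_add)
    also have "\<dots> \<le> ((1 + norm p) * (1 + norm \<xi>)) ^ N0 * cmod (fourier (F (p, \<xi>)) \<xi>)"
      by (intro mult_right_mono power_mono one_plus_le_mult norm_Pair_le) auto
    also have "\<dots> = (1 + norm p) ^ N0 * ((1 + norm \<xi>) ^ N0 * cmod (fourier (F (p, \<xi>)) \<xi>))"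
      by (simp add: power_mult_distrib)
    also have "\<dots> \<le> (1 + norm p) ^ N0 * (C * tail \<xi>)"
      by (intro mult_left_mono tail_power_bound[where F="\<lambda>\<xi>'. fourier (F (p, \<xi>)) \<xi>'"] C(2)) auto
    finally show ?thesis by (simp add: mult_ac)
  qed
  then show ?thesis using C(1) by blast
qed

text \<open>The integrand of the Wigner transform without the first function, in the variables \<open>p = u + y / 2\<close>
and \<open>y\<close>.\<close>
definition A :: "real ^ 'n \<Rightarrow> real ^ 'n \<Rightarrow> complex" where
  "A p y = cnj (g (p - y)) * gk y * gx (p - (1/2) *\<^sub>R y - x) * exp (\<i> * of_real (- (2 * pi * (k \<bullet> y))))"

lemma A_schwartz: "schwartz (\<lambda>z. A (fst z) (snd z))"
proof -
  let ?A2 = "\<lambda>z::(real ^ 'n) \<times> (real ^ 'n). fst z - snd z"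
  let ?A4 = "\<lambda>z::(real ^ 'n) \<times> (real ^ 'n). fst z - (1/2) *\<^sub>R snd z"
  have l: "linear ?A2" "linear (\<lambda>z::(real ^ 'n) \<times> (real ^ 'n). snd z)" "linear ?A4"
    by (auto intro!: linearI simp: algebra_simps)
  note h = hrapid_schwartz_affine[where S="UNIV :: unit set"]
  have "hrapid UNIV (\<lambda>(p::unit) z. norm (?A2 z + 0) + norm (snd z + 0) + norm (?A4 z + (- x)))
     (\<lambda>(p::unit) z. cnj (g (?A2 z + 0)) * gk (snd z + 0) * gx (?A4 z + (- x)))"
    by (intro hrapid_mult h l gk_schwartz gx_schwartz schwartz_cnj[OF g]) auto
  then have "hrapid UNIV (\<lambda>(p::unit) z. norm z)
     (\<lambda>(p::unit) z. cnj (g (?A2 z + 0)) * gk (snd z + 0) * gx (?A4 z + (- x)))"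
  proof (rule hrapid_weaken)
    fix z :: "(real ^ 'n) \<times> (real ^ 'n)"
    obtain p y where z: "z = (p, y)" by (cases z)
    have "norm p \<le> norm (p - y) + norm y" using norm_triangle_ineq[of "p - y" y] by simp
    moreover have "norm z \<le> norm p + norm y" unfolding z by (rule norm_Pair_le)
    ultimately show "norm z \<le> 2 * (1 + (norm (?A2 z + 0) + norm (snd z + 0) + norm (?A4 z + (- x))))"
      unfolding z fst_conv snd_conv add_0_right
      using norm_ge_zero[of "p - y"] norm_ge_zero[of y] norm_ge_zero[of "p - (1/2) *\<^sub>R y + - x"] by argo
  qed auto
  then have 1: "schwartz (\<lambda>z. cnj (g (?A2 z)) * gk (snd z) * gx (?A4 z - x))"
    by (intro schwartz_iff[THEN iffD2]) simp
  have 2: "bounded_linear (\<lambda>z::(real ^ 'n) \<times> (real ^ 'n). - (2 * pi * (k \<bullet> snd z)))"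
    by (auto intro!: bounded_linear_minus bounded_linear_const_mult bounded_linear_inner_right_comp bounded_linear_snd)
  show ?thesis using schwartz_char_mult[OF 1 2] by (simp add: A_def)
qed

text \<open>The kernel of the linear functional that maps a function \<open>h\<close> to its smoothed Wigner transform with
\<open>g\<close> at \<open>(x, k)\<close>.\<close>
definition J :: "real ^ 'n \<Rightarrow> complex" where "J p = (\<integral>y. A p y \<partial>lborel)"

lemma J_continuous: "continuous_on UNIV J"
  using schwartz_slice_continuous[OF A_schwartz] unfolding J_def by simp

lemma J_bound: "\<exists>C\<ge>0. \<forall>p. (1 + norm p) ^ N0 * cmod (J p) \<le> C * tail p"
proof -
  obtain C where C: "C \<ge> 0" "\<And>p \<eta>. (1 + norm \<eta>) ^ 0 * (1 + norm p) ^ (N0 + 2 * DIM(real ^ 'n)) *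
      cmod (fourier (\<lambda>y. A p y) \<eta>) \<le> C"
    using rapid_fourier_decay[OF hrapid_freeze[OF A_schwartz] norm_ge_zero, of 0 "N0 + 2 * DIM(real ^ 'n)", unfolded fst_conv snd_conv] by blast
  have "(1 + norm p) ^ N0 * cmod (J p) \<le> C * tail p" for p
    by (rule tail_power_bound) (use C(2)[of 0 p] in \<open>simp add: fourier_def J_def\<close>)
  then show ?thesis using C(1) by blast
qed

lemma f_bound: "\<exists>C\<ge>0. \<forall>p. (1 + norm p) ^ N0 * cmod (f p) \<le> C * tail p"
proof -
  obtain C where C: "C \<ge> 0" "\<And>p. (1 + norm p) ^ (N0 + 2 * DIM(real ^ 'n)) * cmod (f p) \<le> C"
    using rapidD[OF hered_imp[OF spec[OF schwartz_iff[THEN iffD1, OF f]]]] by (metis UNIV_I)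
  then show ?thesis using tail_power_bound[where F=f] by blast
qed

lemma Q_integral: "(\<integral>y. Q a T y \<partial>lborel) = f (a + (1/2) *\<^sub>R T) * J (a - (1/2) *\<^sub>R T)"
proof -
  have "Q a T y = f (a + (1/2) *\<^sub>R T) * A (a - (1/2) *\<^sub>R T) y" for y
  proof -
    have "a - (1/2) *\<^sub>R T - y = a - y - (1/2) *\<^sub>R T"
      "a - (1/2) *\<^sub>R T - (1/2) *\<^sub>R y - x = a - (1/2) *\<^sub>R y - (1/2) *\<^sub>R T - x" by (simp_all add: algebra_simps)
    then show ?thesis unfolding Q_def A_def by (simp only: mult.assoc)
  qed
  then show ?thesis unfolding J_def by simp
qed

text \<open>Integrating \<open>Q\<close> over \<open>y\<close> leaves the product of \<open>f\<close> and \<open>J\<close> at two points with midpoint \<open>a\<close> and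
difference \<open>T\<close>.\<close>
lemma test_fun_hat_eq: "test_fun_hat a b = wigner_const * (\<integral>T. exp (- (2 * pi * \<i> * of_real (b \<bullet> T))) * (f (a + (1/2) *\<^sub>R T) * J (a - (1/2) *\<^sub>R T)) \<partial>lborel)"
proof -
  have "schwartz (\<lambda>p. Q a (fst p) (snd p))" using schwartz_slice[OF Q_schwartz_a, of a] by simp
  from fourier_fst_slice[OF schwartz_integrable[OF this]] show ?thesis
    unfolding test_fun_hat_def by (simp add: Q_integral fourier_def)
qed

lemma test_fun_hat_measurable: "(\<lambda>z. test_fun_hat (fst z) (snd z)) \<in> borel_measurable borel"
proof -
  have "(\<lambda>w. exp (- (2 * pi * \<i> * of_real (snd (fst w) \<bullet> snd w))) * (f (fst (fst w) + (1/2) *\<^sub>R snd w) * J (fst (fst w) - (1/2) *\<^sub>R snd w)))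
     \<in> borel_measurable (borel :: (((real ^ 'n) \<times> (real ^ 'n)) \<times> (real ^ 'n)) measure)"
    by (intro borel_measurable_continuous_onI continuous_intros continuous_on_compose2[OF J_continuous]
        continuous_on_compose2[OF schwartz_continuous[OF f]]) auto
  from measurable_param_integral[OF this] show ?thesis unfolding test_fun_hat_eq by simp
qed

lemma L_test_fun_hat_integrable: "integrable lborel (\<lambda>z. L z * test_fun_hat (fst z) (snd z))"
proof -
  let ?D = "N0 + 2 * DIM((real ^ 'n) \<times> (real ^ 'n))"
  obtain C where C: "C \<ge> 0" "\<And>z. cmod (L z) \<le> C * (1 + norm z) ^ N0" using L_bound by blast
  obtain E where E: "E \<ge> 0" "\<And>a b. (1 + norm a) ^ ?D * (1 + norm b) ^ ?D * cmod (test_fun_hat a b) \<le> E"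
    using test_fun_hat_decay by blast
  show ?thesis
  proof (rule integrable_tail_bound)
    show "(\<lambda>z. L z * test_fun_hat (fst z) (snd z)) \<in> borel_measurable borel"
      using test_fun_hat_measurable borel_measurable_continuous_onI[OF L_continuous] by measurable
    fix z :: "(real ^ 'n) \<times> (real ^ 'n)"
    have "1 + norm z \<le> (1 + norm (fst z)) * (1 + norm (snd z))"
      using norm_Pair_le[of "fst z" "snd z"] by (intro one_plus_le_mult) auto
    then have "(1 + norm z) ^ ?D \<le> (1 + norm (fst z)) ^ ?D * (1 + norm (snd z)) ^ ?D"
      unfolding power_mult_distrib[symmetric] by (intro power_mono) auto
    then have "(1 + norm z) ^ ?D * cmod (test_fun_hat (fst z) (snd z)) \<le> E"
      using E(2)[of "fst z" "snd z"] by (meson mult_right_mono norm_ge_zero order_trans)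
    then have 1: "(1 + norm z) ^ N0 * cmod (test_fun_hat (fst z) (snd z)) \<le> E * tail z"
      by (rule tail_power_bound[where F="\<lambda>z. test_fun_hat (fst z) (snd z)"])
    have "cmod (L z * test_fun_hat (fst z) (snd z)) \<le> C * ((1 + norm z) ^ N0 * cmod (test_fun_hat (fst z) (snd z)))"
      unfolding norm_mult using mult_right_mono[OF C(2)[of z], of "cmod (test_fun_hat (fst z) (snd z))"] by (simp add: mult_ac)
    also have "\<dots> \<le> C * (E * tail z)" by (rule mult_left_mono[OF 1 C(1)])
    finally show "cmod (L z * test_fun_hat (fst z) (snd z)) \<le> (C * E) * tail z" by (simp add: mult_ac)
  qed
qed

text \<open>The polynomial bound on \<open>h\<close> is the one that \<open>weyl_op L f\<close> inherits from the symbol.\<close>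
lemma smoothed_wigner_A:
  assumes h: "h \<in> borel_measurable borel" and hb: "\<And>p. cmod (h p) \<le> B * (1 + norm p) ^ N0"
  shows "smoothed_wigner sx sk h g (x, k) = wigner_const * (\<integral>p. J p * h p \<partial>lborel)"
proof -
  note cA = continuous_on_compose2[OF schwartz_continuous[OF A_schwartz], of _ "\<lambda>z. (fst z, snd z)", simplified]
  define G where "G = (\<lambda>z. A (fst z) (snd z) * h (fst z))"
  have G: "G \<in> borel_measurable borel"
  proof -
    have "(\<lambda>z. A (fst z) (snd z)) \<in> borel_measurable (borel \<Otimes>\<^sub>M borel)"
      using borel_measurable_continuous_onI[OF schwartz_continuous[OF A_schwartz]] by (simp add: borel_prod)
    then have "G \<in> borel_measurable (borel \<Otimes>\<^sub>M borel)" unfolding G_def using h by measurable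
    then show ?thesis by (simp add: borel_prod)
  qed
  have iG: "integrable lborel G"
  proof -
    obtain C where C: "C \<ge> 0" "\<And>z. (1 + norm z) ^ (N0 + 2 * DIM((real ^ 'n) \<times> (real ^ 'n))) * cmod (A (fst z) (snd z)) \<le> C"
      using rapidD[OF hered_imp[OF spec[OF schwartz_iff[THEN iffD1, OF A_schwartz]]]] by (metis UNIV_I)
    show ?thesis
    proof (rule integrable_tail_bound[OF G])
      fix z :: "(real ^ 'n) \<times> (real ^ 'n)"
      have 1: "(1 + norm z) ^ N0 * cmod (A (fst z) (snd z)) \<le> C * tail z"
        by (rule tail_power_bound[where F="\<lambda>z. A (fst z) (snd z)", OF C(2)])
      have "(1 + norm (fst z)) ^ N0 \<le> (1 + norm z) ^ N0"
        using norm_fst_le[of "fst z" "snd z"] by (intro power_mono) auto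
      then have "\<bar>B\<bar> * (1 + norm (fst z)) ^ N0 \<le> \<bar>B\<bar> * (1 + norm z) ^ N0" by (intro mult_left_mono) auto
      moreover have "B * (1 + norm (fst z)) ^ N0 \<le> \<bar>B\<bar> * (1 + norm (fst z)) ^ N0" by (intro mult_right_mono) auto
      ultimately have "cmod (h (fst z)) \<le> \<bar>B\<bar> * (1 + norm z) ^ N0" using hb[of "fst z"] by linarith
      then have "cmod (G z) \<le> cmod (A (fst z) (snd z)) * (\<bar>B\<bar> * (1 + norm z) ^ N0)"
        unfolding G_def norm_mult by (intro mult_left_mono) auto
      also have "\<dots> \<le> \<bar>B\<bar> * (C * tail z)" using mult_left_mono[OF 1, of "\<bar>B\<bar>"] by (simp add: mult_ac)
      finally show "cmod (G z) \<le> (\<bar>B\<bar> * C) * tail z" by (simp add: mult_ac)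
    qed
  qed
  have "exp (- (2 * pi * \<i> * of_real (k \<bullet> y)) - of_real (pi * sk\<^sup>2 * (y \<bullet> y) / 2)
      - of_real (2 * pi * ((u - x) \<bullet> (u - x)) / sx\<^sup>2)) * h (u + (1/2) *\<^sub>R y) * cnj (g (u - (1/2) *\<^sub>R y)) =
    G (u + (1/2) *\<^sub>R y, y)" for u y
  proof -
    have "u + (1/2) *\<^sub>R y - (1/2) *\<^sub>R y - x = u - x" "u + (1/2) *\<^sub>R y - y = u - (1/2) *\<^sub>R y"
      by (simp_all add: vec_eq_iff field_simps)
    moreover have "exp (- (2 * pi * \<i> * of_real (k \<bullet> y)) - of_real (pi * sk\<^sup>2 * (y \<bullet> y) / 2) - of_real (2 * pi * ((u - x) \<bullet> (u - x)) / sx\<^sup>2)) =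
        gk y * gx (u - x) * exp (\<i> * of_real (- (2 * pi * (k \<bullet> y))))"
    proof -
      define t where "t = (u - x) \<bullet> (u - x)"
      show ?thesis unfolding gk_def gx_def mult_exp_exp t_def[symmetric]
        by (rule arg_cong[where f=exp]) (simp add: algebra_simps)
    qed
    ultimately show ?thesis unfolding G_def A_def fst_conv snd_conv by (simp only: mult_ac)
  qed
  then have "smoothed_wigner sx sk h g (x, k) = wigner_const * (\<integral>z. G (fst z + (1/2) *\<^sub>R snd z, snd z) \<partial>lborel)"
    unfolding smoothed_wigner_def wigner_const_def by (simp add: case_prod_unfold)
  also have "(\<integral>z. G (fst z + (1/2) *\<^sub>R snd z, snd z) \<partial>lborel) = integral\<^sup>L lborel G"
    by (rule integral_shear[OF _ G]) simp
  also have "\<dots> = (\<integral>p. J p * h p \<partial>lborel)"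
    unfolding lborel_integral_fst[OF iG, symmetric] by (simp add: G_def J_def)
  finally show ?thesis .
qed

lemma I_measurable: "(\<lambda>z. I (fst z) (snd z)) \<in> borel_measurable borel"
proof -
  have "(\<lambda>w. weyl_integrand L f (fst (fst w)) (snd (fst w)) (snd w))
     \<in> borel_measurable (borel :: (((real ^ 'n) \<times> (real ^ 'n)) \<times> (real ^ 'n)) measure)"
    unfolding weyl_integrand_def
    by (intro borel_measurable_continuous_onI continuous_intros continuous_on_compose2[OF L_continuous]
        continuous_on_compose2[OF schwartz_continuous[OF f]]) auto
  from measurable_param_integral[OF this] show ?thesis unfolding I_def by simp
qed

text \<open>The transform is an integral over the position \<open>p\<close> of the output, the momentum \<open>\<xi>\<close> and the position
\<open>y\<close> of the input.  Moving the momentum integral outside and replacing \<open>(y, p)\<close> by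
difference and midpoint frees the symbol of one variable.\<close>
lemma wigner_of_weyl:
  "smoothed_wigner sx sk (weyl_op L f) g (x, k) = (\<integral>z. L z * test_fun_hat (fst z) (snd z) \<partial>lborel)"
proof -
  obtain C1 where C1: "C1 \<ge> 0" "\<And>p \<xi>. cmod (I p \<xi>) \<le> C1 * (1 + norm p) ^ N0 * tail \<xi>" using I_bound by blast
  obtain C2 where C2: "C2 \<ge> 0" "\<And>p. (1 + norm p) ^ N0 * cmod (J p) \<le> C2 * tail p" using J_bound by blast
  obtain C3 where C3: "C3 \<ge> 0" "\<And>p. (1 + norm p) ^ N0 * cmod (f p) \<le> C3 * tail p" using f_bound by blast
  obtain C4 where C4: "C4 \<ge> 0" "\<And>z. cmod (L z) \<le> C4 * (1 + norm z) ^ N0" using L_bound by blast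
  have mJ: "J \<in> borel_measurable borel" by (rule borel_measurable_continuous_onI[OF J_continuous])
  have W: "weyl_op L f p = (\<integral>\<xi>. I p \<xi> \<partial>lborel)" for p by (simp add: weyl_op_def I_def)
  define B where "B = C1 * integral\<^sup>L lborel (tail :: real ^ 'n \<Rightarrow> real)"
  have "smoothed_wigner sx sk (weyl_op L f) g (x, k) = wigner_const * (\<integral>p. J p * weyl_op L f p \<partial>lborel)"
  proof (rule smoothed_wigner_A)
    show "weyl_op L f \<in> borel_measurable borel"
      using measurable_param_integral[OF I_measurable] unfolding W[abs_def] by simp
    show "cmod (weyl_op L f p) \<le> B * (1 + norm p) ^ N0" for p
    proof -
      have i: "integrable lborel (\<lambda>\<xi>. C1 * (1 + norm p) ^ N0 * tail (\<xi> :: real ^ 'n))"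
        by (intro integrable_mult_right integrable_tail)
      have "(\<lambda>\<xi>. (p, \<xi>)) \<in> borel \<rightarrow>\<^sub>M borel"
        by (intro borel_measurable_continuous_onI continuous_intros)
      from measurable_compose[OF this I_measurable] have "integrable lborel (I p)"
        by (intro integrable_tail_bound[OF _ C1(2)[of p]]) simp
      then have "(\<integral>\<xi>. cmod (I p \<xi>) \<partial>lborel) \<le> (\<integral>\<xi>. C1 * (1 + norm p) ^ N0 * tail (\<xi> :: real ^ 'n) \<partial>lborel)"
        by (intro integral_mono integrable_norm i C1(2))
      then have "cmod (weyl_op L f p) \<le> (\<integral>\<xi>. C1 * (1 + norm p) ^ N0 * tail (\<xi> :: real ^ 'n) \<partial>lborel)"
        unfolding W by (rule order_trans[OF integral_norm_bound])
      then show ?thesis by (simp add: B_def mult_ac)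
    qed
  qed
  also have "(\<integral>p. J p * weyl_op L f p \<partial>lborel) = (\<integral>p. (\<integral>\<xi>. J p * I p \<xi> \<partial>lborel) \<partial>lborel)"
    unfolding W by simp
  also have "\<dots> = (\<integral>\<xi>. (\<integral>p. J p * I p \<xi> \<partial>lborel) \<partial>lborel)"
  proof -
    have "integrable lborel (\<lambda>z. J (fst z) * I (fst z) (snd z))"
    proof (rule Bochner_Integration.integrable_bound[OF integrable_tensor[OF integrable_mult_right[OF integrable_tail, of "C1 * C2"] integrable_tail]])
      have "(\<lambda>z. J (fst z)) \<in> borel_measurable (borel :: ((real ^ 'n) \<times> (real ^ 'n)) measure)"
        by (intro borel_measurable_continuous_onI continuous_on_compose2[OF J_continuous] continuous_intros) auto
      then show "(\<lambda>z. J (fst z) * I (fst z) (snd z)) \<in> borel_measurable lborel" using I_measurable by simp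
      have "cmod (J p * I p \<xi>) \<le> C1 * C2 * tail p * tail \<xi>" for p \<xi>
      proof -
        have "cmod (J p * I p \<xi>) \<le> cmod (J p) * (C1 * (1 + norm p) ^ N0 * tail \<xi>)"
          unfolding norm_mult by (intro mult_left_mono C1(2)) auto
        also have "\<dots> = (C1 * tail \<xi>) * ((1 + norm p) ^ N0 * cmod (J p))" by (simp only: mult_ac)
        also have "\<dots> \<le> (C1 * tail \<xi>) * (C2 * tail p)"
          using C1(1) tail_pos[of \<xi>] by (intro mult_left_mono C2(2)) auto
        finally show ?thesis by (simp only: mult_ac)
      qed
      then show "AE z in lborel. norm (J (fst z) * I (fst z) (snd z)) \<le> norm (C1 * C2 * tail (fst z) * tail (snd z))"
        by (intro AE_I2, unfold real_norm_def) (rule order_trans[OF _ abs_ge_self])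
    qed
    from lborel_integral_fst[OF this] lborel_integral_snd[OF this] show ?thesis by simp
  qed
  also have "\<dots> = (\<integral>\<xi>. (\<integral>a. L (a, \<xi>) * (\<integral>T. exp (- (2 * pi * \<i> * of_real (\<xi> \<bullet> T))) * (f (a + (1/2) *\<^sub>R T) * J (a - (1/2) *\<^sub>R T)) \<partial>lborel) \<partial>lborel) \<partial>lborel)"
  proof -
    have "(\<integral>p. J p * I p \<xi> \<partial>lborel) = (\<integral>a. L (a, \<xi>) * (\<integral>T. exp (- (2 * pi * \<i> * of_real (\<xi> \<bullet> T))) * (f (a + (1/2) *\<^sub>R T) * J (a - (1/2) *\<^sub>R T)) \<partial>lborel) \<partial>lborel)" for \<xi>
    proof -
      define K where "K = (\<lambda>z. J (snd z) * weyl_integrand L f (snd z) \<xi> (fst z))"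
      define Z where "Z = (\<lambda>z. L (snd z, \<xi>) * (exp (- (2 * pi * \<i> * of_real (\<xi> \<bullet> fst z))) * (f (snd z + (1/2) *\<^sub>R fst z) * J (snd z - (1/2) *\<^sub>R fst z))))"
      have K: "K \<in> borel_measurable borel"
        unfolding K_def weyl_integrand_def
        by (intro borel_measurable_continuous_onI continuous_intros continuous_on_compose2[OF L_continuous]
            continuous_on_compose2[OF J_continuous] continuous_on_compose2[OF schwartz_continuous[OF f]]) auto
      have iK: "integrable lborel K"
      proof (rule Bochner_Integration.integrable_bound[OF integrable_tensor[OF integrable_mult_right[OF integrable_tail, of "C4 * (1 + norm \<xi>) ^ N0 * C3 * C2"] integrable_tail]])
        have "cmod (K (y, p)) \<le> C4 * (1 + norm \<xi>) ^ N0 * C3 * C2 * tail y * tail p" for y p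
        proof -
          have "norm ((1/2) *\<^sub>R (p + y), \<xi>) \<le> norm ((1/2) *\<^sub>R (p + y)) + norm \<xi>" by (rule norm_Pair_le)
          also have "norm ((1/2) *\<^sub>R (p + y)) \<le> norm p + norm y"
            using norm_triangle_ineq[of p y] norm_ge_zero[of p] norm_ge_zero[of y] by (simp del: norm_ge_zero)
          finally have "1 + norm ((1/2) *\<^sub>R (p + y), \<xi>) \<le> (1 + (norm p + norm y)) * (1 + norm \<xi>)"
            by (intro one_plus_le_mult) auto
          also have "\<dots> \<le> ((1 + norm p) * (1 + norm y)) * (1 + norm \<xi>)"
            by (intro mult_right_mono one_plus_le_mult) auto
          finally have "(1 + norm ((1/2) *\<^sub>R (p + y), \<xi>)) ^ N0 \<le> (((1 + norm p) * (1 + norm y)) * (1 + norm \<xi>)) ^ N0"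
            by (intro power_mono) auto
          then have "C4 * (1 + norm ((1/2) *\<^sub>R (p + y), \<xi>)) ^ N0 \<le> C4 * (((1 + norm p) * (1 + norm y)) * (1 + norm \<xi>)) ^ N0"
            by (rule mult_left_mono[OF _ C4(1)])
          then have "cmod (L ((1/2) *\<^sub>R (p + y), \<xi>)) \<le> C4 * ((1 + norm p) ^ N0 * (1 + norm y) ^ N0 * (1 + norm \<xi>) ^ N0)"
            using C4(2)[of "((1/2) *\<^sub>R (p + y), \<xi>)"] by (simp only: power_mult_distrib)
          then have "cmod (K (y, p)) \<le> cmod (J p) * (C4 * ((1 + norm p) ^ N0 * (1 + norm y) ^ N0 * (1 + norm \<xi>) ^ N0) * cmod (f y))"
            unfolding K_def weyl_integrand_def by (simp add: norm_mult mult_left_mono mult_right_mono)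
          also have "\<dots> = (C4 * (1 + norm \<xi>) ^ N0) * (((1 + norm p) ^ N0 * cmod (J p)) * ((1 + norm y) ^ N0 * cmod (f y)))"
            by (simp only: mult_ac)
          also have "\<dots> \<le> (C4 * (1 + norm \<xi>) ^ N0) * ((C2 * tail p) * (C3 * tail y))"
            using C4(1) C2(1) tail_pos[of p] by (intro mult_left_mono mult_mono[OF C2(2) C3(2)]) auto
          finally show ?thesis by (simp only: mult_ac)
        qed
        then show "AE z in lborel. norm (K z) \<le> norm (C4 * (1 + norm \<xi>) ^ N0 * C3 * C2 * tail (fst z) * tail (snd z))"
          by (intro AE_I2, unfold real_norm_def) (metis prod.collapse order_trans[OF _ abs_ge_self])
      qed (use K in simp)
      have K1: "(\<lambda>z. K (fst z + snd z, snd z)) \<in> borel_measurable borel"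
      proof -
        have "continuous_on UNIV (\<lambda>z. K (fst z + snd z, snd z))"
          unfolding K_def weyl_integrand_def
          by (intro continuous_intros continuous_on_compose2[OF L_continuous]
            continuous_on_compose2[OF J_continuous] continuous_on_compose2[OF schwartz_continuous[OF f]]) auto
        then show ?thesis by (rule borel_measurable_continuous_onI)
      qed
      have ZK: "Z z = K (fst z + (snd z + - ((1/2) *\<^sub>R fst z)), snd z + - ((1/2) *\<^sub>R fst z))" for z
      proof -
        obtain T a where z: "z = (T, a)" by (cases z)
        have e: "T + (a - (1/2) *\<^sub>R T) = a + (1/2) *\<^sub>R T" "a + - ((1/2) *\<^sub>R T) = a - (1/2) *\<^sub>R T"
          "(1/2) *\<^sub>R ((a - (1/2) *\<^sub>R T) + (a + (1/2) *\<^sub>R T)) = a" "(a - (1/2) *\<^sub>R T) - (a + (1/2) *\<^sub>R T) = - T"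
          by (simp_all add: vec_eq_iff field_simps)
        show ?thesis unfolding z Z_def K_def weyl_integrand_def fst_conv snd_conv e by (simp add: mult_ac)
      qed
      have "(\<integral>p. J p * I p \<xi> \<partial>lborel) = integral\<^sup>L lborel K"
        unfolding lborel_integral_snd[OF iK, symmetric] by (simp add: K_def I_def)
      also have "\<dots> = (\<integral>z. K (fst z + snd z, snd z) \<partial>lborel)"
        by (rule integral_shear[of "\<lambda>p. p", OF _ K, symmetric]) simp
      also have "\<dots> = integral\<^sup>L lborel Z"
        unfolding ZK[abs_def] using integral_shear_snd[of "\<lambda>T. - ((1/2) *\<^sub>R T)", OF _ K1] by simp
      also have "\<dots> = (\<integral>a. (\<integral>T. Z (T, a) \<partial>lborel) \<partial>lborel)"
      proof -
        have "integrable lborel (\<lambda>z. K (fst z + snd z, snd z))"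
          using integrable_shear[of "\<lambda>p. p", OF _ K] iK by simp
        then have "integrable lborel Z"
          unfolding ZK[abs_def] using integrable_shear_snd[of "\<lambda>T. - ((1/2) *\<^sub>R T)", OF _ K1] by simp
        from lborel_integral_snd[OF this] show ?thesis by simp
      qed
      finally show ?thesis by (simp add: Z_def)
    qed
    then show ?thesis by simp
  qed
  also have "wigner_const * \<dots> = (\<integral>\<xi>. (\<integral>a. L (a, \<xi>) * test_fun_hat a \<xi> \<partial>lborel) \<partial>lborel)"
    unfolding test_fun_hat_eq by (simp add: mult.left_commute[of _ wigner_const])
  also have "\<dots> = (\<integral>z. L z * test_fun_hat (fst z) (snd z) \<partial>lborel)"
    using lborel_integral_snd[OF L_test_fun_hat_integrable] by simp
  finally show ?thesis .
qed

end

section \<open>The kernel that remains after the contour shift\<close>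

context wigner
begin

text \<open>The argument of the symbol in the statement is displaced by minus one half of this vector.  Since the
symbol is evaluated at the midpoint of two points, moving one of them by \<open>symbol_shift \<Xi>\<close> makes
its argument real.\<close>
definition symbol_shift :: "(real ^ 'n) \<times> (real ^ 'n) \<Rightarrow> (complex ^ 'n) \<times> (complex ^ 'n)" where
  "symbol_shift \<Xi> = (cvec (snd \<Xi>) - (\<i> * of_real (sx\<^sup>2)) *s cvec (fst \<Xi>), - cvec (fst \<Xi>) - (\<i> * of_real (sk\<^sup>2)) *s cvec (snd \<Xi>))"

text \<open>The factor that multiplies the symbol in the inner integral of the Weyl operator, once the contour has
been shifted (\<open>H_shifted\<close>).\<close>
definition weyl_kernel :: "(real ^ 'n) \<times> (real ^ 'n) \<Rightarrow> (real ^ 'n) \<times> (real ^ 'n) \<Rightarrow> complex" where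
  "weyl_kernel \<Xi> z = cexp 0 (4 * pi * (fst \<Xi> \<bullet> fst z + fst \<Xi> \<bullet> snd \<Xi> + snd z \<bullet> snd \<Xi>)) *
     fourier (\<lambda>q. Q2 (fst z) (snd \<Xi>) (fst q) (snd q)) (2 *\<^sub>R fst \<Xi>, 2 *\<^sub>R snd z)"

text \<open>The substitution \<open>(u, y) = (q + y' / 2 - K, y' - 2 K)\<close> completes the square in the integral that
defines the extension at the shifted point; the remaining real exponent in \<open>X\<close> and \<open>K\<close>
cancels the one of the character \<open>wave\<close> at that point.\<close>
lemma wigner_ext_shifted:
  "cexp (- (2 * pi * (sx\<^sup>2 * (X \<bullet> X) + sk\<^sup>2 * (K \<bullet> K)))) (4 * pi * (X \<bullet> (x - a) + K \<bullet> (k - b))) *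
     wigner_ext (cvec2 (2 *\<^sub>R (a, b) - (x, k)) + symbol_shift (X, K)) = wigner_const * weyl_kernel (X, K) (a, b)"
proof -
  let ?z = "cvec2 (2 *\<^sub>R (a, b) - (x, k)) + symbol_shift (X, K)"
  define a' b' where "a' = 2 *\<^sub>R a - x + K" and "b' = 2 *\<^sub>R b - k - X"
  define \<alpha> \<beta> where "\<alpha> = - (sx\<^sup>2 *\<^sub>R X)" and "\<beta> = - (sk\<^sup>2 *\<^sub>R K)"
  have z: "re_part ?z = (a', b')" "im_part ?z = (\<alpha>, \<beta>)"
    by (simp_all add: re_part_def im_part_def cvec2_def symbol_shift_def cvec_def vec_eq_iff \<alpha>_def \<beta>_def a'_def b'_def)
  define w where "w = wigner_integrand a' \<alpha> b' \<beta>"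
  have wm: "w \<in> borel_measurable borel" unfolding w_def by (rule wigner_integrand_measurable)
  have wc: "continuous_on UNIV w" unfolding w_def by (rule wigner_integrand_continuous)
  have m2: "(\<lambda>q. w (q + (- K, - 2 *\<^sub>R K))) \<in> borel_measurable borel"
    by (intro borel_measurable_continuous_onI continuous_on_compose2[OF wc] continuous_intros) auto
  have "integral\<^sup>L lborel w = (\<integral>q. w (q + (- K, - 2 *\<^sub>R K)) \<partial>lborel)"
    by (rule integral_translate[OF wm, symmetric])
  also have "\<dots> = (\<integral>q. w ((fst q + (1/2) *\<^sub>R snd q, snd q) + (- K, - 2 *\<^sub>R K)) \<partial>lborel)"
    by (rule integral_shear[where s="\<lambda>y. (1/2) *\<^sub>R y", OF _ m2, symmetric]) simp
  finally have W: "wigner_ext ?z = wigner_const * (\<integral>q. w (fst q + (1/2) *\<^sub>R snd q - K, snd q - 2 *\<^sub>R K) \<partial>lborel)"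
    unfolding wigner_ext_def z fst_conv snd_conv w_def by simp
  define E where "E = cexp (- (2 * pi * (sx\<^sup>2 * (X \<bullet> X) + sk\<^sup>2 * (K \<bullet> K)))) (4 * pi * (X \<bullet> (x - a) + K \<bullet> (k - b)))"
  define D where "D = cexp 0 (4 * pi * (X \<bullet> a + X \<bullet> K + b \<bullet> K))"
  have pw: "E * w (fst p + (1/2) *\<^sub>R snd p - K, snd p - 2 *\<^sub>R K) =
      D * (exp (- (2 * pi * \<i> * of_real ((2 *\<^sub>R X, 2 *\<^sub>R b) \<bullet> p))) * Q2 a K (fst p) (snd p))" for p
  proof -
    obtain q y where p: "p = (q, y)" by (cases p)
    define V where "V = q + (1/2) *\<^sub>R y - 2 *\<^sub>R K - 2 *\<^sub>R a + x"
    have V: "q + (1/2) *\<^sub>R y - K - a' = V" by (simp add: V_def a'_def vec_eq_iff algebra_simps)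
    have V2: "X \<bullet> V = X \<bullet> q + (X \<bullet> y) / 2 - 2 * (X \<bullet> K) - 2 * (X \<bullet> a) + X \<bullet> x"
      by (simp add: V_def inner_diff_right inner_add_right)
    have fg: "q + (1/2) *\<^sub>R y - K + (1/2) *\<^sub>R (y - 2 *\<^sub>R K) = q + y - 2 *\<^sub>R K"
      "q + (1/2) *\<^sub>R y - K - (1/2) *\<^sub>R (y - 2 *\<^sub>R K) = q"
      by (simp_all add: vec_eq_iff field_simps)
    have sx2: "sx\<^sup>2 \<noteq> 0" using sx by simp
    have re: "- (2 * pi * (sx\<^sup>2 * (X \<bullet> X) + sk\<^sup>2 * (K \<bullet> K))) + (2 * pi * (\<beta> \<bullet> (y - 2 *\<^sub>R K)) + 2 * pi / sx\<^sup>2 * (\<alpha> \<bullet> \<alpha>)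
        - pi * sk\<^sup>2 / 2 * ((y - 2 *\<^sub>R K) \<bullet> (y - 2 *\<^sub>R K)) - 2 * pi / sx\<^sup>2 * (V \<bullet> V)) =
      - (pi * sk\<^sup>2 / 2) * (y \<bullet> y) + - (2 * pi / sx\<^sup>2) * (V \<bullet> V)"
    proof -
      have "2 * pi / sx\<^sup>2 * (\<alpha> \<bullet> \<alpha>) = 2 * pi * (sx\<^sup>2 * (X \<bullet> X))"
        using sx2 by (simp add: \<alpha>_def field_simps power2_eq_square)
      then show ?thesis unfolding \<open>_ = 2 * pi * (sx\<^sup>2 * (X \<bullet> X))\<close>
        by (simp add: \<beta>_def inner_diff_left inner_diff_right inner_commute[of K y] algebra_simps)
    qed
    have im: "4 * pi * (X \<bullet> (x - a) + K \<bullet> (k - b)) + (4 * pi / sx\<^sup>2 * (\<alpha> \<bullet> V) - 2 * pi * (b' \<bullet> (y - 2 *\<^sub>R K))) =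
        4 * pi * (X \<bullet> a + X \<bullet> K + b \<bullet> K) + - (2 * pi * (2 * (X \<bullet> q) + 2 * (b \<bullet> y))) + 2 * pi * (k \<bullet> y)"
    proof -
      have "4 * pi / sx\<^sup>2 * (\<alpha> \<bullet> V) = - (4 * pi * (X \<bullet> V))" using sx2 by (simp add: \<alpha>_def)
      then show ?thesis unfolding \<open>_ = - (4 * pi * (X \<bullet> V))\<close>
        by (simp add: V2 b'_def inner_add_right inner_diff_left inner_diff_right inner_commute[of K] algebra_simps)
    qed
    have 1: "exp (- (2 * pi * \<i> * of_real ((2 *\<^sub>R X, 2 *\<^sub>R b) \<bullet> p))) = cexp 0 (- (2 * pi * (2 * (X \<bullet> q) + 2 * (b \<bullet> y))))"
      by (simp add: cexp_def p inner_prod_def algebra_simps)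
    have 2: "exp (\<i> * of_real (2 * pi * (k \<bullet> y))) = cexp 0 (2 * pi * (k \<bullet> y))"
      by (simp add: cexp_def)
    have "E * w (q + (1/2) *\<^sub>R y - K, y - 2 *\<^sub>R K) = cexp (- (pi * sk\<^sup>2 / 2) * (y \<bullet> y) + - (2 * pi / sx\<^sup>2) * (V \<bullet> V))
          (4 * pi * (X \<bullet> a + X \<bullet> K + b \<bullet> K) + - (2 * pi * (2 * (X \<bullet> q) + 2 * (b \<bullet> y))) + 2 * pi * (k \<bullet> y)) *
        (f (q + y - 2 *\<^sub>R K) * cnj (g q))"
      unfolding E_def w_def wigner_integrand_def fst_conv snd_conv V fg mult.assoc[symmetric] cexp_mult re im by (simp only: mult.assoc)
    also have "\<dots> = D * (cexp 0 (- (2 * pi * (2 * (X \<bullet> q) + 2 * (b \<bullet> y)))) * Q2 a K q y)"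
      unfolding Q2_def V_def[symmetric] gk_cexp gx_cexp 2 cexp_collect D_def mult.assoc[symmetric] cexp_mult
      by (simp only: add_0_left add.assoc)
    finally show ?thesis unfolding 1[unfolded p] p fst_conv snd_conv .
  qed
  have "E * wigner_ext ?z = wigner_const * (\<integral>q. E * w (fst q + (1/2) *\<^sub>R snd q - K, snd q - 2 *\<^sub>R K) \<partial>lborel)"
    unfolding W by simp
  then have "E * wigner_ext ?z = wigner_const * (D * fourier (\<lambda>q. Q2 a K (fst q) (snd q)) (2 *\<^sub>R X, 2 *\<^sub>R b))"
    unfolding pw fourier_def by simp
  then show ?thesis unfolding E_def D_def weyl_kernel_def by simp
qed

text \<open>The frequency controls \<open>X\<close> and \<open>b\<close>, the parameters are \<open>a\<close> and \<open>K\<close>; together they control both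
\<open>z = (a, b)\<close> and \<open>\<Xi> = (X, K)\<close>.\<close>
lemma weyl_kernel_bound:
  "\<exists>C\<ge>0. \<forall>\<Xi> z. (1 + norm z) ^ N * ((1 + norm \<Xi>) ^ M * cmod (weyl_kernel \<Xi> z)) \<le> C"
proof -
  have "schwartz (\<lambda>z. Q2 (fst (fst z)) (snd (fst z)) (fst (snd z)) (snd (snd z)))" by (rule Q2_schwartz)
  from rapid_fourier_decay[OF hrapid_freeze[OF this] norm_ge_zero, of "N + M" "N + M"]
  obtain C where C: "C \<ge> 0" "\<And>p \<eta>. (1 + norm \<eta>) ^ (N + M) * (1 + norm p) ^ (N + M) *
      cmod (fourier (\<lambda>q. Q2 (fst p) (snd p) (fst q) (snd q)) \<eta>) \<le> C"
    unfolding fst_conv snd_conv by blast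
  have "(1 + norm z) ^ N * ((1 + norm \<Xi>) ^ M * cmod (weyl_kernel \<Xi> z)) \<le> C" for \<Xi> z
  proof -
    obtain X K a b where e: "\<Xi> = (X, K)" "z = (a, b)" by (metis prod.collapse)
    define r where "r = (1 + norm (2 *\<^sub>R X, 2 *\<^sub>R b)) * (1 + norm (a, K))"
    have n: "norm X \<le> norm (2 *\<^sub>R X, 2 *\<^sub>R b)" "norm b \<le> norm (2 *\<^sub>R X, 2 *\<^sub>R b)" "norm a \<le> norm (a, K)" "norm K \<le> norm (a, K)"
      using norm_fst_le[of "2 *\<^sub>R X" "2 *\<^sub>R b"] norm_snd_le[of "2 *\<^sub>R b" "2 *\<^sub>R X"] norm_fst_le[of a K] norm_snd_le[of K a]
        norm_ge_zero[of X] norm_ge_zero[of b] by (simp_all del: norm_ge_zero)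
    have "norm z \<le> norm (2 *\<^sub>R X, 2 *\<^sub>R b) + norm (a, K)" "norm \<Xi> \<le> norm (2 *\<^sub>R X, 2 *\<^sub>R b) + norm (a, K)"
      unfolding e using norm_Pair_le[of a b] norm_Pair_le[of X K] n by linarith+
    then have "1 + norm z \<le> r" "1 + norm \<Xi> \<le> r" unfolding r_def by (auto intro!: one_plus_le_mult)
    then have "(1 + norm z) ^ N * (1 + norm \<Xi>) ^ M \<le> r ^ N * r ^ M"
      by (intro mult_mono power_mono) (auto simp: r_def)
    then have "(1 + norm z) ^ N * (1 + norm \<Xi>) ^ M * cmod (weyl_kernel \<Xi> z) \<le> r ^ (N + M) * cmod (weyl_kernel \<Xi> z)"
      unfolding power_add by (rule mult_right_mono) simp
    also have "\<dots> \<le> C"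
      using C(2)[of "(2 *\<^sub>R X, 2 *\<^sub>R b)" "(a, K)"] unfolding e weyl_kernel_def r_def power_mult_distrib fst_conv snd_conv
      by (simp only: norm_mult norm_cexp exp_zero mult_1_left)
    finally show ?thesis by (simp only: mult.assoc)
  qed
  then show ?thesis using C(1) by blast
qed

lemma weyl_kernel_measurable: "(\<lambda>w. weyl_kernel (fst w) (snd w)) \<in> borel_measurable borel"
proof -
  note c = continuous_on_compose2[OF schwartz_continuous[OF Q2_schwartz], of UNIV
      "\<lambda>w. ((fst (snd (fst w)), snd (fst (fst w))), snd w)", unfolded fst_conv snd_conv]
  have "(\<lambda>w. exp (- (2 * pi * \<i> * of_real ((2 *\<^sub>R fst (fst (fst w)), 2 *\<^sub>R snd (snd (fst w))) \<bullet> snd w))) *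
      Q2 (fst (snd (fst w))) (snd (fst (fst w))) (fst (snd w)) (snd (snd w)))
    \<in> borel_measurable (borel :: ((((real ^ 'n) \<times> (real ^ 'n)) \<times> ((real ^ 'n) \<times> (real ^ 'n))) \<times> ((real ^ 'n) \<times> (real ^ 'n))) measure)"
    by (intro borel_measurable_continuous_onI continuous_intros c) auto
  from measurable_param_integral[OF this]
  have 1: "(\<lambda>w. fourier (\<lambda>q. Q2 (fst (snd w)) (snd (fst w)) (fst q) (snd q)) (2 *\<^sub>R fst (fst w), 2 *\<^sub>R snd (snd w))) \<in> borel_measurable borel"
    unfolding fourier_def by simp
  have "(\<lambda>w. cexp 0 (4 * pi * (fst (fst w) \<bullet> fst (snd w) + fst (fst w) \<bullet> snd (fst w) + snd (snd w) \<bullet> snd (fst w))))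
     \<in> borel_measurable (borel :: (((real ^ 'n) \<times> (real ^ 'n)) \<times> ((real ^ 'n) \<times> (real ^ 'n))) measure)"
    by (intro borel_measurable_continuous_onI continuous_intros)
  then show ?thesis unfolding weyl_kernel_def using 1 by measurable
qed

lemma weyl_kernel_integrable: "integrable lborel (\<lambda>\<Xi>. weyl_kernel \<Xi> z)"
proof -
  obtain C where C: "C \<ge> 0" "\<And>\<Xi> z. (1 + norm z) ^ 0 * ((1 + norm \<Xi>) ^ (2 * DIM((real ^ 'n) \<times> (real ^ 'n))) * cmod (weyl_kernel \<Xi> z)) \<le> C"
    using weyl_kernel_bound by blast
  have "(\<lambda>\<Xi>. (\<Xi>, z)) \<in> borel \<rightarrow>\<^sub>M (borel :: (((real ^ 'n) \<times> (real ^ 'n)) \<times> ((real ^ 'n) \<times> (real ^ 'n))) measure)"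
    by (intro borel_measurable_continuous_onI continuous_intros)
  from measurable_compose[OF this weyl_kernel_measurable] show ?thesis
    by (intro integrable_tail_bound[where C=C] tail_bound[where F="\<lambda>\<Xi>. weyl_kernel \<Xi> z"]) (use C(2)[of z] in simp_all)
qed

lemma Q2_diagonal: "Q2 a K (a + K) (- y) = Q a (- 2 *\<^sub>R y + (- 2) *\<^sub>R K) y"
proof -
  let ?V = "a - (1/2) *\<^sub>R y - (1/2) *\<^sub>R (- 2 *\<^sub>R y + (- 2) *\<^sub>R K) - x"
  have e: "a + K + - y - 2 *\<^sub>R K = a + (1/2) *\<^sub>R (- 2 *\<^sub>R y + (- 2) *\<^sub>R K)"
    "a + K = a - y - (1/2) *\<^sub>R (- 2 *\<^sub>R y + (- 2) *\<^sub>R K)"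
    "a + K + (1/2) *\<^sub>R (- y) - 2 *\<^sub>R K - 2 *\<^sub>R a + x = - ?V"
    by (simp_all add: vec_eq_iff field_simps)
  have "gk (- y) = gk y" "gx (- ?V) = gx ?V" by (simp_all only: gk_def gx_def inner_minus_left inner_minus_right minus_minus)
  then show ?thesis unfolding Q2_def Q_def e(1,3) e(2)[symmetric] by simp
qed

text \<open>Integrating over \<open>X\<close> is Fourier inversion in \<open>q\<close>, at the point \<open>q = a + K\<close>.  On this diagonal, and after
reflecting \<open>y\<close>, \<open>Q2\<close> becomes \<open>Q\<close> at \<open>T = - 2 (K + y)\<close>; integrating over \<open>K\<close> and \<open>y\<close> then
gives the Fourier transform of \<open>Q\<close>.  The dilations by two in \<open>X\<close> and in \<open>K\<close> produce the power of
two.\<close>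
lemma weyl_kernel_integral: "2 ^ (2 * CARD('n)) * (wigner_const * (\<integral>\<Xi>. weyl_kernel \<Xi> (a, b) \<partial>lborel)) = test_fun_hat a b"
proof -
  \<comment> \<open>V carries Q and the character in T; both integrations are substitutions in V.\<close>
  define V where "V = (\<lambda>z. cexp 0 (- (2 * pi * (b \<bullet> fst z))) * Q a (fst z) (snd z))"
  have sQ: "schwartz (\<lambda>p. Q a (fst p) (snd p))"
    using schwartz_slice[OF Q_schwartz_a, of a] by simp
  have blV: "bounded_linear (\<lambda>z::(real ^ 'n) \<times> (real ^ 'n). - (2 * pi * (b \<bullet> fst z)))"
    by (auto intro!: bounded_linear_minus bounded_linear_const_mult bounded_linear_inner_right_comp bounded_linear_fst)
  have sV: "schwartz V"
    using schwartz_char_mult[OF sQ blV] by (simp add: V_def cexp_def mult.commute)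
  let ?A = "\<lambda>z::(real ^ 'n) \<times> (real ^ 'n). (- 2 *\<^sub>R snd z + (- 2) *\<^sub>R fst z, snd z)"
  have sV': "schwartz (\<lambda>z. V (?A z))"
  proof (rule schwartz_linear[OF sV, of _ 3])
    show "linear ?A" by (rule linearI) (auto simp: algebra_simps)
    fix z :: "(real ^ 'n) \<times> (real ^ 'n)"
    obtain K y where z: "z = (K, y)" by (cases z)
    have "2 *\<^sub>R K = - 2 *\<^sub>R y - (- 2 *\<^sub>R y + (- 2) *\<^sub>R K)" by (simp add: algebra_simps)
    then have "norm (2 *\<^sub>R K) \<le> norm (- 2 *\<^sub>R y) + norm (- 2 *\<^sub>R y + (- 2) *\<^sub>R K)" by (metis norm_triangle_ineq4)
    then have "2 * norm K \<le> 2 * norm y + norm (- 2 *\<^sub>R y + (- 2) *\<^sub>R K)" by simp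
    moreover have "norm z \<le> norm K + norm y" unfolding z by (rule norm_Pair_le)
    moreover have "norm (- 2 *\<^sub>R y + (- 2) *\<^sub>R K) \<le> norm (?A z)" "norm y \<le> norm (?A z)"
      unfolding z fst_conv snd_conv by (rule norm_fst_le norm_snd_le)+
    ultimately show "norm z \<le> 3 * (1 + norm (?A z))" using norm_ge_zero[of "?A z"] by argo
  qed
  have inner: "(\<integral>X. weyl_kernel (X, K) (a, b) \<partial>lborel) = (\<integral>y. V (?A (K, y)) \<partial>lborel) / 2 ^ CARD('n)" for K
  proof -
    define F where "F = (\<lambda>z. Q2 a K (fst z) (snd z) * exp (\<i> * of_real (- (4 * pi * (b \<bullet> snd z)))))"
    have sQ2: "schwartz (\<lambda>z. Q2 a K (fst z) (snd z))"
      using schwartz_slice[OF Q2_schwartz, of "(a, K)"] by simp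
    have bl: "bounded_linear (\<lambda>z::(real ^ 'n) \<times> (real ^ 'n). - (4 * pi * (b \<bullet> snd z)))"
      by (auto intro!: bounded_linear_minus bounded_linear_const_mult bounded_linear_inner_right_comp bounded_linear_snd)
    have sF: "schwartz F" unfolding F_def by (rule schwartz_char_mult[OF sQ2 bl])
    define h where "h = (\<lambda>q. \<integral>y. F (q, y) \<partial>lborel)"
    have h1: "integrable lborel h" unfolding h_def by (rule lborel_integrable_fst[OF schwartz_integrable[OF sF]])
    have hc: "continuous_on UNIV h" unfolding h_def by (rule schwartz_slice_continuous[OF sF])
    then have h2: "isCont h (a + K)" by (rule continuous_on_interior) simp
    have hF: "fourier h \<xi> = fourier F (\<xi>, 0)" for \<xi>
      unfolding h_def by (rule fourier_fst_slice[OF schwartz_integrable[OF sF], symmetric])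
    have mh: "fourier h \<in> borel_measurable borel"
    proof -
      have "(\<lambda>w. exp (- (2 * pi * \<i> * of_real (fst w \<bullet> snd w))) * h (snd w)) \<in> borel_measurable (borel :: ((real ^ 'n) \<times> (real ^ 'n)) measure)"
        by (intro borel_measurable_continuous_onI continuous_intros continuous_on_compose2[OF hc]) auto
      from measurable_param_integral[OF this] show ?thesis unfolding fourier_def by simp
    qed
    have "hrapid UNIV (\<lambda>(_::unit) z. 0 + norm z) (\<lambda>_. F)" using schwartz_iff[THEN iffD1, OF sF] by simp
    from rapid_fourier_decay[OF this, of "2 * DIM(real ^ 'n)" 0]
    obtain C where C: "\<And>\<eta>. (1 + norm \<eta>) ^ (2 * DIM(real ^ 'n)) * cmod (fourier F \<eta>) \<le> C" by auto
    have h3: "integrable lborel (fourier h)"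
      by (rule integrable_tail_bound[OF mh tail_bound[where F="fourier h"]])
        (use C[of "(_, 0)"] in \<open>simp add: hF norm_Pair\<close>)
    define G where "G = (\<lambda>\<xi>. exp (2 * pi * \<i> * of_real (\<xi> \<bullet> (a + K))) * fourier h \<xi>)"
    have "(\<lambda>\<xi>::real ^ 'n. exp (2 * pi * \<i> * of_real (\<xi> \<bullet> (a + K)))) \<in> borel_measurable borel"
      by (intro borel_measurable_continuous_onI continuous_intros)
    then have mG: "G \<in> borel_measurable borel" unfolding G_def using mh by simp
    have pw: "weyl_kernel (X, K) (a, b) = cexp 0 (4 * pi * (b \<bullet> K)) * G (0 + 2 *\<^sub>R X)" for X
    proof -
      have "fourier (\<lambda>q. Q2 a K (fst q) (snd q)) (2 *\<^sub>R X, 2 *\<^sub>R b) = fourier h (2 *\<^sub>R X)"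
        unfolding hF unfolding fourier_def F_def
      proof (rule Bochner_Integration.integral_cong[OF refl])
        fix p :: "(real ^ 'n) \<times> (real ^ 'n)"
        have "exp (- (2 * pi * \<i> * of_real ((2 *\<^sub>R X, 2 *\<^sub>R b) \<bullet> p))) =
            exp (- (2 * pi * \<i> * of_real ((2 *\<^sub>R X, 0) \<bullet> p))) * exp (\<i> * of_real (- (4 * pi * (b \<bullet> snd p))))"
          unfolding mult_exp_exp by (simp add: inner_prod_def algebra_simps)
        then show "exp (- (2 * pi * \<i> * of_real ((2 *\<^sub>R X, 2 *\<^sub>R b) \<bullet> p))) * Q2 a K (fst p) (snd p) =
            exp (- (2 * pi * \<i> * of_real ((2 *\<^sub>R X, 0) \<bullet> p))) * (Q2 a K (fst p) (snd p) * exp (\<i> * of_real (- (4 * pi * (b \<bullet> snd p)))))"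
          by (simp only: mult_ac)
      qed
      moreover have "cexp 0 (4 * pi * (X \<bullet> a + X \<bullet> K + b \<bullet> K)) = cexp 0 (4 * pi * (b \<bullet> K)) * exp (2 * pi * \<i> * of_real ((0 + 2 *\<^sub>R X) \<bullet> (a + K)))"
        unfolding cexp_def mult_exp_exp by (simp add: inner_add_right algebra_simps)
      ultimately show ?thesis unfolding weyl_kernel_def G_def fst_conv snd_conv by (simp only: mult.assoc add_0_left)
    qed
    have "(\<integral>X. weyl_kernel (X, K) (a, b) \<partial>lborel) = cexp 0 (4 * pi * (b \<bullet> K)) * (integral\<^sup>L lborel G / 2 ^ CARD('n))"
      unfolding pw using integral_affine[OF mG, of 2 0] by simp
    also have "integral\<^sup>L lborel G = h (a + K)" unfolding G_def by (rule fourier_inversion[OF h1 h2 h3])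
    also have "h (a + K) = (\<integral>y. F (a + K, - y) \<partial>lborel)"
    proof -
      have "(\<lambda>y. F (a + K, y)) \<in> borel_measurable borel"
        by (intro borel_measurable_continuous_onI continuous_on_compose2[OF schwartz_continuous[OF sF]] continuous_intros) auto
      from integral_affine[OF this, of "-1" 0] show ?thesis by (simp add: h_def)
    qed
    also have "cexp 0 (4 * pi * (b \<bullet> K)) * (\<dots> / 2 ^ CARD('n)) = (\<integral>y. cexp 0 (4 * pi * (b \<bullet> K)) * F (a + K, - y) \<partial>lborel) / 2 ^ CARD('n)"
      by simp
    also have "(\<lambda>y. cexp 0 (4 * pi * (b \<bullet> K)) * F (a + K, - y)) = (\<lambda>y. V (?A (K, y)))"
    proof
      fix y
      have "exp (\<i> * of_real (- (4 * pi * (b \<bullet> (- y))))) * cexp 0 (4 * pi * (b \<bullet> K)) = cexp 0 (- (2 * pi * (b \<bullet> (- 2 *\<^sub>R y + (- 2) *\<^sub>R K))))"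
        unfolding cexp_def mult_exp_exp by (simp add: inner_add_right inner_diff_right algebra_simps)
      moreover have "c * (q * p) = d * q" if "p * c = d" for c d p q :: complex
        using that by (simp add: mult_ac)
      ultimately show "cexp 0 (4 * pi * (b \<bullet> K)) * F (a + K, - y) = V (?A (K, y))"
        unfolding F_def V_def fst_conv snd_conv Q2_diagonal by blast
    qed
    finally show ?thesis .
  qed
  have mV: "V \<in> borel_measurable borel" by (rule borel_measurable_continuous_onI[OF schwartz_continuous[OF sV]])
  have mVy: "(\<lambda>T. V (T, y)) \<in> borel_measurable borel" for y
    by (intro borel_measurable_continuous_onI continuous_on_compose2[OF schwartz_continuous[OF sV]] continuous_intros) auto
  have "(\<integral>\<Xi>. weyl_kernel \<Xi> (a, b) \<partial>lborel) = (\<integral>K. (\<integral>X. weyl_kernel (X, K) (a, b) \<partial>lborel) \<partial>lborel)"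
    by (rule lborel_integral_snd[OF weyl_kernel_integrable, symmetric])
  also have "\<dots> = (\<integral>K. (\<integral>y. V (?A (K, y)) \<partial>lborel) \<partial>lborel) / 2 ^ CARD('n)"
    unfolding inner by simp
  also have "(\<integral>K. (\<integral>y. V (?A (K, y)) \<partial>lborel) \<partial>lborel) = (\<integral>y. (\<integral>K. V (?A (K, y)) \<partial>lborel) \<partial>lborel)"
    using lborel_integral_fst[OF schwartz_integrable[OF sV']] lborel_integral_snd[OF schwartz_integrable[OF sV']] by simp
  also have "\<dots> = (\<integral>y. (\<integral>T. V (T, y) \<partial>lborel) / 2 ^ CARD('n) \<partial>lborel)"
  proof -
    have "(\<integral>K. V (?A (K, y)) \<partial>lborel) = (\<integral>T. V (T, y) \<partial>lborel) / 2 ^ CARD('n)" for y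
      using integral_affine[OF mVy, of "- 2" "- 2 *\<^sub>R y" y] by simp
    then show ?thesis by simp
  qed
  also have "\<dots> = integral\<^sup>L lborel V / 2 ^ CARD('n)"
    using lborel_integral_snd[OF schwartz_integrable[OF sV]] by simp
  also have "integral\<^sup>L lborel V = fourier (\<lambda>p. Q a (fst p) (snd p)) (b, 0)"
    unfolding V_def fourier_def cexp_def by (simp add: inner_prod_def mult_ac)
  finally have "(\<integral>\<Xi>. weyl_kernel \<Xi> (a, b) \<partial>lborel) = fourier (\<lambda>p. Q a (fst p) (snd p)) (b, 0) / 2 ^ CARD('n) / 2 ^ CARD('n)" .
  then show ?thesis unfolding test_fun_hat_def by (simp add: mult_2 power_add)
qed

end

lemma cscale_cvec2: "cscale (of_real c) (cvec2 p) = cvec2 (c *\<^sub>R p)"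
  by (simp add: cscale_def cvec2_def cvec_def vec_eq_iff)

section \<open>The Weyl integral on phase space\<close>

context wigner_symbol
begin

definition shifted_symbol :: "((real ^ 'n) \<times> (real ^ 'n)) \<times> ((real ^ 'n) \<times> (real ^ 'n)) \<Rightarrow> complex" where
  "shifted_symbol w = Lext (cvec2 (fst w) - cscale (1/2) (symbol_shift (snd w)))"

definition imag_shift :: "(real ^ 'n) \<times> (real ^ 'n) \<Rightarrow> (real ^ 'n) \<times> (real ^ 'n)" where
  "imag_shift \<Xi> = (- (sx\<^sup>2 *\<^sub>R fst \<Xi>), - (sk\<^sup>2 *\<^sub>R snd \<Xi>))"

text \<open>The inner integrand of the Weyl operator on phase space, moved by \<open>\<tau>\<close> times \<open>imag_shift \<Xi>\<close> in the
complex domain.  The vector \<open>\<i>\<close> times \<open>imag_shift \<Xi>\<close> is the imaginary part of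
\<open>symbol_shift \<Xi>\<close>; the real part is an ordinary translation.\<close>
definition H :: "(real ^ 'n) \<times> (real ^ 'n) \<Rightarrow> complex \<Rightarrow> (real ^ 'n) \<times> (real ^ 'n) \<Rightarrow> complex" where
  "H \<Xi> \<tau> p = exp (2 * pi * \<i> * of_real (\<Xi> \<bullet> (x, k))) * wave (cvec2 p + cscale \<tau> (cvec2 (imag_shift \<Xi>))) \<Xi> *
     Lext ((cvec2 ((1/2) *\<^sub>R ((x, k) + p)) - cscale (1/2) (symbol_shift \<Xi>)) + cscale \<tau> (cvec2 ((1/2) *\<^sub>R imag_shift \<Xi>))) *
     wigner_ext (cvec2 p + cscale \<tau> (cvec2 (imag_shift \<Xi>)))"

lemma cscale_zero [simp]: "cscale 0 z = 0"
  by (simp add: cscale_def prod_eq_iff vec_eq_iff)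

lemma H_zero: "H \<Xi> 0 p = weyl_integrand shifted_symbol (smoothed_wigner sx sk f g) (x, k) \<Xi> p"
proof -
  have "exp (2 * pi * \<i> * of_real (\<Xi> \<bullet> (x, k))) * wave (cvec2 p) \<Xi> = exp (2 * pi * \<i> * of_real (\<Xi> \<bullet> ((x, k) - p)))"
    unfolding wave_def cdot_cvec2 mult_exp_exp inner_diff_right by (simp add: inner_commute[of p] algebra_simps)
  then show ?thesis unfolding H_def weyl_integrand_def shifted_symbol_def smoothed_wigner_eq by simp
qed

lemma H_measurable: "H \<Xi> \<tau> \<in> borel_measurable borel"
proof -
  have c: "continuous_on UNIV (cvec2 :: (real ^ 'n) \<times> (real ^ 'n) \<Rightarrow> _)"
    unfolding cvec2_def cvec_def by (intro continuous_intros)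
  have w: "continuous_on UNIV (\<lambda>p. wave (p + z) \<Xi>)" for z
    unfolding wave_def
    by (intro continuous_intros bounded_bilinear.continuous_on[OF cdot_bounded_bilinear])
  note cc = continuous_on_compose2[OF c] continuous_on_compose2[OF Lext_continuous]
    continuous_on_compose2[OF wigner_ext_continuous] continuous_on_compose2[OF w]
  show ?thesis unfolding H_def
    by (intro borel_measurable_continuous_onI continuous_intros cc) auto
qed

lemma H_holomorphic: "(\<lambda>\<tau>. H \<Xi> \<tau> p) holomorphic_on UNIV"
proof -
  have "wave (cvec2 p + cscale \<tau> (cvec2 (imag_shift \<Xi>))) \<Xi> = exp (- (2 * pi * \<i>) * (cdot (cvec2 p) \<Xi> + \<tau> * cdot (cvec2 (imag_shift \<Xi>)) \<Xi>))" for \<tau>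
    unfolding wave_def bounded_bilinear.add_left[OF cdot_bounded_bilinear] cdot_cscale ..
  then show ?thesis unfolding H_def
    by (simp only:) (intro holomorphic_on_mult Lext_line wigner_ext_holomorphic_line holomorphic_intros)
qed

lemma H_real: "H \<Xi> (of_real r) p = H \<Xi> 0 (p + r *\<^sub>R imag_shift \<Xi>)"
proof -
  have 1: "cvec2 p + cscale (of_real r) (cvec2 (imag_shift \<Xi>)) = cvec2 (p + r *\<^sub>R imag_shift \<Xi>) + cscale 0 (cvec2 (imag_shift \<Xi>))"
    unfolding cscale_cvec2 cscale_zero by (simp add: cvec2_def cvec_def vec_eq_iff)
  have 2: "(cvec2 ((1/2) *\<^sub>R ((x, k) + p)) - s) + cscale (of_real r) (cvec2 ((1/2) *\<^sub>R imag_shift \<Xi>)) =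
      (cvec2 ((1/2) *\<^sub>R ((x, k) + (p + r *\<^sub>R imag_shift \<Xi>))) - s) + cscale 0 (cvec2 ((1/2) *\<^sub>R imag_shift \<Xi>))" for s
    unfolding cscale_cvec2 cscale_zero by (simp add: prod_eq_iff cvec2_def cvec_def vec_eq_iff algebra_simps)
  show ?thesis unfolding H_def 1 2 ..
qed

text \<open>For bounded \<open>\<tau>\<close> the point stays in a strip, on which the exponential is bounded, the symbol grows
polynomially and the extended Wigner transform decays rapidly.\<close>
lemma H_tail: "\<exists>C. \<forall>\<tau> p. cmod \<tau> \<le> R \<longrightarrow> cmod (H \<Xi> \<tau> p) \<le> C * tail p"
proof -
  let ?D = "N0 + 2 * DIM((real ^ 'n) \<times> (real ^ 'n))"
  define h where "h = cvec2 (imag_shift \<Xi>)"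
  define h2 where "h2 = cvec2 ((1/2) *\<^sub>R imag_shift \<Xi>)"
  define s where "s = cscale (1/2) (symbol_shift \<Xi>)"
  define M where "M = \<bar>R\<bar> * norm h + norm h2 * \<bar>R\<bar> + norm s"
  obtain C1 where C1: "C1 \<ge> 0" "\<And>z. norm (im_part z) \<le> M \<Longrightarrow> cmod (Lext z) \<le> C1 * (1 + norm z) ^ N0"
    using Lext_bound by blast
  obtain C2 where C2: "C2 \<ge> 0" "\<And>z. norm (im_part z) \<le> M \<Longrightarrow> (1 + norm (re_part z)) ^ ?D * cmod (wigner_ext z) \<le> C2"
    using wigner_ext_decay by blast
  define c where "c = norm (x, k) + M"
  have M0: "M \<ge> 0" unfolding M_def by simp
  have wigner_const: "c \<ge> 0" unfolding c_def using M0 by simp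
  define E where "E = exp (2 * pi * (M * norm \<Xi>))"
  have "cmod (H \<Xi> \<tau> p) \<le> (E * (C1 * (1 + c) ^ N0) * ((1 + M) ^ ?D * C2)) * tail p" if \<tau>: "cmod \<tau> \<le> R" for \<tau> p
  proof -
    have nh: "norm (cscale \<tau> h) \<le> \<bar>R\<bar> * norm h" "norm (cscale \<tau> h2) \<le> \<bar>R\<bar> * norm h2"
      unfolding norm_cscale using \<tau> by (auto intro!: mult_right_mono)
    have nn: "0 \<le> \<bar>R\<bar> * norm h" "0 \<le> \<bar>R\<bar> * norm h2" "0 \<le> norm s" by auto
    have nM: "norm (cscale \<tau> h) \<le> M" "norm (cscale \<tau> h2) + norm s \<le> M"
      using nh nn unfolding M_def by (simp_all only: mult.commute[of "norm h2"])
    define z where "z = cvec2 p + cscale \<tau> h"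
    define y where "y = (cvec2 ((1/2) *\<^sub>R ((x, k) + p)) - s) + cscale \<tau> h2"
    have iz: "im_part z = im_part (cscale \<tau> h)" unfolding z_def by (simp add: bounded_linear.linear[OF bounded_linear_im_part, THEN linear_add])
    have iy: "im_part y = im_part (cscale \<tau> h2 - s)"
    proof -
      have "y = cvec2 ((1/2) *\<^sub>R ((x, k) + p)) + (cscale \<tau> h2 - s)" unfolding y_def by simp
      then show ?thesis by (simp only: bounded_linear.linear[OF bounded_linear_im_part, THEN linear_add] im_part_cvec2 add_0_left)
    qed
    have izM: "norm (im_part z) \<le> M" unfolding iz using norm_im_part_le[of "cscale \<tau> h"] nM(1) by linarith
    have iyM: "norm (im_part y) \<le> M" unfolding iy using norm_im_part_le[of "cscale \<tau> h2 - s"] norm_triangle_ineq4[of "cscale \<tau> h2" s] nM(2) by linarith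
    have w: "cmod (wave z \<Xi>) \<le> E"
      unfolding cmod_wave E_def
      using order_trans[OF norm_cauchy_schwarz mult_right_mono[OF izM norm_ge_zero], of \<Xi>] by simp
    have "norm y \<le> norm ((1/2) *\<^sub>R ((x, k) + p)) + norm s + norm (cscale \<tau> h2)"
      unfolding y_def using norm_triangle_ineq[of "cvec2 ((1/2) *\<^sub>R ((x, k) + p)) - s" "cscale \<tau> h2"]
        norm_triangle_ineq4[of "cvec2 ((1/2) *\<^sub>R ((x, k) + p))" s] unfolding norm_cvec2 by linarith
    also have "norm ((1/2) *\<^sub>R ((x, k) + p)) \<le> norm (x, k) + norm p"
      using norm_triangle_ineq[of "(x, k)" p] norm_ge_zero[of "(x, k) + p"] unfolding norm_scaleR by linarith
    finally have "norm y \<le> norm p + c" unfolding c_def using nM(2) by linarith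
    then have "1 + norm y \<le> (1 + norm p) * (1 + c)" by (rule one_plus_le_mult) (use wigner_const in auto)
    then have "(1 + norm y) ^ N0 \<le> (1 + norm p) ^ N0 * (1 + c) ^ N0"
      unfolding power_mult_distrib[symmetric] by (intro power_mono) auto
    then have l: "cmod (Lext y) \<le> (C1 * (1 + c) ^ N0) * (1 + norm p) ^ N0"
      using C1(2)[OF iyM] mult_left_mono[OF _ C1(1)] by (smt (verit) mult.assoc mult.commute)
    have rz: "p = re_part z - re_part (cscale \<tau> h)"
    proof -
      have "re_part z = re_part (cvec2 p) + re_part (cscale \<tau> h)"
        unfolding z_def by (rule bounded_linear.linear[OF bounded_linear_re_part, THEN linear_add])
      moreover have "re_part (cvec2 p) = p" by (simp add: re_part_def cvec2_def cvec_def prod_eq_iff vec_eq_iff)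
      ultimately show ?thesis by simp
    qed
    have "norm p \<le> norm (re_part z) + norm (re_part (cscale \<tau> h))"
      by (subst rz) (rule norm_triangle_ineq4)
    then have "norm p \<le> norm (re_part z) + M" using norm_re_part_le[of "cscale \<tau> h"] nM(1) by linarith
    then have "1 + norm p \<le> (1 + norm (re_part z)) * (1 + M)" by (rule one_plus_le_mult) (use M0 in auto)
    then have "(1 + norm p) ^ ?D \<le> (1 + norm (re_part z)) ^ ?D * (1 + M) ^ ?D"
      unfolding power_mult_distrib[symmetric] by (intro power_mono) auto
    then have "(1 + norm p) ^ ?D * cmod (wigner_ext z) \<le> ((1 + norm (re_part z)) ^ ?D * (1 + M) ^ ?D) * cmod (wigner_ext z)"
      by (rule mult_right_mono) simp
    also have "\<dots> = (1 + M) ^ ?D * ((1 + norm (re_part z)) ^ ?D * cmod (wigner_ext z))" by (simp only: mult_ac)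
    also have "\<dots> \<le> (1 + M) ^ ?D * C2" using M0 by (intro mult_left_mono C2(2)[OF izM]) auto
    finally have W: "(1 + norm p) ^ N0 * cmod (wigner_ext z) \<le> ((1 + M) ^ ?D * C2) * tail p"
      by (rule tail_power_bound[where F="\<lambda>p. wigner_ext (cvec2 p + cscale \<tau> h)" and x=p, folded z_def])
    have "cmod (H \<Xi> \<tau> p) = cmod (wave z \<Xi>) * cmod (Lext y) * cmod (wigner_ext z)"
      unfolding H_def h_def[symmetric] h2_def[symmetric] s_def[symmetric] z_def[symmetric] y_def[symmetric] norm_mult
      by (simp add: norm_exp_eq_Re)
    also have "\<dots> \<le> E * ((C1 * (1 + c) ^ N0) * (1 + norm p) ^ N0) * cmod (wigner_ext z)"
      by (intro mult_right_mono mult_mono w l) (auto simp: E_def)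
    also have "\<dots> = (E * (C1 * (1 + c) ^ N0)) * ((1 + norm p) ^ N0 * cmod (wigner_ext z))" by (simp only: mult_ac)
    also have "\<dots> \<le> (E * (C1 * (1 + c) ^ N0)) * (((1 + M) ^ ?D * C2) * tail p)"
      by (intro mult_left_mono W) (use C1(1) wigner_const in \<open>auto simp: E_def\<close>)
    finally show ?thesis by (simp only: mult.assoc)
  qed
  then show ?thesis by blast
qed

text \<open>At \<open>\<tau> = \<i>\<close> and after the real part of the shift the symbol has the real argument \<open>z\<close>.\<close>
lemma H_shifted: "H (X, K) \<i> (((K, - X) - (x, k)) + 2 *\<^sub>R z) = wigner_const * (L z * weyl_kernel (X, K) z)"
proof -
  obtain a b where z: "z = (a, b)" by (cases z)
  let ?p = "((K, - X) - (x, k)) + 2 *\<^sub>R z"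
  let ?q = "2 *\<^sub>R (a, b) - (x, k)"
  have 1: "cvec2 ?p + cscale \<i> (cvec2 (imag_shift (X, K))) = cvec2 ?q + symbol_shift (X, K)"
    by (simp add: z cvec2_def cscale_def symbol_shift_def imag_shift_def cvec_def vec_eq_iff algebra_simps)
  \<comment> \<open>Here the argument of the symbol becomes real.\<close>
  have 2: "(cvec2 ((1/2) *\<^sub>R ((x, k) + ?p)) - cscale (1/2) (symbol_shift (X, K))) + cscale \<i> (cvec2 ((1/2) *\<^sub>R imag_shift (X, K))) = cvec2 (a, b)"
    by (simp add: z cvec2_def cscale_def symbol_shift_def imag_shift_def cvec_def vec_eq_iff field_simps)
  have symbol_shift: "symbol_shift (X, K) = cvec2 (K, - X) + cscale \<i> (cvec2 (imag_shift (X, K)))"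
    by (simp add: cvec2_def cscale_def symbol_shift_def imag_shift_def cvec_def vec_eq_iff)
  have "(K, - X) \<bullet> (X, K) = 0" by (simp add: inner_commute)
  then have cd: "cdot (cvec2 ?q + symbol_shift (X, K)) (X, K) = of_real (?q \<bullet> (X, K)) + \<i> * of_real (imag_shift (X, K) \<bullet> (X, K))"
    unfolding symbol_shift by (simp only: bounded_bilinear.add_left[OF cdot_bounded_bilinear] cdot_cvec2 cdot_cscale of_real_0 add_0_left)
  \<comment> \<open>The modulus of the character at the shifted point supplies the Gaussian weight.\<close>
  have pre: "exp (2 * pi * \<i> * of_real ((X, K) \<bullet> (x, k))) * wave (cvec2 ?q + symbol_shift (X, K)) (X, K) =
      cexp (- (2 * pi * (sx\<^sup>2 * (X \<bullet> X) + sk\<^sup>2 * (K \<bullet> K)))) (4 * pi * (X \<bullet> (x - a) + K \<bullet> (k - b)))"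
    unfolding wave_def cd cexp_def mult_exp_exp
    by (intro arg_cong[where f=exp])
      (simp add: imag_shift_def inner_diff_left inner_diff_right inner_commute[of a X] inner_commute[of x X] inner_commute[of b K]
        inner_commute[of k K] complex_eq_iff algebra_simps)
  have "H (X, K) \<i> ?p = L (a, b) * (exp (2 * pi * \<i> * of_real ((X, K) \<bullet> (x, k))) * wave (cvec2 ?q + symbol_shift (X, K)) (X, K) * wigner_ext (cvec2 ?q + symbol_shift (X, K)))"
    unfolding H_def 1 2 Lext_real by (simp only: mult_ac)
  also have "\<dots> = L (a, b) * (wigner_const * weyl_kernel (X, K) (a, b))" unfolding pre wigner_ext_shifted ..
  finally show ?thesis unfolding z by (simp only: mult_ac)
qed

text \<open>The contour shift, followed by the substitution of the midpoint \<open>z\<close>, which contributes the power of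
two.\<close>
lemma weyl_inner:
  "integrable lborel (weyl_integrand shifted_symbol (smoothed_wigner sx sk f g) (x, k) \<Xi>)"
  "(\<integral>p. weyl_integrand shifted_symbol (smoothed_wigner sx sk f g) (x, k) \<Xi> p \<partial>lborel) =
     2 ^ (2 * CARD('n)) * (wigner_const * (\<integral>z. L z * weyl_kernel \<Xi> z \<partial>lborel))"
proof -
  have w: "weyl_integrand shifted_symbol (smoothed_wigner sx sk f g) (x, k) \<Xi> = H \<Xi> 0" using H_zero by (intro ext) simp
  obtain C where "\<And>p. cmod (H \<Xi> 0 p) \<le> C * tail p" using H_tail[of 0 \<Xi>] by auto
  then show "integrable lborel (weyl_integrand shifted_symbol (smoothed_wigner sx sk f g) (x, k) \<Xi>)"
    unfolding w by (rule integrable_tail_bound[OF H_measurable])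
  obtain X K where \<Xi>: "\<Xi> = (X, K)" by (cases \<Xi>)
  \<comment> \<open>The imaginary part of the shift; the real part is contained in the affine substitution that follows.\<close>
  have "integral\<^sup>L lborel (H \<Xi> 0) = integral\<^sup>L lborel (H \<Xi> \<i>)"
    by (rule integral_complex_translation[where \<eta>="imag_shift \<Xi>", OF H_measurable H_holomorphic H_tail H_real, symmetric])
  also have "\<dots> = 2 ^ (2 * CARD('n)) * (\<integral>z. H \<Xi> \<i> (((K, - X) - (x, k)) + 2 *\<^sub>R z) \<partial>lborel)"
    using integral_affine[OF H_measurable, of 2 \<Xi> \<i> "(K, - X) - (x, k)"] by (simp add: mult_2)
  also have "(\<integral>z. H \<Xi> \<i> (((K, - X) - (x, k)) + 2 *\<^sub>R z) \<partial>lborel) = wigner_const * (\<integral>z. L z * weyl_kernel \<Xi> z \<partial>lborel)"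
    unfolding \<Xi> H_shifted by simp
  finally show "(\<integral>p. weyl_integrand shifted_symbol (smoothed_wigner sx sk f g) (x, k) \<Xi> p \<partial>lborel) =
     2 ^ (2 * CARD('n)) * (wigner_const * (\<integral>z. L z * weyl_kernel \<Xi> z \<partial>lborel))" unfolding w .
qed

text \<open>The exchange of the two integrals rests on this; before the contour shift the integrand may grow
exponentially in \<open>\<Xi>\<close>.\<close>
lemma L_weyl_kernel_integrable: "integrable lborel (\<lambda>w. L (snd w) * weyl_kernel (fst w) (snd w))"
proof -
  let ?D = "2 * DIM((real ^ 'n) \<times> (real ^ 'n))"
  obtain C1 where C1: "C1 \<ge> 0" "\<And>z. cmod (L z) \<le> C1 * (1 + norm z) ^ N0" using L_bound by blast
  obtain C2 where C2: "C2 \<ge> 0" "\<And>\<Xi> z. (1 + norm z) ^ (N0 + ?D) * ((1 + norm \<Xi>) ^ ?D * cmod (weyl_kernel \<Xi> z)) \<le> C2"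
    using weyl_kernel_bound by blast
  show ?thesis
  proof (rule Bochner_Integration.integrable_bound[OF integrable_tensor[OF integrable_mult_right[OF integrable_tail, of "C1 * C2"] integrable_tail]])
    have "(\<lambda>w. L (snd w)) \<in> borel_measurable (borel :: (((real ^ 'n) \<times> (real ^ 'n)) \<times> ((real ^ 'n) \<times> (real ^ 'n))) measure)"
      by (intro borel_measurable_continuous_onI continuous_on_compose2[OF L_continuous] continuous_intros) auto
    then show "(\<lambda>w. L (snd w) * weyl_kernel (fst w) (snd w)) \<in> borel_measurable lborel"
      using weyl_kernel_measurable by (simp add: borel_measurable_times)
    have "cmod (L z * weyl_kernel \<Xi> z) \<le> C1 * C2 * tail \<Xi> * tail z" for \<Xi> z
    proof -
      have "(1 + norm \<Xi>) ^ ?D * cmod (of_real ((1 + norm z) ^ N0) * weyl_kernel \<Xi> z) \<le> C2 * tail z"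
      proof -
        have "(1 + norm z) ^ (N0 + ?D) * cmod (of_real ((1 + norm \<Xi>) ^ ?D) * weyl_kernel \<Xi> z) \<le> C2"
          using C2(2)[of z \<Xi>] by (simp add: norm_mult norm_power del: of_real_add)
        from tail_power_bound[where F="\<lambda>z. of_real ((1 + norm \<Xi>) ^ ?D) * weyl_kernel \<Xi> z", OF this]
        show ?thesis by (simp add: norm_mult norm_power mult_ac del: of_real_add)
      qed
      from tail_bound[where F="\<lambda>\<Xi>. of_real ((1 + norm z) ^ N0) * weyl_kernel \<Xi> z", OF this]
      have 1: "(1 + norm z) ^ N0 * cmod (weyl_kernel \<Xi> z) \<le> C2 * tail z * tail \<Xi>"
        by (simp add: norm_mult norm_power del: of_real_add)
      have "cmod (L z * weyl_kernel \<Xi> z) \<le> (C1 * (1 + norm z) ^ N0) * cmod (weyl_kernel \<Xi> z)"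
        unfolding norm_mult by (rule mult_right_mono[OF C1(2)]) simp
      also have "\<dots> = C1 * ((1 + norm z) ^ N0 * cmod (weyl_kernel \<Xi> z))" by (rule mult.assoc)
      also have "\<dots> \<le> C1 * (C2 * tail z * tail \<Xi>)" by (rule mult_left_mono[OF 1 C1(1)])
      finally show ?thesis by (simp only: mult_ac)
    qed
    then show "AE w in lborel. norm (L (snd w) * weyl_kernel (fst w) (snd w)) \<le> norm (C1 * C2 * tail (fst w) * tail (snd w))"
      by (intro AE_I2, unfold real_norm_def) (rule order_trans[OF _ abs_ge_self])
  qed
qed

lemma weyl_shifted_symbol:
  shows weyl_converges_shifted_symbol: "weyl_converges shifted_symbol (smoothed_wigner sx sk f g) (x, k)"
    and weyl_op_shifted_symbol: "weyl_op shifted_symbol (smoothed_wigner sx sk f g) (x, k) = (\<integral>z. L z * test_fun_hat (fst z) (snd z) \<partial>lborel)"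
proof -
  note i = L_weyl_kernel_integrable
  show "weyl_converges shifted_symbol (smoothed_wigner sx sk f g) (x, k)"
    unfolding weyl_converges_def weyl_inner(2)
    using weyl_inner(1) lborel_integrable_fst[OF i] by auto
  have "weyl_op shifted_symbol (smoothed_wigner sx sk f g) (x, k) = 2 ^ (2 * CARD('n)) * (wigner_const * (\<integral>\<Xi>. (\<integral>z. L z * weyl_kernel \<Xi> z \<partial>lborel) \<partial>lborel))"
    unfolding weyl_op_def weyl_inner(2) by simp
  also have "(\<integral>\<Xi>. (\<integral>z. L z * weyl_kernel \<Xi> z \<partial>lborel) \<partial>lborel) = (\<integral>z. (\<integral>\<Xi>. L z * weyl_kernel \<Xi> z \<partial>lborel) \<partial>lborel)"
    using lborel_integral_fst[OF i] lborel_integral_snd[OF i] by simp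
  also have "2 ^ (2 * CARD('n)) * (wigner_const * \<dots>) = (\<integral>z. L z * (2 ^ (2 * CARD('n)) * (wigner_const * (\<integral>\<Xi>. weyl_kernel \<Xi> z \<partial>lborel))) \<partial>lborel)"
  proof -
    have "L z * (2 ^ (2 * CARD('n)) * (wigner_const * (\<integral>\<Xi>. weyl_kernel \<Xi> z \<partial>lborel))) = (2 ^ (2 * CARD('n)) * wigner_const) * (\<integral>\<Xi>. L z * weyl_kernel \<Xi> z \<partial>lborel)" for z
      unfolding integral_mult_right_zero by (simp only: mult_ac)
    then have "(\<integral>z. L z * (2 ^ (2 * CARD('n)) * (wigner_const * (\<integral>\<Xi>. weyl_kernel \<Xi> z \<partial>lborel))) \<partial>lborel) =
        (2 ^ (2 * CARD('n)) * wigner_const) * (\<integral>z. (\<integral>\<Xi>. L z * weyl_kernel \<Xi> z \<partial>lborel) \<partial>lborel)"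
      by (simp only: integral_mult_right_zero)
    then show ?thesis by (simp only: mult.assoc)
  qed
  also have "\<dots> = (\<integral>z. L z * test_fun_hat (fst z) (snd z) \<partial>lborel)"
    unfolding weyl_kernel_integral[symmetric] by simp
  finally show "weyl_op shifted_symbol (smoothed_wigner sx sk f g) (x, k) = (\<integral>z. L z * test_fun_hat (fst z) (snd z) \<partial>lborel)" .
qed

end

section \<open>Uniqueness of entire extensions\<close>

text \<open>Free the coordinates from the real axis one at a time, by the identity theorem in one variable.\<close>
lemma separately_holomorphic_zero:
  fixes D :: "complex ^ 'n \<Rightarrow> complex"
  assumes hol: "\<And>z i. (\<lambda>t. D (\<chi> j. if j = i then t else z $ j)) holomorphic_on UNIV"
    and real: "\<And>x. D (cvec x) = 0"
  shows "D z = 0"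
proof -
  have "\<forall>z. (\<forall>i. i \<notin> A \<longrightarrow> z $ i \<in> \<real>) \<longrightarrow> D z = 0" if "finite A" for A :: "'n set"
    using that
  proof (induction A)
    case empty
    show ?case
    proof (intro allI impI)
      fix z :: "complex ^ 'n" assume "\<forall>i. i \<notin> {} \<longrightarrow> z $ i \<in> \<real>"
      then have "z = cvec (\<chi> i. Re (z $ i))" by (simp add: cvec_def vec_eq_iff)
      then show "D z = 0" using real by metis
    qed
  next
    case (insert i A)
    show ?case
    proof (intro allI impI)
      fix z :: "complex ^ 'n" assume z: "\<forall>j. j \<notin> insert i A \<longrightarrow> z $ j \<in> \<real>"
      let ?\<phi> = "\<lambda>t. D (\<chi> j. if j = i then t else z $ j)"
      have lim: "(0::complex) islimpt \<real>"
        unfolding islimpt_approachable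
      proof (intro allI impI)
        fix e :: real assume "e > 0"
        then show "\<exists>t\<in>\<real>. t \<noteq> (0::complex) \<and> dist t 0 < e"
          by (intro bexI[of _ "of_real (e / 2)"]) auto
      qed
      have "?\<phi> t = 0" if "t \<in> \<real>" for t
        using insert.IH z that by simp
      then have "?\<phi> (z $ i) = 0"
        using analytic_continuation[OF hol open_UNIV connected_UNIV subset_UNIV UNIV_I lim _ UNIV_I] by blast
      moreover have "(\<chi> j. if j = i then z $ i else z $ j) = z" by (simp add: vec_eq_iff)
      ultimately show "D z = 0" by simp
    qed
  qed
  from this[of UNIV] show ?thesis by simp
qed

lemma entire_unique:
  fixes F G :: "(complex ^ 'n) \<times> (complex ^ 'n) \<Rightarrow> complex"
  assumes F: "entire F" and G: "entire G" and eq: "\<And>x k. F (cvec x, cvec k) = G (cvec x, cvec k)"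
  shows "F = G"
proof
  fix w :: "(complex ^ 'n) \<times> (complex ^ 'n)"
  obtain z \<zeta> where w: "w = (z, \<zeta>)" by (cases w)
  have 1: "F (z, cvec k) - G (z, cvec k) = 0" for z k
    by (rule separately_holomorphic_zero[of "\<lambda>z. F (z, cvec k) - G (z, cvec k)"])
      (use F G eq in \<open>auto simp: entire_def intro!: holomorphic_on_diff\<close>)
  have "F (z, \<zeta>) - G (z, \<zeta>) = 0"
    by (rule separately_holomorphic_zero[of "\<lambda>\<zeta>. F (z, \<zeta>) - G (z, \<zeta>)"])
      (use F G 1 in \<open>auto simp: entire_def intro!: holomorphic_on_diff\<close>)
  then show "F w = G w" by (simp add: w)
qed

text \<open>Coordinate lines are special complex lines.\<close>
lemma entire_of_lines:
  fixes F :: "(complex ^ 'n) \<times> (complex ^ 'n) \<Rightarrow> complex"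
  assumes "continuous_on UNIV F" "\<And>z h. (\<lambda>t. F (z + cscale t h)) holomorphic_on UNIV"
  shows "entire F"
  unfolding entire_def
proof (intro conjI allI assms(1))
  fix z \<zeta> :: "complex ^ 'n" and i
  have e: "(\<chi> j. if j = i then 0 else z $ j, \<zeta>) + cscale t (axis i 1, 0) = (\<chi> j. if j = i then t else z $ j, \<zeta>)"
    "(z, \<chi> j. if j = i then 0 else \<zeta> $ j) + cscale t (0, axis i 1) = (z, \<chi> j. if j = i then t else \<zeta> $ j)" for t
    by (simp_all add: cscale_def axis_def vec_eq_iff)
  show "(\<lambda>t. F (\<chi> j. if j = i then t else z $ j, \<zeta>)) holomorphic_on UNIV"
    using assms(2)[of "(\<chi> j. if j = i then 0 else z $ j, \<zeta>)" "(axis i 1, 0)"] unfolding e .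
  show "(\<lambda>t. F (z, \<chi> j. if j = i then t else \<zeta> $ j)) holomorphic_on UNIV"
    using assms(2)[of "(z, \<chi> j. if j = i then 0 else \<zeta> $ j)" "(0, axis i 1)"] unfolding e .
qed

lemma entire_ext_eq:
  assumes "entire F" "\<And>x k. F (cvec x, cvec k) = w (x, k)"
  shows "entire_ext w = F"
proof -
  have "entire (entire_ext w) \<and> (\<forall>x k. entire_ext w (cvec x, cvec k) = w (x, k))"
    unfolding entire_ext_def by (rule someI[of _ F]) (use assms in blast)
  then show ?thesis using entire_unique[of "entire_ext w" F] assms by simp
qed

section \<open>The two entire extensions in the statement\<close>

lemma (in wigner) entire_ext_wigner: "entire_ext (smoothed_wigner sx sk f g) = wigner_ext"
  by (rule entire_ext_eq[OF entire_of_lines[OF wigner_ext_continuous wigner_ext_holomorphic_line]])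
    (simp add: smoothed_wigner_eq cvec2_def)

lemma (in wigner) tilde_op_eq:
  "tilde_op sx sk L (smoothed_wigner sx sk f g) (x, k) = (\<integral>z. L z * test_fun_hat (fst z) (snd z) \<partial>lborel)"
proof -
  have "fourier (\<lambda>z. test_fun (fst z) (snd z)) z = test_fun_hat (fst z) (snd z)" for z
    using fourier_test_fun[of "fst z" "snd z"] by simp
  then show ?thesis
    unfolding tilde_op_def entire_ext_wigner prod.case tilde_integrand fourier_distribution_def regular_distribution_def
    by (simp add: case_prod_unfold)
qed

lemma (in wigner_symbol) tilde_symbol_eq: "tilde_symbol sx sk L = shifted_symbol"
proof -
  have "entire_ext L = Lext"
    by (rule entire_ext_eq[OF entire_of_lines[OF Lext_continuous Lext_line]])
      (use Lext_real[of "(_, _)"] in \<open>simp add: cvec2_def\<close>)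
  moreover have "(cvec a - (1/2) *s (cvec K - (\<i> * of_real (sx\<^sup>2)) *s cvec X),
      cvec b + (1/2) *s (cvec X + (\<i> * of_real (sk\<^sup>2)) *s cvec K)) = cvec2 (a, b) - cscale (1/2) (symbol_shift (X, K))" for a b X K
    unfolding cvec2_def cscale_def symbol_shift_def fst_conv snd_conv by (simp add: vec_eq_iff algebra_simps)
  ultimately show ?thesis
    by (intro ext) (simp only: tilde_symbol_def shifted_symbol_def case_prod_unfold fst_conv snd_conv prod.collapse)
qed

theorem theorem1p5:
  fixes \<sigma>\<^sub>x \<sigma>\<^sub>k :: real
    and f g :: "real ^ ('n::finite) \<Rightarrow> complex"
    and L :: "(real ^ 'n) \<times> (real ^ 'n) \<Rightarrow> complex"
    and v :: "((real ^ 'n) \<times> (real ^ 'n) \<Rightarrow> complex) \<Rightarrow> complex"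
    and x k :: "real ^ 'n"
  assumes "\<sigma>\<^sub>x > 0" and "\<sigma>\<^sub>k > 0"
    and "schwartz f" and "schwartz g"
    and "tempered_distribution v" and "compactly_supported v"
    and "is_fourier_transform_of L v"
  shows "let w = smoothed_wigner \<sigma>\<^sub>x \<sigma>\<^sub>k f g in
           smoothed_wigner \<sigma>\<^sub>x \<sigma>\<^sub>k (weyl_op L f) g (x, k) = tilde_op \<sigma>\<^sub>x \<sigma>\<^sub>k L w (x, k) \<and>
           weyl_converges (tilde_symbol \<sigma>\<^sub>x \<sigma>\<^sub>k L) w (x, k) \<and>
           tilde_op \<sigma>\<^sub>x \<sigma>\<^sub>k L w (x, k) = weyl_op (tilde_symbol \<sigma>\<^sub>x \<sigma>\<^sub>k L) w (x, k)"
proof -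
  obtain C0 N0 where v: "\<And>\<phi> \<psi>. schwartz \<phi> \<Longrightarrow> schwartz \<psi> \<Longrightarrow> v (\<lambda>x. \<phi> x + \<psi> x) = v \<phi> + v \<psi>"
    "\<And>c \<phi>. schwartz \<phi> \<Longrightarrow> v (\<lambda>x. c * \<phi> x) = c * v \<phi>"
    "\<And>\<phi>. schwartz \<phi> \<Longrightarrow> cmod (v \<phi>) \<le> C0 * schwartz_seminorm N0 \<phi>"
    using assms(5) unfolding tempered_distribution_def by blast
  \<comment> \<open>The cutoff is one on a ball around the support of v, where it does not affect the pairing with v.\<close>
  obtain K where K: "compact K" "supported_in v K" using assms(6) unfolding compactly_supported_def by blast
  obtain r where r: "0 < r" "K \<subseteq> ball 0 r" using bounded_subset_ballD[OF compact_imp_bounded[OF K(1)]] by blast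
  obtain \<kappa> :: "(real ^ 'n) \<times> (real ^ 'n) \<Rightarrow> complex" where \<kappa>: "smooth \<kappa>" "\<And>\<zeta>. norm \<zeta> \<le> r \<Longrightarrow> \<kappa> \<zeta> = 1" "\<And>\<zeta>. r + 1 \<le> norm \<zeta> \<Longrightarrow> \<kappa> \<zeta> = 0"
    using exists_cutoff[OF less_imp_le[OF r(1)]] by metis
  have bump: "bump \<kappa>" unfolding bump_def using \<kappa>(1,3) by (intro conjI exI[of _ "r + 1"]) auto
  \<comment> \<open>The Fourier-Laplace transform of v.\<close>
  define Lext where "Lext = (\<lambda>z. v (\<lambda>\<zeta>. \<kappa> \<zeta> * wave z \<zeta>))"
  have real: "Lext (cvec2 p) = L p" for p
    unfolding Lext_def by (rule pairing_eq_symbol[OF v \<kappa> r(2) K(2) assms(7), symmetric])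
  interpret wigner_symbol \<sigma>\<^sub>x \<sigma>\<^sub>k f g x k L Lext N0
  proof
    show "hered (\<lambda>F. \<exists>C\<ge>0. \<forall>z. cmod (F () z) \<le> C * (1 + norm z) ^ N0) n (\<lambda>_::unit. L)" for n
      using pairing_real_moderate[OF v bump, of n] unfolding Lext_def[symmetric, THEN fun_cong] real .
    show "continuous_on UNIV Lext"
      unfolding continuous_on_eq_continuous_at[OF open_UNIV] Lext_def
      by (intro ballI has_derivative_continuous[OF pairing_has_derivative[OF v bump]])
    show "(\<lambda>t. Lext (z + cscale t h)) holomorphic_on UNIV" for z h
      unfolding Lext_def by (rule pairing_holomorphic_line[OF v bump])
    show "\<exists>C\<ge>0. \<forall>z. norm (im_part z) \<le> M \<longrightarrow> cmod (Lext z) \<le> C * (1 + norm z) ^ N0" for M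
      unfolding Lext_def by (rule pairing_strip_bound[OF v bump])
  qed (use assms real in auto)
  show ?thesis
    unfolding Let_def tilde_op_eq wigner_of_weyl tilde_symbol_eq
    using weyl_converges_shifted_symbol weyl_op_shifted_symbol by simp
qed

end
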